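(* Let $-\infty\le a<b\le\infty$, let $1 \leq p < \infty$, $0 < q, r < \infty$ and let $u, v, w$ be weights on $(a,b)$. Consider the inequality $$\bigg(\int_a^b \bigg(\int_a^x \bigg(\int_a^t f(s)\,ds \bigg)^q u(t)\, dt \bigg)^{\frac{r}{q}} w(x)\, dx \bigg)^{\frac{1}{r}} \leq C \bigg(\int_a^b f(x)^p v(x)\, dx \bigg)^{\frac{1}{p}}. \qquad ( * )$$ Define $$C_1 := \operatorname*{ess\,sup}_{x \in (a, b)} \bigg(\int_x^b w(t) \bigg(\int_x^t u \bigg)^{\frac{r}{q}} dt \bigg)^{\frac{1}{r}} V_p(a, x),$$ and, when the exponents are in the ranges in which they are used below, $$C_2 :=\bigg(\int_a^b \bigg(\int_x^b w \bigg)^{\frac{r}{p-r}} w(x) \operatorname*{ess\,sup}_{t \in (a, x)} \bigg(\int_t^{x} u \bigg)^{\frac{rp}{q(p-r)}} V_p(a, t)^{\frac{pr}{p-r}} dx \bigg)^{\frac{p-r}{pr}},$$ $$C_3 := \bigg( \int_a^b \bigg(\int_x^b w(s) \bigg(\int_{x}^s u \bigg)^{\frac{r}{q}} ds \bigg)^{\frac{r}{p-r}} w(x) \operatorname*{ess\,sup}_{t \in (a, x)} \bigg(\int_t^{x} u \bigg)^{\frac{r}{q}} V_p(a, t)^{\frac{pr}{p-r}} dx \bigg)^{\frac{p-r}{pr}},$$ $$C_4 := \sup_{x \in (a, b)} \bigg(\int_x^b w \bigg)^{\frac{1}{r}} \bigg( \int_a^x \bigg(\int_{t}^x u \bigg)^{\frac{q}{p-q}}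 u(t) V_p(a, t)^{\frac{pq}{p-q}} dt \bigg)^{\frac{p-q}{pq}},$$ $$C_5 := \bigg( \int_a^b \bigg(\int_x^b w \bigg)^{\frac{r}{p-r}} w(x) \bigg( \int_a^x \bigg(\int_{t}^x u \bigg)^{\frac{q}{p-q}} u(t) V_p(a, t)^{\frac{pq}{p-q}} dt \bigg)^{\frac{r(p-q)}{q(p-r)}} dx \bigg)^{\frac{p-r}{pr}}.$$ Then there is a constant $C\in(0,\infty)$ such that $( * )$ holds for all $f \in \mathfrak{M}^+(a, b)$ if and only if the following holds: (i) in the case $p \leq r$, $p\leq q$: $C_1<\infty$; moreover, the best constant $C$ in $( * )$ satisfies $C \approx C_1$; (ii) in the case $r < p \leq q$: $C_2<\infty$ and $C_3<\infty$; moreover, the best constant $C$ in $( * )$ satisfies $C \approx C_2 + C_3$; (iii) in the case $q< p \leq r$: $C_1 < \infty$ and $C_4<\infty$; moreover, the best constant $C$ in $( * )$ satisfies $C \approx C_1 + C_4$; (iv) in the case $r < p$, $q < p$: $C_3 < \infty$ and $C_5<\infty$; moreover, the best constant $C$ in $( * )$ satisfies $C \approx C_3 + C_5$.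
   Context: $\mathfrak{M}^+(a,b)$ is the set of all non-negative measurable functions on $(a,b)$. A weight on $(a,b)$ is a positive measurable function on $(a,b)$ (values in $(0,\infty)$; no integrability is assumed). Conventions: $0\cdot\infty=\infty/\infty=0/0=0$. $A\lesssim B$ means $A\le cB$ with a constant $c>0$ depending only on $p,q,r$; $A\approx B$ means $A\lesssim B$ and $B\lesssim A$. For $x,y\in[a,b]$, $$V_p(x,y):=\bigg(\int_x^y v^{-\frac{1}{p-1}}\bigg)^{\frac{p-1}{p}}\ \text{ if } 1<p<\infty,\qquad V_1(x,y):=\operatorname*{ess\,sup}_{s\in(x,y)} v(s)^{-1}\ \text{ if } p=1.$$ *)

theory Defs
  imports "HOL-Analysis.Analysis" "HOL-Probability.Essential_Supremum"
begin

text \<open>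
  All integrals are nonnegative Lebesgue integrals with values in \<^typ>\<open>ennreal\<close>, whose arithmetic
  satisfies \<open>0 * \<infinity> = \<infinity> / \<infinity> = 0 / 0 = 0\<close>. Intervals have endpoints in \<^typ>\<open>ereal\<close>; functions on
  \<open>(a,b)\<close> are functions on \<^typ>\<open>real\<close> of which only the restriction to \<open>(a,b)\<close> matters.
\<close>

text \<open>Powers of extended nonnegative reals, intended for exponents \<open>s > 0\<close> only; so \<open>0\<close> and \<open>\<infinity>\<close>
  are mapped to themselves.\<close>

definition epowr :: "ennreal \<Rightarrow> real \<Rightarrow> ennreal" (infixr \<open>epowr\<close> 80) where
  "x epowr s = (if x = \<infinity> then \<infinity> else ennreal (enn2real x powr s))"

definition integ :: "ereal \<Rightarrow> ereal \<Rightarrow> (real \<Rightarrow> ennreal) \<Rightarrow> ennreal" where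
  "integ x y g = (\<integral>\<^sup>+ t \<in> einterval x y. g t \<partial>lebesgue)"

text \<open>The library's \<^const>\<open>esssup\<close> is \<open>\<infinity>\<close> for nonmeasurable functions; all functions to which
  it is applied below are measurable (reciprocals of weights, and products of monotone functions).\<close>

definition ess_sup_on :: "ereal \<Rightarrow> ereal \<Rightarrow> (real \<Rightarrow> ennreal) \<Rightarrow> ennreal" where
  "ess_sup_on x y g = esssup (lebesgue_on (einterval x y)) g"

definition nonneg_measurable :: "ereal \<Rightarrow> ereal \<Rightarrow> (real \<Rightarrow> ennreal) set" where
  "nonneg_measurable a b = borel_measurable (lebesgue_on (einterval a b))"

definition weight :: "ereal \<Rightarrow> ereal \<Rightarrow> (real \<Rightarrow> real) \<Rightarrow> bool" where
  "weight a b u \<longleftrightarrow>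
     u \<in> borel_measurable (lebesgue_on (einterval a b)) \<and> (\<forall>x\<in>einterval a b. 0 < u x)"

definition Vp :: "real \<Rightarrow> (real \<Rightarrow> real) \<Rightarrow> ereal \<Rightarrow> ereal \<Rightarrow> ennreal" where
  "Vp p v x y =
     (if p = 1 then ess_sup_on x y (\<lambda>s. ennreal (inverse (v s)))
      else (integ x y (\<lambda>s. ennreal (v s powr (- (1 / (p - 1)))))) epowr ((p - 1) / p))"

definition hardy_ineq ::
  "real \<Rightarrow> real \<Rightarrow> real \<Rightarrow> ereal \<Rightarrow> ereal \<Rightarrow> (real \<Rightarrow> real) \<Rightarrow> (real \<Rightarrow> real) \<Rightarrow> (real \<Rightarrow> real)
    \<Rightarrow> real \<Rightarrow> (real \<Rightarrow> ennreal) \<Rightarrow> bool" where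
  "hardy_ineq p q r a b u v w C f \<longleftrightarrow>
     (integ a b (\<lambda>x. (integ a x (\<lambda>t. (integ a t f) epowr q * ennreal (u t))) epowr (r / q)
                      * ennreal (w x))) epowr (1 / r)
     \<le> ennreal C * (integ a b (\<lambda>x. (f x) epowr p * ennreal (v x))) epowr (1 / p)"

definition admissible ::
  "real \<Rightarrow> real \<Rightarrow> real \<Rightarrow> ereal \<Rightarrow> ereal \<Rightarrow> (real \<Rightarrow> real) \<Rightarrow> (real \<Rightarrow> real) \<Rightarrow> (real \<Rightarrow> real)
    \<Rightarrow> real set" where
  "admissible p q r a b u v w =
     {C. 0 < C \<and> (\<forall>f\<in>nonneg_measurable a b. hardy_ineq p q r a b u v w C f)}"

text \<open>The best constant; it is \<open>\<infinity>\<close> if no constant is admissible.\<close>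

definition best_const ::
  "real \<Rightarrow> real \<Rightarrow> real \<Rightarrow> ereal \<Rightarrow> ereal \<Rightarrow> (real \<Rightarrow> real) \<Rightarrow> (real \<Rightarrow> real) \<Rightarrow> (real \<Rightarrow> real)
    \<Rightarrow> ennreal" where
  "best_const p q r a b u v w = (INF C\<in>admissible p q r a b u v w. ennreal C)"

definition C1 ::
  "real \<Rightarrow> real \<Rightarrow> real \<Rightarrow> ereal \<Rightarrow> ereal \<Rightarrow> (real \<Rightarrow> real) \<Rightarrow> (real \<Rightarrow> real) \<Rightarrow> (real \<Rightarrow> real)
    \<Rightarrow> ennreal" where
  "C1 p q r a b u v w =
     ess_sup_on a b (\<lambda>x.
       (integ x b (\<lambda>t. ennreal (w t) * (integ x t (\<lambda>s. ennreal (u s))) epowr (r / q))) epowr (1 / r) * Vp p v a x)"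

definition C2 ::
  "real \<Rightarrow> real \<Rightarrow> real \<Rightarrow> ereal \<Rightarrow> ereal \<Rightarrow> (real \<Rightarrow> real) \<Rightarrow> (real \<Rightarrow> real) \<Rightarrow> (real \<Rightarrow> real)
    \<Rightarrow> ennreal" where
  "C2 p q r a b u v w =
     (integ a b (\<lambda>x.
        (integ x b (\<lambda>s. ennreal (w s))) epowr (r / (p - r)) * ennreal (w x) *
        ess_sup_on a x (\<lambda>t.
          (integ t x (\<lambda>s. ennreal (u s))) epowr (r * p / (q * (p - r))) * (Vp p v a t) epowr (p * r / (p - r)))))
     epowr ((p - r) / (p * r))"

definition C3 ::
  "real \<Rightarrow> real \<Rightarrow> real \<Rightarrow> ereal \<Rightarrow> ereal \<Rightarrow> (real \<Rightarrow> real) \<Rightarrow> (real \<Rightarrow> real) \<Rightarrow> (real \<Rightarrow> real)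
    \<Rightarrow> ennreal" where
  "C3 p q r a b u v w =
     (integ a b (\<lambda>x.
        (integ x b (\<lambda>s. ennreal (w s) * (integ x s (\<lambda>s. ennreal (u s))) epowr (r / q))) epowr (r / (p - r)) *
        ennreal (w x) *
        ess_sup_on a x (\<lambda>t.
          (integ t x (\<lambda>s. ennreal (u s))) epowr (r / q) * (Vp p v a t) epowr (p * r / (p - r)))))
     epowr ((p - r) / (p * r))"

definition C4 ::
  "real \<Rightarrow> real \<Rightarrow> real \<Rightarrow> ereal \<Rightarrow> ereal \<Rightarrow> (real \<Rightarrow> real) \<Rightarrow> (real \<Rightarrow> real) \<Rightarrow> (real \<Rightarrow> real)
    \<Rightarrow> ennreal" where
  "C4 p q r a b u v w =
     (SUP x\<in>einterval a b.
        (integ x b (\<lambda>s. ennreal (w s))) epowr (1 / r) *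
        (integ a x (\<lambda>t.
           (integ t x (\<lambda>s. ennreal (u s))) epowr (q / (p - q)) * ennreal (u t) *
           (Vp p v a t) epowr (p * q / (p - q)))) epowr ((p - q) / (p * q)))"

definition C5 ::
  "real \<Rightarrow> real \<Rightarrow> real \<Rightarrow> ereal \<Rightarrow> ereal \<Rightarrow> (real \<Rightarrow> real) \<Rightarrow> (real \<Rightarrow> real) \<Rightarrow> (real \<Rightarrow> real)
    \<Rightarrow> ennreal" where
  "C5 p q r a b u v w =
     (integ a b (\<lambda>x.
        (integ x b (\<lambda>s. ennreal (w s))) epowr (r / (p - r)) * ennreal (w x) *
        (integ a x (\<lambda>t.
           (integ t x (\<lambda>s. ennreal (u s))) epowr (q / (p - q)) * ennreal (u t) *
           (Vp p v a t) epowr (p * q / (p - q)))) epowr (r * (p - q) / (q * (p - r)))))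
     epowr ((p - r) / (p * r))"

end

theory Submission
  imports Defs
begin

text \<open>
  Write \<open>F t = \<integral>\<^sub>a\<^sup>t f\<close>, \<open>U t x = \<integral>\<^sub>t\<^sup>x u\<close> and \<open>H x = \<integral>\<^sub>a\<^sup>x F\<^sup>q u\<close>, and let \<open>Kl y\<close> be the best constant of the
  one-weight Hardy inequality \<open>H y \<le> Kl y (\<integral> f\<^sup>p v)\<^bsup>q/p\<^esup>\<close>; it is equivalent to a supremum if \<open>p \<le> q\<close> and
  to an integral if \<open>q < p\<close>. Choose decreasing points \<open>y\<^sub>k\<close> at which \<open>H\<close> is halved. To the right of
  \<open>y\<^sub>k\<close>, up to the previous point, \<open>H x\<close> is dominated by \<open>\<integral> F\<^sup>q u\<close> over \<open>(y\<^sub>k\<^sub>+\<^sub>1, y\<^sub>k)\<close> and hence by the sum of a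
  nonlocal term \<open>F(y\<^sub>k\<^sub>+\<^sub>1)\<^sup>q U(y\<^sub>k\<^sub>+\<^sub>1, x)\<close> and a local term, \<open>Kl(y\<^sub>k)\<close> times the \<open>q/p\<close>-th power of the part
  of \<open>\<integral> f\<^sup>p v\<close> between \<open>y\<^sub>k\<^sub>+\<^sub>1\<close> and \<open>y\<^sub>k\<close>. Summing over \<open>k\<close>, the nonlocal terms are controlled by
  \<open>C\<^sub>1\<close> or \<open>C\<^sub>3\<close> (after a second halving, of \<open>F\<close>), the local ones by the remaining constants.
  Conversely, for \<open>p \<le> r\<close> single test functions suffice. For \<open>r < p\<close> one superposes test functions that live
  on the dyadic level sets of the function whose integral is to be bounded and sums by parts. In \<open>C\<^sub>3\<close> the
  inner supremum depends on both variables; there the line is first cut at points where \<open>\<integral>\<^sub>x\<^sup>b w\<close> decreases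
  geometrically.
\<close>


section \<open>Powers and integrals of extended nonnegative functions\<close>

text \<open>The weight \<open>v\<close> enters only through \<open>\<Phi>\<close>, so p = 1 and p >
  1 are treated at once, and the inner inequality only through \<open>Kl\<close>. The four cases
  thus become two: for p <= r the suprema of P \<Phi>^(r/p) and W Kl^(r/q), for r < p two integrals.
  Only at the end is \<open>Kl\<close> replaced by \<open>SS\<close> or \<open>BB\<close>. For r < p
  the sums over the points are estimated by Hoelder's inequality with exponents p/r and p/(p-r). It
  leaves powers of integrals over single levels; \<open>power_rule\<close> turns these into
  integrals of powers of tails, which is the origin of the factors W^(r/(p-r)) w in the constants.
  In the converse the coefficients of the superposition are the terms of the very sum to be bounded,
  so that this sum is bounded by a power R < 1 of itself and can be absorbed. No weight is assumed
  integrable. Therefore every halving starts from a finite integral, finiteness is extracted from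
  the constants themselves, extremal functions are only approximate (every N below
  \<open>\<Phi>\<close>), and the whole interval is reached by monotone convergence.\<close>

lemma epowr_0 [simp]: "0 epowr s = 0"
  by (simp add: epowr_def)

lemma epowr_top [simp]: "top epowr s = top"
  by (simp add: epowr_def)

lemma epowr_1 [simp]: "1 epowr s = 1"
  by (simp add: epowr_def)

lemma epowr_one [simp]: "x epowr 1 = x"
  by (cases x) (auto simp: epowr_def)

lemma epowr_ennreal: "0 \<le> c \<Longrightarrow> ennreal c epowr s = ennreal (c powr s)"
  by (simp add: epowr_def)

lemma epowr_eq_top_iff [simp]: "x epowr s = top \<longleftrightarrow> x = top"
  by (simp add: epowr_def)

lemma epowr_less_top_iff [simp]: "x epowr s < top \<longleftrightarrow> x < top"
  by (simp add: less_top[symmetric])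

lemma epowr_eq_0_iff [simp]: "x epowr s = 0 \<longleftrightarrow> x = 0"
  by (cases x) (auto simp: epowr_def)

lemma epowr_pos_iff [simp]: "0 < x epowr s \<longleftrightarrow> 0 < x"
  by (metis epowr_eq_0_iff zero_less_iff_neq_zero)

lemma epowr_mono: "x \<le> y \<Longrightarrow> 0 < s \<Longrightarrow> x epowr s \<le> y epowr s"
  by (cases x; cases y) (auto simp: epowr_def powr_mono2 top_unique)

text \<open>Every power fixes 0 and \<open>top\<close>, and 0 * top = 0 on both sides, so the laws
  of exponents extend from the finite case to all values and all real exponents.\<close>

lemma epowr_mult: "(x * y) epowr s = x epowr s * y epowr s"
proof (cases "x = top \<or> y = top")
  case True
  then show ?thesis
    by (cases "x = 0"; cases "y = 0") (auto simp: ennreal_mult_top ennreal_top_mult)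
next
  case False
  then obtain a b where "x = ennreal a" "y = ennreal b" "0 \<le> a" "0 \<le> b"
    by (metis ennreal_cases infinity_ennreal_def)
  then show ?thesis
    by (simp add: epowr_ennreal powr_mult flip: ennreal_mult)
qed

lemma epowr_epowr: "(x epowr s) epowr t = x epowr (s * t)"
  by (cases x) (auto simp: epowr_ennreal powr_powr)

lemma epowr_add: "x epowr (s + t) = x epowr s * x epowr t"
  by (cases x) (auto simp: epowr_ennreal powr_add ennreal_mult ennreal_top_mult)

text \<open>A power and its inverse power form a Galois connection; this is how
  \<open>epowr_SUP\<close> moves powers through suprema.\<close>

lemma epowr_le_iff:
  assumes "0 < s"
  shows "x epowr s \<le> y \<longleftrightarrow> x \<le> y epowr (1 / s)"
proof
  assume "x epowr s \<le> y"
  then have "(x epowr s) epowr (1 / s) \<le> y epowr (1 / s)"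
    using assms by (intro epowr_mono) auto
  then show "x \<le> y epowr (1 / s)"
    using assms by (simp add: epowr_epowr)
next
  assume "x \<le> y epowr (1 / s)"
  then have "x epowr s \<le> (y epowr (1 / s)) epowr s"
    using assms by (intro epowr_mono) auto
  then show "x epowr s \<le> y"
    using assms by (simp add: epowr_epowr)
qed

lemma epowr_SUP:
  assumes "0 < s"
  shows "(SUP i\<in>I. g i) epowr s = (SUP i\<in>I. g i epowr s)"
proof (rule antisym)
  have "g i \<le> (SUP i\<in>I. g i epowr s) epowr (1 / s)" if "i \<in> I" for i
    unfolding epowr_le_iff[OF assms, symmetric] using that by (rule SUP_upper)
  then show "(SUP i\<in>I. g i) epowr s \<le> (SUP i\<in>I. g i epowr s)"
    unfolding epowr_le_iff[OF assms] by (rule SUP_least)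
  show "(SUP i\<in>I. g i epowr s) \<le> (SUP i\<in>I. g i) epowr s"
    using assms by (intro SUP_least epowr_mono SUP_upper) auto
qed

lemma epowr_plus_le:
  assumes "0 < s"
  shows "(x + y) epowr s \<le> 2 epowr s * (x epowr s + y epowr s)"
proof -
  have "x + y \<le> 2 * max x y"
    by (simp add: mult_2 add_mono)
  then have "(x + y) epowr s \<le> 2 epowr s * (max x y) epowr s"
    using assms by (metis epowr_mono epowr_mult)
  also have "(max x y) epowr s \<le> x epowr s + y epowr s"
    by (auto simp: max_def)
  finally show ?thesis
    by (simp add: mult_left_mono)
qed

lemma borel_measurable_epowr [measurable (raw)]:
  assumes [measurable]: "g \<in> borel_measurable M"
  shows "(\<lambda>x. g x epowr s) \<in> borel_measurable M"
  unfolding epowr_def by measurable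

text \<open>An up-closed set is a closed ray if it has a least element, and otherwise the union of
  the open rays at its points. Super-level sets of monotone functions are of this kind.\<close>

lemma up_closed_borel:
  fixes A :: "real set"
  assumes up: "\<And>x y. x \<in> A \<Longrightarrow> x \<le> y \<Longrightarrow> y \<in> A"
  shows "A \<in> sets borel"
proof (cases "\<exists>m\<in>A. \<forall>x\<in>A. m \<le> x")
  case True
  then obtain m where "m \<in> A" "\<forall>x\<in>A. m \<le> x" by blast
  then have "A = {m..}" using up by auto
  then show ?thesis by simp
next
  case False
  then have "A = (\<Union>x\<in>A. {x<..})"
    using up by (auto simp: not_le)
  moreover have "open (\<Union>x\<in>A. {x<..})" by (intro open_UN ballI open_greaterThan)
  ultimately show ?thesis by (metis borel_open)
qed

lemma borel_measurable_mono_ennreal: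
  fixes g :: "real \<Rightarrow> ennreal"
  assumes "mono g"
  shows "g \<in> borel_measurable borel"
proof (rule borel_measurableI_greater)
  fix y
  show "{x \<in> space borel. y < g x} \<in> sets borel"
    by (rule up_closed_borel) (use assms in \<open>auto dest: monoD intro: less_le_trans\<close>)
qed

lemma borel_measurable_antimono_ennreal:
  fixes g :: "real \<Rightarrow> ennreal"
  assumes "antimono g"
  shows "g \<in> borel_measurable borel"
proof -
  have "mono (\<lambda>x. g (- x))"
    using assms by (simp add: antimono_def mono_def)
  then have [measurable]: "(\<lambda>x. g (- x)) \<in> borel_measurable borel"
    by (rule borel_measurable_mono_ennreal)
  have "(\<lambda>x. (\<lambda>x. g (- x)) (- x)) \<in> borel_measurable borel"
    by measurable
  then show ?thesis by simp
qed

section \<open>Integrals over subsets of the line\<close>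

text \<open>A set replaces the two endpoints because the proof integrates over levels and over
  unions of levels; functions given on an interval are extended by zero.\<close>

definition ig :: "real set \<Rightarrow> (real \<Rightarrow> ennreal) \<Rightarrow> ennreal" where
  "ig A g = (\<integral>\<^sup>+x\<in>A. g x \<partial>lebesgue)"

lemma ig_mono: "A \<subseteq> B \<Longrightarrow> (\<And>x. x \<in> A \<Longrightarrow> g x \<le> h x) \<Longrightarrow> ig A g \<le> ig B h"
  unfolding ig_def by (rule nn_integral_mono) (auto simp: indicator_def)

lemma ig_cong: "A = B \<Longrightarrow> (\<And>x. x \<in> A \<Longrightarrow> g x = h x) \<Longrightarrow> ig A g = ig B h"
  by (intro antisym ig_mono) simp_all

lemma ig_restrict: "(\<And>x. x \<in> A - B \<Longrightarrow> g x = 0) \<Longrightarrow> ig A g = ig (A \<inter> B) g"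
  unfolding ig_def by (rule nn_integral_cong) (auto simp: indicator_def)

lemma ig_empty [simp]: "ig {} g = 0"
  by (simp add: ig_def)

lemma ig_eq_0: "(\<And>x. x \<in> A \<Longrightarrow> g x = 0) \<Longrightarrow> ig A g = 0"
  unfolding ig_def by (subst nn_integral_cong[of _ _ "\<lambda>_. 0"]) (auto simp: indicator_def)

lemma borel_lebesgue: "A \<in> sets borel \<Longrightarrow> A \<in> sets lebesgue"
  by simp

lemma ig_cmult:
  assumes [measurable]: "g \<in> borel_measurable lebesgue" "A \<in> sets lebesgue"
  shows "ig A (\<lambda>x. c * g x) = c * ig A g"
  unfolding ig_def mult.assoc by (intro nn_integral_cmult) measurable

lemma ig_add:
  assumes [measurable]: "g \<in> borel_measurable lebesgue" "h \<in> borel_measurable lebesgue" "A \<in> sets lebesgue"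
  shows "ig A (\<lambda>x. g x + h x) = ig A g + ig A h"
  unfolding ig_def distrib_right by (intro nn_integral_add) measurable

lemma ig_UN:
  assumes [measurable]: "g \<in> borel_measurable lebesgue" "\<And>n. A n \<in> sets lebesgue" and "disjoint_family A"
  shows "ig (\<Union>n. A n) g = (\<Sum>n. ig (A n) g)"
proof -
  have "g x * indicator (\<Union>n. A n) x = (\<Sum>n. g x * indicator (A n) x)" for x
    using suminf_indicator[OF assms(3), of x] by simp
  then show ?thesis
    unfolding ig_def by (subst nn_integral_suminf[symmetric]) simp_all
qed

lemma ig_Un:
  assumes [measurable]: "g \<in> borel_measurable lebesgue" "A \<in> sets lebesgue" "B \<in> sets lebesgue" and "A \<inter> B = {}"
  shows "ig (A \<union> B) g = ig A g + ig B g"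
  unfolding ig_def using assms(4)
  by (subst nn_integral_add[symmetric]) (auto intro!: nn_integral_cong simp: indicator_def)

lemma ig_SUP:
  assumes [measurable]: "g \<in> borel_measurable lebesgue" "\<And>n. A n \<in> sets lebesgue" and "incseq A"
  shows "ig (\<Union>n. A n) g = (SUP n. ig (A n) g)"
proof -
  have "g x * indicator (\<Union>n. A n) x = (SUP n. g x * indicator (A n) x)" for x
  proof (cases "x \<in> (\<Union>n. A n)")
    case True
    then obtain n where "x \<in> A n" by blast
    then have "g x * indicator (A n) x = g x" by simp
    then have "g x \<le> (SUP n. g x * indicator (A n) x)"
      by (metis SUP_upper UNIV_I)
    moreover have "(SUP n. g x * indicator (A n) x) \<le> g x"
      by (rule SUP_least) (auto simp: indicator_def)
    ultimately show ?thesis using True by (auto intro: antisym)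
  qed (auto intro!: antisym SUP_least)
  moreover have "incseq (\<lambda>n x. g x * indicator (A n) x)"
    using assms(3) by (auto simp: incseq_def le_fun_def indicator_def)
  ultimately show ?thesis
    unfolding ig_def by (subst nn_integral_monotone_convergence_SUP[symmetric]) auto
qed

lemma ig_cover_le:
  assumes [measurable]: "g \<in> borel_measurable lebesgue" "A \<in> sets lebesgue" "\<And>n. B n \<in> sets lebesgue"
    and "disjoint_family B" and "\<And>x. x \<in> A \<Longrightarrow> x \<notin> (\<Union>n. B n) \<Longrightarrow> g x = 0"
  shows "ig A g = (\<Sum>n. ig (A \<inter> B n) g)"
proof -
  have "ig A g = ig (A \<inter> (\<Union>n. B n)) g"
    using assms(5) by (intro ig_restrict) auto
  also have "\<dots> = ig (\<Union>n. A \<inter> B n) g"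
    by (intro ig_cong) blast+
  also have "\<dots> = (\<Sum>n. ig (A \<inter> B n) g)"
    using assms(4) by (intro ig_UN) (simp_all add: disjoint_family_on_def, blast)
  finally show ?thesis .
qed

lemma ig_point:
  assumes "N \<in> null_sets lebesgue"
  shows "ig (A \<union> N) g = ig A g"
proof -
  have "AE x in lebesgue. x \<notin> N"
    using assms by (rule AE_not_in)
  then show ?thesis
    unfolding ig_def by (intro nn_integral_cong_AE) (auto elim!: eventually_mono simp: indicator_def)
qed

lemma ig_pos:
  assumes [measurable]: "g \<in> borel_measurable lebesgue" and "x < y" and pos: "\<And>t. t \<in> {x<..<y} \<Longrightarrow> 0 < g t"
    and "{x<..<y} \<subseteq> A"
  shows "0 < ig A g"
proof -
  have [measurable]: "{x<..<y} \<in> sets lebesgue" by simp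
  have "ig {x<..<y} g \<noteq> 0"
  proof
    assume "ig {x<..<y} g = 0"
    then have "AE t in lebesgue. g t * indicator {x<..<y} t = 0"
      unfolding ig_def by (subst (asm) nn_integral_0_iff_AE) auto
    then have "AE t in lebesgue. t \<notin> {x<..<y}"
      by (rule eventually_mono) (use pos in \<open>force simp: indicator_def split: if_splits\<close>)
    then have "emeasure lebesgue {x<..<y} = 0"
      by (subst (asm) AE_iff_measurable[where N="{x<..<y}"]) auto
    then show False using \<open>x < y\<close> by simp
  qed
  moreover have "ig {x<..<y} g \<le> ig A g"
    using assms(4) by (intro ig_mono) auto
  ultimately show ?thesis
    by (metis le_zero_eq zero_less_iff_neq_zero)
qed

section \<open>Hoelder's inequality for integrals and series\<close>

lemma epowr_Young:
  assumes "0 < s" "s < 1"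
  shows "x epowr s * y epowr (1 - s) \<le> ennreal s * x + ennreal (1 - s) * y"
proof (cases "x = top \<or> y = top")
  case True
  then show ?thesis using assms by (auto simp: ennreal_mult_top)
next
  case False
  then obtain a b where ab: "x = ennreal a" "y = ennreal b" "0 \<le> a" "0 \<le> b"
    by (metis ennreal_cases)
  have "a powr s * b powr (1 - s) \<le> s * a + (1 - s) * b"
    using Youngs_inequality_0[of s "1 - s" a b] assms ab by (cases "a = 0"; cases "b = 0") auto
  then show ?thesis
    using ab assms by (simp add: epowr_ennreal flip: ennreal_mult ennreal_plus)
qed

text \<open>The conjugate exponents are 1/s and 1/(1-s). Young's inequality is integrated after
  normalising both integrals to 1; integrals equal to 0 or \<open>top\<close> are treated
  apart.\<close>

lemma nn_integral_Hoelder: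
  assumes [measurable]: "f \<in> borel_measurable M" "g \<in> borel_measurable M" and s: "0 < s" "s < 1"
  shows "(\<integral>\<^sup>+x. f x epowr s * g x epowr (1 - s) \<partial>M)
    \<le> (\<integral>\<^sup>+x. f x \<partial>M) epowr s * (\<integral>\<^sup>+x. g x \<partial>M) epowr (1 - s)"
proof -
  define A B where "A = (\<integral>\<^sup>+x. f x \<partial>M)" and "B = (\<integral>\<^sup>+x. g x \<partial>M)"
  consider "A = 0 \<or> B = 0" | "A \<noteq> 0" "B \<noteq> 0" "A = top \<or> B = top" | "A \<noteq> 0" "B \<noteq> 0" "A < top" "B < top"
    unfolding less_top[symmetric] by blast
  then show ?thesis
  proof cases
    case 1
    then have "AE x in M. f x epowr s * g x epowr (1 - s) = 0"
      unfolding A_def B_def by (auto simp: nn_integral_0_iff_AE elim!: eventually_mono)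
    then have "(\<integral>\<^sup>+x. f x epowr s * g x epowr (1 - s) \<partial>M) = 0"
      by (subst nn_integral_0_iff_AE) auto
    then show ?thesis by simp
  next
    case 2
    then show ?thesis
      unfolding A_def[symmetric] B_def[symmetric] by (auto simp: ennreal_mult_top ennreal_top_mult)
  next
    case 3
    define \<alpha> \<beta> where "\<alpha> = inverse A" and "\<beta> = inverse B"
    have inv: "A * \<alpha> = 1" "B * \<beta> = 1"
      using 3 unfolding \<alpha>_def \<beta>_def by (auto simp: ennreal_inverse_mult zero_less_iff_neq_zero intro: ennreal_divide_self[unfolded divide_ennreal_def])
    have "(\<integral>\<^sup>+x. f x epowr s * g x epowr (1 - s) \<partial>M)
        = (\<integral>\<^sup>+x. A epowr s * B epowr (1 - s) * ((\<alpha> * f x) epowr s * (\<beta> * g x) epowr (1 - s)) \<partial>M)"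
    proof (rule nn_integral_cong)
      fix x
      have "f x = A * (\<alpha> * f x)" "g x = B * (\<beta> * g x)"
        by (simp_all add: inv flip: mult.assoc)
      then show "f x epowr s * g x epowr (1 - s)
          = A epowr s * B epowr (1 - s) * ((\<alpha> * f x) epowr s * (\<beta> * g x) epowr (1 - s))"
        by (metis (no_types, lifting) epowr_mult mult.assoc mult.left_commute)
    qed
    also have "\<dots> = A epowr s * B epowr (1 - s) * (\<integral>\<^sup>+x. (\<alpha> * f x) epowr s * (\<beta> * g x) epowr (1 - s) \<partial>M)"
      by (intro nn_integral_cmult) measurable
    also have "(\<integral>\<^sup>+x. (\<alpha> * f x) epowr s * (\<beta> * g x) epowr (1 - s) \<partial>M)
        \<le> (\<integral>\<^sup>+x. ennreal s * (\<alpha> * f x) + ennreal (1 - s) * (\<beta> * g x) \<partial>M)"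
      by (intro nn_integral_mono epowr_Young s)
    also have "\<dots> = ennreal s * (A * \<alpha>) + ennreal (1 - s) * (B * \<beta>)"
      by (simp add: nn_integral_add nn_integral_cmult A_def B_def mult.commute)
    also have "\<dots> = 1"
      using s by (simp add: inv flip: ennreal_plus)
    finally show ?thesis
      by (simp add: A_def B_def mult_left_mono)
  qed
qed

lemma suminf_Hoelder:
  fixes f g :: "nat \<Rightarrow> ennreal"
  assumes "0 < s" "s < 1"
  shows "(\<Sum>k. f k epowr s * g k epowr (1 - s)) \<le> (\<Sum>k. f k) epowr s * (\<Sum>k. g k) epowr (1 - s)"
  using nn_integral_Hoelder[of f "count_space UNIV" g s] assms by (simp add: nn_integral_count_space_nat)

text \<open>Each term is at most the sum \<open>L\<close>, hence f^s <= L^(s-1) f. This embedding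
  takes the place of Hoelder's inequality whenever the exponent is at least 1.\<close>

lemma suminf_epowr_le:
  fixes f :: "nat \<Rightarrow> ennreal"
  assumes "1 \<le> s"
  shows "(\<Sum>k. f k epowr s) \<le> (\<Sum>k. f k) epowr s"
proof -
  define L where "L = (\<Sum>k. f k)"
  have le: "f k \<le> L" for k
    unfolding L_def using sum_le_suminf[of f "{k}"] by simp
  show ?thesis
  proof (cases "s = 1")
    case True
    then show ?thesis by simp
  next
    case False
    have "f k epowr s \<le> L epowr (s - 1) * f k" for k
      using epowr_add[of "f k" "s - 1" 1] epowr_mono[OF le, of "s - 1" k] assms False
      by (simp add: mult_right_mono)
    then have "(\<Sum>k. f k epowr s) \<le> (\<Sum>k. L epowr (s - 1) * f k)"
      by (intro suminf_le) auto
    also have "\<dots> = L epowr (s - 1) * L epowr 1"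
      by (simp add: L_def)
    also have "\<dots> = L epowr s"
      by (subst epowr_add[symmetric]) simp
    finally show ?thesis by (simp add: L_def)
  qed
qed

lemma suminf_ennreal_mono: "(\<And>k. f k \<le> g k) \<Longrightarrow> (\<Sum>k. f k) \<le> (\<Sum>k. g k :: ennreal)"
  by (intro suminf_le) auto

section \<open>Exhaustion by sequences and continuity of the integral\<close>

text \<open>The infimum of \<open>A\<close> need not belong to \<open>A\<close>; a decreasing
  sequence inside \<open>A\<close> that passes every point of \<open>A\<close> serves in its
  place.\<close>

lemma cofinal_sequence:
  fixes A :: "real set"
  assumes "A \<noteq> {}"
  obtains y :: "nat \<Rightarrow> real" where "\<And>n. y n \<in> A" "decseq y" "\<And>x. x \<in> A \<Longrightarrow> \<exists>n. y n \<le> x"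
proof -
  obtain a0 where a0: "a0 \<in> A" using assms by blast
  \<comment> \<open>An element of \<open>A\<close> below the n-th rational if there is one, and
    \<open>a0\<close> otherwise. Running minima make the sequence decreasing.\<close>
  define z :: "nat \<Rightarrow> real" where "z n = (if \<exists>x\<in>A. x < of_rat (nat_to_rat_surj n)
    then SOME x. x \<in> A \<and> x < of_rat (nat_to_rat_surj n) else a0)" for n
  have z1: "z n \<in> A \<and> z n < of_rat (nat_to_rat_surj n)" if "x \<in> A" "x < of_rat (nat_to_rat_surj n)" for x n
  proof -
    have "\<exists>x. x \<in> A \<and> x < of_rat (nat_to_rat_surj n)" using that by blast
    from someI_ex[OF this] that show ?thesis unfolding z_def by auto
  qed
  have zA: "z n \<in> A" for n
  proof (cases "\<exists>x\<in>A. x < of_rat (nat_to_rat_surj n)")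
    case True
    then show ?thesis using z1 by blast
  next
    case False
    then show ?thesis using a0 by (simp add: z_def)
  qed
  show thesis
  proof (cases "\<exists>m\<in>A. \<forall>x\<in>A. m \<le> x")
    case True
    then obtain m where "m \<in> A" "\<forall>x\<in>A. m \<le> x" by blast
    then show thesis by (intro that[of "\<lambda>_. m"]) (auto simp: decseq_def)
  next
    case False
    have ex: "\<exists>n. z n \<le> x" if x: "x \<in> A" for x
    proof -
      obtain x' where x': "x' \<in> A" "x' < x" using False x by (auto simp: not_le)
      obtain \<rho> where \<rho>: "x' < of_rat \<rho>" "of_rat \<rho> < x"
        using of_rat_dense[OF x'(2)] by blast
      obtain n where n: "\<rho> = nat_to_rat_surj n"
        using surj_nat_to_rat_surj by (rule surjE)
      have "z n < of_rat \<rho>" using z1[of x' n] x' \<rho> n by simp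
      then show ?thesis using \<rho> by (intro exI[of _ n]) simp
    qed
    show thesis
    proof
      fix n
      have "Min (z ` {..n}) \<in> z ` {..n}" by (rule Min_in) auto
      then show "Min (z ` {..n}) \<in> A" using zA by (metis imageE)
    next
      show "decseq (\<lambda>n. Min (z ` {..n}))"
        unfolding decseq_def by (intro allI impI Min_antimono image_mono) auto
    next
      fix x assume "x \<in> A"
      then obtain n where "z n \<le> x" using ex by blast
      then show "\<exists>n. Min (z ` {..n}) \<le> x"
        by (intro exI[of _ n]) (meson Min_le atMost_iff finite_atMost finite_imageI imageI le_refl order_trans)
    qed
  qed
qed

text \<open>Monotone convergence along half-lines whose endpoints run through a cofinal sequence in
  \<open>D\<close>. Estimates are first proved up to, or from, one point of \<open>D\<close>, and
  this lemma removes that point. In the second part openness places every point of \<open>D\<close>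
  strictly below some endpoint.\<close>

lemma ig_le_cutoff:
  assumes "g \<in> borel_measurable lebesgue" "D \<noteq> {}"
  shows "(\<And>y. y \<in> D \<Longrightarrow> ig {y..} g \<le> B) \<Longrightarrow> ig D g \<le> B"
    and "(\<And>y. y \<in> D \<Longrightarrow> ig {..<y} g \<le> B) \<Longrightarrow> open D \<Longrightarrow> ig D g \<le> B"
proof -
  assume B: "\<And>y. y \<in> D \<Longrightarrow> ig {y..} g \<le> B"
  obtain y where y: "\<And>n. y n \<in> D" "decseq y" "\<And>x. x \<in> D \<Longrightarrow> \<exists>n. y n \<le> x"
    using cofinal_sequence[OF assms(2)] by blast
  have "ig D g \<le> ig (\<Union>n. {y n..}) g"
    using y by (intro ig_mono) auto
  also have "\<dots> = (SUP n. ig {y n..} g)"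
    using y(2) assms(1) by (intro ig_SUP) (auto simp: incseq_def decseq_def)
  also have "\<dots> \<le> B" using B y by (intro SUP_least) auto
  finally show "ig D g \<le> B" .
next
  assume B: "\<And>y. y \<in> D \<Longrightarrow> ig {..<y} g \<le> B" and D: "open D"
  obtain y where y: "\<And>n. y n \<in> uminus ` D" "decseq y" "\<And>x. x \<in> uminus ` D \<Longrightarrow> \<exists>n. y n \<le> x"
    using cofinal_sequence[of "uminus ` D"] assms(2) by (metis image_is_empty)
  have yD: "- y n \<in> D" for n using y(1)[of n] by auto
  have "ig D g \<le> ig (\<Union>n. {..<- y n}) g"
  proof (intro ig_mono subsetI)
    fix x assume "x \<in> D"
    then obtain e where "0 < e" "x + e \<in> D"
      using D unfolding open_dist by (metis add_diff_cancel_left' abs_of_pos dist_real_def field_sum_of_halves half_gt_zero less_add_same_cancel1)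
    then obtain n where "y n \<le> - (x + e)" using y(3) by blast
    then show "x \<in> (\<Union>n. {..<- y n})" using \<open>0 < e\<close> by (intro UN_I[of n]) auto
  qed simp
  also have "\<dots> = (SUP n. ig {..<- y n} g)"
    using y(2) assms(1) by (intro ig_SUP) (auto simp: incseq_def decseq_def intro: less_le_trans)
  also have "\<dots> \<le> B" using B yD by (intro SUP_least) auto
  finally show "ig D g \<le> B" .
qed

lemma ig_density: "g \<in> borel_measurable lebesgue \<Longrightarrow> A \<in> sets lebesgue \<Longrightarrow> emeasure (density lebesgue g) A = ig A g"
  by (simp add: emeasure_density ig_def)

text \<open>The measure with density \<open>h\<close> has no atoms, so the integral over
  \<open>{..<x}\<close> is continuous in x. At the supremum of the points with value at most
  \<open>c\<close>, approximation from the left gives at most \<open>c\<close> on the open ray,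
  approximation from the right at least \<open>c\<close> on the closed ray, and the two rays differ
  by a null set.\<close>

lemma ig_intermediate_value:
  assumes h [measurable]: "h \<in> borel_measurable lebesgue" and fin: "ig UNIV h < top"
    and c: "0 < c" "c < ig UNIV h"
  obtains x where "ig {..<x} h = c"
proof -
  define \<mu> where "\<mu> = density lebesgue h"
  have mu: "emeasure \<mu> A = ig A h" if "A \<in> sets borel" for A
    using that h unfolding \<mu>_def by (intro ig_density) auto
  have sets [simp]: "A \<in> sets \<mu>" if "A \<in> sets borel" for A
    using that by (simp add: \<mu>_def)
  have mono: "ig {..<x} h \<le> ig {..<y} h" if "x \<le> y" for x y
    using that by (intro ig_mono) auto
  have finA: "ig A h \<noteq> top" for A
    using ig_mono[of A UNIV h h] fin by (metis less_top order.trans subset_UNIV top.extremum_uniqueI order_refl)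
  define S where "S = {x. ig {..<x} h \<le> c}"
  have "(\<lambda>n. emeasure \<mu> {..<real n}) \<longlonglongrightarrow> emeasure \<mu> (\<Union>n. {..<real n})"
    by (intro Lim_emeasure_incseq) (auto simp: incseq_def)
  moreover have "(\<Union>n. {..<real n}) = UNIV"
    by (auto intro: reals_Archimedean2)
  ultimately have "(\<lambda>n. ig {..<real n} h) \<longlonglongrightarrow> ig UNIV h"
    by (simp add: mu)
  then have "\<forall>\<^sub>F n in sequentially. c < ig {..<real n} h"
    using c(2) by (rule order_tendstoD)
  then obtain N where N: "c < ig {..<real N} h"
    by (meson eventually_sequentially order_refl)
  have bdd: "bdd_above S"
    unfolding S_def using N mono
    by (intro bdd_aboveI[of _ "real N"]) (metis linorder_le_cases mem_Collect_eq not_less order.trans)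
  have "(\<lambda>n. emeasure \<mu> {..<- real n}) \<longlonglongrightarrow> emeasure \<mu> (\<Inter>n. {..<- real n})"
    by (intro Lim_emeasure_decseq) (auto simp: decseq_def mu finA)
  moreover have "(\<Inter>n. {..<- real n}) = {}"
  proof -
    have "\<exists>n. \<not> x < - real n" for x
      using reals_Archimedean2[of "- x"] by (metis less_minus_iff not_less_iff_gr_or_eq)
    then show ?thesis by auto
  qed
  ultimately have "(\<lambda>n. ig {..<- real n} h) \<longlonglongrightarrow> 0"
    by (simp add: mu)
  then have "\<forall>\<^sub>F n in sequentially. ig {..<- real n} h < c"
    using c(1) by (rule order_tendstoD)
  then obtain N' where "ig {..<- real N'} h < c"
    by (meson eventually_sequentially order_refl)
  then have S0: "S \<noteq> {}" unfolding S_def by (auto intro: less_imp_le)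
  define x where "x = Sup S"
  have le: "ig {..<x - 1 / real (Suc n)} h \<le> c" for n
  proof -
    have "x - 1 / real (Suc n) < x" by simp
    then obtain s where "s \<in> S" "x - 1 / real (Suc n) < s"
      unfolding x_def using less_cSup_iff[OF S0 bdd] by blast
    then show ?thesis
      using mono[of "x - 1 / real (Suc n)" s] unfolding S_def by auto
  qed
  have gt: "c \<le> ig {..<x + 1 / real (Suc n)} h" for n
  proof (rule ccontr)
    assume "\<not> ?thesis"
    then have "x + 1 / real (Suc n) \<in> S" unfolding S_def by auto
    then have "x + 1 / real (Suc n) \<le> x" unfolding x_def by (rule cSup_upper[OF _ bdd])
    then show False by simp
  qed
  have "(\<lambda>n. emeasure \<mu> {..<x - 1 / real (Suc n)}) \<longlonglongrightarrow> emeasure \<mu> (\<Union>n. {..<x - 1 / real (Suc n)})"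
    by (intro Lim_emeasure_incseq) (auto simp: incseq_def field_simps intro: less_le_trans)
  moreover have "(\<Union>n. {..<x - 1 / real (Suc n)}) = {..<x}"
  proof -
    have "\<exists>n. y < x - 1 / real (Suc n)" if "y < x" for y
      using reals_Archimedean[of "x - y"] that by (auto simp: inverse_eq_divide algebra_simps)
    then show ?thesis by (auto intro: less_le_trans)
  qed
  ultimately have "(\<lambda>n. ig {..<x - 1 / real (Suc n)} h) \<longlonglongrightarrow> ig {..<x} h"
    by (simp add: mu)
  then have "ig {..<x} h \<le> c"
    using le by (intro LIMSEQ_le_const2) blast+
  have "(\<lambda>n. emeasure \<mu> {..<x + 1 / real (Suc n)}) \<longlonglongrightarrow> emeasure \<mu> (\<Inter>n. {..<x + 1 / real (Suc n)})"
    by (intro Lim_emeasure_decseq) (auto simp: decseq_def mu finA field_simps intro: less_le_trans)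
  moreover have "(\<Inter>n. {..<x + 1 / real (Suc n)}) = {..x}"
  proof -
    have "\<exists>n. \<not> y < x + 1 / real (Suc n)" if "x < y" for y
      using reals_Archimedean[of "y - x"] that by (auto simp: inverse_eq_divide algebra_simps not_less intro: less_imp_le)
    moreover have "y < x + 1 / real (Suc n)" if "y \<le> x" for y n
      using that by (intro le_less_trans[OF that]) simp
    ultimately show ?thesis by (auto simp: set_eq_iff) (meson not_le)
  qed
  ultimately have "(\<lambda>n. ig {..<x + 1 / real (Suc n)} h) \<longlonglongrightarrow> ig {..x} h"
    by (simp add: mu)
  then have "c \<le> ig {..x} h"
    using gt by (intro LIMSEQ_le_const) blast+
  also have "{..x} = {..<x} \<union> {x}" by auto
  also have "ig ({..<x} \<union> {x}) h = ig {..<x} h"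
    by (intro ig_point) simp
  finally show thesis using \<open>ig {..<x} h \<le> c\<close> by (intro that[of x]) simp
qed

section \<open>Points halving an integral\<close>

text \<open>In all uses \<open>t\<close> is decreasing, so that the levels are numbered from right to left.\<close>

definition lv :: "(nat \<Rightarrow> real) \<Rightarrow> nat \<Rightarrow> real set" where
  "lv t k = {x. t k < x \<and> (\<forall>j<k. x \<le> t j)}"

lemma lv_borel [measurable]: "lv t k \<in> sets borel"
  unfolding lv_def by measurable

lemma lv_lebesgue [simp]: "lv t k \<in> sets lebesgue"
  by (intro borel_lebesgue lv_borel)

lemma lv_disjoint: "disjoint_family (lv t)"
  unfolding disjoint_family_on_def lv_def
  by (auto; metis linorder_neqE_nat not_le)

lemma lv_less: "x \<in> lv t k \<Longrightarrow> t k < x"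
  by (simp add: lv_def)

lemma lv_le: "x \<in> lv t (Suc k) \<Longrightarrow> x \<le> t k"
  by (simp add: lv_def)

lemma not_in_lv: "x \<notin> (\<Union>k. lv t k) \<Longrightarrow> x \<le> t k"
proof (rule ccontr)
  assume x: "x \<notin> (\<Union>k. lv t k)" and "\<not> x \<le> t k"
  then have "t k < x" by simp
  define m where "m = (LEAST j. t j < x)"
  have "t m < x" unfolding m_def using \<open>t k < x\<close> by (rule LeastI)
  moreover have "x \<le> t j" if "j < m" for j
    using not_less_Least[of j "\<lambda>j. t j < x"] that unfolding m_def by simp
  ultimately have "x \<in> lv t m" by (simp add: lv_def)
  then show False using x by blast
qed

text \<open>Level k is the interval from \<open>t k\<close>, excluded, to t (k-1), included; level 0
  is the whole ray to the right of \<open>t 0\<close>. Up to a point of level k the integral is at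
  most l / 2^k, which is four times the integral over the block from t (k+1) to t k just left of the
  level. This factor 4 recurs in all level estimates. A point in no level lies left of all
  \<open>t k\<close>.\<close>

lemma level_points:
  assumes h [measurable]: "h \<in> borel_measurable lebesgue" and l: "ig UNIV h = ennreal l" "0 < l"
  obtains t :: "nat \<Rightarrow> real" where "\<And>k. t (Suc k) < t k"
    and "\<And>k. ig {..<t k} h = ennreal (l / 2 ^ (k + 1))"
    and "\<And>k. ig {t (Suc k)..<t k} h = ennreal (l / 2 ^ (k + 2))"
    and "\<And>k x. x \<in> lv t k \<Longrightarrow> ig {..<x} h \<le> ennreal (l / 2 ^ k)"
    and "\<And>x. x \<notin> (\<Union>k. lv t k) \<Longrightarrow> ig {..<x} h = 0"
proof -
  have "\<exists>x. ig {..<x} h = ennreal (l / 2 ^ (k + 1))" for k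
  proof (rule ig_intermediate_value[OF h, of "ennreal (l / 2 ^ (k + 1))"])
    have "1 < (2::real) ^ (k + 1)" by (intro one_less_power) auto
    then have "l / 2 ^ (k + 1) < l" using l(2) by (simp add: field_simps)
    then show "ennreal (l / 2 ^ (k + 1)) < ig UNIV h" using l by (simp add: ennreal_lessI)
  qed (use l in auto)
  then obtain t where t: "\<And>k. ig {..<t k} h = ennreal (l / 2 ^ (k + 1))" by metis
  have mono: "ig {..<x} h \<le> ig {..<y} h" if "x \<le> y" for x y
    using that by (intro ig_mono) auto
  have dec: "t (Suc k) < t k" for k
  proof (rule ccontr)
    assume "\<not> ?thesis"
    then have "ennreal (l / 2 ^ (k + 1)) \<le> ennreal (l / 2 ^ (k + 2))"
      using mono[of "t k" "t (Suc k)"] by (simp add: t)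
    then show False using l(2) by (simp add: field_simps)
  qed
  show thesis
  proof
    show "t (Suc k) < t k" for k by (rule dec)
    show "ig {..<t k} h = ennreal (l / 2 ^ (k + 1))" for k by (rule t)
    show "ig {t (Suc k)..<t k} h = ennreal (l / 2 ^ (k + 2))" for k
    proof -
      have "ig {..<t k} h = ig ({..<t (Suc k)} \<union> {t (Suc k)..<t k}) h"
        using dec[of k] by (intro ig_cong) auto
      also have "\<dots> = ig {..<t (Suc k)} h + ig {t (Suc k)..<t k} h"
        by (rule ig_Un[OF h]) auto
      finally have "ig {..<t k} h = ig {..<t (Suc k)} h + ig {t (Suc k)..<t k} h" .
      moreover have "l / 2 ^ (k + 1) = l / 2 ^ (k + 2) + l / 2 ^ (k + 2)" by (simp add: field_simps)
      ultimately have "ennreal (l / 2 ^ (k + 2)) + ennreal (l / 2 ^ (k + 2))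
          = ennreal (l / 2 ^ (k + 2)) + ig {t (Suc k)..<t k} h"
        using l(2) by (simp add: t flip: ennreal_plus)
      then show ?thesis
        by (simp add: ennreal_add_left_cancel)
    qed
    show "ig {..<x} h \<le> ennreal (l / 2 ^ k)" if "x \<in> lv t k" for k x
    proof (cases k)
      case 0
      then show ?thesis using ig_mono[of "{..<x}" UNIV h h] l by simp
    next
      case (Suc j)
      then show ?thesis using mono[of x "t j"] lv_le[of x t j] that by (simp add: t)
    qed
    show "ig {..<x} h = 0" if x: "x \<notin> (\<Union>k. lv t k)" for x
    proof (rule ccontr)
      assume "ig {..<x} h \<noteq> 0"
      moreover have le: "ig {..<x} h \<le> ennreal (l / 2 ^ (k + 1))" for k
        using mono[OF not_in_lv[OF x]] by (simp add: t)
      ultimately obtain e where e: "ig {..<x} h = ennreal e" "0 < e"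
        by (metis ennreal_cases ennreal_neq_top ennreal_0 less_eq_real_def neq_top_trans)
      obtain k where "l / e < 2 ^ k" using real_arch_pow[of 2 "l / e"] by auto
      then have "l / 2 ^ (k + 1) < e" using e(2) l(2) by (simp add: field_simps)
      then show False using le[of k] e l(2) by (simp add: ennreal_le_iff)
    qed
  qed
qed

text \<open>Stands in for integrating the derivative of the (s+1)-st power of the tail. At a median
  \<open>x0\<close> the points to the left carry half of the mass, and each of them has a tail of at
  least the other half.\<close>

lemma power_rule:
  assumes g [measurable]: "g \<in> borel_measurable lebesgue" and E: "E \<in> sets borel"
    and fin: "ig E g < top" and s: "0 < s"
  shows "ig E g epowr (s + 1) \<le> 2 epowr (s + 1) * ig E (\<lambda>x. g x * ig (E \<inter> {x..}) g epowr s)"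
proof (cases "ig E g = 0")
  case False
  note [measurable] = borel_lebesgue[OF E]
  define h where "h x = g x * indicator E x" for x
  have [measurable]: "h \<in> borel_measurable lebesgue" unfolding h_def by measurable
  have h: "ig A h = ig (E \<inter> A) g" for A
    unfolding ig_def h_def by (intro nn_integral_cong) (auto simp: indicator_def)
  define L where "L = ig E g"
  obtain l where l: "L = ennreal l" "0 < l"
    using fin False unfolding L_def by (metis ennreal_cases ennreal_0 less_eq_real_def less_irrefl)
  have l2: "L = 2 * ennreal (l / 2)" using l by (simp flip: ennreal_numeral ennreal_mult)
  obtain x0 where x0: "ig {..<x0} h = ennreal (l / 2)"
    using ig_intermediate_value[of h "ennreal (l / 2)"] l fin h[of UNIV] unfolding L_def
    by (auto simp: ennreal_lessI)
  have "ig UNIV h = ig ({..<x0} \<union> {x0..}) h" by (rule ig_cong) auto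
  also have "\<dots> = ig {..<x0} h + ig {x0..} h" by (intro ig_Un) auto
  finally have "ennreal (l / 2) + ennreal (l / 2) = ennreal (l / 2) + ig {x0..} h"
    using l by (simp add: h[of UNIV] x0 L_def flip: ennreal_plus)
  then have x1: "ig {x0..} h = ennreal (l / 2)"
    by (simp add: ennreal_add_left_cancel)
  have "L epowr (s + 1) = 2 epowr (s + 1) * (ennreal (l / 2) epowr s * ig (E \<inter> {..<x0}) g)"
    unfolding l2 epowr_mult using x0 h[of "{..<x0}"] by (simp add: epowr_add)
  also have "ennreal (l / 2) epowr s * ig (E \<inter> {..<x0}) g
      = ig (E \<inter> {..<x0}) (\<lambda>x. ennreal (l / 2) epowr s * g x)"
    using E by (intro ig_cmult[symmetric]) auto
  also have "\<dots> \<le> ig E (\<lambda>x. g x * ig (E \<inter> {x..}) g epowr s)"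
  proof (intro ig_mono)
    fix x assume x: "x \<in> E \<inter> {..<x0}"
    have "ennreal (l / 2) \<le> ig (E \<inter> {x..}) g"
      unfolding x1[symmetric] h using x by (intro ig_mono) auto
    then have "ennreal (l / 2) epowr s \<le> ig (E \<inter> {x..}) g epowr s"
      using s by (intro epowr_mono)
    then show "ennreal (l / 2) epowr s * g x \<le> g x * ig (E \<inter> {x..}) g epowr s"
      by (simp add: mult.commute mult_left_mono)
  qed auto
  finally show ?thesis by (simp add: L_def mult_left_mono)
qed simp

section \<open>Testing an inequality on level sets\<close>

lemma powr_diff_le:
  fixes x y s :: real
  assumes "1 < s" "0 \<le> y" "y \<le> x"
  shows "x powr s - y powr s \<le> s * (x powr (s - 1) * (x - y))"
proof (cases "x = y")
  case False
  then have xy: "y < x" using assms by simp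
  show ?thesis
  proof (cases "y = 0")
    case True
    then show ?thesis
      using assms xy by (simp add: powr_mult_base[symmetric] mult.commute[of "x powr (s-1)"])
        (simp add: powr_mult_base mult_le_cancel_right1)
  next
    case False
    then have y: "0 < y" using assms by simp
    have "\<exists>z. z > y \<and> z < x \<and> x powr s - y powr s = (x - y) * (s * z powr (s - 1))"
      using xy y by (intro MVT2) (auto intro!: derivative_eq_intros simp: )
    then obtain z where z: "y < z" "z < x" "x powr s - y powr s = (x - y) * (s * z powr (s - 1))"
      by blast
    have "z powr (s - 1) \<le> x powr (s - 1)"
      using z y assms by (intro powr_mono2) auto
    then show ?thesis
      using z(3) xy assms by (simp add: mult.commute mult.left_commute mult_left_mono)
  qed
qed simp

text \<open>Summation by parts: (1 - 1/\<beta>) \<beta>^i is the increment from \<beta>^(i-1) to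
  \<beta>^i. It is shifted onto the differences of m^s, which \<open>powr_diff_le\<close>
  bounds.\<close>

lemma Abel_geometric:
  fixes m :: "nat \<Rightarrow> real"
  assumes s: "1 < s" and \<beta>: "1 < \<beta>" and m: "\<And>i. 0 \<le> m i" "\<And>i. m (Suc i) \<le> m i"
  shows "(1 - 1 / \<beta>) * (\<Sum>i\<le>k. \<beta> ^ i * m i powr s)
    \<le> s * (\<Sum>i<k. \<beta> ^ i * m i powr (s - 1) * (m i - m (Suc i))) + \<beta> ^ k * m k powr s"
proof (induction k)
  case 0
  show ?case using \<beta> by (simp add: mult_left_le_one_le mult_le_cancel_right1)
next
  case (Suc k)
  have "(1 - 1 / \<beta>) * (\<Sum>i\<le>Suc k. \<beta> ^ i * m i powr s)
    = (1 - 1 / \<beta>) * (\<Sum>i\<le>k. \<beta> ^ i * m i powr s) + (\<beta> ^ Suc k - \<beta> ^ k) * m (Suc k) powr s"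
    using \<beta> by (simp add: field_simps)
  also have "\<dots> \<le> s * (\<Sum>i<k. \<beta> ^ i * m i powr (s - 1) * (m i - m (Suc i))) + \<beta> ^ k * m k powr s
      + (\<beta> ^ Suc k - \<beta> ^ k) * m (Suc k) powr s"
    using Suc by simp
  also have "\<dots> = s * (\<Sum>i<k. \<beta> ^ i * m i powr (s - 1) * (m i - m (Suc i)))
      + \<beta> ^ k * (m k powr s - m (Suc k) powr s) + \<beta> ^ Suc k * m (Suc k) powr s"
    by (simp add: algebra_simps)
  also have "\<beta> ^ k * (m k powr s - m (Suc k) powr s)
      \<le> \<beta> ^ k * (s * (m k powr (s - 1) * (m k - m (Suc k))))"
    using powr_diff_le[OF s m(1) m(2)] \<beta> by (intro mult_left_mono) auto
  finally show ?case
    by (simp add: algebra_simps)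
qed

text \<open>With \<rho> = R/(1-R), the first factor 2^\<rho> is the loss in replacing a value by the
  next dyadic level below it. The second is K^(\<rho>+1), where K = (\<rho>+1) / (1 - 2^(-\<rho>))
  is the constant of \<open>Abel_geometric\<close> for the ratio 2^\<rho> and the exponent comes
  from absorbing a power R of the sum.\<close>

definition hardyL_const :: "real \<Rightarrow> real" where
  "hardyL_const R = 2 powr (R / (1 - R)) *
    ((1 / (1 - R)) / (1 - 1 / 2 powr (R / (1 - R)))) powr (1 / (1 - R))"

lemma hardyL_const_nonneg: "0 \<le> hardyL_const R"
  by (simp add: hardyL_const_def)

text \<open>The necessity half of all inequalities with an exponent \<open>R < 1\<close> on the left. The test family
  lives on the dyadic levels of \<open>S\<close>; the sets \<open>N \<theta> n\<close> exhaust the super-level set of \<open>\<theta>\<close>, on which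
  a test function need not be uniformly bounded below.\<close>

lemma level_set_test:
  fixes S :: "'a \<Rightarrow> real" and R Z :: real
  assumes R: "0 < R" "R < 1" and Z: "0 \<le> Z"
    and S [measurable]: "S \<in> borel_measurable M" and S0: "\<And>x. 0 \<le> S x"
    and N [measurable]: "\<And>\<theta> n. N \<theta> n \<in> sets M"
    and Ninc: "\<And>\<theta>. 0 < \<theta> \<Longrightarrow> incseq (N \<theta>)"
    and NU: "\<And>\<theta>. 0 < \<theta> \<Longrightarrow> (\<Union>n. N \<theta> n) = {x \<in> space M. \<theta> < S x}"
    and test: "\<And>k \<theta> n a. (\<And>i. i \<le> k \<Longrightarrow> 0 < \<theta> i \<and> 0 \<le> a i) \<Longrightarrow>
      \<exists>h\<in>borel_measurable M. (\<forall>i\<le>k. \<forall>x\<in>N (\<theta> i) n. ennreal ((a i * \<theta> i) powr R) \<le> h x) \<and>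
        (\<integral>\<^sup>+x. h x \<partial>M) \<le> ennreal (Z * (\<Sum>i\<le>(k::nat). a i) powr R)"
  shows "(\<integral>\<^sup>+x. emeasure M {y \<in> space M. S x \<le> S y} epowr (R / (1 - R)) * ennreal (S x) epowr (R / (1 - R)) \<partial>M)
    \<le> ennreal (hardyL_const R * Z powr (1 / (1 - R)))"
proof -
  \<comment> \<open>The identity (\<rho>+1) R = \<rho> lets the coefficients chosen below reproduce
    the sum that they test.\<close>
  define \<rho> where "\<rho> = R / (1 - R)"
  have \<rho>: "0 < \<rho>" "(\<rho> + 1) * R = \<rho>" "\<rho> + 1 = 1 / (1 - R)"
    using R by (auto simp: \<rho>_def field_simps)
  define L where "L \<theta> = {x \<in> space M. \<theta> < S x}" for \<theta>
  have [measurable]: "L \<theta> \<in> sets M" for \<theta> unfolding L_def by measurable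
  have lim: "(\<lambda>n. emeasure M (A \<inter> N \<theta> n)) \<longlonglongrightarrow> emeasure M (A \<inter> L \<theta>)" if "0 < \<theta>" "A \<in> sets M" for A \<theta>
  proof -
    have "(\<lambda>n. emeasure M (A \<inter> N \<theta> n)) \<longlonglongrightarrow> emeasure M (\<Union>n. A \<inter> N \<theta> n)"
      using Ninc[OF that(1)] that(2) by (intro Lim_emeasure_incseq) (auto simp: incseq_def)
    also have "(\<Union>n. A \<inter> N \<theta> n) = A \<inter> L \<theta>"
      using NU[OF that(1)] unfolding L_def by blast
    finally show ?thesis .
  qed
  \<comment> \<open>A single test function, with k = 0, already bounds the measure of a super-level
    set. Only then may such measures be subtracted.\<close>
  have finL: "emeasure M (L \<theta>) < top" if \<theta>: "0 < \<theta>" for \<theta>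
  proof -
    have bnd: "emeasure M (L \<theta> \<inter> N \<theta> n) \<le> ennreal (Z / \<theta> powr R)" for n
    proof -
      obtain h where h: "h \<in> borel_measurable M" "\<forall>x\<in>N \<theta> n. ennreal (\<theta> powr R) \<le> h x"
        "(\<integral>\<^sup>+x. h x \<partial>M) \<le> ennreal Z"
        using test[of 0 "\<lambda>_. \<theta>" "\<lambda>_. 1" n] \<theta> by auto
      have "ennreal (\<theta> powr R) * emeasure M (N \<theta> n) = (\<integral>\<^sup>+x. ennreal (\<theta> powr R) * indicator (N \<theta> n) x \<partial>M)"
        by (simp add: nn_integral_cmult_indicator)
      also have "\<dots> \<le> (\<integral>\<^sup>+x. h x \<partial>M)"
        using h(2) by (intro nn_integral_mono) (auto simp: indicator_def)
      finally have "ennreal (\<theta> powr R) * emeasure M (N \<theta> n) \<le> ennreal Z" using h(3) by simp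
      then have "emeasure M (N \<theta> n) \<le> ennreal (Z / \<theta> powr R)"
        using \<theta> Z by (cases "emeasure M (N \<theta> n)")
          (auto simp: ennreal_mult_top top_unique field_simps ennreal_le_iff simp flip: ennreal_mult)
      moreover have "emeasure M (L \<theta> \<inter> N \<theta> n) \<le> emeasure M (N \<theta> n)"
        by (intro emeasure_mono) auto
      ultimately show ?thesis by simp
    qed
    have "(\<lambda>n. emeasure M (L \<theta> \<inter> N \<theta> n)) \<longlonglongrightarrow> emeasure M (L \<theta>)"
      using lim[OF \<theta>, of "L \<theta>"] by simp
    then have "emeasure M (L \<theta>) \<le> ennreal (Z / \<theta> powr R)"
      using bnd by (intro LIMSEQ_le_const2) blast+
    then show ?thesis by (simp add: le_less_trans)
  qed
  have sumbound: "(\<Sum>i\<le>k. (\<theta>0 * 2 ^ i) powr \<rho> * measure M (L (\<theta>0 * 2 ^ i)) powr (\<rho> + 1))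
      \<le> ((\<rho> + 1) / (1 - 1 / 2 powr \<rho>)) powr (\<rho> + 1) * Z powr (\<rho> + 1)" if \<theta>0: "0 < \<theta>0" for \<theta>0 k
  proof -
    define \<theta> where "\<theta> i = \<theta>0 * 2 ^ i" for i
    have \<theta>: "0 < \<theta> i" for i using \<theta>0 by (simp add: \<theta>_def)
    have \<theta>Suc: "\<theta> i \<le> \<theta> (Suc i)" for i using \<theta>0 by (simp add: \<theta>_def)
    define m where "m i = measure M (L (\<theta> i))" for i
    have em: "emeasure M (L (\<theta> i)) = ennreal (m i)" for i
      using finL[OF \<theta>[of i]] by (simp add: m_def emeasure_eq_ennreal_measure)
    have Lsub: "L (\<theta> (Suc i)) \<subseteq> L (\<theta> i)" for i
      using \<theta>Suc[of i] by (auto simp: L_def)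
    have m: "0 \<le> m i" "m (Suc i) \<le> m i" for i
    proof -
      show "0 \<le> m i" by (simp add: m_def)
      have "emeasure M (L (\<theta> (Suc i))) \<le> emeasure M (L (\<theta> i))"
        using Lsub by (intro emeasure_mono) auto
      then show "m (Suc i) \<le> m i" unfolding em by (simp add: m_def ennreal_le_iff)
    qed
    \<comment> \<open>The coefficients are the terms of the sum to be bounded. Then (a \<theta>)^R =
      b, and summing b against the measures of the slices gives the right-hand side of
      \<open>Abel_geometric\<close>.\<close>
    define a where "a i = \<theta> i powr \<rho> * m i powr (\<rho> + 1)" for i
    define b where "b i = \<theta> i powr \<rho> * m i powr \<rho>" for i
    have a0: "0 \<le> a i" for i by (simp add: a_def)
    have ab: "(a i * \<theta> i) powr R = b i" for i
    proof -
      have "a i * \<theta> i = \<theta> i powr (\<rho> + 1) * m i powr (\<rho> + 1)"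
        using \<theta>[of i] by (simp add: a_def powr_add)
      then show ?thesis using \<theta>[of i] m(1)[of i] by (simp add: b_def powr_mult powr_powr \<rho>(2))
    qed
    \<comment> \<open>Disjoint slices of the nested super-level sets. The topmost one stays whole
      and yields the boundary term of the summation by parts.\<close>
    define B where "B i = (if i < k then L (\<theta> i) - L (\<theta> (Suc i)) else L (\<theta> i))" for i
    have [measurable]: "B i \<in> sets M" for i unfolding B_def by auto
    have Bsub: "B i \<subseteq> L (\<theta> i)" for i by (auto simp: B_def)
    have Lmono: "L (\<theta> j) \<subseteq> L (\<theta> i)" if "i \<le> j" for i j
      using that by (induction rule: dec_induct) (use Lsub in blast)+
    have Bdis: "B i \<inter> B j = {}" if "i < j" "j \<le> k" for i j
      using Lmono[of "Suc i" j] that Bsub[of j] by (auto simp: B_def)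
    have Bdis': "disjoint_family_on B {..k}"
      unfolding disjoint_family_on_def
      by (metis Bdis Int_commute atMost_iff linorder_neqE_nat)
    define A where "A = (\<Sum>i\<le>k. a i)"
    have A0: "0 \<le> A" unfolding A_def by (intro sum_nonneg a0)
    have step: "(\<Sum>i\<le>k. ennreal (b i) * emeasure M (B i \<inter> N (\<theta> i) n)) \<le> ennreal (Z * A powr R)" for n
    proof -
      obtain h where h: "h \<in> borel_measurable M" "\<forall>i\<le>k. \<forall>x\<in>N (\<theta> i) n. ennreal (b i) \<le> h x"
        "(\<integral>\<^sup>+x. h x \<partial>M) \<le> ennreal (Z * A powr R)"
        using test[of k \<theta> a n] \<theta> a0 ab unfolding A_def by auto
      have "(\<Sum>i\<le>k. ennreal (b i) * emeasure M (B i \<inter> N (\<theta> i) n))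
          = (\<integral>\<^sup>+x. (\<Sum>i\<le>k. ennreal (b i) * indicator (B i \<inter> N (\<theta> i) n) x) \<partial>M)"
        by (subst nn_integral_sum) (auto simp: nn_integral_cmult_indicator)
      also have "\<dots> \<le> (\<integral>\<^sup>+x. h x \<partial>M)"
      proof (rule nn_integral_mono)
        fix x
        show "(\<Sum>i\<le>k. ennreal (b i) * indicator (B i \<inter> N (\<theta> i) n) x) \<le> h x"
        proof (cases "\<exists>j\<le>k. x \<in> B j")
          case True
          then obtain j where j: "j \<le> k" "x \<in> B j" by blast
          have "(\<Sum>i\<le>k. ennreal (b i) * indicator (B i \<inter> N (\<theta> i) n) x)
              = (\<Sum>i\<in>{j}. ennreal (b i) * indicator (B i \<inter> N (\<theta> i) n) x)"
          proof (rule sum.mono_neutral_right)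
            show "\<forall>i\<in>{..k} - {j}. ennreal (b i) * indicator (B i \<inter> N (\<theta> i) n) x = 0"
              using Bdis' j unfolding disjoint_family_on_def by (fastforce simp: indicator_def)
          qed (use j in auto)
          also have "\<dots> \<le> h x" using h(2) j by (cases "x \<in> N (\<theta> j) n") (auto simp: Int_insert_left)
          finally show ?thesis .
        next
          case False
          then have "(\<Sum>i\<le>k. ennreal (b i) * indicator (B i \<inter> N (\<theta> i) n) x) = 0"
            by (intro sum.neutral) (auto simp: indicator_def)
          then show ?thesis by simp
        qed
      qed
      finally show ?thesis using h(3) by simp
    qed
    \<comment> \<open>As n grows, the sets \<open>N (\<theta> i) n\<close> fill the super-level sets
      while the bound stays fixed.\<close>
    have "(\<lambda>n. \<Sum>i\<le>k. ennreal (b i) * emeasure M (B i \<inter> N (\<theta> i) n))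
        \<longlonglongrightarrow> (\<Sum>i\<le>k. ennreal (b i) * emeasure M (B i \<inter> L (\<theta> i)))"
      using \<theta> by (intro tendsto_sum ennreal_tendsto_cmult lim) auto
    then have "(\<Sum>i\<le>k. ennreal (b i) * emeasure M (B i \<inter> L (\<theta> i))) \<le> ennreal (Z * A powr R)"
      using step by (intro LIMSEQ_le_const2) blast+
    moreover have "emeasure M (B i \<inter> L (\<theta> i)) = ennreal (if i < k then m i - m (Suc i) else m i)" for i
    proof -
      have "B i \<inter> L (\<theta> i) = B i" using Bsub by blast
      moreover have "emeasure M (L (\<theta> i) - L (\<theta> (Suc i))) = ennreal (m i) - ennreal (m (Suc i))"
        using Lsub[of i] by (subst emeasure_Diff) (auto simp: em)
      ultimately show ?thesis
        using m[of i] m(1)[of "Suc i"] by (simp add: B_def em ennreal_minus)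
    qed
    ultimately have "(\<Sum>i\<le>k. ennreal (b i * (if i < k then m i - m (Suc i) else m i))) \<le> ennreal (Z * A powr R)"
      using m by (simp add: ennreal_mult b_def)
    then have "ennreal (\<Sum>i\<le>k. b i * (if i < k then m i - m (Suc i) else m i)) \<le> ennreal (Z * A powr R)"
      using m by (subst sum_ennreal[symmetric]) (auto simp: b_def)
    then have le: "(\<Sum>i\<le>k. b i * (if i < k then m i - m (Suc i) else m i)) \<le> Z * A powr R"
      using Z by (simp add: ennreal_le_iff)
    have split: "(\<Sum>i\<le>k. b i * (if i < k then m i - m (Suc i) else m i))
        = (\<Sum>i<k. b i * (m i - m (Suc i))) + b k * m k"
      by (simp flip: lessThan_Suc_atMost)
    define \<beta> where "\<beta> = 2 powr \<rho>"
    have \<beta>: "1 < \<beta>" unfolding \<beta>_def using \<rho>(1) by (simp add: gr_one_powr)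
    have th_be: "\<theta> i powr \<rho> = \<theta>0 powr \<rho> * \<beta> ^ i" for i
      using \<theta>0 by (simp add: \<theta>_def \<beta>_def powr_mult powr_realpow[symmetric] powr_powr mult.commute)
    have "(1 - 1 / \<beta>) * A = \<theta>0 powr \<rho> * ((1 - 1 / \<beta>) * (\<Sum>i\<le>k. \<beta> ^ i * m i powr (\<rho> + 1)))"
      unfolding A_def a_def th_be by (simp add: sum_distrib_left mult.assoc mult.left_commute)
    also have "\<dots> \<le> \<theta>0 powr \<rho> * ((\<rho> + 1) * (\<Sum>i<k. \<beta> ^ i * m i powr \<rho> * (m i - m (Suc i))) + \<beta> ^ k * m k powr (\<rho> + 1))"
      using Abel_geometric[of "\<rho> + 1" \<beta> m k] \<beta> \<rho>(1) m by (intro mult_left_mono) auto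
    also have "\<dots> = (\<rho> + 1) * (\<Sum>i<k. b i * (m i - m (Suc i))) + b k * m k"
      unfolding b_def th_be using m(1)[of k]
      by (simp add: sum_distrib_left algebra_simps powr_add)
    also have "\<dots> \<le> (\<rho> + 1) * ((\<Sum>i<k. b i * (m i - m (Suc i))) + b k * m k)"
      using \<rho>(1) m(1)[of k] mult_right_mono[of 1 "\<rho> + 1" "b k * m k"] by (simp add: distrib_left b_def)
    also have "\<dots> \<le> (\<rho> + 1) * (Z * A powr R)"
      using le \<rho>(1) unfolding split by (intro mult_left_mono) auto
    finally have main: "(1 - 1 / \<beta>) * A \<le> (\<rho> + 1) * (Z * A powr R)" .
    define K where "K = (\<rho> + 1) / (1 - 1 / \<beta>)"
    have K: "0 < K" unfolding K_def using \<beta> \<rho>(1) by simp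
    have AK: "A \<le> K * Z * A powr R"
      unfolding K_def using main \<beta> by (simp add: field_simps)
    \<comment> \<open>\<open>A\<close> is a finite real, so A <= K Z A^R may be divided by
      A^R.\<close>
    have "A \<le> (K * Z) powr (\<rho> + 1)"
    proof (cases "A = 0")
      case False
      then have A: "0 < A" using A0 by simp
      have "A powr (1 - R) = A / A powr R"
        using A by (simp add: powr_diff)
      also have "\<dots> \<le> K * Z"
        using AK A by (simp add: field_simps)
      finally have "(A powr (1 - R)) powr (\<rho> + 1) \<le> (K * Z) powr (\<rho> + 1)"
        using \<rho>(1) by (intro powr_mono2) auto
      moreover have "(1 - R) * (\<rho> + 1) = 1" using R by (simp add: \<rho>(3))
      ultimately show ?thesis using A by (simp add: powr_powr)
    qed simp
    also have "(K * Z) powr (\<rho> + 1) = K powr (\<rho> + 1) * Z powr (\<rho> + 1)"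
      using K Z by (simp add: powr_mult)
    finally show ?thesis
      unfolding A_def a_def m_def \<theta>_def K_def \<beta>_def .
  qed
  define B where "B = ((\<rho> + 1) / (1 - 1 / 2 powr \<rho>)) powr (\<rho> + 1) * Z powr (\<rho> + 1)"
  define G where "G x = emeasure M {y \<in> space M. S x \<le> S y} epowr \<rho> * ennreal (S x) epowr \<rho>" for x
  have "antimono (\<lambda>s. emeasure M {y \<in> space M. s \<le> S y})"
    by (auto simp: antimono_def intro!: emeasure_mono)
  then have [measurable]: "(\<lambda>s. emeasure M {y \<in> space M. s \<le> S y}) \<in> borel_measurable borel"
    by (rule borel_measurable_antimono_ennreal)
  have [measurable]: "G \<in> borel_measurable M"
    unfolding G_def by measurable
  \<comment> \<open>On \<open>P K\<close> the values of \<open>S\<close> span 2 K doublings, so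
    finitely many levels cover them; the bound does not depend on K.\<close>
  define P where "P K = {x \<in> space M. 1 / 2 ^ K < S x \<and> S x \<le> 2 ^ K}" for K :: nat
  have [measurable]: "P K \<in> sets M" for K unfolding P_def by measurable
  have part: "(\<integral>\<^sup>+x. G x * indicator (P K) x \<partial>M) \<le> ennreal (2 powr \<rho> * B)" for K
  proof -
    define \<theta>0 :: real where "\<theta>0 = 1 / 2 ^ K"
    define \<theta> where "\<theta> i = \<theta>0 * 2 ^ i" for i
    have \<theta>: "0 < \<theta> i" for i by (simp add: \<theta>_def \<theta>0_def)
    define c where "c i = (2 * \<theta> i) powr \<rho> * measure M (L (\<theta> i)) powr \<rho>" for i
    have pw: "G x * indicator (P K) x \<le> (\<Sum>i\<le>2*K. ennreal (c i) * indicator (L (\<theta> i)) x)" for x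
    proof (cases "x \<in> P K")
      case True
      then have x: "x \<in> space M" "\<theta> 0 < S x" "S x \<le> \<theta> (2 * K)"
        by (auto simp: P_def \<theta>_def \<theta>0_def mult_2 power_add)
      define i where "i = (LEAST i. S x \<le> \<theta> i) - 1"
      define l where "l = (LEAST i. S x \<le> \<theta> i)"
      have l: "S x \<le> \<theta> l" unfolding l_def using x(3) by (rule LeastI)
      have l0: "l \<noteq> 0" using l x(2) by (metis not_le)
      have lK: "l \<le> 2 * K" unfolding l_def using x(3) by (rule Least_le)
      have i: "l = Suc i" using l0 by (simp add: i_def l_def)
      have lt: "\<theta> i < S x"
        using not_less_Least[of i "\<lambda>i. S x \<le> \<theta> i"] i unfolding l_def by (simp add: not_le)
      have le2: "S x \<le> 2 * \<theta> i" using l unfolding i by (simp add: \<theta>_def)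
      have "emeasure M {y \<in> space M. S x \<le> S y} \<le> emeasure M (L (\<theta> i))"
        using lt by (intro emeasure_mono) (auto simp: L_def)
      then have "emeasure M {y \<in> space M. S x \<le> S y} \<le> ennreal (measure M (L (\<theta> i)))"
        using finL[OF \<theta>[of i]] by (simp add: emeasure_eq_ennreal_measure)
      then have "G x \<le> ennreal (measure M (L (\<theta> i))) epowr \<rho> * ennreal (2 * \<theta> i) epowr \<rho>"
        unfolding G_def using le2 \<rho>(1) by (intro mult_mono epowr_mono ennreal_leI) auto
      also have "\<dots> = ennreal (c i)"
        using \<theta>[of i] epowr_ennreal[of "2 * \<theta> i" \<rho>]
        by (simp only: c_def) (simp add: epowr_ennreal ennreal_mult mult.commute)
      also have "\<dots> = ennreal (c i) * indicator (L (\<theta> i)) x"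
        using lt x by (simp add: L_def)
      also have "\<dots> \<le> (\<Sum>i\<le>2*K. ennreal (c i) * indicator (L (\<theta> i)) x)"
        using i lK by (intro member_le_sum) auto
      finally show ?thesis using True by simp
    qed simp
    have "(\<integral>\<^sup>+x. G x * indicator (P K) x \<partial>M) \<le> (\<integral>\<^sup>+x. (\<Sum>i\<le>2*K. ennreal (c i) * indicator (L (\<theta> i)) x) \<partial>M)"
      using pw by (intro nn_integral_mono)
    also have "\<dots> = (\<Sum>i\<le>2*K. ennreal (c i) * emeasure M (L (\<theta> i)))"
      by (subst nn_integral_sum) (auto simp: nn_integral_cmult_indicator)
    also have "\<dots> = (\<Sum>i\<le>2*K. ennreal (2 powr \<rho> * (\<theta> i powr \<rho> * measure M (L (\<theta> i)) powr (\<rho> + 1))))"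
    proof (intro sum.cong refl)
      fix i
      have "ennreal (c i) * emeasure M (L (\<theta> i)) = ennreal (c i * measure M (L (\<theta> i)))"
        using finL[OF \<theta>[of i]] by (simp add: emeasure_eq_ennreal_measure ennreal_mult c_def)
      also have "c i * measure M (L (\<theta> i)) = 2 powr \<rho> * (\<theta> i powr \<rho> * measure M (L (\<theta> i)) powr (\<rho> + 1))"
        using \<theta>[of i] by (simp add: c_def powr_mult powr_add)
      finally show "ennreal (c i) * emeasure M (L (\<theta> i)) = ennreal (2 powr \<rho> * (\<theta> i powr \<rho> * measure M (L (\<theta> i)) powr (\<rho> + 1)))" .
    qed
    also have "\<dots> = ennreal (2 powr \<rho> * (\<Sum>i\<le>2*K. \<theta> i powr \<rho> * measure M (L (\<theta> i)) powr (\<rho> + 1)))"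
      by (subst sum_ennreal) (auto simp: sum_distrib_left)
    also have "\<dots> \<le> ennreal (2 powr \<rho> * B)"
      using sumbound[of \<theta>0 "2 * K"] unfolding B_def \<theta>_def
      by (intro ennreal_leI mult_left_mono) (auto simp: \<theta>0_def)
    finally show ?thesis .
  qed
  have inc: "incseq (\<lambda>K x. G x * indicator (P K) x)"
  proof -
    have "P K \<subseteq> P (Suc K)" for K
    proof
      fix x assume "x \<in> P K"
      moreover have "(1::real) / 2 ^ Suc K \<le> 1 / 2 ^ K" by (simp add: field_simps)
      moreover have "(2::real) ^ K \<le> 2 ^ Suc K" by simp
      ultimately show "x \<in> P (Suc K)" unfolding P_def mem_Collect_eq by linarith
    qed
    then show ?thesis
      by (intro incseq_SucI) (auto simp: le_fun_def indicator_def)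
  qed
  have "G x = (SUP K. G x * indicator (P K) x)" if x: "x \<in> space M" for x
  proof (cases "S x = 0")
    case True
    then show ?thesis by (simp add: G_def)
  next
    case False
    then have Sx: "0 < S x" using S0[of x] by simp
    obtain K1 where K1: "S x < 2 ^ K1" using real_arch_pow[of 2 "S x"] by auto
    obtain K2 where K2: "1 / S x < 2 ^ K2" using real_arch_pow[of 2 "1 / S x"] by auto
    define K where "K = max K1 K2"
    have "(2::real) ^ K1 \<le> 2 ^ K" "(2::real) ^ K2 \<le> 2 ^ K"
      unfolding K_def by (intro power_increasing; simp)+
    then have "S x \<le> 2 ^ K" "1 / S x < 2 ^ K" using K1 K2 by linarith+
    then have "x \<in> P K" using x Sx by (simp add: P_def field_simps)
    then have "G x \<le> (SUP K. G x * indicator (P K) x)"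
      by (intro SUP_upper2[of K]) auto
    moreover have "(SUP K. G x * indicator (P K) x) \<le> G x"
      by (intro SUP_least) (auto simp: indicator_def)
    ultimately show ?thesis by (rule antisym)
  qed
  then have "(\<integral>\<^sup>+x. G x \<partial>M) = (\<integral>\<^sup>+x. (SUP K. G x * indicator (P K) x) \<partial>M)"
    by (intro nn_integral_cong)
  also have "\<dots> = (SUP K. (\<integral>\<^sup>+x. G x * indicator (P K) x \<partial>M))"
    using inc by (intro nn_integral_monotone_convergence_SUP) auto
  also have "\<dots> \<le> ennreal (2 powr \<rho> * B)"
    using part by (intro SUP_least)
  also have "2 powr \<rho> * B = hardyL_const R * Z powr (1 / (1 - R))"
    unfolding B_def hardyL_const_def \<rho>(3) by (simp add: \<rho>_def)
  finally show ?thesis unfolding G_def \<rho>_def .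
qed

text \<open>The super-level sets of a nondecreasing \<open>\<Phi>\<close> are right segments of
  \<open>I\<close>. In the measure with density \<open>\<omega>\<close> on \<open>I\<close>, the
  points with a value of at least \<Phi> x include all of \<open>I\<close> right of x, whence the
  tail integrals in the conclusion. The left end of a super-level set may be missing from it; the
  sets \<open>N\<close> therefore start at the points of a cofinal sequence.\<close>

lemma monotone_level_test:
  fixes \<omega> \<Phi> :: "real \<Rightarrow> ennreal" and I :: "real set" and R Z :: real
  assumes R: "0 < R" "R < 1" and Z: "0 \<le> Z" and I: "I \<in> sets borel"
    and \<omega> [measurable]: "\<omega> \<in> borel_measurable lebesgue" and \<Phi> [measurable]: "\<Phi> \<in> borel_measurable lebesgue"
    and mono: "\<And>x y. x \<in> I \<Longrightarrow> y \<in> I \<Longrightarrow> x \<le> y \<Longrightarrow> \<Phi> x \<le> \<Phi> y"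
    and fin: "\<And>x. x \<in> I \<Longrightarrow> \<Phi> x < top"
    and test: "\<And>J y \<theta> a. finite J \<Longrightarrow>
      (\<And>i::nat. i \<in> J \<Longrightarrow> y i \<in> I \<and> 0 < \<theta> i \<and> ennreal (\<theta> i) < \<Phi> (y i) \<and> 0 \<le> a i) \<Longrightarrow>
      \<exists>h\<in>borel_measurable lebesgue. (\<forall>i\<in>J. \<forall>x\<in>I. y i \<le> x \<longrightarrow> ennreal ((a i * \<theta> i) powr R) \<le> h x) \<and>
        ig I (\<lambda>x. h x * \<omega> x) \<le> ennreal (Z * (\<Sum>i\<in>J. a i) powr R)"
  shows "ig I (\<lambda>x. ig (I \<inter> {x..}) \<omega> epowr (R / (1 - R)) * \<omega> x * \<Phi> x epowr (R / (1 - R)))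
    \<le> ennreal (hardyL_const R * Z powr (1 / (1 - R)))"
proof -
  note [measurable] = borel_lebesgue[OF I]
  define M where "M = density lebesgue (\<lambda>x. \<omega> x * indicator I x)"
  define S where "S x = (if x \<in> I then enn2real (\<Phi> x) else 0)" for x
  have [measurable_cong]: "sets M = sets lebesgue" by (simp add: M_def)
  have [simp]: "space M = UNIV" by (simp add: M_def)
  define A where "A \<theta> = {x\<in>I. ennreal \<theta> < \<Phi> x}" for \<theta>
  have SA: "{x. \<theta> < S x} = A \<theta>" if "0 < \<theta>" for \<theta>
  proof -
    have "\<theta> < enn2real (\<Phi> x) \<longleftrightarrow> ennreal \<theta> < \<Phi> x" if "x \<in> I" for x
      using fin[OF that] \<open>0 < \<theta>\<close> by (cases "\<Phi> x") (auto simp: ennreal_less_iff)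
    then show ?thesis using that by (auto simp: S_def A_def)
  qed
  have "\<exists>y :: nat \<Rightarrow> real. A \<theta> \<noteq> {} \<longrightarrow> (\<forall>n. y n \<in> A \<theta>) \<and> decseq y \<and> (\<forall>x\<in>A \<theta>. \<exists>n. y n \<le> x)" for \<theta>
    by (cases "A \<theta> = {}") (auto elim!: cofinal_sequence[of "A \<theta>"])
  then obtain yy :: "real \<Rightarrow> nat \<Rightarrow> real" where yy: "\<And>\<theta>. A \<theta> \<noteq> {} \<Longrightarrow>
      (\<forall>n. yy \<theta> n \<in> A \<theta>) \<and> decseq (yy \<theta>) \<and> (\<forall>x\<in>A \<theta>. \<exists>n. yy \<theta> n \<le> x)"
    by metis
  define N where "N \<theta> n = (if A \<theta> = {} then {} else I \<inter> {yy \<theta> n..})" for \<theta> n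
  have "(\<integral>\<^sup>+x. emeasure M {y \<in> space M. S x \<le> S y} epowr (R / (1 - R)) * ennreal (S x) epowr (R / (1 - R)) \<partial>M)
    \<le> ennreal (hardyL_const R * Z powr (1 / (1 - R)))"
  proof (rule level_set_test[OF R Z, where N = N])
    show "S \<in> borel_measurable M" unfolding S_def by measurable
    show "0 \<le> S x" for x by (simp add: S_def)
    show "N \<theta> n \<in> sets M" for \<theta> n unfolding N_def using I by (simp add: M_def)
    show "incseq (N \<theta>)" if "0 < \<theta>" for \<theta>
    proof (cases "A \<theta> = {}")
      case False
      then have "yy \<theta> n \<le> yy \<theta> m" if "m \<le> n" for m n
        using yy[of \<theta>] that by (auto simp: decseq_def)
      then show ?thesis by (fastforce simp: N_def incseq_def)
    qed (simp add: N_def incseq_def)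
    show "(\<Union>n. N \<theta> n) = {x \<in> space M. \<theta> < S x}" if \<theta>: "0 < \<theta>" for \<theta>
    proof (cases "A \<theta> = {}")
      case True
      then show ?thesis using SA[OF \<theta>] by (simp add: N_def)
    next
      case False
      have "x \<in> A \<theta>" if "x \<in> I" "yy \<theta> n \<le> x" for x n
        using yy[OF False] mono[of "yy \<theta> n" x] that by (auto simp: A_def intro: less_le_trans)
      moreover have "\<exists>n. yy \<theta> n \<le> x \<and> x \<in> I" if "x \<in> A \<theta>" for x
        using yy[OF False] that by (auto simp: A_def)
      ultimately show ?thesis using False SA[OF \<theta>] by (auto simp: N_def)
    qed
    fix k :: nat and \<theta> :: "nat \<Rightarrow> real" and n and a :: "nat \<Rightarrow> real"
    assume *: "\<And>i. i \<le> k \<Longrightarrow> 0 < \<theta> i \<and> 0 \<le> a i"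
    \<comment> \<open>Levels above all values of \<open>\<Phi>\<close> offer no point at which to
      place a test function.\<close>
    define J where "J = {i. i \<le> k \<and> A (\<theta> i) \<noteq> {}}"
    have J: "finite J" unfolding J_def by simp
    have yA: "yy (\<theta> i) n \<in> A (\<theta> i)" if "i \<in> J" for i
      using yy that by (simp add: J_def)
    obtain h where h [measurable]: "h \<in> borel_measurable lebesgue"
      and h1: "\<forall>i\<in>J. \<forall>x\<in>I. yy (\<theta> i) n \<le> x \<longrightarrow> ennreal ((a i * \<theta> i) powr R) \<le> h x"
      and h2: "ig I (\<lambda>x. h x * \<omega> x) \<le> ennreal (Z * (\<Sum>i\<in>J. a i) powr R)"
      using test[OF J, of "\<lambda>i. yy (\<theta> i) n" \<theta> a] yA * by (force simp: A_def J_def)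
    show "\<exists>h\<in>borel_measurable M. (\<forall>i\<le>k. \<forall>x\<in>N (\<theta> i) n. ennreal ((a i * \<theta> i) powr R) \<le> h x) \<and>
        (\<integral>\<^sup>+x. h x \<partial>M) \<le> ennreal (Z * (\<Sum>i\<le>k. a i) powr R)"
    proof (intro bexI[of _ h] conjI allI impI ballI)
      fix i x assume "i \<le> k" "x \<in> N (\<theta> i) n"
      then show "ennreal ((a i * \<theta> i) powr R) \<le> h x"
        using h1 by (auto simp: N_def J_def split: if_splits)
    next
      have "(\<integral>\<^sup>+x. h x \<partial>M) = ig I (\<lambda>x. h x * \<omega> x)"
        unfolding M_def ig_def by (subst nn_integral_density) (auto simp: ac_simps)
      also have "\<dots> \<le> ennreal (Z * (\<Sum>i\<in>J. a i) powr R)" by (rule h2)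
      also have "\<dots> \<le> ennreal (Z * (\<Sum>i\<le>k. a i) powr R)"
        using R Z * by (intro ennreal_leI mult_left_mono powr_mono2 sum_mono2 sum_nonneg) (auto simp: J_def)
      finally show "(\<integral>\<^sup>+x. h x \<partial>M) \<le> ennreal (Z * (\<Sum>i\<le>k. a i) powr R)" .
    qed measurable
  qed
  moreover have "ig I (\<lambda>x. ig (I \<inter> {x..}) \<omega> epowr (R / (1 - R)) * \<omega> x * \<Phi> x epowr (R / (1 - R)))
     \<le> (\<integral>\<^sup>+x. emeasure M {y \<in> space M. S x \<le> S y} epowr (R / (1 - R)) * ennreal (S x) epowr (R / (1 - R)) \<partial>M)"
  proof -
    define G where "G x = emeasure M {y. S x \<le> S y} epowr (R / (1 - R)) * ennreal (S x) epowr (R / (1 - R))" for x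
    have [measurable]: "S \<in> borel_measurable lebesgue" unfolding S_def by measurable
    have "{y \<in> space lebesgue. s \<le> S y} \<in> sets lebesgue" for s
      by measurable
    then have Sset: "{y. s \<le> S y} \<in> sets M" for s by (simp add: M_def)
    then have "antimono (\<lambda>s. emeasure M {y. s \<le> S y})"
      unfolding antimono_def by (intro allI impI emeasure_mono) auto
    then have [measurable]: "(\<lambda>s. emeasure M {y. s \<le> S y}) \<in> borel_measurable borel"
      by (rule borel_measurable_antimono_ennreal)
    have [measurable]: "G \<in> borel_measurable lebesgue" unfolding G_def by measurable
    have "ig I (\<lambda>x. ig (I \<inter> {x..}) \<omega> epowr (R / (1 - R)) * \<omega> x * \<Phi> x epowr (R / (1 - R))) \<le> ig I (\<lambda>x. \<omega> x * G x)"
    proof (intro ig_mono)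
      fix x assume x: "x \<in> I"
      have "ig (I \<inter> {x..}) \<omega> = emeasure M (I \<inter> {x..})"
        unfolding M_def by (subst ig_density) (auto simp: ig_def indicator_def intro!: nn_integral_cong)
      also have "\<dots> \<le> emeasure M {y. S x \<le> S y}"
      proof (rule emeasure_mono[OF _ Sset])
        show "I \<inter> {x..} \<subseteq> {y. S x \<le> S y}"
          using x mono fin by (auto simp: S_def intro!: enn2real_mono)
      qed
      finally have "ig (I \<inter> {x..}) \<omega> epowr (R / (1 - R)) * \<Phi> x epowr (R / (1 - R)) \<le> G x"
        unfolding G_def using x fin[OF x] R
        by (intro mult_mono epowr_mono) (auto simp: S_def less_top)
      then show "ig (I \<inter> {x..}) \<omega> epowr (R / (1 - R)) * \<omega> x * \<Phi> x epowr (R / (1 - R)) \<le> \<omega> x * G x"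
        by (metis mult.assoc mult.commute mult_left_mono zero_le)
    qed simp
    also have "\<dots> = (\<integral>\<^sup>+x. G x \<partial>M)"
      unfolding M_def ig_def by (subst nn_integral_density) (auto simp: ac_simps)
    finally show ?thesis by (simp add: G_def)
  qed
  ultimately show ?thesis by simp
qed

text \<open>An extended number is the supremum of the positive reals strictly below it, so
  near-extremal functions suffice, also when \<open>x\<close> is \<open>top\<close>.\<close>

lemma ennreal_mult_epowr_le:
  assumes "0 < s" and "\<And>N. 0 < N \<Longrightarrow> ennreal N < x \<Longrightarrow> c * ennreal N epowr s \<le> B"
  shows "c * x epowr s \<le> B"
proof -
  have "x = (SUP N\<in>{N. 0 < N \<and> ennreal N < x}. ennreal N)" (is "_ = ?S")
  proof (rule antisym)
    show "x \<le> ?S"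
    proof (rule dense_le)
      fix y assume "y < x"
      then obtain a where a: "y = ennreal a" "0 \<le> a" by (cases y) auto
      show "y \<le> ?S"
      proof (cases "a = 0")
        case False
        then show ?thesis using a \<open>y < x\<close> by (intro SUP_upper2[of a]) auto
      qed (use a in simp)
    qed
    show "?S \<le> x" by (intro SUP_least) auto
  qed
  then have "c * x epowr s = (SUP N\<in>{N. 0 < N \<and> ennreal N < x}. c * ennreal N epowr s)"
    using assms(1) by (metis (no_types, lifting) SUP_mult_left_ennreal epowr_SUP SUP_cong)
  also have "\<dots> \<le> B" using assms(2) by (intro SUP_least) auto
  finally show ?thesis .
qed

lemma mono_lebesgue: "mono g \<Longrightarrow> g \<in> borel_measurable lebesgue" for g :: "real \<Rightarrow> ennreal"
  by (simp add: measurable_completion borel_measurable_mono_ennreal)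

lemma antimono_lebesgue: "antimono g \<Longrightarrow> g \<in> borel_measurable lebesgue" for g :: "real \<Rightarrow> ennreal"
  by (simp add: measurable_completion borel_measurable_antimono_ennreal)

lemma disjoint_steps:
  fixes t :: "nat \<Rightarrow> real"
  assumes "\<And>k. t (Suc k) < t k"
  shows "disjoint_family (\<lambda>k. {t (Suc k)..<t k})"
proof -
  have dec: "t n \<le> t m" if "m \<le> n" for m n
    by (rule lift_Suc_antimono_le[OF _ that]) (simp add: assms less_imp_le)
  have "{t (Suc m)..<t m} \<inter> {t (Suc n)..<t n} = {}" if "m < n" for m n
    using dec[of "Suc m" n] that by auto
  then show ?thesis
    unfolding disjoint_family_on_def by (metis Int_commute linorder_neqE_nat)
qed

lemma interval_lebesgue [measurable]:
  "{..<y} \<in> sets lebesgue" "{x..} \<in> sets lebesgue" "{x..<y} \<in> sets lebesgue" for x y :: real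
  by simp_all

section \<open>The one-weight Hardy inequality\<close>

text \<open>In the application \<open>D\<close> is the interval \<open>(a, b)\<close> and \<open>\<Phi> t\<close> is \<open>V\<^sub>p(a, t)\<^sup>p\<close>. All that is needed about
  \<open>V\<^sub>p\<close> is that \<open>\<Phi> t\<close> is the best constant \<open>k\<close> in \<open>(\<integral>\<^sub>a\<^sup>t f)\<^sup>p \<le> k \<integral> f\<^sup>p v\<close>.\<close>

locale hardy_core =
  fixes D :: "real set" and u w v \<Phi> :: "real \<Rightarrow> ennreal" and p q r :: real
  assumes D_open: "open D" and D_ne: "D \<noteq> {}"
    and D_interval: "\<And>x y z. x \<in> D \<Longrightarrow> z \<in> D \<Longrightarrow> x \<le> y \<Longrightarrow> y \<le> z \<Longrightarrow> y \<in> D"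
    and u_m [measurable]: "u \<in> borel_measurable lebesgue"
    and w_m [measurable]: "w \<in> borel_measurable lebesgue"
    and v_m [measurable]: "v \<in> borel_measurable lebesgue"
    and u_0: "\<And>x. x \<notin> D \<Longrightarrow> u x = 0" and w_0: "\<And>x. x \<notin> D \<Longrightarrow> w x = 0"
    and u_pos: "\<And>x. x \<in> D \<Longrightarrow> 0 < u x" and w_pos: "\<And>x. x \<in> D \<Longrightarrow> 0 < w x"
    and p: "0 < p" and q: "0 < q" and r: "0 < r"
    and \<Phi>_mono: "mono \<Phi>" and \<Phi>_pos: "\<And>x. x \<in> D \<Longrightarrow> 0 < \<Phi> x"
    and Hoelder: "\<And>f A t. f \<in> borel_measurable lebesgue \<Longrightarrow> (\<And>x. x \<notin> D \<Longrightarrow> f x = 0) \<Longrightarrow> A \<in> sets borel \<Longrightarrow>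
      t \<in> D \<Longrightarrow> A \<subseteq> {..<t} \<Longrightarrow> ig A f epowr p \<le> \<Phi> t * ig A (\<lambda>x. f x epowr p * v x)"
    and extremal: "\<And>y N. y \<in> D \<Longrightarrow> 0 < N \<Longrightarrow> ennreal N < \<Phi> y \<Longrightarrow> \<exists>f\<in>borel_measurable lebesgue.
      (\<forall>x. f x \<noteq> 0 \<longrightarrow> x \<in> D \<and> x < y) \<and> ig UNIV (\<lambda>x. f x epowr p * v x) \<le> 1 \<and> ennreal N \<le> ig UNIV f epowr p"
begin

lemma D_borel [measurable]: "D \<in> sets borel" using D_open by simp

lemma \<Phi>_m [measurable]: "\<Phi> \<in> borel_measurable lebesgue" by (rule mono_lebesgue[OF \<Phi>_mono])

definition U :: "real \<Rightarrow> real \<Rightarrow> ennreal" where "U t x = ig {t..<x} u"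
definition W :: "real \<Rightarrow> ennreal" where "W x = ig {x..} w"
definition P :: "real \<Rightarrow> ennreal" where "P x = ig {x..} (\<lambda>s. w s * U x s epowr (r / q))"
definition F :: "(real \<Rightarrow> ennreal) \<Rightarrow> real \<Rightarrow> ennreal" where "F f t = ig {..<t} f"
definition HL :: "(real \<Rightarrow> ennreal) \<Rightarrow> real \<Rightarrow> ennreal" where "HL f x = ig {..<x} (\<lambda>t. F f t epowr q * u t)"
text \<open>The p-th power of the weighted norm, not the norm: it is additive over disjoint pieces
  of the line.\<close>

definition nrm :: "(real \<Rightarrow> ennreal) \<Rightarrow> ennreal" where "nrm f = ig UNIV (\<lambda>x. f x epowr p * v x)"
definition Adm :: "(real \<Rightarrow> ennreal) set" where
  "Adm = {f \<in> borel_measurable lebesgue. \<forall>x. x \<notin> D \<longrightarrow> f x = 0}"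

definition Kl :: "real \<Rightarrow> ennreal" where "Kl y = (SUP f\<in>{f \<in> Adm. nrm f \<le> 1}. HL f y)"

text \<open>\<open>SS y\<close> for p <= q, and \<open>BB y epowr ((p - q) / p)\<close> for q < p,
  are the explicit quantities equivalent to \<open>Kl y\<close> where \<open>\<Phi>\<close> and
  \<open>U\<close> are finite.\<close>

definition SS :: "real \<Rightarrow> ennreal" where "SS y = (SUP t\<in>D \<inter> {..<y}. U t y * \<Phi> t epowr (q / p))"
definition BB :: "real \<Rightarrow> ennreal" where
  "BB y = ig {..<y} (\<lambda>t. U t y epowr (q / (p - q)) * u t * \<Phi> t epowr (q / (p - q)))"

lemma Adm_m: "f \<in> Adm \<Longrightarrow> f \<in> borel_measurable lebesgue" and Adm_0: "f \<in> Adm \<Longrightarrow> x \<notin> D \<Longrightarrow> f x = 0"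
  by (auto simp: Adm_def)

lemma U_mono: "s \<le> t \<Longrightarrow> x \<le> y \<Longrightarrow> U t x \<le> U s y"
  unfolding U_def by (intro ig_mono) auto

lemma U_m1 [measurable]: "(\<lambda>x. U t x) \<in> borel_measurable lebesgue"
  by (intro mono_lebesgue) (auto simp: mono_def intro: U_mono)

lemma U_m2 [measurable]: "(\<lambda>t. U t x) \<in> borel_measurable lebesgue"
  by (intro antimono_lebesgue) (auto simp: antimono_def intro: U_mono)

lemma U_add: "s \<le> t \<Longrightarrow> t \<le> x \<Longrightarrow> U s x = U s t + U t x"
  unfolding U_def by (subst ig_Un[symmetric]) (auto intro!: ig_cong)

lemma W_mono: "x \<le> y \<Longrightarrow> W y \<le> W x"
  unfolding W_def by (intro ig_mono) auto

lemma W_m [measurable]: "W \<in> borel_measurable lebesgue"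
  by (intro antimono_lebesgue) (auto simp: antimono_def intro: W_mono)

lemma P_mono: "x \<le> y \<Longrightarrow> P y \<le> P x"
  unfolding P_def using q r by (intro ig_mono mult_left_mono epowr_mono U_mono) auto

lemma P_m [measurable]: "P \<in> borel_measurable lebesgue"
  by (intro antimono_lebesgue) (auto simp: antimono_def intro: P_mono)

lemma F_mono: "s \<le> t \<Longrightarrow> F f s \<le> F f t"
  unfolding F_def by (intro ig_mono) auto

lemma F_m [measurable]: "F f \<in> borel_measurable lebesgue"
  by (intro mono_lebesgue) (auto simp: mono_def intro: F_mono)

lemma HL_mono: "x \<le> y \<Longrightarrow> HL f x \<le> HL f y"
  unfolding HL_def by (intro ig_mono) auto

lemma HL_m [measurable]: "HL f \<in> borel_measurable lebesgue"
  by (intro mono_lebesgue) (auto simp: mono_def intro: HL_mono)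

lemma Kl_mono: "x \<le> y \<Longrightarrow> Kl x \<le> Kl y"
  unfolding Kl_def by (intro SUP_mono) (auto intro: HL_mono)

lemma Kl_m [measurable]: "Kl \<in> borel_measurable lebesgue"
  by (intro mono_lebesgue) (auto simp: mono_def intro: Kl_mono)

lemma D_right: "x \<in> D \<Longrightarrow> \<exists>y\<in>D. x < y \<and> (\<forall>t. x < t \<longrightarrow> t < y \<longrightarrow> t \<in> D)"
proof -
  assume x: "x \<in> D"
  then obtain e where e: "0 < e" "ball x e \<subseteq> D" using D_open open_contains_ball by blast
  then have "x + e / 2 \<in> D" by (auto simp: dist_real_def)
  then show ?thesis using e x D_interval[of x "x + e / 2"] by (intro bexI[of _ "x + e / 2"]) auto
qed

lemma D_left: "x \<in> D \<Longrightarrow> \<exists>y\<in>D. y < x"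
proof -
  assume x: "x \<in> D"
  then obtain e where e: "0 < e" "ball x e \<subseteq> D" using D_open open_contains_ball by blast
  then have "x - e / 2 \<in> D" by (auto simp: dist_real_def)
  then show ?thesis using e by (intro bexI[of _ "x - e / 2"]) auto
qed

lemma U_pos: "t \<in> D \<Longrightarrow> t < x \<Longrightarrow> 0 < U t x"
proof -
  assume t: "t \<in> D" "t < x"
  obtain y where y: "y \<in> D" "t < y" "\<forall>s. t < s \<longrightarrow> s < y \<longrightarrow> s \<in> D" using D_right[OF t(1)] by blast
  show ?thesis unfolding U_def
    by (rule ig_pos[where x=t and y="min x y"]) (use t y u_pos in auto)
qed

lemma W_pos: "x \<in> D \<Longrightarrow> 0 < W x"
proof -
  assume x: "x \<in> D"
  obtain y where y: "y \<in> D" "x < y" "\<forall>t. x < t \<longrightarrow> t < y \<longrightarrow> t \<in> D" using D_right[OF x] by blast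
  show ?thesis unfolding W_def
    by (rule ig_pos[where x=x and y=y]) (use y w_pos in auto)
qed

lemma P_pos: "x \<in> D \<Longrightarrow> 0 < P x"
proof -
  assume x: "x \<in> D"
  obtain y where y: "y \<in> D" "x < y" "\<forall>t. x < t \<longrightarrow> t < y \<longrightarrow> t \<in> D" using D_right[OF x] by blast
  show ?thesis unfolding P_def
  proof (rule ig_pos[where x=x and y=y])
    fix t assume t: "t \<in> {x<..<y}"
    then have "0 < w t" "0 < U x t" using y w_pos U_pos[OF x] by auto
    then show "0 < w t * U x t epowr (r / q)" by (simp add: ennreal_zero_less_mult_iff)
  qed (use y in auto)
qed

lemma UW_le_P: "U t x epowr (r / q) * W x \<le> P t" if "t \<le> x"
proof -
  have "U t x epowr (r / q) * W x = ig {x..} (\<lambda>s. U t x epowr (r / q) * w s)"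
    unfolding W_def by (intro ig_cmult[symmetric]) auto
  also have "\<dots> \<le> P t"
    unfolding P_def using that q r
    by (intro ig_mono) (auto simp: mult.commute intro!: mult_left_mono epowr_mono U_mono)
  finally show ?thesis .
qed

lemma nrm_scale: "f \<in> Adm \<Longrightarrow> nrm (\<lambda>x. c * f x) = c epowr p * nrm f"
proof -
  assume "f \<in> Adm"
  note [measurable] = Adm_m[OF this]
  show ?thesis unfolding nrm_def by (subst ig_cmult[symmetric]) (auto simp: epowr_mult mult.assoc)
qed

lemma HL_scale: "f \<in> Adm \<Longrightarrow> HL (\<lambda>x. c * f x) y = c epowr q * HL f y"
proof -
  assume "f \<in> Adm"
  note [measurable] = Adm_m[OF this]
  have "F (\<lambda>x. c * f x) t = c * F f t" for t
    unfolding F_def by (intro ig_cmult) auto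
  then show ?thesis unfolding HL_def by (subst ig_cmult[symmetric]) (auto simp: epowr_mult mult.assoc)
qed

lemma F_Hoelder: "f \<in> Adm \<Longrightarrow> t \<in> D \<Longrightarrow> F f t epowr p \<le> \<Phi> t * nrm f"
proof -
  assume f: "f \<in> Adm" "t \<in> D"
  have "F f t epowr p \<le> \<Phi> t * ig {..<t} (\<lambda>x. f x epowr p * v x)"
    unfolding F_def using f by (intro Hoelder) (auto simp: Adm_def)
  also have "\<dots> \<le> \<Phi> t * nrm f"
    unfolding nrm_def by (intro mult_left_mono ig_mono) auto
  finally show ?thesis .
qed

text \<open>By homogeneity \<open>f\<close> may be scaled to norm 1. A function of norm 0 cannot be
  scaled; for it the finiteness of \<open>\<Phi> y\<close> forces \<open>F f\<close>, and with it
  \<open>HL f\<close>, to vanish up to \<open>y\<close>.\<close>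

lemma HL_le_Kl:
  assumes f: "f \<in> Adm" and y: "y \<in> D" and fin: "\<Phi> y < top" "nrm f < top"
  shows "HL f y \<le> nrm f epowr (q / p) * Kl y"
proof (cases "nrm f = 0")
  case True
  have "F f y epowr p \<le> 0" using F_Hoelder[OF f y] True by simp
  then have "F f y = 0" by simp
  then have "F f t = 0" if "t < y" for t using F_mono[of t y f] that by auto
  then have "HL f y = 0" unfolding HL_def by (intro ig_eq_0) auto
  then show ?thesis by simp
next
  case False
  then obtain n where n: "nrm f = ennreal n" "0 < n"
    using fin(2) by (metis ennreal_cases ennreal_0 less_eq_real_def less_irrefl)
  define c where "c = ennreal (n powr (- 1 / p))"
  have "nrm (\<lambda>x. c * f x) = 1"
    unfolding nrm_scale[OF f] c_def using n p
    by (simp add: epowr_ennreal powr_powr flip: ennreal_mult)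
  moreover have "(\<lambda>x. c * f x) \<in> Adm" using f by (auto simp: Adm_def)
  ultimately have "HL (\<lambda>x. c * f x) y \<le> Kl y"
    unfolding Kl_def by (intro SUP_upper) auto
  then have "c epowr q * HL f y \<le> Kl y" by (simp add: HL_scale[OF f])
  then have "nrm f epowr (q / p) * (c epowr q * HL f y) \<le> nrm f epowr (q / p) * Kl y"
    by (intro mult_left_mono) auto
  moreover have "nrm f epowr (q / p) * c epowr q = 1"
  proof -
    have "n powr (q / p) * (n powr (- 1 / p)) powr q = n powr (q / p + (- 1 / p) * q)"
      by (simp only: powr_add powr_powr)
    then show ?thesis
      using n by (simp add: c_def epowr_ennreal flip: ennreal_mult)
  qed
  ultimately show ?thesis by (simp flip: mult.assoc)
qed

text \<open>The p-th root of a combination of p-th powers: its \<open>nrm\<close> is exactly the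
  combination of the \<open>nrm\<close> of the summands, for every p > 0, and pointwise it still
  dominates each scaled summand.\<close>

lemma combine:
  fixes J :: "nat set" and a :: "nat \<Rightarrow> real"
  assumes J: "finite J" and f: "\<And>i. i \<in> J \<Longrightarrow> f i \<in> Adm \<and> nrm (f i) \<le> 1 \<and> 0 \<le> a i"
  obtains g where "g \<in> Adm" "nrm g \<le> ennreal (\<Sum>i\<in>J. a i)"
    "\<And>i x. i \<in> J \<Longrightarrow> ennreal (a i) epowr (1 / p) * f i x \<le> g x"
proof -
  define g where "g x = (\<Sum>i\<in>J. ennreal (a i) * f i x epowr p) epowr (1 / p)" for x
  have [measurable]: "f i \<in> borel_measurable lebesgue" if "i \<in> J" for i
    using f[OF that] by (auto simp: Adm_def)
  have gm [measurable]: "g \<in> borel_measurable lebesgue" unfolding g_def by measurable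
  show thesis
  proof
    show "g \<in> Adm" unfolding Adm_def using f by (auto simp: g_def Adm_def gm)
    have "nrm g = ig UNIV (\<lambda>x. \<Sum>i\<in>J. ennreal (a i) * (f i x epowr p * v x))"
      unfolding nrm_def using p by (intro ig_cong) (auto simp: g_def epowr_epowr sum_distrib_right mult.assoc)
    also have "\<dots> = (\<Sum>i\<in>J. ennreal (a i) * nrm (f i))"
      unfolding ig_def nrm_def by (simp add: nn_integral_sum nn_integral_cmult)
    also have "\<dots> \<le> (\<Sum>i\<in>J. ennreal (a i) * 1)"
      using f by (intro sum_mono mult_left_mono) auto
    also have "\<dots> = ennreal (\<Sum>i\<in>J. a i)" using f by simp
    finally show "nrm g \<le> ennreal (\<Sum>i\<in>J. a i)" .
    fix i x assume i: "i \<in> J"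
    have "ennreal (a i) epowr (1 / p) * f i x = (ennreal (a i) * f i x epowr p) epowr (1 / p)"
      using p by (simp add: epowr_mult epowr_epowr)
    also have "\<dots> \<le> g x"
      unfolding g_def using J i p by (intro epowr_mono member_le_sum) auto
    finally show "ennreal (a i) epowr (1 / p) * f i x \<le> g x" .
  qed
qed

lemma F_le: "(\<And>x. f x \<le> g x) \<Longrightarrow> F f t \<le> F g t"
  unfolding F_def by (intro ig_mono) auto

lemma HL_le: "(\<And>x. f x \<le> g x) \<Longrightarrow> HL f t \<le> HL g t"
  unfolding HL_def using q by (intro ig_mono mult_right_mono epowr_mono F_le) auto

lemma extremal_F:
  assumes "y \<in> D" "0 < N" "ennreal N < \<Phi> y"
  obtains f where "f \<in> Adm" "nrm f \<le> 1" "\<And>t. y \<le> t \<Longrightarrow> ennreal N \<le> F f t epowr p"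
proof -
  obtain f where f: "f \<in> borel_measurable lebesgue" "\<forall>x. f x \<noteq> 0 \<longrightarrow> x \<in> D \<and> x < y"
    "ig UNIV (\<lambda>x. f x epowr p * v x) \<le> 1" "ennreal N \<le> ig UNIV f epowr p"
    using extremal[OF assms] by blast
  have "F f t = ig UNIV f" if "y \<le> t" for t
  proof -
    have "ig UNIV f = ig (UNIV \<inter> {..<t}) f"
      using f(2) that by (intro ig_restrict) force
    then show ?thesis by (simp add: F_def)
  qed
  then show thesis using f by (intro that[of f]) (auto simp: Adm_def nrm_def)
qed

lemma HL_lower: "t \<le> x \<Longrightarrow> F f t epowr q * U t x \<le> HL f x"
proof -
  assume "t \<le> x"
  have "F f t epowr q * U t x = ig {t..<x} (\<lambda>s. F f t epowr q * u s)"
    unfolding U_def by (intro ig_cmult[symmetric]) auto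
  also have "\<dots> \<le> HL f x"
    unfolding HL_def using q by (intro ig_mono mult_right_mono epowr_mono F_mono) auto
  finally show ?thesis .
qed

lemma U\<Phi>_le_Kl:
  assumes "t \<in> D" "t \<le> y"
  shows "U t y * \<Phi> t epowr (q / p) \<le> Kl y"
proof (rule ennreal_mult_epowr_le)
  fix N :: real assume N: "0 < N" "ennreal N < \<Phi> t"
  obtain f where f: "f \<in> Adm" "nrm f \<le> 1" "\<And>s. t \<le> s \<Longrightarrow> ennreal N \<le> F f s epowr p"
    using extremal_F[OF assms(1) N] by blast
  have "ennreal N epowr (q / p) \<le> (F f t epowr p) epowr (q / p)"
    using f(3) p q by (intro epowr_mono) auto
  then have "U t y * ennreal N epowr (q / p) \<le> F f t epowr q * U t y"
    using p by (simp add: epowr_epowr mult.commute mult_left_mono)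
  also have "\<dots> \<le> HL f y" using assms(2) by (rule HL_lower)
  also have "\<dots> \<le> Kl y" unfolding Kl_def using f by (intro SUP_upper) auto
  finally show "U t y * ennreal N epowr (q / p) \<le> Kl y" .
qed (use p q in auto)

lemma SS_le_Kl: "SS y \<le> Kl y"
  unfolding SS_def by (intro SUP_least U\<Phi>_le_Kl) auto

text \<open>The points \<open>t\<close> halve \<open>F f\<close>, and \<open>m k\<close> is the part
  of \<open>nrm f\<close> on the block from t (k+1) to t k. \<open>Hoelder\<close> with the constant
  \<Phi> (t k) bounds the integral of \<open>f\<close> over that block, and four times this integral
  bounds \<open>F f\<close> on level k. The blocks are disjoint, hence the bound for the sum of
  \<open>m\<close>.\<close>

lemma F_levels:
  assumes f: "f \<in> Adm" and y: "y \<in> D" and fin: "\<Phi> y < top" "nrm f < top" and F0: "F f y \<noteq> 0"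
  shows "\<exists>(t :: nat \<Rightarrow> real) m. (\<forall>k. t k \<in> D \<and> t k < y \<and> t (Suc k) < t k) \<and>
    (\<forall>k x. x \<in> lv t k \<longrightarrow> x \<le> y \<longrightarrow> F f x epowr p \<le> 4 epowr p * (m k * \<Phi> (t k))) \<and>
    (\<forall>x\<le>y. x \<notin> (\<Union>k. lv t k) \<longrightarrow> F f x = 0) \<and> (\<Sum>k. m k) \<le> nrm f"
proof -
  note [measurable] = Adm_m[OF f]
  define h where "h x = f x * indicator {..<y} x" for x
  have hm [measurable]: "h \<in> borel_measurable lebesgue" unfolding h_def by measurable
  have hF: "ig A h = ig (A \<inter> {..<y}) f" for A
    unfolding ig_def h_def by (intro nn_integral_cong) (auto simp: indicator_def)
  have "F f y epowr p < top"
    using F_Hoelder[OF f y] fin by (metis ennreal_mult_less_top le_less_trans)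
  then have "F f y < top" by simp
  then obtain l where l: "F f y = ennreal l" "0 < l"
    using F0 by (metis ennreal_cases ennreal_0 less_eq_real_def less_irrefl)
  have l': "ig UNIV h = ennreal l" using l by (simp add: hF F_def)
  obtain t :: "nat \<Rightarrow> real" where t: "\<And>k. t (Suc k) < t k"
    "\<And>k. ig {..<t k} h = ennreal (l / 2 ^ (k + 1))"
    "\<And>k. ig {t (Suc k)..<t k} h = ennreal (l / 2 ^ (k + 2))"
    "\<And>k x. x \<in> lv t k \<Longrightarrow> ig {..<x} h \<le> ennreal (l / 2 ^ k)"
    "\<And>x. x \<notin> (\<Union>k. lv t k) \<Longrightarrow> ig {..<x} h = 0"
    using level_points[OF hm l' l(2)] by blast
  define m where "m k = ig {t (Suc k)..<t k} (\<lambda>x. f x epowr p * v x)" for k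
  have ty: "t k < y" for k
  proof (rule ccontr)
    assume "\<not> ?thesis"
    then have "ig {..<t k} h = F f y" unfolding hF F_def by (intro ig_cong) auto
    then have "ig {..<t k} h = ennreal l" by (simp add: l)
    moreover have "l / 2 ^ (k + 1) < l"
      using l(2) one_less_power[of "2::real" "k + 1"] by (simp add: field_simps)
    ultimately show False using t(2)[of k] l(2) by simp
  qed
  have tD: "t k \<in> D" for k
  proof (rule ccontr)
    assume n: "t k \<notin> D"
    have "x \<notin> D" if "x < t k" for x using D_interval[OF _ y, of x "t k"] ty[of k] n that by auto
    then have "ig {..<t k} h = 0" using Adm_0[OF f] by (intro ig_eq_0) (auto simp: h_def)
    then show False using t(2)[of k] l(2) by simp
  qed
  have Fh: "F f x = ig {..<x} h" if "x \<le> y" for x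
    unfolding hF F_def using that by (intro ig_cong) auto
  show ?thesis
  proof (intro exI[of _ t] exI[of _ m] conjI allI impI)
    show "t k \<in> D" "t k < y" "t (Suc k) < t k" for k by (fact tD ty t(1))+
    show "F f x = 0" if "x \<le> y" "x \<notin> (\<Union>k. lv t k)" for x using Fh t(5) that by simp
    show "F f x epowr p \<le> 4 epowr p * (m k * \<Phi> (t k))" if x: "x \<in> lv t k" "x \<le> y" for k x
    proof -
      have "ig {t (Suc k)..<t k} f = ennreal (l / 2 ^ (k + 2))"
        unfolding t(3)[symmetric] hF using ty[of k] by (intro ig_cong) auto
      then have 1: "ennreal (l / 2 ^ (k + 2)) epowr p \<le> \<Phi> (t k) * m k"
        unfolding m_def using Hoelder[of f "{t (Suc k)..<t k}" "t k"] tD f by (fastforce simp: Adm_def)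
      have "F f x \<le> ennreal (l / 2 ^ k)" using Fh[OF x(2)] t(4)[OF x(1)] by simp
      also have "ennreal (l / 2 ^ k) = 4 * ennreal (l / 2 ^ (k + 2))"
        using l(2) ennreal_mult[of 4 "l / 2 ^ (k + 2)"] by simp
      finally have "F f x epowr p \<le> 4 epowr p * ennreal (l / 2 ^ (k + 2)) epowr p"
        unfolding epowr_mult[symmetric] using p by (rule epowr_mono)
      also have "\<dots> \<le> 4 epowr p * (m k * \<Phi> (t k))"
        using 1 by (intro mult_left_mono) (auto simp: mult.commute)
      finally show ?thesis .
    qed
    have "(\<Sum>k. m k) = ig (\<Union>k. {t (Suc k)..<t k}) (\<lambda>x. f x epowr p * v x)"
      unfolding m_def by (intro ig_UN[symmetric]) (simp_all add: disjoint_steps t(1))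
    also have "\<dots> \<le> nrm f" unfolding nrm_def by (intro ig_mono) auto
    finally show "(\<Sum>k. m k) \<le> nrm f" .
  qed
qed

end

lemma hardyL_const_pos:
  assumes "0 < R" "R < 1"
  shows "0 < hardyL_const R"
proof -
  have "0 < R / (1 - R)" using assms by simp
  then have "1 < 2 powr (R / (1 - R))" by (simp add: gr_one_powr)
  then have "0 < 1 - 1 / 2 powr (R / (1 - R))" by simp
  then have "0 < (1 / (1 - R)) / (1 - 1 / 2 powr (R / (1 - R)))" using assms by (intro divide_pos_pos) auto
  then show ?thesis unfolding hardyL_const_def by (intro mult_pos_pos) auto
qed

context hardy_core
begin

text \<open>The inner supremum of \<open>C3\<close>: the power V_p^(pr/(p-r)) is
  \<Phi>^(r/(p-r)).\<close>

definition TT :: "real \<Rightarrow> ennreal" where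
  "TT x = (SUP t\<in>D \<inter> {..<x}. U t x epowr (r / q) * \<Phi> t epowr (r / (p - r)))"

lemma TT_mono: "x \<le> y \<Longrightarrow> TT x \<le> TT y"
  unfolding TT_def using q r
  by (intro SUP_subset_mono mult_right_mono epowr_mono U_mono) auto

lemma TT_m [measurable]: "TT \<in> borel_measurable lebesgue"
  by (intro mono_lebesgue) (auto simp: mono_def intro: TT_mono)

text \<open>With \<open>F f\<close> replaced on each level by its bound, \<open>HL f y\<close>
  becomes a series in m^(q/p); here the cases p <= q and q < p part.\<close>

lemma HL_levels:
  assumes f: "f \<in> Adm" and y: "y \<in> D" and fin: "\<Phi> y < top" "nrm f \<le> 1" and F0: "F f y \<noteq> 0"
  obtains t :: "nat \<Rightarrow> real" and m :: "nat \<Rightarrow> ennreal" where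
    "\<And>k. t k \<in> D" "\<And>k. t k < y" "(\<Sum>k. m k) \<le> 1"
    "HL f y \<le> 4 epowr q * (\<Sum>k. m k epowr (q / p) * (\<Phi> (t k) epowr (q / p) * ig ({..<y} \<inter> lv t k) u))"
proof -
  have nf: "nrm f < top" using fin(2) by (simp add: le_less_trans)
  obtain t m where t: "\<forall>k. t k \<in> D \<and> t k < y \<and> t (Suc k) < t k"
    "\<forall>k x. x \<in> lv t k \<longrightarrow> x \<le> y \<longrightarrow> F f x epowr p \<le> 4 epowr p * (m k * \<Phi> (t k))"
    "\<forall>x\<le>y. x \<notin> (\<Union>k. lv t k) \<longrightarrow> F f x = 0" "(\<Sum>k. m k) \<le> nrm f"
    using F_levels[OF f y fin(1) nf F0] by (elim exE conjE) (rule that)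
  have "HL f y = (\<Sum>k. ig ({..<y} \<inter> lv t k) (\<lambda>x. F f x epowr q * u x))"
    unfolding HL_def using t(3) by (intro ig_cover_le lv_disjoint) auto
  also have "\<dots> \<le> (\<Sum>k. 4 epowr q * (m k epowr (q / p) * (\<Phi> (t k) epowr (q / p) * ig ({..<y} \<inter> lv t k) u)))"
  proof (intro suminf_ennreal_mono)
    fix k
    have "F f x epowr q \<le> 4 epowr q * (m k epowr (q / p) * \<Phi> (t k) epowr (q / p))" if "x \<in> {..<y} \<inter> lv t k" for x
    proof -
      have "F f x epowr q = (F f x epowr p) epowr (q / p)" using p by (simp add: epowr_epowr)
      also have "\<dots> \<le> (4 epowr p * (m k * \<Phi> (t k))) epowr (q / p)"
        using t(2) that p q by (intro epowr_mono) auto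
      also have "\<dots> = 4 epowr q * (m k epowr (q / p) * \<Phi> (t k) epowr (q / p))"
        using p by (simp add: epowr_mult epowr_epowr)
      finally show ?thesis .
    qed
    then have "ig ({..<y} \<inter> lv t k) (\<lambda>x. F f x epowr q * u x)
        \<le> ig ({..<y} \<inter> lv t k) (\<lambda>x. (4 epowr q * (m k epowr (q / p) * \<Phi> (t k) epowr (q / p))) * u x)"
      by (intro ig_mono mult_right_mono) auto
    also have "\<dots> = (4 epowr q * (m k epowr (q / p) * \<Phi> (t k) epowr (q / p))) * ig ({..<y} \<inter> lv t k) u"
      by (intro ig_cmult) auto
    finally show "ig ({..<y} \<inter> lv t k) (\<lambda>x. F f x epowr q * u x)
      \<le> 4 epowr q * (m k epowr (q / p) * (\<Phi> (t k) epowr (q / p) * ig ({..<y} \<inter> lv t k) u))"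
      by (simp add: mult.assoc)
  qed
  also have "\<dots> = 4 epowr q * (\<Sum>k. m k epowr (q / p) * (\<Phi> (t k) epowr (q / p) * ig ({..<y} \<inter> lv t k) u))"
    by simp
  finally show thesis using t fin(2) by (intro that[of t m]) (auto intro: order_trans)
qed

lemma HL_F0: "F f y = 0 \<Longrightarrow> HL f y = 0"
  unfolding HL_def using F_mono[of _ y f] by (intro ig_eq_0) (auto dest: less_imp_le)

text \<open>For q/p >= 1 the powers m^(q/p) again sum to at most 1, so the largest of their
  coefficients decides, and each coefficient is one of the values under the supremum
  \<open>SS\<close>.\<close>

lemma Kl_le_SS:
  assumes pq: "p \<le> q" and y: "y \<in> D" "\<Phi> y < top"
  shows "Kl y \<le> 4 epowr q * SS y"
  unfolding Kl_def
proof (rule SUP_least)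
  fix f assume "f \<in> {f \<in> Adm. nrm f \<le> 1}"
  then have f: "f \<in> Adm" "nrm f \<le> 1" by auto
  show "HL f y \<le> 4 epowr q * SS y"
  proof (cases "F f y = 0")
    case False
    obtain t m where t: "\<And>k. t k \<in> D" "\<And>k. t k < y" "(\<Sum>k. m k) \<le> 1"
      "HL f y \<le> 4 epowr q * (\<Sum>k. m k epowr (q / p) * (\<Phi> (t k) epowr (q / p) * ig ({..<y} \<inter> lv t k) u))"
      using HL_levels[OF f(1) y f(2) False] by blast
    have "\<Phi> (t k) epowr (q / p) * ig ({..<y} \<inter> lv t k) u \<le> SS y" for k
    proof -
      have "ig ({..<y} \<inter> lv t k) u \<le> U (t k) y"
        unfolding U_def by (intro ig_mono) (auto dest: lv_less)
      then have "\<Phi> (t k) epowr (q / p) * ig ({..<y} \<inter> lv t k) u \<le> U (t k) y * \<Phi> (t k) epowr (q / p)"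
        unfolding mult.commute[of "\<Phi> (t k) epowr (q / p)"] by (intro mult_right_mono) auto
      also have "\<dots> \<le> SS y" unfolding SS_def using t by (intro SUP_upper) auto
      finally show ?thesis .
    qed
    then have "(\<Sum>k. m k epowr (q / p) * (\<Phi> (t k) epowr (q / p) * ig ({..<y} \<inter> lv t k) u)) \<le> (\<Sum>k. m k epowr (q / p) * SS y)"
      by (intro suminf_ennreal_mono mult_left_mono) auto
    also have "\<dots> = (\<Sum>k. m k epowr (q / p)) * SS y" by simp
    also have "(\<Sum>k. m k epowr (q / p)) \<le> (\<Sum>k. m k) epowr (q / p)"
      using pq p by (intro suminf_epowr_le) simp
    also have "\<dots> \<le> 1 epowr (q / p)" using t(3) p q by (intro epowr_mono) auto
    finally have "(\<Sum>k. m k epowr (q / p) * (\<Phi> (t k) epowr (q / p) * ig ({..<y} \<inter> lv t k) u)) \<le> SS y"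
      by (simp add: mult_right_mono)
    then show ?thesis using t(4) by (meson mult_left_mono order_trans zero_le)
  qed (simp add: HL_F0)
qed

text \<open>For q/p < 1, Hoelder's inequality in k leaves the series of \<Phi>(t k)^\<rho> times the
  (\<rho>+1)-st power of the integral of \<open>u\<close> over a level. \<open>power_rule\<close>
  turns each term into an integral over the level, where \<Phi> (t k) <= \<Phi> x and tails of
  \<open>u\<close> are at most \<open>U x y\<close>. The factor 2 is the power 1 - s of
  2^(\<rho>+1).\<close>

lemma Kl_le_BB:
  assumes qp: "q < p" and y: "y \<in> D" "\<Phi> y < top" and U: "\<And>t. t \<in> D \<Longrightarrow> U t y < top"
  shows "Kl y \<le> 4 epowr q * (2 * BB y epowr ((p - q) / p))"
  unfolding Kl_def
proof (rule SUP_least)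
  fix f assume "f \<in> {f \<in> Adm. nrm f \<le> 1}"
  then have f: "f \<in> Adm" "nrm f \<le> 1" by auto
  show "HL f y \<le> 4 epowr q * (2 * BB y epowr ((p - q) / p))"
  proof (cases "F f y = 0")
    case False
    obtain t m where t: "\<And>k. t k \<in> D" "\<And>k. t k < y" "(\<Sum>k. m k) \<le> 1"
      "HL f y \<le> 4 epowr q * (\<Sum>k. m k epowr (q / p) * (\<Phi> (t k) epowr (q / p) * ig ({..<y} \<inter> lv t k) u))"
      using HL_levels[OF f(1) y f(2) False] by blast
    define s where "s = q / p"
    define \<rho> where "\<rho> = q / (p - q)"
    have s: "0 < s" "s < 1" "1 - s = (p - q) / p" using p q qp by (auto simp: s_def field_simps)
    have \<rho>: "0 < \<rho>" "\<rho> * (1 - s) = s" "(\<rho> + 1) * (1 - s) = 1"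
      unfolding s(3) using p q qp by (auto simp: s_def \<rho>_def field_simps)
    define E where "E k = {..<y} \<inter> lv t k" for k
    have [measurable]: "E k \<in> sets borel" for k unfolding E_def by simp
    have EU: "ig (E k) u \<le> U (t k) y" for k
      unfolding U_def E_def by (intro ig_mono) (auto dest: lv_less)
    define n where "n k = \<Phi> (t k) epowr \<rho> * ig (E k) u epowr (\<rho> + 1)" for k
    have n: "n k \<le> 2 epowr (\<rho> + 1) * ig (E k) (\<lambda>x. U x y epowr \<rho> * u x * \<Phi> x epowr \<rho>)" for k
    proof -
      have "ig (E k) u < top" using EU U[OF t(1)] by (rule le_less_trans)
      then have "ig (E k) u epowr (\<rho> + 1) \<le> 2 epowr (\<rho> + 1) * ig (E k) (\<lambda>x. u x * ig (E k \<inter> {x..}) u epowr \<rho>)"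
        using \<rho> by (intro power_rule) auto
      then have "n k \<le> \<Phi> (t k) epowr \<rho> * (2 epowr (\<rho> + 1) * ig (E k) (\<lambda>x. u x * ig (E k \<inter> {x..}) u epowr \<rho>))"
        unfolding n_def by (intro mult_left_mono) auto
      also have "\<dots> \<le> \<Phi> (t k) epowr \<rho> * (2 epowr (\<rho> + 1) * ig (E k) (\<lambda>x. u x * U x y epowr \<rho>))"
        unfolding U_def using \<rho> by (intro mult_left_mono ig_mono epowr_mono) (auto simp: E_def)
      also have "\<dots> = 2 epowr (\<rho> + 1) * ig (E k) (\<lambda>x. \<Phi> (t k) epowr \<rho> * (u x * U x y epowr \<rho>))"
        by (subst ig_cmult) (auto simp: mult.left_commute borel_lebesgue)
      also have "\<dots> \<le> 2 epowr (\<rho> + 1) * ig (E k) (\<lambda>x. U x y epowr \<rho> * u x * \<Phi> x epowr \<rho>)"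
      proof (intro mult_left_mono ig_mono)
        fix x assume "x \<in> E k"
        then have "\<Phi> (t k) \<le> \<Phi> x" using \<Phi>_mono by (auto simp: E_def mono_def dest: lv_less)
        then have "\<Phi> (t k) epowr \<rho> \<le> \<Phi> x epowr \<rho>" using \<rho> by (intro epowr_mono)
        then have "(u x * U x y epowr \<rho>) * \<Phi> (t k) epowr \<rho> \<le> (u x * U x y epowr \<rho>) * \<Phi> x epowr \<rho>"
          by (intro mult_left_mono) auto
        then show "\<Phi> (t k) epowr \<rho> * (u x * U x y epowr \<rho>) \<le> U x y epowr \<rho> * u x * \<Phi> x epowr \<rho>"
          by (simp add: ac_simps)
      qed auto
      finally show ?thesis .
    qed
    have "(\<Sum>k. n k) \<le> 2 epowr (\<rho> + 1) * (\<Sum>k. ig (E k) (\<lambda>x. U x y epowr \<rho> * u x * \<Phi> x epowr \<rho>))"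
      unfolding ennreal_suminf_cmult[symmetric] by (intro suminf_ennreal_mono n)
    also have "(\<Sum>k. ig (E k) (\<lambda>x. U x y epowr \<rho> * u x * \<Phi> x epowr \<rho>)) = ig (\<Union>k. E k) (\<lambda>x. U x y epowr \<rho> * u x * \<Phi> x epowr \<rho>)"
      using lv_disjoint[of t] by (intro ig_UN[symmetric]) (auto simp: E_def disjoint_family_on_def borel_lebesgue)
    also have "\<dots> \<le> BB y" unfolding BB_def \<rho>_def by (intro ig_mono) (auto simp: E_def)
    finally have sn: "(\<Sum>k. n k) \<le> 2 epowr (\<rho> + 1) * BB y" by (simp add: mult_left_mono)
    have "(\<Sum>k. m k epowr (q / p) * (\<Phi> (t k) epowr (q / p) * ig ({..<y} \<inter> lv t k) u)) = (\<Sum>k. m k epowr s * n k epowr (1 - s))"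
      using \<rho> by (simp add: n_def epowr_mult epowr_epowr s_def E_def)
    also have "\<dots> \<le> (\<Sum>k. m k) epowr s * (\<Sum>k. n k) epowr (1 - s)"
      using s by (intro suminf_Hoelder) auto
    also have "\<dots> \<le> 1 epowr s * (2 epowr (\<rho> + 1) * BB y) epowr (1 - s)"
      using s t(3) sn by (intro mult_mono epowr_mono) auto
    also have "\<dots> = 2 * BB y epowr ((p - q) / p)"
      using \<rho> by (simp add: epowr_mult epowr_epowr s(3)[symmetric])
    finally show ?thesis using t(4) by (meson mult_left_mono order_trans zero_le)
  qed (simp add: HL_F0)
qed

lemma combine_F:
  assumes "f \<in> Adm" and "\<And>x. ennreal a epowr (1 / p) * f x \<le> g x"
  shows "ennreal a epowr (1 / p) * F f x \<le> F g x" and "ennreal a epowr (q / p) * HL f x \<le> HL g x"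
proof -
  note [measurable] = Adm_m[OF assms(1)]
  have "ennreal a epowr (1 / p) * F f x = F (\<lambda>x. ennreal a epowr (1 / p) * f x) x"
    unfolding F_def by (intro ig_cmult[symmetric]) auto
  then show "ennreal a epowr (1 / p) * F f x \<le> F g x" using F_le[OF assms(2)] by simp
  have "ennreal a epowr (q / p) * HL f x = HL (\<lambda>x. ennreal a epowr (1 / p) * f x) x"
    by (simp add: HL_scale[OF assms(1)] epowr_epowr)
  then show "ennreal a epowr (q / p) * HL f x \<le> HL g x" using HL_le[OF assms(2)] by simp
qed

lemma extremal_family:
  fixes J :: "nat set"
  assumes J: "finite J" "\<And>i. i \<in> J \<Longrightarrow> y i \<in> D \<and> 0 < \<theta> i \<and> ennreal (\<theta> i) < \<Phi> (y i) \<and> 0 \<le> a i"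
  obtains g where "g \<in> Adm" "nrm g \<le> ennreal (\<Sum>i\<in>J. a i)"
    "\<And>i x. i \<in> J \<Longrightarrow> y i \<le> x \<Longrightarrow> ennreal (a i * \<theta> i) \<le> F g x epowr p"
proof -
  have "\<exists>f. i \<in> J \<longrightarrow> f \<in> Adm \<and> nrm f \<le> 1 \<and> (\<forall>t\<ge>y i. ennreal (\<theta> i) \<le> F f t epowr p)" for i
    using J(2)[of i] extremal_F[of "y i" "\<theta> i"] by metis
  then obtain f where f: "\<And>i. i \<in> J \<Longrightarrow> f i \<in> Adm \<and> nrm (f i) \<le> 1 \<and> (\<forall>t\<ge>y i. ennreal (\<theta> i) \<le> F (f i) t epowr p)"
    by metis
  obtain g where g: "g \<in> Adm" "nrm g \<le> ennreal (\<Sum>i\<in>J. a i)"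
    "\<And>i x. i \<in> J \<Longrightarrow> ennreal (a i) epowr (1 / p) * f i x \<le> g x"
    using combine[OF J(1), of f a] f J(2) by metis
  show thesis
  proof
    fix i x assume i: "i \<in> J" "y i \<le> x"
    have "ennreal (a i * \<theta> i) = ennreal (a i) * ennreal (\<theta> i)"
      using J(2)[OF i(1)] by (simp add: ennreal_mult)
    also have "\<dots> \<le> ennreal (a i) * F (f i) x epowr p"
      using f i by (intro mult_left_mono) auto
    also have "\<dots> = (ennreal (a i) epowr (1 / p) * F (f i) x) epowr p"
      using p by (simp add: epowr_mult epowr_epowr)
    also have "\<dots> \<le> F g x epowr p"
      using p f[OF i(1)] g(3)[OF i(1)] by (intro epowr_mono combine_F) auto
    finally show "ennreal (a i * \<theta> i) \<le> F g x epowr p" .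
  qed (use g in auto)
qed

text \<open>This is \<open>monotone_level_test\<close> with R = q/p, density \<open>u\<close> and
  bound Kl y on the part of \<open>D\<close> left of \<open>y\<close>: there R/(1-R) = q/(p-q), the
  tails of \<open>u\<close> are \<open>U x y\<close>, and the test functions are superposed
  near-extremals of \<open>\<Phi>\<close>.\<close>

lemma BB_le_Kl:
  assumes qp: "q < p" and y: "y \<in> D" and \<Phi>: "\<And>t. t \<in> D \<Longrightarrow> \<Phi> t < top"
  shows "BB y epowr ((p - q) / p) \<le> ennreal (hardyL_const (q / p) powr ((p - q) / p)) * Kl y"
proof (cases "Kl y = top \<or> hardyL_const (q / p) = 0")
  case True
  have "0 < hardyL_const (q / p)" using p q qp by (intro hardyL_const_pos) auto
  then show ?thesis using True by (auto simp: ennreal_mult_top)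
next
  case False
  define Z where "Z = enn2real (Kl y)"
  have Z: "Kl y = ennreal Z" "0 \<le> Z" using False by (auto simp: Z_def less_top)
  define I where "I = D \<inter> {..<y}"
  have sQ: "q / p / (1 - q / p) = q / (p - q)" "1 / (1 - q / p) = p / (p - q)"
    using p qp by (auto simp: field_simps)
  have "ig I (\<lambda>x. ig (I \<inter> {x..}) u epowr (q / p / (1 - q / p)) * u x * \<Phi> x epowr (q / p / (1 - q / p)))
    \<le> ennreal (hardyL_const (q / p) * Z powr (1 / (1 - q / p)))"
  proof (rule monotone_level_test)
    show "0 < q / p" "q / p < 1" using p q qp by auto
    show "0 \<le> Z" by (rule Z)
    show "I \<in> sets borel" by (simp add: I_def)
    show "u \<in> borel_measurable lebesgue" "\<Phi> \<in> borel_measurable lebesgue" by measurable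
    show "\<Phi> x \<le> \<Phi> z" if "x \<le> z" for x z using \<Phi>_mono that by (auto simp: mono_def)
    show "\<Phi> x < top" if "x \<in> I" for x using \<Phi> that by (simp add: I_def)
    fix J :: "nat set" and z \<theta> a :: "nat \<Rightarrow> real"
    assume J: "finite J" "\<And>i. i \<in> J \<Longrightarrow> z i \<in> I \<and> 0 < \<theta> i \<and> ennreal (\<theta> i) < \<Phi> (z i) \<and> 0 \<le> a i"
    obtain g where g: "g \<in> Adm" "nrm g \<le> ennreal (\<Sum>i\<in>J. a i)"
      "\<And>i x. i \<in> J \<Longrightarrow> z i \<le> x \<Longrightarrow> ennreal (a i * \<theta> i) \<le> F g x epowr p"
      using extremal_family[OF J(1), of z \<theta> a] J(2) unfolding I_def by blast
    show "\<exists>h\<in>borel_measurable lebesgue. (\<forall>i\<in>J. \<forall>x\<in>I. z i \<le> x \<longrightarrow> ennreal ((a i * \<theta> i) powr (q / p)) \<le> h x) \<and>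
        ig I (\<lambda>x. h x * u x) \<le> ennreal (Z * (\<Sum>i\<in>J. a i) powr (q / p))"
    proof (intro bexI[of _ "\<lambda>x. F g x epowr q"] conjI ballI impI)
      fix i x assume i: "i \<in> J" "x \<in> I" "z i \<le> x"
      have "ennreal ((a i * \<theta> i) powr (q / p)) = ennreal (a i * \<theta> i) epowr (q / p)"
        using J(2)[OF i(1)] by (simp add: epowr_ennreal)
      also have "\<dots> \<le> (F g x epowr p) epowr (q / p)"
        using g(3) i p q by (intro epowr_mono) auto
      also have "\<dots> = F g x epowr q" using p by (simp add: epowr_epowr)
      finally show "ennreal ((a i * \<theta> i) powr (q / p)) \<le> F g x epowr q" .
    next
      have S0: "0 \<le> (\<Sum>i\<in>J. a i)" using J(2) by (intro sum_nonneg) auto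
      have "ig I (\<lambda>x. F g x epowr q * u x) \<le> HL g y"
        unfolding HL_def I_def by (intro ig_mono) auto
      also have "\<dots> \<le> nrm g epowr (q / p) * Kl y"
        using g \<Phi> y by (intro HL_le_Kl) (auto intro: le_less_trans)
      also have "\<dots> \<le> ennreal (\<Sum>i\<in>J. a i) epowr (q / p) * Kl y"
        using g p q by (intro mult_right_mono epowr_mono) auto
      also have "\<dots> = ennreal (Z * (\<Sum>i\<in>J. a i) powr (q / p))"
        using S0 Z by (simp add: epowr_ennreal ennreal_mult mult.commute)
      finally show "ig I (\<lambda>x. F g x epowr q * u x) \<le> ennreal (Z * (\<Sum>i\<in>J. a i) powr (q / p))" .
    qed measurable
  qed
  moreover have "BB y = ig I (\<lambda>x. ig (I \<inter> {x..}) u epowr (q / p / (1 - q / p)) * u x * \<Phi> x epowr (q / p / (1 - q / p)))"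
  proof -
    have "ig (I \<inter> {x..}) u = U x y" if "x \<in> I" for x
    proof -
      have "U x y = ig ({x..<y} \<inter> D) u" unfolding U_def using u_0 by (intro ig_restrict) auto
      then show ?thesis unfolding I_def using that by (auto intro: ig_cong)
    qed
    moreover have "BB y = ig ({..<y} \<inter> D) (\<lambda>t. U t y epowr (q / (p - q)) * u t * \<Phi> t epowr (q / (p - q)))"
      unfolding BB_def using u_0 by (intro ig_restrict) auto
    ultimately show ?thesis unfolding sQ by (auto simp: I_def intro!: ig_cong)
  qed
  ultimately have "BB y \<le> ennreal (hardyL_const (q / p)) * Kl y epowr (p / (p - q))"
    using Z hardyL_const_nonneg[of "q / p"] by (simp add: sQ epowr_ennreal ennreal_mult)
  then have "BB y epowr ((p - q) / p) \<le> (ennreal (hardyL_const (q / p)) * Kl y epowr (p / (p - q))) epowr ((p - q) / p)"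
    using p qp by (intro epowr_mono) auto
  also have "\<dots> = ennreal (hardyL_const (q / p) powr ((p - q) / p)) * Kl y"
    using p qp hardyL_const_nonneg[of "q / p"] by (simp add: epowr_mult epowr_epowr epowr_ennreal)
  finally show ?thesis .
qed

section \<open>Sufficiency\<close>

text \<open>On the block from \<open>s\<close> to \<open>t\<close>, \<open>F f\<close> is the
  constant F f s plus the primitive of \<open>f\<close> cut to the block. The constant gives the
  nonlocal term; the one-weight inequality for the cut function gives the local one.\<close>

lemma HL_split:
  assumes f: "f \<in> Adm" "nrm f < top" and st: "s < t" "t \<in> D" "\<Phi> t < top"
  shows "ig {s..<t} (\<lambda>x. F f x epowr q * u x)
    \<le> 2 epowr q * (F f s epowr q * U s t + ig {s..<t} (\<lambda>x. f x epowr p * v x) epowr (q / p) * Kl t)"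
proof -
  note [measurable] = Adm_m[OF f(1)]
  define g where "g x = f x * indicator {s..<t} x" for x
  have g: "g \<in> Adm" using f unfolding Adm_def g_def by auto
  note [measurable] = Adm_m[OF g]
  have ng: "nrm g = ig {s..<t} (\<lambda>x. f x epowr p * v x)"
    unfolding nrm_def ig_def g_def by (intro nn_integral_cong) (auto simp: indicator_def)
  have "nrm g \<le> nrm f" unfolding ng unfolding nrm_def by (intro ig_mono) auto
  then have nf: "nrm g < top" using f(2) by (rule le_less_trans)
  have Fx: "F f x = F f s + F g x" if "x \<in> {s..<t}" for x
  proof -
    have "F f x = ig ({..<s} \<union> {s..<x}) f" unfolding F_def using that by (intro ig_cong) auto
    also have "\<dots> = F f s + ig {s..<x} f" unfolding F_def by (intro ig_Un) auto
    also have "ig {s..<x} f = F g x"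
      unfolding F_def ig_def g_def using that by (intro nn_integral_cong) (auto simp: indicator_def)
    finally show ?thesis .
  qed
  have "ig {s..<t} (\<lambda>x. F f x epowr q * u x) \<le> ig {s..<t} (\<lambda>x. 2 epowr q * (F f s epowr q * u x + F g x epowr q * u x))"
  proof (intro ig_mono)
    fix x assume x: "x \<in> {s..<t}"
    have "F f x epowr q * u x \<le> (2 epowr q * (F f s epowr q + F g x epowr q)) * u x"
      unfolding Fx[OF x] using q by (intro mult_right_mono epowr_plus_le) auto
    then show "F f x epowr q * u x \<le> 2 epowr q * (F f s epowr q * u x + F g x epowr q * u x)"
      by (simp add: mult.assoc distrib_right distrib_left)
  qed auto
  also have "\<dots> = 2 epowr q * (F f s epowr q * U s t + ig {s..<t} (\<lambda>x. F g x epowr q * u x))"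
    unfolding U_def by (simp add: ig_cmult ig_add)
  also have "ig {s..<t} (\<lambda>x. F g x epowr q * u x) \<le> HL g t"
    unfolding HL_def by (intro ig_mono) auto
  also have "HL g t \<le> nrm g epowr (q / p) * Kl t"
    using g st nf by (intro HL_le_Kl) auto
  finally show ?thesis unfolding ng by (simp add: mult_left_mono add_left_mono)
qed

text \<open>The points \<open>y\<close> halve \<open>HL f\<close>, and \<open>\<mu> k\<close> is the
  part of \<open>nrm f\<close> on the block left of level k. In the constant, 4 comes from the
  halving, 2^q from \<open>HL_split\<close>, and a further 2 from distributing the power r/q over a
  sum.\<close>

lemma HL_points:
  assumes f: "f \<in> Adm" "nrm f < top" and x1: "x1 \<in> D" and fin: "\<forall>x\<in>D. \<Phi> x < top"
    and HL: "HL f x1 < top" "HL f x1 \<noteq> 0"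
  shows "\<exists>(y :: nat \<Rightarrow> real) \<mu>. (\<forall>k. y k \<in> D \<and> y k < x1 \<and> y (Suc k) < y k) \<and>
    (\<forall>k x. x \<in> lv y k \<longrightarrow> x \<le> x1 \<longrightarrow> HL f x epowr (r / q) \<le> (8 * 2 epowr q) epowr (r / q) *
      (F f (y (Suc k)) epowr r * U (y (Suc k)) x epowr (r / q) + \<mu> k epowr (r / p) * Kl (y k) epowr (r / q))) \<and>
    (\<forall>x\<le>x1. x \<notin> (\<Union>k. lv y k) \<longrightarrow> HL f x = 0) \<and> (\<Sum>k. \<mu> k) \<le> nrm f"
proof -
  note [measurable] = Adm_m[OF f(1)]
  define h where "h x = (F f x epowr q * u x) * indicator {..<x1} x" for x
  have hm [measurable]: "h \<in> borel_measurable lebesgue" unfolding h_def by measurable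
  have hF: "ig A h = ig (A \<inter> {..<x1}) (\<lambda>x. F f x epowr q * u x)" for A
    unfolding ig_def h_def by (intro nn_integral_cong) (auto simp: indicator_def)
  obtain l where l: "HL f x1 = ennreal l" "0 < l"
    using HL by (metis ennreal_cases ennreal_0 less_eq_real_def less_irrefl)
  have l': "ig UNIV h = ennreal l" using l by (simp add: hF HL_def)
  obtain y :: "nat \<Rightarrow> real" where y: "\<And>k. y (Suc k) < y k"
    "\<And>k. ig {..<y k} h = ennreal (l / 2 ^ (k + 1))"
    "\<And>k. ig {y (Suc k)..<y k} h = ennreal (l / 2 ^ (k + 2))"
    "\<And>k x. x \<in> lv y k \<Longrightarrow> ig {..<x} h \<le> ennreal (l / 2 ^ k)"
    "\<And>x. x \<notin> (\<Union>k. lv y k) \<Longrightarrow> ig {..<x} h = 0"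
    using level_points[OF hm l' l(2)] by blast
  define \<mu> where "\<mu> k = ig {y (Suc k)..<y k} (\<lambda>x. f x epowr p * v x)" for k
  have yx: "y k < x1" for k
  proof (rule ccontr)
    assume "\<not> ?thesis"
    then have "ig {..<y k} h = HL f x1" unfolding hF HL_def by (intro ig_cong) auto
    then have "ig {..<y k} h = ennreal l" by (simp add: l)
    moreover have "l / 2 ^ (k + 1) < l"
      using l(2) one_less_power[of "2::real" "k + 1"] by (simp add: field_simps)
    ultimately show False using y(2)[of k] l(2) by simp
  qed
  have yD: "y k \<in> D" for k
  proof (rule ccontr)
    assume n: "y k \<notin> D"
    have "x \<notin> D" if "x < y k" for x using D_interval[OF _ x1, of x "y k"] yx[of k] n that by auto
    then have "ig {..<y k} h = 0" using u_0 by (intro ig_eq_0) (auto simp: h_def)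
    then show False using y(2)[of k] l(2) by simp
  qed
  have HLh: "HL f x = ig {..<x} h" if "x \<le> x1" for x
    unfolding hF HL_def using that by (intro ig_cong) auto
  show ?thesis
  proof (intro exI[of _ y] exI[of _ \<mu>] conjI allI impI)
    show "y k \<in> D" "y k < x1" "y (Suc k) < y k" for k by (fact yD yx y(1))+
    show "HL f x = 0" if "x \<le> x1" "x \<notin> (\<Union>k. lv y k)" for x using HLh y(5) that by simp
    have "(\<Sum>k. \<mu> k) = ig (\<Union>k. {y (Suc k)..<y k}) (\<lambda>x. f x epowr p * v x)"
      unfolding \<mu>_def by (intro ig_UN[symmetric]) (simp_all add: disjoint_steps y(1))
    also have "\<dots> \<le> nrm f" unfolding nrm_def by (intro ig_mono) auto
    finally show "(\<Sum>k. \<mu> k) \<le> nrm f" .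
    fix k x assume x: "x \<in> lv y k" "x \<le> x1"
    have "ig {y (Suc k)..<y k} (\<lambda>x. F f x epowr q * u x) = ennreal (l / 2 ^ (k + 2))"
      unfolding y(3)[symmetric] hF using yx[of k] by (intro ig_cong) auto
    moreover have "HL f x \<le> ennreal (l / 2 ^ k)" using HLh[OF x(2)] y(4)[OF x(1)] by simp
    moreover have "ennreal (l / 2 ^ k) = 4 * ennreal (l / 2 ^ (k + 2))"
      using l(2) ennreal_mult[of 4 "l / 2 ^ (k + 2)"] by simp
    ultimately have "HL f x \<le> 4 * ig {y (Suc k)..<y k} (\<lambda>x. F f x epowr q * u x)" by simp
    also have "\<dots> \<le> 4 * (2 epowr q * (F f (y (Suc k)) epowr q * U (y (Suc k)) (y k) + \<mu> k epowr (q / p) * Kl (y k)))"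
      unfolding \<mu>_def using f y(1) yD fin by (intro mult_left_mono HL_split) auto
    \<comment> \<open>Extending \<open>U\<close> from y k up to x gives the nonlocal term the shape
      of the integrand of \<open>P\<close>.\<close>
    also have "\<dots> \<le> 4 * (2 epowr q * (F f (y (Suc k)) epowr q * U (y (Suc k)) x + \<mu> k epowr (q / p) * Kl (y k)))"
      using lv_less[OF x(1)] by (intro mult_left_mono add_right_mono U_mono) auto
    finally have "HL f x epowr (r / q) \<le> (4 * (2 epowr q * (F f (y (Suc k)) epowr q * U (y (Suc k)) x + \<mu> k epowr (q / p) * Kl (y k)))) epowr (r / q)"
      using q r by (intro epowr_mono) auto
    also have "\<dots> = (4 * 2 epowr q) epowr (r / q) * (F f (y (Suc k)) epowr q * U (y (Suc k)) x + \<mu> k epowr (q / p) * Kl (y k)) epowr (r / q)"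
      by (simp only: epowr_mult mult.assoc)
    also have "\<dots> \<le> (4 * 2 epowr q) epowr (r / q) * (2 epowr (r / q) * ((F f (y (Suc k)) epowr q * U (y (Suc k)) x) epowr (r / q) + (\<mu> k epowr (q / p) * Kl (y k)) epowr (r / q)))"
      using q r by (intro mult_left_mono epowr_plus_le) auto
    also have "\<dots> = (8 * 2 epowr q) epowr (r / q) *
      (F f (y (Suc k)) epowr r * U (y (Suc k)) x epowr (r / q) + \<mu> k epowr (r / p) * Kl (y k) epowr (r / q))"
    proof -
      have "(8 * 2 epowr q) epowr (r / q) = (4 * 2 epowr q) epowr (r / q) * 2 epowr (r / q)"
        by (simp flip: epowr_mult add: mult.commute mult.left_commute)
      then show ?thesis using q by (simp add: epowr_mult epowr_epowr mult.assoc)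
    qed
    finally show "HL f x epowr (r / q) \<le> (8 * 2 epowr q) epowr (r / q) *
      (F f (y (Suc k)) epowr r * U (y (Suc k)) x epowr (r / q) + \<mu> k epowr (r / p) * Kl (y k) epowr (r / q))" .
  qed
qed

text \<open>Level k lies to the right of y k, so its w-mass is at most W (y k) and every coefficient
  is at most \<open>X\<close>. Since r/p >= 1, the powers of \<open>\<mu>\<close> sum by
  \<open>suminf_epowr_le\<close>.\<close>

lemma local_sum_ge:
  assumes pr: "p \<le> r" and X: "\<And>y. y \<in> D \<Longrightarrow> W y * Kl y epowr (r / q) \<le> X"
    and y: "\<And>k. y k \<in> D" and \<mu>: "(\<Sum>k. \<mu> k) \<le> n"
  shows "(\<Sum>k. \<mu> k epowr (r / p) * (Kl (y k) epowr (r / q) * ig ({..<x1} \<inter> lv y k) w)) \<le> X * n epowr (r / p)"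
proof -
  have "Kl (y k) epowr (r / q) * ig ({..<x1} \<inter> lv y k) w \<le> X" for k
  proof -
    have "ig ({..<x1} \<inter> lv y k) w \<le> W (y k)" unfolding W_def by (intro ig_mono) (auto dest: lv_less)
    then have "Kl (y k) epowr (r / q) * ig ({..<x1} \<inter> lv y k) w \<le> W (y k) * Kl (y k) epowr (r / q)"
      unfolding mult.commute[of "Kl (y k) epowr (r / q)"] by (intro mult_right_mono) auto
    then show ?thesis using X[OF y] by (rule order_trans)
  qed
  then have "(\<Sum>k. \<mu> k epowr (r / p) * (Kl (y k) epowr (r / q) * ig ({..<x1} \<inter> lv y k) w)) \<le> (\<Sum>k. \<mu> k epowr (r / p) * X)"
    by (intro suminf_ennreal_mono mult_left_mono) auto
  also have "\<dots> = X * (\<Sum>k. \<mu> k epowr (r / p))" by (simp add: mult.commute)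
  also have "\<dots> \<le> X * (\<Sum>k. \<mu> k) epowr (r / p)"
    using p pr by (intro mult_left_mono suminf_epowr_le) auto
  also have "\<dots> \<le> X * n epowr (r / p)"
    using p r \<mu> by (intro mult_left_mono epowr_mono) auto
  finally show ?thesis .
qed

text \<open>The scheme of \<open>Kl_le_BB\<close>, with \<open>w\<close>, \<open>W\<close>,
  \<open>Kl\<close> in the roles of \<open>u\<close>, \<open>U\<close>, \<open>\<Phi>\<close>:
  Hoelder's inequality in k, then \<open>power_rule\<close> on each level, where Kl (y k) <= Kl
  x.\<close>

lemma local_sum_less:
  assumes rp: "r < p" and X: "ig D (\<lambda>x. W x epowr (r / (p - r)) * w x * Kl x epowr (r * p / (q * (p - r)))) \<le> X"
    and W: "\<And>y. y \<in> D \<Longrightarrow> W y < top"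
    and y: "\<And>k. y k \<in> D" and x1: "x1 \<in> D" and \<mu>: "(\<Sum>k. \<mu> k) \<le> n"
  shows "(\<Sum>k. \<mu> k epowr (r / p) * (Kl (y k) epowr (r / q) * ig ({..<x1} \<inter> lv y k) w))
    \<le> 2 * X epowr ((p - r) / p) * n epowr (r / p)"
proof -
  define s where "s = r / p"
  define \<rho> where "\<rho> = r / (p - r)"
  have s: "0 < s" "s < 1" "1 - s = (p - r) / p" using p r rp by (auto simp: s_def field_simps)
  have \<rho>: "0 < \<rho>" "\<rho> * (1 - s) = s" "(\<rho> + 1) * (1 - s) = 1" "\<rho> + 1 = p / (p - r)"
    "r * p / (q * (p - r)) * (1 - s) = r / q"
    unfolding s(3) using p q r rp by (auto simp: s_def \<rho>_def field_simps)
  define E where "E k = {..<x1} \<inter> lv y k" for k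
  have E [measurable]: "E k \<in> sets borel" for k unfolding E_def by simp
  define N where "N k = Kl (y k) epowr (r * p / (q * (p - r))) * ig (E k) w epowr (\<rho> + 1)" for k
  define G where "G x = W x epowr \<rho> * w x * Kl x epowr (r * p / (q * (p - r)))" for x
  have [measurable]: "G \<in> borel_measurable lebesgue" unfolding G_def by measurable
  have N: "N k \<le> 2 epowr (\<rho> + 1) * ig (E k \<inter> D) G" for k
  proof -
    have "ig (E k) w \<le> W (y k)" unfolding W_def E_def by (intro ig_mono) (auto dest: lv_less)
    then have fin: "ig (E k) w < top" using W[OF y] by (rule le_less_trans)
    have "ig (E k) w epowr (\<rho> + 1) \<le> 2 epowr (\<rho> + 1) * ig (E k) (\<lambda>x. w x * ig (E k \<inter> {x..}) w epowr \<rho>)"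
      using \<rho> fin by (intro power_rule) auto
    also have "ig (E k) (\<lambda>x. w x * ig (E k \<inter> {x..}) w epowr \<rho>) \<le> ig (E k) (\<lambda>x. w x * W x epowr \<rho>)"
      unfolding W_def using \<rho> by (intro ig_mono mult_left_mono epowr_mono) auto
    finally have "N k \<le> Kl (y k) epowr (r * p / (q * (p - r))) * (2 epowr (\<rho> + 1) * ig (E k) (\<lambda>x. w x * W x epowr \<rho>))"
      unfolding N_def by (simp add: mult_left_mono)
    also have "\<dots> = 2 epowr (\<rho> + 1) * ig (E k) (\<lambda>x. Kl (y k) epowr (r * p / (q * (p - r))) * (w x * W x epowr \<rho>))"
      by (subst ig_cmult) (auto simp: mult.left_commute borel_lebesgue)
    also have "ig (E k) (\<lambda>x. Kl (y k) epowr (r * p / (q * (p - r))) * (w x * W x epowr \<rho>)) \<le> ig (E k) G"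
    proof (intro ig_mono)
      fix x assume "x \<in> E k"
      then have "Kl (y k) epowr (r * p / (q * (p - r))) \<le> Kl x epowr (r * p / (q * (p - r)))"
        using p q r rp by (intro epowr_mono Kl_mono) (auto simp: E_def dest: lv_less)
      then have "(w x * W x epowr \<rho>) * Kl (y k) epowr (r * p / (q * (p - r))) \<le> (w x * W x epowr \<rho>) * Kl x epowr (r * p / (q * (p - r)))"
        by (intro mult_left_mono) auto
      then show "Kl (y k) epowr (r * p / (q * (p - r))) * (w x * W x epowr \<rho>) \<le> G x"
        by (simp add: G_def ac_simps)
    qed auto
    also have "ig (E k) G = ig (E k \<inter> D) G" using w_0 by (intro ig_restrict) (auto simp: G_def)
    finally show ?thesis by (simp add: mult_left_mono)
  qed
  have "(\<Sum>k. N k) \<le> 2 epowr (\<rho> + 1) * (\<Sum>k. ig (E k \<inter> D) G)"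
    unfolding ennreal_suminf_cmult[symmetric] by (intro suminf_ennreal_mono N)
  also have "(\<Sum>k. ig (E k \<inter> D) G) = ig (\<Union>k. E k \<inter> D) G"
    using lv_disjoint[of y] by (intro ig_UN[symmetric]) (auto simp: E_def disjoint_family_on_def borel_lebesgue)
  also have "\<dots> \<le> ig D G" by (intro ig_mono) auto
  also have "\<dots> \<le> X" using X by (simp add: G_def[abs_def] \<rho>_def)
  finally have sN: "(\<Sum>k. N k) \<le> 2 epowr (\<rho> + 1) * X" by (simp add: mult_left_mono)
  have "(\<Sum>k. \<mu> k epowr (r / p) * (Kl (y k) epowr (r / q) * ig ({..<x1} \<inter> lv y k) w)) = (\<Sum>k. \<mu> k epowr s * N k epowr (1 - s))"
    by (simp only: N_def epowr_mult epowr_epowr \<rho>(3,5) epowr_one E_def) (simp only: s_def)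
  also have "\<dots> \<le> (\<Sum>k. \<mu> k) epowr s * (\<Sum>k. N k) epowr (1 - s)"
    using s by (intro suminf_Hoelder) auto
  also have "\<dots> \<le> n epowr s * (2 epowr (\<rho> + 1) * X) epowr (1 - s)"
    using s \<mu> sN by (intro mult_mono epowr_mono) auto
  also have "\<dots> = 2 * X epowr ((p - r) / p) * n epowr (r / p)"
    unfolding epowr_mult epowr_epowr \<rho>(3) epowr_one unfolding s(3) unfolding s_def by (simp only: ac_simps)
  finally show ?thesis .
qed

text \<open>A point x in level k of \<open>y\<close> has the starting point \<tau> x = y (k+1). A
  second sequence \<open>t\<close> halves \<open>F f\<close>, and \<open>H k\<close> gathers the x
  whose starting point lies in level k of \<open>t\<close>; so one bound for \<open>F f\<close>
  serves all of \<open>H k\<close>, which may contain many levels of \<open>y\<close>. Since \<tau>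
  is nondecreasing, the starting point of x also serves every later point of \<open>H k\<close>.
  This is what the clause about \<open>g\<close> records; it is needed to estimate tails.\<close>

lemma nonlocal_levels:
  assumes f: "f \<in> Adm" "nrm f < top" and x1: "x1 \<in> D" "\<Phi> x1 < top" and F0: "F f x1 \<noteq> 0"
    and y': "\<forall>k. y k \<in> D \<and> y k < x1 \<and> y (Suc k) < y k"
  shows "\<exists>(t :: nat \<Rightarrow> real) m H g. (\<forall>k. t k \<in> D \<and> H k \<in> sets borel) \<and> (\<Sum>k. m k) \<le> nrm f \<and> disjoint_family H \<and>
    g \<in> borel_measurable lebesgue \<and>
    (\<forall>k. \<forall>x\<in>H k. \<exists>s. s \<in> D \<and> t k < s \<and> s < x \<and> g x = U s x epowr (r / q) \<and>
      (\<forall>z\<in>H k. x \<le> z \<longrightarrow> g z \<le> U s z epowr (r / q))) \<and>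
    (\<Sum>k. ig ({..<x1} \<inter> lv y k) (\<lambda>x. F f (y (Suc k)) epowr r * (U (y (Suc k)) x epowr (r / q) * w x)))
      \<le> 4 epowr r * (\<Sum>k. m k epowr (r / p) * (\<Phi> (t k) epowr (r / p) * ig (H k) (\<lambda>x. g x * w x)))"
proof -
  note y = y'[rule_format]
  obtain t m where t: "\<forall>k. t k \<in> D \<and> t k < x1 \<and> t (Suc k) < t k"
    "\<forall>k x. x \<in> lv t k \<longrightarrow> x \<le> x1 \<longrightarrow> F f x epowr p \<le> 4 epowr p * (m k * \<Phi> (t k))"
    "\<forall>x\<le>x1. x \<notin> (\<Union>k. lv t k) \<longrightarrow> F f x = 0" "(\<Sum>k. m k) \<le> nrm f"
    using F_levels[OF f(1) x1 f(2) F0] by (elim exE conjE) (rule that)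
  have ydec: "y n \<le> y m" if "m \<le> n" for m n
    by (rule lift_Suc_antimono_le[OF _ that]) (simp add: y less_imp_le)
  define E where "E k = {..<x1} \<inter> lv y k" for k
  have E [measurable]: "E k \<in> sets borel" for k unfolding E_def by simp
  have Edis: "disjoint_family E" using lv_disjoint[of y] by (auto simp: E_def disjoint_family_on_def)
  \<comment> \<open>The level number as a least index is a measurable function of x, and so are the
    functions composed with it.\<close>
  define jj where "jj x = (LEAST j. y j < x)" for x
  have jj: "jj x = k" if "x \<in> lv y k" for x k
    unfolding jj_def using that by (intro Least_equality) (auto simp: lv_def not_less[symmetric])
  have [measurable]: "jj \<in> measurable lebesgue (count_space UNIV)"
  proof -
    have "{x \<in> space lebesgue. y j < x} \<in> sets lebesgue" for j
      using borel_lebesgue[of "{y j<..}"] by (simp add: greaterThan_def)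
    then have "(\<lambda>x. y j < x) \<in> measurable lebesgue (count_space UNIV)" for j
      by (simp only: Measurable.pred_def)
    then show ?thesis unfolding jj_def by (rule measurable_Least)
  qed
  define \<tau> where "\<tau> x = y (Suc (jj x))" for x
  define g where "g x = U (\<tau> x) x epowr (r / q)" for x
  have gm [measurable]: "g \<in> borel_measurable lebesgue"
    unfolding g_def \<tau>_def
    by (rule measurable_compose_countable[where f="\<lambda>j x. U (y (Suc j)) x epowr (r / q)" and g=jj]) measurable
  define H where "H k = (\<Union>j\<in>{j. y (Suc j) \<in> lv t k}. E j)" for k
  have H [measurable]: "H k \<in> sets borel" for k unfolding H_def by (intro sets.countable_UN') auto
  have HE: "x \<in> H k \<longleftrightarrow> x \<in> (\<Union>k. E k) \<and> \<tau> x \<in> lv t k" for x k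
    unfolding H_def \<tau>_def using jj by (auto simp: E_def)
  have Hdis: "disjoint_family H"
    using lv_disjoint[of t] unfolding disjoint_family_on_def set_eq_iff by (simp add: HE)
  have \<tau>x: "\<tau> x < x" "\<tau> x \<le> x1" "\<tau> x \<in> D" if xE: "x \<in> (\<Union>k. E k)" for x
  proof -
    obtain k where k: "x \<in> E k" using xE by blast
    then have "y k < x" by (auto simp: E_def dest: lv_less)
    then show "\<tau> x < x" "\<tau> x \<le> x1" "\<tau> x \<in> D"
      using jj[of x k] k y[of k] y[of "Suc k"] by (auto simp: \<tau>_def E_def)
  qed
  have "(\<Sum>k. ig (E k) (\<lambda>x. F f (y (Suc k)) epowr r * (U (y (Suc k)) x epowr (r / q) * w x)))
      = (\<Sum>k. ig (E k) (\<lambda>x. F f (\<tau> x) epowr r * (g x * w x)))"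
    by (intro suminf_cong ig_cong) (auto simp: g_def \<tau>_def E_def jj)
  also have "\<dots> = ig (\<Union>k. E k) (\<lambda>x. F f (\<tau> x) epowr r * (g x * w x))"
  proof (intro ig_UN[symmetric] Edis)
    have "(\<lambda>x. F f (\<tau> x)) \<in> borel_measurable lebesgue"
      unfolding \<tau>_def by (rule measurable_compose_countable[where f="\<lambda>j x. F f (y (Suc j))" and g=jj]) measurable
    then show "(\<lambda>x. F f (\<tau> x) epowr r * (g x * w x)) \<in> borel_measurable lebesgue" by measurable
  qed (simp add: borel_lebesgue)
  also have "\<dots> \<le> ig (\<Union>k. H k) (\<lambda>x. F f (\<tau> x) epowr r * (g x * w x))"
  proof -
    \<comment> \<open>A starting point in no level of \<open>t\<close> lies where \<open>F f\<close>
      vanishes, so the sets \<open>H k\<close> lose nothing.\<close>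
    have "F f (\<tau> x) = 0" if "x \<in> (\<Union>k. E k)" "x \<notin> (\<Union>k. H k)" for x
      using t(3) \<tau>x[OF that(1)] that by (auto simp: HE)
    then have "ig (\<Union>k. E k) (\<lambda>x. F f (\<tau> x) epowr r * (g x * w x))
        = ig ((\<Union>k. E k) \<inter> (\<Union>k. H k)) (\<lambda>x. F f (\<tau> x) epowr r * (g x * w x))"
      by (intro ig_restrict) auto
    also have "\<dots> \<le> ig (\<Union>k. H k) (\<lambda>x. F f (\<tau> x) epowr r * (g x * w x))"
      by (intro ig_mono) auto
    finally show ?thesis .
  qed
  also have "\<dots> \<le> ig (\<Union>k. H k) (\<lambda>x. (\<Sum>k. 4 epowr r * (m k epowr (r / p) * \<Phi> (t k) epowr (r / p)) * indicator (H k) x) * (g x * w x))"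
  proof (intro ig_mono mult_right_mono)
    fix x assume "x \<in> (\<Union>k. H k)"
    then obtain k where k: "x \<in> H k" by blast
    have "F f (\<tau> x) epowr r = (F f (\<tau> x) epowr p) epowr (r / p)" using p by (simp add: epowr_epowr)
    also have "\<dots> \<le> (4 epowr p * (m k * \<Phi> (t k))) epowr (r / p)"
      using t(2) k \<tau>x[of x] p r by (intro epowr_mono) (auto simp: HE)
    also have "\<dots> = 4 epowr r * (m k epowr (r / p) * \<Phi> (t k) epowr (r / p))"
      using p by (simp add: epowr_mult epowr_epowr)
    also have "\<dots> = (\<Sum>k. 4 epowr r * (m k epowr (r / p) * \<Phi> (t k) epowr (r / p)) * indicator (H k) x)"
      using suminf_cmult_indicator[OF Hdis k, of "\<lambda>k. 4 epowr r * (m k epowr (r / p) * \<Phi> (t k) epowr (r / p))"] by simp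
    finally show "F f (\<tau> x) epowr r \<le> (\<Sum>k. 4 epowr r * (m k epowr (r / p) * \<Phi> (t k) epowr (r / p)) * indicator (H k) x)" .
  qed auto
  also have "\<dots> = (\<Sum>k. ig (H k) (\<lambda>x. (4 epowr r * (m k epowr (r / p) * \<Phi> (t k) epowr (r / p))) * (g x * w x)))"
  proof -
    have "ig (\<Union>k. H k) (\<lambda>x. (\<Sum>k. 4 epowr r * (m k epowr (r / p) * \<Phi> (t k) epowr (r / p)) * indicator (H k) x) * (g x * w x))
      = (\<Sum>k. ig (H k) (\<lambda>x. (\<Sum>k. 4 epowr r * (m k epowr (r / p) * \<Phi> (t k) epowr (r / p)) * indicator (H k) x) * (g x * w x)))"
    proof (intro ig_UN Hdis)
      have [measurable]: "H k \<in> sets lebesgue" for k by (rule borel_lebesgue[OF H])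
      show "H k \<in> sets lebesgue" for k by measurable
      show "(\<lambda>x. (\<Sum>k. 4 epowr r * (m k epowr (r / p) * \<Phi> (t k) epowr (r / p)) * indicator (H k) x) * (g x * w x)) \<in> borel_measurable lebesgue"
        by measurable
    qed
    also have "\<dots> = (\<Sum>k. ig (H k) (\<lambda>x. (4 epowr r * (m k epowr (r / p) * \<Phi> (t k) epowr (r / p))) * (g x * w x)))"
      using suminf_cmult_indicator[OF Hdis, of _ _ "\<lambda>k. 4 epowr r * (m k epowr (r / p) * \<Phi> (t k) epowr (r / p))"]
      by (intro suminf_cong ig_cong) auto
    finally show ?thesis .
  qed
  also have "\<dots> = (\<Sum>k. 4 epowr r * (m k epowr (r / p) * (\<Phi> (t k) epowr (r / p) * ig (H k) (\<lambda>x. g x * w x))))"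
    by (subst ig_cmult) (auto simp: mult.assoc borel_lebesgue)
  also have "\<dots> = 4 epowr r * (\<Sum>k. m k epowr (r / p) * (\<Phi> (t k) epowr (r / p) * ig (H k) (\<lambda>x. g x * w x)))"
    by simp
  finally have main: "(\<Sum>k. ig ({..<x1} \<inter> lv y k) (\<lambda>x. F f (y (Suc k)) epowr r * (U (y (Suc k)) x epowr (r / q) * w x)))
      \<le> 4 epowr r * (\<Sum>k. m k epowr (r / p) * (\<Phi> (t k) epowr (r / p) * ig (H k) (\<lambda>x. g x * w x)))"
    by (simp add: E_def)
  show ?thesis
  proof (intro exI[of _ t] exI[of _ m] exI[of _ H] exI[of _ g] conjI allI ballI main gm Hdis t(4) H)
    show "t k \<in> D" for k using t(1) by blast
    fix k x assume x: "x \<in> H k"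
    show "\<exists>s. s \<in> D \<and> t k < s \<and> s < x \<and> g x = U s x epowr (r / q) \<and> (\<forall>z\<in>H k. x \<le> z \<longrightarrow> g z \<le> U s z epowr (r / q))"
    proof (intro exI[of _ "\<tau> x"] conjI ballI impI)
      show "\<tau> x \<in> D" "t k < \<tau> x" "\<tau> x < x" using x \<tau>x[of x] by (auto simp: HE dest: lv_less)
      show "g x = U (\<tau> x) x epowr (r / q)" by (simp add: g_def)
      fix z assume z: "z \<in> H k" "x \<le> z"
      obtain i j where ij: "x \<in> lv y i" "z \<in> lv y j" using x z(1) by (auto simp: HE E_def)
      have "jj z \<le> jj x" unfolding jj[OF ij(1)] unfolding jj_def
        using lv_less[OF ij(1)] z(2) by (intro Least_le) simp
      then have "\<tau> x \<le> \<tau> z" unfolding \<tau>_def by (intro ydec) simp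
      then show "g z \<le> U (\<tau> x) z epowr (r / q)"
        unfolding g_def using q r by (intro epowr_mono U_mono) auto
    qed
  qed
qed

text \<open>All starting points in \<open>H k\<close> lie to the right of t k, so \<open>g\<close>
  is at most the power of \<open>U (t k)\<close> that occurs in P (t k).\<close>

lemma nonlocal_sum_ge:
  assumes pr: "p \<le> r" and X: "\<And>t. t \<in> D \<Longrightarrow> P t * \<Phi> t epowr (r / p) \<le> X"
    and f: "f \<in> Adm" "nrm f < top" and x1: "x1 \<in> D" "\<Phi> x1 < top"
    and y': "\<forall>k. y k \<in> D \<and> y k < x1 \<and> y (Suc k) < y k"
  shows "(\<Sum>k. ig ({..<x1} \<inter> lv y k) (\<lambda>x. F f (y (Suc k)) epowr r * (U (y (Suc k)) x epowr (r / q) * w x)))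
      \<le> 4 epowr r * (X * nrm f epowr (r / p))"
proof (cases "F f x1 = 0")
  case True
  have "F f (y k) = 0" for k using F_mono[of "y k" x1 f] y'[rule_format, of k] True by auto
  then show ?thesis by (simp add: ig_eq_0)
next
  case False
  obtain t m H g where t: "\<forall>k. t k \<in> D \<and> H k \<in> sets borel" "(\<Sum>k. m k) \<le> nrm f"
    "\<forall>k. \<forall>x\<in>H k. \<exists>s. s \<in> D \<and> t k < s \<and> s < x \<and> g x = U s x epowr (r / q) \<and>
      (\<forall>z\<in>H k. x \<le> z \<longrightarrow> g z \<le> U s z epowr (r / q))"
    "(\<Sum>k. ig ({..<x1} \<inter> lv y k) (\<lambda>x. F f (y (Suc k)) epowr r * (U (y (Suc k)) x epowr (r / q) * w x)))
      \<le> 4 epowr r * (\<Sum>k. m k epowr (r / p) * (\<Phi> (t k) epowr (r / p) * ig (H k) (\<lambda>x. g x * w x)))"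
    using nonlocal_levels[OF f x1 False y'] by (elim exE conjE) (rule that)
  have le: "\<Phi> (t k) epowr (r / p) * ig (H k) (\<lambda>x. g x * w x) \<le> X" for k
  proof -
    have "ig (H k) (\<lambda>x. g x * w x) \<le> P (t k)"
      unfolding P_def
    proof (intro ig_mono subsetI)
      fix x assume "x \<in> H k"
      then obtain s where s: "t k < s" "s < x" "g x = U s x epowr (r / q)" using t(3) by blast
      then show "x \<in> {t k..}" by simp
      have "g x \<le> U (t k) x epowr (r / q)" unfolding s(3) using s q r by (intro epowr_mono U_mono) auto
      then show "g x * w x \<le> w x * U (t k) x epowr (r / q)"
        unfolding mult.commute[of "w x"] by (intro mult_right_mono) auto
    qed
    then have "\<Phi> (t k) epowr (r / p) * ig (H k) (\<lambda>x. g x * w x) \<le> P (t k) * \<Phi> (t k) epowr (r / p)"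
      unfolding mult.commute[of "\<Phi> (t k) epowr (r / p)"] by (intro mult_right_mono) auto
    also have "\<dots> \<le> X" using X t(1) by blast
    finally show ?thesis .
  qed
  have "(\<Sum>k. m k epowr (r / p) * (\<Phi> (t k) epowr (r / p) * ig (H k) (\<lambda>x. g x * w x))) \<le> (\<Sum>k. m k epowr (r / p) * X)"
    using le by (intro suminf_ennreal_mono mult_left_mono) auto
  also have "\<dots> = X * (\<Sum>k. m k epowr (r / p))" by (simp add: mult.commute)
  also have "\<dots> \<le> X * (\<Sum>k. m k) epowr (r / p)"
    using p pr by (intro mult_left_mono suminf_epowr_le) auto
  also have "\<dots> \<le> X * nrm f epowr (r / p)"
    using p r t(2) by (intro mult_left_mono epowr_mono) auto
  finally show ?thesis using t(4) by (meson mult_left_mono order_trans zero_le)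
qed

text \<open>Hoelder's inequality in k, then \<open>power_rule\<close> for the density g w on
  \<open>H k\<close>. Beyond x the additivity U s z = U s x + U x z splits the tail into a multiple
  of W x and P x. With the factor g x the first part is absorbed by \<open>Kl\<close>, the second by
  \<open>TT\<close>; hence both integrals are assumed. In \<open>c\<close>, 2^(r/(p-r)+1) is due to
  \<open>power_rule\<close>, the next two factors to two powers of sums, and the last 2 to adding
  the two integrals.\<close>

lemma nonlocal_sum_less:
  assumes rp: "r < p"
    and X: "ig D (\<lambda>x. W x epowr (r / (p - r)) * w x * Kl x epowr (r * p / (q * (p - r)))) \<le> X"
      "ig D (\<lambda>x. P x epowr (r / (p - r)) * w x * TT x) \<le> X"
    and P: "\<And>x. x \<in> D \<Longrightarrow> P x < top"
    and f: "f \<in> Adm" "nrm f < top" and x1: "x1 \<in> D" "\<Phi> x1 < top"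
    and y': "\<forall>k. y k \<in> D \<and> y k < x1 \<and> y (Suc k) < y k"
  defines "c \<equiv> (2 epowr (r / (p - r) + 1) * ((2 epowr (r / q)) epowr (r / (p - r)) * 2 epowr (r / (p - r))) * 2) epowr ((p - r) / p)"
  shows "(\<Sum>k. ig ({..<x1} \<inter> lv y k) (\<lambda>x. F f (y (Suc k)) epowr r * (U (y (Suc k)) x epowr (r / q) * w x)))
      \<le> 4 epowr r * (c * (X epowr ((p - r) / p) * nrm f epowr (r / p)))"
proof (cases "F f x1 = 0")
  case True
  have "F f (y k) = 0" for k using F_mono[of "y k" x1 f] y'[rule_format, of k] True by auto
  then show ?thesis by (simp add: ig_eq_0)
next
  case False
  obtain t m H g where t: "\<forall>k. t k \<in> D \<and> H k \<in> sets borel" "(\<Sum>k. m k) \<le> nrm f" "disjoint_family H"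
    "g \<in> borel_measurable lebesgue"
    "\<forall>k. \<forall>x\<in>H k. \<exists>s. s \<in> D \<and> t k < s \<and> s < x \<and> g x = U s x epowr (r / q) \<and>
      (\<forall>z\<in>H k. x \<le> z \<longrightarrow> g z \<le> U s z epowr (r / q))"
    "(\<Sum>k. ig ({..<x1} \<inter> lv y k) (\<lambda>x. F f (y (Suc k)) epowr r * (U (y (Suc k)) x epowr (r / q) * w x)))
      \<le> 4 epowr r * (\<Sum>k. m k epowr (r / p) * (\<Phi> (t k) epowr (r / p) * ig (H k) (\<lambda>x. g x * w x)))"
    using nonlocal_levels[OF f x1 False y'] by (elim exE conjE) (rule that)
  note [measurable] = t(4)
  have H [measurable]: "H k \<in> sets borel" for k using t(1) by blast
  define s where "s = r / p"
  define \<rho> where "\<rho> = r / (p - r)"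
  define \<kappa> where "\<kappa> = r / q"
  define \<sigma> where "\<sigma> = r * p / (q * (p - r))"
  have s: "0 < s" "s < 1" "1 - s = (p - r) / p" using p r rp by (auto simp: s_def field_simps)
  have \<rho>: "0 < \<rho>" "\<rho> * (1 - s) = s" "(\<rho> + 1) * (1 - s) = 1"
    unfolding s(3) using p q r rp by (auto simp: s_def \<rho>_def field_simps)
  have \<kappa>: "0 < \<kappa>" "0 < \<sigma>" "\<kappa> + \<kappa> * \<rho> = \<sigma>" "q / p * \<sigma> = \<rho>"
    using p q r rp by (auto simp: \<rho>_def \<kappa>_def \<sigma>_def field_simps)
  define G where "G x = W x epowr \<rho> * w x * Kl x epowr \<sigma> + P x epowr \<rho> * w x * TT x" for x
  have [measurable]: "G \<in> borel_measurable lebesgue" unfolding G_def by measurable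
  define N where "N k = \<Phi> (t k) epowr \<rho> * ig (H k) (\<lambda>x. g x * w x) epowr (\<rho> + 1)" for k
  define c0 where "c0 = 2 epowr (\<rho> + 1) * ((2 epowr \<kappa>) epowr \<rho> * 2 epowr \<rho>)"
  have N: "N k \<le> c0 * ig (H k \<inter> D) G" for k
  proof -
    have tail: "ig (H k \<inter> {x..}) (\<lambda>x. g x * w x) \<le> 2 epowr \<kappa> * (U a x epowr \<kappa> * W x + P x)"
      if a: "a < x" "\<forall>z\<in>H k. x \<le> z \<longrightarrow> g z \<le> U a z epowr \<kappa>" for a x
    proof -
      have "ig (H k \<inter> {x..}) (\<lambda>x. g x * w x) \<le> ig {x..} (\<lambda>z. 2 epowr \<kappa> * (U a x epowr \<kappa> * w z + w z * U x z epowr \<kappa>))"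
      proof (intro ig_mono)
        fix z assume z: "z \<in> H k \<inter> {x..}"
        have "g z \<le> U a z epowr \<kappa>" using a z by auto
        also have "U a z = U a x + U x z" using a z by (intro U_add) auto
        also have "(U a x + U x z) epowr \<kappa> \<le> 2 epowr \<kappa> * (U a x epowr \<kappa> + U x z epowr \<kappa>)"
          using \<kappa> by (intro epowr_plus_le) auto
        finally have "g z * w z \<le> 2 epowr \<kappa> * (U a x epowr \<kappa> + U x z epowr \<kappa>) * w z"
          by (intro mult_right_mono) auto
        then show "g z * w z \<le> 2 epowr \<kappa> * (U a x epowr \<kappa> * w z + w z * U x z epowr \<kappa>)"
          by (simp add: mult.assoc distrib_right mult.commute[of "w z"])
      qed auto
      also have "\<dots> = 2 epowr \<kappa> * (U a x epowr \<kappa> * W x + P x)"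
        unfolding W_def P_def \<kappa>_def by (simp add: ig_cmult ig_add)
      finally show ?thesis .
    qed
    have "ig (H k) (\<lambda>x. g x * w x) \<le> P (t k)"
      unfolding P_def
    proof (intro ig_mono subsetI)
      fix x assume "x \<in> H k"
      then obtain a where a: "t k < a" "a < x" "g x = U a x epowr (r / q)" using t(5) by blast
      then show "x \<in> {t k..}" by simp
      have "g x \<le> U (t k) x epowr (r / q)" unfolding a(3) using a q r by (intro epowr_mono U_mono) auto
      then show "g x * w x \<le> w x * U (t k) x epowr (r / q)"
        unfolding mult.commute[of "w x"] by (intro mult_right_mono) auto
    qed
    then have "ig (H k) (\<lambda>x. g x * w x) < top" using P t(1) by (blast intro: le_less_trans)
    then have "ig (H k) (\<lambda>x. g x * w x) epowr (\<rho> + 1)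
        \<le> 2 epowr (\<rho> + 1) * ig (H k) (\<lambda>x. (g x * w x) * ig (H k \<inter> {x..}) (\<lambda>x. g x * w x) epowr \<rho>)"
      using \<rho> by (intro power_rule) auto
    then have "N k \<le> \<Phi> (t k) epowr \<rho> * (2 epowr (\<rho> + 1) * ig (H k) (\<lambda>x. (g x * w x) * ig (H k \<inter> {x..}) (\<lambda>x. g x * w x) epowr \<rho>))"
      unfolding N_def by (intro mult_left_mono) auto
    also have "\<dots> = 2 epowr (\<rho> + 1) * ig (H k) (\<lambda>x. \<Phi> (t k) epowr \<rho> * ((g x * w x) * ig (H k \<inter> {x..}) (\<lambda>x. g x * w x) epowr \<rho>))"
    proof (subst ig_cmult)
      have "antimono (\<lambda>x. ig (H k \<inter> {x..}) (\<lambda>x. g x * w x))"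
        by (auto simp: antimono_def intro!: ig_mono)
      then have [measurable]: "(\<lambda>x. ig (H k \<inter> {x..}) (\<lambda>x. g x * w x)) \<in> borel_measurable lebesgue"
        by (rule antimono_lebesgue)
      show "(\<lambda>x. (g x * w x) * ig (H k \<inter> {x..}) (\<lambda>x. g x * w x) epowr \<rho>) \<in> borel_measurable lebesgue"
        by measurable
    qed (auto simp: mult.left_commute borel_lebesgue)
    also have "\<dots> \<le> 2 epowr (\<rho> + 1) * ig (H k) (\<lambda>x. ((2 epowr \<kappa>) epowr \<rho> * 2 epowr \<rho>) * G x)"
    proof (intro mult_left_mono ig_mono)
      fix x assume x: "x \<in> H k"
      then obtain a where a: "a \<in> D" "t k < a" "a < x" "g x = U a x epowr \<kappa>" "\<forall>z\<in>H k. x \<le> z \<longrightarrow> g z \<le> U a z epowr \<kappa>"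
        using t(5) unfolding \<kappa>_def by blast
      have \<Phi>a: "\<Phi> (t k) epowr \<rho> \<le> \<Phi> a epowr \<rho>"
        using a(2) \<rho> \<Phi>_mono by (intro epowr_mono) (auto simp: mono_def)
      have "ig (H k \<inter> {x..}) (\<lambda>x. g x * w x) epowr \<rho> \<le> (2 epowr \<kappa> * (U a x epowr \<kappa> * W x + P x)) epowr \<rho>"
        using \<rho> tail[OF a(3,5)] by (intro epowr_mono) auto
      also have "\<dots> = (2 epowr \<kappa>) epowr \<rho> * (U a x epowr \<kappa> * W x + P x) epowr \<rho>" by (rule epowr_mult)
      also have "\<dots> \<le> (2 epowr \<kappa>) epowr \<rho> * (2 epowr \<rho> * ((U a x epowr \<kappa> * W x) epowr \<rho> + P x epowr \<rho>))"
        using \<rho> by (intro mult_left_mono epowr_plus_le) auto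
      finally have tl: "ig (H k \<inter> {x..}) (\<lambda>x. g x * w x) epowr \<rho>
          \<le> (2 epowr \<kappa>) epowr \<rho> * 2 epowr \<rho> * (U a x epowr (\<kappa> * \<rho>) * W x epowr \<rho> + P x epowr \<rho>)"
        by (simp add: epowr_mult epowr_epowr mult.assoc)
      \<comment> \<open>The exponents match: \<kappa> + \<kappa> \<rho> = \<sigma> for
        \<open>U\<close>, and (q/p) \<sigma> = \<rho> for \<open>\<Phi>\<close>.\<close>
      have "(U a x * \<Phi> a epowr (q / p)) epowr \<sigma> \<le> Kl x epowr \<sigma>"
        using \<kappa> a by (intro epowr_mono U\<Phi>_le_Kl) auto
      then have K: "U a x epowr \<kappa> * U a x epowr (\<kappa> * \<rho>) * \<Phi> a epowr \<rho> \<le> Kl x epowr \<sigma>"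
        by (simp only: epowr_mult epowr_epowr \<kappa>(4) epowr_add[symmetric] \<kappa>(3))
      have T: "U a x epowr \<kappa> * \<Phi> a epowr \<rho> \<le> TT x"
        unfolding TT_def \<kappa>_def \<rho>_def using a by (intro SUP_upper) auto
      have "\<Phi> (t k) epowr \<rho> * ((g x * w x) * ig (H k \<inter> {x..}) (\<lambda>x. g x * w x) epowr \<rho>)
        \<le> \<Phi> a epowr \<rho> * ((U a x epowr \<kappa> * w x) * ((2 epowr \<kappa>) epowr \<rho> * 2 epowr \<rho> * (U a x epowr (\<kappa> * \<rho>) * W x epowr \<rho> + P x epowr \<rho>)))"
        unfolding a(4) by (intro mult_mono \<Phi>a tl order_refl) auto
      also have "\<dots> = (2 epowr \<kappa>) epowr \<rho> * 2 epowr \<rho> *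
          ((W x epowr \<rho> * w x) * (U a x epowr \<kappa> * U a x epowr (\<kappa> * \<rho>) * \<Phi> a epowr \<rho>) + (P x epowr \<rho> * w x) * (U a x epowr \<kappa> * \<Phi> a epowr \<rho>))"
        by (simp add: distrib_left ac_simps)
      also have "\<dots> \<le> (2 epowr \<kappa>) epowr \<rho> * 2 epowr \<rho> * G x"
        unfolding G_def by (intro mult_left_mono add_mono K T) auto
      finally show "\<Phi> (t k) epowr \<rho> * ((g x * w x) * ig (H k \<inter> {x..}) (\<lambda>x. g x * w x) epowr \<rho>) \<le> ((2 epowr \<kappa>) epowr \<rho> * 2 epowr \<rho>) * G x" .
    qed auto
    also have "\<dots> = c0 * ig (H k) G"
      by (subst ig_cmult) (auto simp: c0_def mult.assoc borel_lebesgue)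
    also have "ig (H k) G = ig (H k \<inter> D) G" using w_0 by (intro ig_restrict) (auto simp: G_def)
    finally show ?thesis .
  qed
  have "(\<Sum>k. N k) \<le> c0 * (\<Sum>k. ig (H k \<inter> D) G)"
    unfolding ennreal_suminf_cmult[symmetric] by (intro suminf_ennreal_mono N)
  also have "(\<Sum>k. ig (H k \<inter> D) G) = ig (\<Union>k. H k \<inter> D) G"
    using t(3) by (intro ig_UN[symmetric]) (auto simp: disjoint_family_on_def borel_lebesgue)
  also have "\<dots> \<le> ig D G" by (intro ig_mono) auto
  also have "\<dots> = ig D (\<lambda>x. W x epowr \<rho> * w x * Kl x epowr \<sigma>) + ig D (\<lambda>x. P x epowr \<rho> * w x * TT x)"
    unfolding G_def by (intro ig_add) auto
  also have "\<dots> \<le> X + X" using X unfolding \<rho>_def \<sigma>_def by (intro add_mono)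
  also have "\<dots> = 2 * X" by (simp add: mult_2)
  finally have sN: "(\<Sum>k. N k) \<le> c0 * 2 * X" by (simp add: mult_left_mono mult.assoc)
  have "(\<Sum>k. m k epowr (r / p) * (\<Phi> (t k) epowr (r / p) * ig (H k) (\<lambda>x. g x * w x))) = (\<Sum>k. m k epowr s * N k epowr (1 - s))"
    by (simp only: N_def epowr_mult epowr_epowr \<rho>(2,3) epowr_one) (simp only: s_def)
  also have "\<dots> \<le> (\<Sum>k. m k) epowr s * (\<Sum>k. N k) epowr (1 - s)"
    using s by (intro suminf_Hoelder) auto
  also have "\<dots> \<le> nrm f epowr s * (c0 * 2 * X) epowr (1 - s)"
    using s t(2) sN by (intro mult_mono epowr_mono) auto
  also have "\<dots> = c * (X epowr ((p - r) / p) * nrm f epowr (r / p))"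
    unfolding epowr_mult[of "c0 * 2"] unfolding s(3) unfolding c_def c0_def \<rho>_def \<kappa>_def s_def by (simp only: ac_simps)
  finally show ?thesis using t(6) by (meson mult_left_mono order_trans zero_le)
qed

end

lemma ennreal_mult_less_topD: "a * b < top \<Longrightarrow> 0 < a \<Longrightarrow> b < (top::ennreal)"
  by (metis ennreal_mult_top less_top zero_less_iff_neq_zero)

text \<open>The factor lost in \<open>nonlocal_sum_less\<close>.\<close>

definition c_less :: "real \<Rightarrow> real \<Rightarrow> real \<Rightarrow> ennreal" where
  "c_less p q r = (2 epowr (r / (p - r) + 1) * ((2 epowr (r / q)) epowr (r / (p - r)) * 2 epowr (r / (p - r))) * 2) epowr ((p - r) / p)"

context hardy_core
begin

lemma Kl_pos: "y \<in> D \<Longrightarrow> 0 < Kl y"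
proof -
  assume y: "y \<in> D"
  obtain t where t: "t \<in> D" "t < y" using D_left[OF y] by blast
  have "0 < U t y * \<Phi> t epowr (q / p)"
    using U_pos[OF t] \<Phi>_pos[OF t(1)] by (simp add: ennreal_zero_less_mult_iff)
  also have "\<dots> \<le> Kl y" using t by (intro U\<Phi>_le_Kl) auto
  finally show ?thesis .
qed

lemma TT_pos: "y \<in> D \<Longrightarrow> 0 < TT y"
proof -
  assume y: "y \<in> D"
  obtain t where t: "t \<in> D" "t < y" using D_left[OF y] by blast
  have "0 < U t y epowr (r / q) * \<Phi> t epowr (r / (p - r))"
    using U_pos[OF t] \<Phi>_pos[OF t(1)] by (simp add: ennreal_zero_less_mult_iff)
  also have "\<dots> \<le> TT y" unfolding TT_def using t by (intro SUP_upper) auto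
  finally show ?thesis .
qed

text \<open>If \<open>g\<close> were infinite on a whole subinterval, the positive w-mass of that
  subinterval would make the integral infinite.\<close>

lemma finite_point:
  assumes g [measurable]: "g \<in> borel_measurable lebesgue" and fin: "ig D (\<lambda>x. w x * g x) < top"
    and ab: "a < b" "{a<..<b} \<subseteq> D"
  shows "\<exists>z. a < z \<and> z < b \<and> g z < top"
proof (rule ccontr)
  assume "\<not> ?thesis"
  then have top: "g z = top" if "z \<in> {a<..<b}" for z using that by (auto simp: less_top[symmetric])
  have [measurable]: "{a<..<b} \<in> sets lebesgue" by simp
  have "top * ig {a<..<b} w = ig {a<..<b} (\<lambda>x. top * w x)"
    by (intro ig_cmult[symmetric]) auto
  also have "\<dots> \<le> ig D (\<lambda>x. w x * g x)"
    using ab top by (intro ig_mono) (auto simp: mult.commute)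
  finally have "top * ig {a<..<b} w < top" using fin by (rule le_less_trans)
  moreover have "0 < ig {a<..<b} w" using ab w_pos by (intro ig_pos[where x=a and y=b]) auto
  ultimately show False by (auto simp: ennreal_top_mult split: if_splits)
qed

lemma D_left_interval: "x \<in> D \<Longrightarrow> \<exists>a. a < x \<and> {a<..<x} \<subseteq> D"
  using D_left[of x] D_interval[of _ x] by (metis greaterThanLessThan_iff less_imp_le subsetI)

lemma D_right_interval: "x \<in> D \<Longrightarrow> \<exists>b. x < b \<and> {x<..<b} \<subseteq> D"
  using D_right[of x] by fastforce

text \<open>\<open>W\<close> decreases and \<open>Kl\<close> increases, so finiteness at
  \<open>x\<close> is inherited from a point with finite integrand to the left for \<open>W\<close>,
  to the right for \<open>Kl\<close>. The other factor is positive there and can be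
  cancelled.\<close>

lemma finite_of_integrals:
  assumes rp: "r < p" and X: "X < top"
    and X1: "ig D (\<lambda>x. W x epowr (r / (p - r)) * w x * Kl x epowr (r * p / (q * (p - r)))) \<le> X"
    and x: "x \<in> D"
  shows "W x < top" "Kl x < top"
proof -
  have [measurable]: "(\<lambda>x. W x epowr (r / (p - r)) * Kl x epowr (r * p / (q * (p - r)))) \<in> borel_measurable lebesgue"
    by measurable
  have fin: "ig D (\<lambda>x. w x * (W x epowr (r / (p - r)) * Kl x epowr (r * p / (q * (p - r))))) < top"
    using le_less_trans[OF X1 X] by (simp add: ac_simps)
  obtain a where a: "a < x" "{a<..<x} \<subseteq> D" using D_left_interval[OF x] by blast
  obtain z where z: "a < z" "z < x" "W z epowr (r / (p - r)) * Kl z epowr (r * p / (q * (p - r))) < top"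
    using finite_point[OF _ fin a] by auto
  have "Kl z epowr (r * p / (q * (p - r))) * W z epowr (r / (p - r)) < top" using z(3) by (simp add: mult.commute)
  then have "W z epowr (r / (p - r)) < top"
    by (rule ennreal_mult_less_topD) (use a z Kl_pos in auto)
  then show "W x < top" using W_mono[of z x] z(2) by (auto intro: le_less_trans)
  obtain b where b: "x < b" "{x<..<b} \<subseteq> D" using D_right_interval[OF x] by blast
  obtain z where z: "x < z" "z < b" "W z epowr (r / (p - r)) * Kl z epowr (r * p / (q * (p - r))) < top"
    using finite_point[OF _ fin b] by auto
  then have "Kl z epowr (r * p / (q * (p - r))) < top"
    by (intro ennreal_mult_less_topD[OF z(3)]) (use b W_pos in auto)
  then show "Kl x < top" using Kl_mono[of x z] z(1) by (auto intro: le_less_trans)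
qed

text \<open>The same argument for \<open>P\<close> and \<open>TT\<close>. If TT z is finite for some
  z > x, then so is \<open>\<Phi> x\<close>, because x competes in that supremum with the positive
  factor \<open>U x z\<close>.\<close>

lemma finite_of_integrals':
  assumes rp: "r < p" and X: "X < top"
    and X1: "ig D (\<lambda>x. P x epowr (r / (p - r)) * w x * TT x) \<le> X" and x: "x \<in> D"
  shows "P x < top" "\<Phi> x < top"
proof -
  have [measurable]: "(\<lambda>x. P x epowr (r / (p - r)) * TT x) \<in> borel_measurable lebesgue"
    by measurable
  have fin: "ig D (\<lambda>x. w x * (P x epowr (r / (p - r)) * TT x)) < top"
    using le_less_trans[OF X1 X] by (simp add: ac_simps)
  obtain a where a: "a < x" "{a<..<x} \<subseteq> D" using D_left_interval[OF x] by blast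
  obtain z where z: "a < z" "z < x" "P z epowr (r / (p - r)) * TT z < top"
    using finite_point[OF _ fin a] by auto
  have "TT z * P z epowr (r / (p - r)) < top" using z(3) by (simp add: mult.commute)
  then have "P z epowr (r / (p - r)) < top"
    by (rule ennreal_mult_less_topD) (use a z TT_pos in auto)
  then show "P x < top" using P_mono[of z x] z(2) by (auto intro: le_less_trans)
  obtain b where b: "x < b" "{x<..<b} \<subseteq> D" using D_right_interval[OF x] by blast
  obtain z where z: "x < z" "z < b" "P z epowr (r / (p - r)) * TT z < top"
    using finite_point[OF _ fin b] by auto
  have "TT z < top"
    by (intro ennreal_mult_less_topD[OF z(3)]) (use z b P_pos in auto)
  moreover have "U x z epowr (r / q) * \<Phi> x epowr (r / (p - r)) \<le> TT z"
    unfolding TT_def using x z by (intro SUP_upper) auto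
  ultimately have "U x z epowr (r / q) * \<Phi> x epowr (r / (p - r)) < top" by (auto intro: le_less_trans)
  then have "\<Phi> x epowr (r / (p - r)) < top"
    by (rule ennreal_mult_less_topD) (use U_pos[OF x z(1)] in auto)
  then show "\<Phi> x < top" by simp
qed

text \<open>Finiteness of \<open>Kl x1\<close> makes \<open>HL f x1\<close> finite, so it can be
  halved; \<open>HL_points\<close> is then integrated against \<open>w\<close> level by
  level.\<close>

lemma HL_decomposition:
  assumes f: "f \<in> Adm" "nrm f < top" and x1: "x1 \<in> D" and fin: "\<forall>x\<in>D. \<Phi> x < top" "Kl x1 < top"
    and HL0: "HL f x1 \<noteq> 0"
  shows "\<exists>(y :: nat \<Rightarrow> real) \<mu>. (\<forall>k. y k \<in> D \<and> y k < x1 \<and> y (Suc k) < y k) \<and> (\<Sum>k. \<mu> k) \<le> nrm f \<and>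
    ig {..<x1} (\<lambda>x. HL f x epowr (r / q) * w x) \<le> (8 * 2 epowr q) epowr (r / q) *
      ((\<Sum>k. ig ({..<x1} \<inter> lv y k) (\<lambda>x. F f (y (Suc k)) epowr r * (U (y (Suc k)) x epowr (r / q) * w x)))
      + (\<Sum>k. \<mu> k epowr (r / p) * (Kl (y k) epowr (r / q) * ig ({..<x1} \<inter> lv y k) w)))"
proof -
  have "HL f x1 \<le> nrm f epowr (q / p) * Kl x1" using f x1 fin by (intro HL_le_Kl) auto
  also have "\<dots> < top" using f(2) fin(2) by (simp add: ennreal_mult_less_top)
  finally have HLt: "HL f x1 < top" .
  obtain y \<mu> where y: "\<forall>k. y k \<in> D \<and> y k < x1 \<and> y (Suc k) < y k"
    "\<forall>k x. x \<in> lv y k \<longrightarrow> x \<le> x1 \<longrightarrow> HL f x epowr (r / q) \<le> (8 * 2 epowr q) epowr (r / q) *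
      (F f (y (Suc k)) epowr r * U (y (Suc k)) x epowr (r / q) + \<mu> k epowr (r / p) * Kl (y k) epowr (r / q))"
    "\<forall>x\<le>x1. x \<notin> (\<Union>k. lv y k) \<longrightarrow> HL f x = 0" "(\<Sum>k. \<mu> k) \<le> nrm f"
    using HL_points[OF f x1 fin(1) HLt HL0] by (elim exE conjE) (rule that)
  define c where "c = (8 * 2 epowr q) epowr (r / q)"
  define A where "A k x = F f (y (Suc k)) epowr r * (U (y (Suc k)) x epowr (r / q) * w x)" for k x
  have [measurable]: "A k \<in> borel_measurable lebesgue" for k unfolding A_def by measurable
  have "ig {..<x1} (\<lambda>x. HL f x epowr (r / q) * w x) = (\<Sum>k. ig ({..<x1} \<inter> lv y k) (\<lambda>x. HL f x epowr (r / q) * w x))"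
    using y(3) by (intro ig_cover_le lv_disjoint) auto
  also have "\<dots> \<le> (\<Sum>k. c * (ig ({..<x1} \<inter> lv y k) (A k) + \<mu> k epowr (r / p) * (Kl (y k) epowr (r / q) * ig ({..<x1} \<inter> lv y k) w)))"
  proof (intro suminf_ennreal_mono)
    fix k
    have "ig ({..<x1} \<inter> lv y k) (\<lambda>x. HL f x epowr (r / q) * w x)
      \<le> ig ({..<x1} \<inter> lv y k) (\<lambda>x. c * (A k x + (\<mu> k epowr (r / p) * Kl (y k) epowr (r / q)) * w x))"
    proof (intro ig_mono)
      fix x assume x: "x \<in> {..<x1} \<inter> lv y k"
      have "HL f x epowr (r / q) * w x \<le> (c * (F f (y (Suc k)) epowr r * U (y (Suc k)) x epowr (r / q) + \<mu> k epowr (r / p) * Kl (y k) epowr (r / q))) * w x"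
        using y(2) x unfolding c_def by (intro mult_right_mono) auto
      then show "HL f x epowr (r / q) * w x \<le> c * (A k x + (\<mu> k epowr (r / p) * Kl (y k) epowr (r / q)) * w x)"
        by (simp add: A_def distrib_right mult.assoc)
    qed auto
    also have "\<dots> = c * (ig ({..<x1} \<inter> lv y k) (A k) + (\<mu> k epowr (r / p) * Kl (y k) epowr (r / q)) * ig ({..<x1} \<inter> lv y k) w)"
      by (subst ig_cmult, measurable, simp) (subst ig_add, auto simp: ig_cmult)
    finally show "ig ({..<x1} \<inter> lv y k) (\<lambda>x. HL f x epowr (r / q) * w x)
      \<le> c * (ig ({..<x1} \<inter> lv y k) (A k) + \<mu> k epowr (r / p) * (Kl (y k) epowr (r / q) * ig ({..<x1} \<inter> lv y k) w))"
      by (simp add: mult.assoc)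
  qed
  also have "\<dots> = c * ((\<Sum>k. ig ({..<x1} \<inter> lv y k) (A k)) + (\<Sum>k. \<mu> k epowr (r / p) * (Kl (y k) epowr (r / q) * ig ({..<x1} \<inter> lv y k) w)))"
    by (simp add: suminf_add[symmetric])
  finally show ?thesis
    using y(1,4) unfolding c_def A_def by (intro exI[of _ y] exI[of _ \<mu>]) simp
qed

text \<open>Everything happens left of a point \<open>x1\<close> with a bound independent of
  \<open>x1\<close>. Since \<open>P\<close> and \<open>W\<close> are positive, the two suprema also
  yield the finiteness of \<open>\<Phi>\<close> and \<open>Kl\<close>. The summand 4^r belongs to
  the nonlocal sum, 1 to the local one.\<close>

lemma sufficiency_ge:
  assumes pr: "p \<le> r" and X: "X < top"
    and X1: "\<And>t. t \<in> D \<Longrightarrow> P t * \<Phi> t epowr (r / p) \<le> X" and X2: "\<And>y. y \<in> D \<Longrightarrow> W y * Kl y epowr (r / q) \<le> X"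
    and f: "f \<in> Adm" "nrm f < top"
  shows "ig D (\<lambda>x. HL f x epowr (r / q) * w x)
    \<le> (8 * 2 epowr q) epowr (r / q) * (4 epowr r + 1) * (X * nrm f epowr (r / p))"
proof (rule ig_le_cutoff(2)[OF _ D_ne _ D_open])
  fix x1 assume x1: "x1 \<in> D"
  have \<Phi>: "\<Phi> x < top" if "x \<in> D" for x
    using ennreal_mult_less_topD[OF le_less_trans[OF X1[OF that] X] P_pos[OF that]] by simp
  then have \<Phi>': "\<forall>x\<in>D. \<Phi> x < top" by blast
  have Kl: "Kl x1 < top"
    using ennreal_mult_less_topD[OF le_less_trans[OF X2[OF x1] X] W_pos[OF x1]] by simp
  show "ig {..<x1} (\<lambda>x. HL f x epowr (r / q) * w x)
    \<le> (8 * 2 epowr q) epowr (r / q) * (4 epowr r + 1) * (X * nrm f epowr (r / p))"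
  proof (cases "HL f x1 = 0")
    case True
    have "HL f x = 0" if "x < x1" for x using HL_mono[of x x1 f] that True by auto
    then have "ig {..<x1} (\<lambda>x. HL f x epowr (r / q) * w x) = 0" by (intro ig_eq_0) auto
    then show ?thesis by simp
  next
    case False
    obtain y \<mu> where y: "\<forall>k. y k \<in> D \<and> y k < x1 \<and> y (Suc k) < y k" "(\<Sum>k. \<mu> k) \<le> nrm f"
      "ig {..<x1} (\<lambda>x. HL f x epowr (r / q) * w x) \<le> (8 * 2 epowr q) epowr (r / q) *
      ((\<Sum>k. ig ({..<x1} \<inter> lv y k) (\<lambda>x. F f (y (Suc k)) epowr r * (U (y (Suc k)) x epowr (r / q) * w x)))
      + (\<Sum>k. \<mu> k epowr (r / p) * (Kl (y k) epowr (r / q) * ig ({..<x1} \<inter> lv y k) w)))"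
      using HL_decomposition[OF f x1 \<Phi>' Kl False] by (elim exE conjE) (rule that)
    note y(3)
    also have "(\<Sum>k. ig ({..<x1} \<inter> lv y k) (\<lambda>x. F f (y (Suc k)) epowr r * (U (y (Suc k)) x epowr (r / q) * w x)))
        \<le> 4 epowr r * (X * nrm f epowr (r / p))"
      by (rule nonlocal_sum_ge[OF pr X1 f x1 \<Phi>[OF x1] y(1)])
    also have "(\<Sum>k. \<mu> k epowr (r / p) * (Kl (y k) epowr (r / q) * ig ({..<x1} \<inter> lv y k) w)) \<le> X * nrm f epowr (r / p)"
      using y by (intro local_sum_ge[OF pr X2]) auto
    finally show ?thesis by (simp add: distrib_right mult.assoc mult_left_mono add_mono)
  qed
qed measurable

lemma sufficiency_less:
  assumes rp: "r < p" and X: "X < top"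
    and X1: "ig D (\<lambda>x. W x epowr (r / (p - r)) * w x * Kl x epowr (r * p / (q * (p - r)))) \<le> X"
    and X2: "ig D (\<lambda>x. P x epowr (r / (p - r)) * w x * TT x) \<le> X"
    and f: "f \<in> Adm" "nrm f < top"
  shows "ig D (\<lambda>x. HL f x epowr (r / q) * w x)
    \<le> (8 * 2 epowr q) epowr (r / q) * (4 epowr r * c_less p q r + 2) * (X epowr ((p - r) / p) * nrm f epowr (r / p))"
proof (rule ig_le_cutoff(2)[OF _ D_ne _ D_open])
  fix x1 assume x1: "x1 \<in> D"
  note fin1 = finite_of_integrals[OF rp X X1]
  note fin2 = finite_of_integrals'[OF rp X X2]
  have \<Phi>': "\<forall>x\<in>D. \<Phi> x < top" using fin2(2) by blast
  show "ig {..<x1} (\<lambda>x. HL f x epowr (r / q) * w x)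
    \<le> (8 * 2 epowr q) epowr (r / q) * (4 epowr r * c_less p q r + 2) * (X epowr ((p - r) / p) * nrm f epowr (r / p))"
  proof (cases "HL f x1 = 0")
    case True
    have "HL f x = 0" if "x < x1" for x using HL_mono[of x x1 f] that True by auto
    then have "ig {..<x1} (\<lambda>x. HL f x epowr (r / q) * w x) = 0" by (intro ig_eq_0) auto
    then show ?thesis by simp
  next
    case False
    obtain y \<mu> where y: "\<forall>k. y k \<in> D \<and> y k < x1 \<and> y (Suc k) < y k" "(\<Sum>k. \<mu> k) \<le> nrm f"
      "ig {..<x1} (\<lambda>x. HL f x epowr (r / q) * w x) \<le> (8 * 2 epowr q) epowr (r / q) *
      ((\<Sum>k. ig ({..<x1} \<inter> lv y k) (\<lambda>x. F f (y (Suc k)) epowr r * (U (y (Suc k)) x epowr (r / q) * w x)))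
      + (\<Sum>k. \<mu> k epowr (r / p) * (Kl (y k) epowr (r / q) * ig ({..<x1} \<inter> lv y k) w)))"
      using HL_decomposition[OF f x1 \<Phi>' fin1(2)[OF x1] False] by (elim exE conjE) (rule that)
    note y(3)
    also have "(\<Sum>k. ig ({..<x1} \<inter> lv y k) (\<lambda>x. F f (y (Suc k)) epowr r * (U (y (Suc k)) x epowr (r / q) * w x)))
        \<le> 4 epowr r * (c_less p q r * (X epowr ((p - r) / p) * nrm f epowr (r / p)))"
      unfolding c_less_def by (rule nonlocal_sum_less[OF rp X1 X2 fin2(1) f x1 fin2(2)[OF x1] y(1)])
    also have "(\<Sum>k. \<mu> k epowr (r / p) * (Kl (y k) epowr (r / q) * ig ({..<x1} \<inter> lv y k) w))
        \<le> 2 * X epowr ((p - r) / p) * nrm f epowr (r / p)"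
      using y x1 fin1(1) by (intro local_sum_less[OF rp X1]) auto
    finally show ?thesis by (simp add: distrib_right mult.assoc mult_left_mono add_mono)
  qed
qed measurable

section \<open>Necessity\<close>

text \<open>A near-extremal function for \<open>\<Phi> t\<close> lives left of \<open>t\<close>, so
  beyond \<open>t\<close> the function \<open>HL f\<close> is at least a constant times
  \<open>U t\<close>; integration against \<open>w\<close> gives \<open>P t\<close>.\<close>

lemma necessity_P:
  assumes Z: "\<And>f. f \<in> Adm \<Longrightarrow> ig D (\<lambda>x. HL f x epowr (r / q) * w x) \<le> Z * nrm f epowr (r / p)" and t: "t \<in> D"
  shows "P t * \<Phi> t epowr (r / p) \<le> Z"
proof (rule ennreal_mult_epowr_le)
  fix N :: real assume N: "0 < N" "ennreal N < \<Phi> t"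
  obtain f where f: "f \<in> Adm" "nrm f \<le> 1" "\<And>s. t \<le> s \<Longrightarrow> ennreal N \<le> F f s epowr p"
    using extremal_F[OF t N] by blast
  have "P t * ennreal N epowr (r / p) = ig {t..} (\<lambda>x. ennreal N epowr (r / p) * (w x * U t x epowr (r / q)))"
    unfolding P_def by (subst ig_cmult) (auto simp: mult.commute)
  also have "\<dots> \<le> ig {t..} (\<lambda>x. HL f x epowr (r / q) * w x)"
  proof (intro ig_mono)
    fix x assume "x \<in> {t..}"
    then have x: "t \<le> x" by simp
    have "ennreal N epowr (r / p) \<le> (F f t epowr p) epowr (r / p)"
      using p r f(3) by (intro epowr_mono) auto
    then have "ennreal N epowr (r / p) * U t x epowr (r / q) \<le> (F f t epowr q * U t x) epowr (r / q)"
      using p q by (simp add: epowr_mult epowr_epowr mult_right_mono)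
    also have "\<dots> \<le> HL f x epowr (r / q)" using q r x by (intro epowr_mono HL_lower) auto
    finally have "(ennreal N epowr (r / p) * U t x epowr (r / q)) * w x \<le> HL f x epowr (r / q) * w x"
      by (intro mult_right_mono) auto
    then show "ennreal N epowr (r / p) * (w x * U t x epowr (r / q)) \<le> HL f x epowr (r / q) * w x"
      by (simp add: ac_simps)
  qed auto
  also have "\<dots> = ig ({t..} \<inter> D) (\<lambda>x. HL f x epowr (r / q) * w x)"
    using w_0 by (intro ig_restrict) auto
  also have "\<dots> \<le> ig D (\<lambda>x. HL f x epowr (r / q) * w x)" by (intro ig_mono) auto
  also have "\<dots> \<le> Z * nrm f epowr (r / p)" by (rule Z[OF f(1)])
  also have "\<dots> \<le> Z * 1 epowr (r / p)" using f(2) p r by (intro mult_left_mono epowr_mono) auto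
  finally show "P t * ennreal N epowr (r / p) \<le> Z" by simp
qed (use p r in auto)

lemma W_HL_le: "W y * HL f y epowr (r / q) \<le> ig D (\<lambda>x. HL f x epowr (r / q) * w x)"
proof -
  have "W y * HL f y epowr (r / q) = ig {y..} (\<lambda>x. HL f y epowr (r / q) * w x)"
    unfolding W_def by (subst ig_cmult) (auto simp: mult.commute)
  also have "\<dots> \<le> ig {y..} (\<lambda>x. HL f x epowr (r / q) * w x)"
    using q r by (intro ig_mono mult_right_mono epowr_mono HL_mono) auto
  also have "\<dots> = ig ({y..} \<inter> D) (\<lambda>x. HL f x epowr (r / q) * w x)"
    using w_0 by (intro ig_restrict) auto
  also have "\<dots> \<le> ig D (\<lambda>x. HL f x epowr (r / q) * w x)" by (intro ig_mono) auto
  finally show ?thesis .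
qed

lemma necessity_Kl:
  assumes Z: "\<And>f. f \<in> Adm \<Longrightarrow> ig D (\<lambda>x. HL f x epowr (r / q) * w x) \<le> Z * nrm f epowr (r / p)"
  shows "W y * Kl y epowr (r / q) \<le> Z"
proof -
  have "W y * Kl y epowr (r / q) = (SUP f\<in>{f \<in> Adm. nrm f \<le> 1}. W y * HL f y epowr (r / q))"
    unfolding Kl_def using q r by (simp add: epowr_SUP SUP_mult_left_ennreal)
  also have "\<dots> \<le> Z"
  proof (rule SUP_least)
    fix f assume "f \<in> {f \<in> Adm. nrm f \<le> 1}"
    then have f: "f \<in> Adm" "nrm f \<le> 1" by auto
    have "W y * HL f y epowr (r / q) \<le> Z * nrm f epowr (r / p)"
      using W_HL_le Z[OF f(1)] by (rule order_trans)
    also have "\<dots> \<le> Z * 1 epowr (r / p)" using f(2) p r by (intro mult_left_mono epowr_mono) auto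
    finally show "W y * HL f y epowr (r / q) \<le> Z" by simp
  qed
  finally show ?thesis .
qed

text \<open>A factor a in \<open>nrm\<close> becomes a^(q/p) in \<open>HL\<close>. Comparing the
  thresholds \<theta> with Kl^(p/q) gives both the same power, the form that
  \<open>monotone_level_test\<close> asks for.\<close>

lemma Kl_family:
  fixes J :: "nat set"
  assumes J: "finite J" "\<And>i. i \<in> J \<Longrightarrow> 0 < \<theta> i \<and> ennreal (\<theta> i) < Kl (y i) epowr (p / q) \<and> 0 \<le> a i"
  obtains g where "g \<in> Adm" "nrm g \<le> ennreal (\<Sum>i\<in>J. a i)"
    "\<And>i x. i \<in> J \<Longrightarrow> y i \<le> x \<Longrightarrow> ennreal ((a i * \<theta> i) powr (q / p)) \<le> HL g x"
proof -
  have "\<exists>f. i \<in> J \<longrightarrow> f \<in> Adm \<and> nrm f \<le> 1 \<and> ennreal (\<theta> i powr (q / p)) \<le> HL f (y i)" for i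
  proof (cases "i \<in> J")
    case True
    have "ennreal (\<theta> i) epowr (q / p) < Kl (y i)"
    proof (rule ccontr)
      assume "\<not> ?thesis"
      then have "Kl (y i) epowr (p / q) \<le> (ennreal (\<theta> i) epowr (q / p)) epowr (p / q)"
        using p q by (intro epowr_mono) auto
      then show False using J(2)[OF True] p q by (auto simp: epowr_epowr)
    qed
    then obtain f where "f \<in> Adm" "nrm f \<le> 1" "ennreal (\<theta> i) epowr (q / p) < HL f (y i)"
      unfolding Kl_def less_SUP_iff by auto
    then show ?thesis using J(2)[OF True] by (intro exI[of _ f]) (auto simp: epowr_ennreal intro: less_imp_le)
  qed simp
  then obtain f where f: "\<And>i. i \<in> J \<Longrightarrow> f i \<in> Adm \<and> nrm (f i) \<le> 1 \<and> ennreal (\<theta> i powr (q / p)) \<le> HL (f i) (y i)"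
    by metis
  obtain g where g: "g \<in> Adm" "nrm g \<le> ennreal (\<Sum>i\<in>J. a i)"
    "\<And>i x. i \<in> J \<Longrightarrow> ennreal (a i) epowr (1 / p) * f i x \<le> g x"
    using combine[OF J(1), of f a] f J(2) by metis
  show thesis
  proof
    fix i x assume i: "i \<in> J" "y i \<le> x"
    have "ennreal ((a i * \<theta> i) powr (q / p)) = ennreal (a i) epowr (q / p) * ennreal (\<theta> i powr (q / p))"
      using J(2)[OF i(1)] by (simp add: ennreal_mult powr_mult epowr_ennreal)
    also have "\<dots> \<le> ennreal (a i) epowr (q / p) * HL (f i) x"
      using f[OF i(1)] HL_mono[OF i(2), of "f i"] by (intro mult_left_mono) auto
    also have "\<dots> \<le> HL g x"
      using f[OF i(1)] g(3)[OF i(1)] by (intro combine_F) auto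
    finally show "ennreal ((a i * \<theta> i) powr (q / p)) \<le> HL g x" .
  qed (use g in auto)
qed

text \<open>This is \<open>monotone_level_test\<close> with R = r/p, density \<open>w\<close> and
  the nondecreasing function Kl^(p/q), for which R/(1-R) = r/(p-r). Finiteness of \<open>Kl\<close>
  comes from \<open>necessity_Kl\<close>.\<close>

lemma necessity_Kl_less:
  assumes rp: "r < p" and Z0: "0 \<le> Z"
    and Z: "\<And>f. f \<in> Adm \<Longrightarrow> ig D (\<lambda>x. HL f x epowr (r / q) * w x) \<le> ennreal Z * nrm f epowr (r / p)"
  shows "ig D (\<lambda>x. W x epowr (r / (p - r)) * w x * Kl x epowr (r * p / (q * (p - r))))
    \<le> ennreal (hardyL_const (r / p) * Z powr (p / (p - r)))"
proof -
  have sR: "r / p / (1 - r / p) = r / (p - r)" "1 / (1 - r / p) = p / (p - r)"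
    using p rp by (auto simp: field_simps)
  have KW: "ig (D \<inter> {x..}) w = W x" for x
  proof -
    have "W x = ig ({x..} \<inter> D) w" unfolding W_def using w_0 by (intro ig_restrict) auto
    then show ?thesis by (simp add: Int_commute)
  qed
  have "ig D (\<lambda>x. ig (D \<inter> {x..}) w epowr (r / p / (1 - r / p)) * w x * (Kl x epowr (p / q)) epowr (r / p / (1 - r / p)))
    \<le> ennreal (hardyL_const (r / p) * Z powr (1 / (1 - r / p)))"
  proof (rule monotone_level_test[OF _ _ Z0])
    show "0 < r / p" "r / p < 1" using p r rp by auto
    show "Kl x epowr (p / q) \<le> Kl z epowr (p / q)" if "x \<le> z" for x z
      using that p q by (intro epowr_mono Kl_mono) auto
    show "Kl x epowr (p / q) < top" if "x \<in> D" for x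
    proof -
      have "W x * Kl x epowr (r / q) \<le> ennreal Z" by (rule necessity_Kl[OF Z])
      then have "W x * Kl x epowr (r / q) < top" by (rule le_less_trans) simp
      then have "Kl x epowr (r / q) < top" by (rule ennreal_mult_less_topD[OF _ W_pos[OF that]])
      then show ?thesis by simp
    qed
    fix J :: "nat set" and z \<theta> a :: "nat \<Rightarrow> real"
    assume J: "finite J" "\<And>i. i \<in> J \<Longrightarrow> z i \<in> D \<and> 0 < \<theta> i \<and> ennreal (\<theta> i) < Kl (z i) epowr (p / q) \<and> 0 \<le> a i"
    obtain g where g: "g \<in> Adm" "nrm g \<le> ennreal (\<Sum>i\<in>J. a i)"
      "\<And>i x. i \<in> J \<Longrightarrow> z i \<le> x \<Longrightarrow> ennreal ((a i * \<theta> i) powr (q / p)) \<le> HL g x"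
      using Kl_family[OF J(1), of \<theta> z a] J(2) by blast
    show "\<exists>h\<in>borel_measurable lebesgue. (\<forall>i\<in>J. \<forall>x\<in>D. z i \<le> x \<longrightarrow> ennreal ((a i * \<theta> i) powr (r / p)) \<le> h x) \<and>
        ig D (\<lambda>x. h x * w x) \<le> ennreal (Z * (\<Sum>i\<in>J. a i) powr (r / p))"
    proof (intro bexI[of _ "\<lambda>x. HL g x epowr (r / q)"] conjI ballI impI)
      fix i x assume i: "i \<in> J" "x \<in> D" "z i \<le> x"
      have "ennreal ((a i * \<theta> i) powr (r / p)) = ennreal ((a i * \<theta> i) powr (q / p)) epowr (r / q)"
        using q by (simp add: epowr_ennreal powr_powr)
      also have "\<dots> \<le> HL g x epowr (r / q)"
        using g(3) i q r by (intro epowr_mono) auto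
      finally show "ennreal ((a i * \<theta> i) powr (r / p)) \<le> HL g x epowr (r / q)" .
    next
      have S0: "0 \<le> (\<Sum>i\<in>J. a i)" using J(2) by (intro sum_nonneg) auto
      have "ig D (\<lambda>x. HL g x epowr (r / q) * w x) \<le> ennreal Z * nrm g epowr (r / p)" by (rule Z[OF g(1)])
      also have "\<dots> \<le> ennreal Z * ennreal (\<Sum>i\<in>J. a i) epowr (r / p)"
        using g p r by (intro mult_left_mono epowr_mono) auto
      also have "\<dots> = ennreal (Z * (\<Sum>i\<in>J. a i) powr (r / p))"
        using S0 Z0 by (simp add: epowr_ennreal ennreal_mult)
      finally show "ig D (\<lambda>x. HL g x epowr (r / q) * w x) \<le> ennreal (Z * (\<Sum>i\<in>J. a i) powr (r / p))" .
    qed measurable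
  qed measurable
  then show ?thesis using q p rp unfolding sR KW epowr_epowr by (simp add: field_simps)
qed

end

section \<open>Geometric weights, discretisation and the necessity of \<open>C3\<close>\<close>

lemma suminf_inj_le:
  fixes f :: "nat \<Rightarrow> ennreal"
  assumes "inj g"
  shows "(\<Sum>k. f (g k)) \<le> (\<Sum>l. f l)"
proof (rule suminf_le_const)
  fix n
  have "(\<Sum>k<n. f (g k)) = (\<Sum>l\<in>g ` {..<n}. f l)"
    using assms by (subst sum.reindex) (auto intro: inj_on_subset)
  also have "\<dots> \<le> (\<Sum>l. f l)" by (intro sum_le_suminf) auto
  finally show "(\<Sum>k<n. f (g k)) \<le> (\<Sum>l. f l)" .
qed auto

text \<open>With \<delta> = 2^(1/s) - 1, so that (1+\<delta>)^s = 2, this is (1 +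
  1/\<delta>)^s.\<close>

definition quasi_const :: "real \<Rightarrow> real" where
  "quasi_const s = (1 + 1 / (2 powr (1 / s) - 1)) powr s"

text \<open>If y <= \<delta> x then x + y <= (1+\<delta>) x, otherwise x + y <= (1 + 1/\<delta>) y.
  The coefficient 2 of x^s stays below the ratio 4 of the geometric weights whatever s is, unlike
  the 2^s of \<open>epowr_plus_le\<close>.\<close>

lemma epowr_plus_le2:
  assumes s: "0 < s"
  shows "1 \<le> quasi_const s" and "(x + y) epowr s \<le> 2 * x epowr s + ennreal (quasi_const s) * y epowr s"
proof -
  define \<delta> where "\<delta> = 2 powr (1 / s) - 1"
  have \<delta>: "0 < \<delta>" unfolding \<delta>_def using s by (simp add: gr_one_powr)
  have "1 powr s \<le> (1 + 1 / \<delta>) powr s" using \<delta> s by (intro powr_mono2) auto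
  then show "1 \<le> quasi_const s" by (simp add: quasi_const_def \<delta>_def)
  have 2: "ennreal (1 + \<delta>) epowr s = 2"
    using s by (simp add: epowr_ennreal \<delta>_def powr_powr)
  have q: "ennreal (quasi_const s) = ennreal (1 + 1 / \<delta>) epowr s"
  proof -
    have "0 \<le> 1 + 1 / \<delta>" using \<delta> by simp
    then show ?thesis by (simp only: epowr_ennreal quasi_const_def \<delta>_def)
  qed
  have d: "ennreal (1 + \<delta>) = 1 + ennreal \<delta>" "ennreal (1 + 1 / \<delta>) = 1 + ennreal (1 / \<delta>)"
    using \<delta> by (auto simp: ennreal_plus simp del: ennreal_plus[symmetric])
  show "(x + y) epowr s \<le> 2 * x epowr s + ennreal (quasi_const s) * y epowr s"
  proof (cases "y \<le> ennreal \<delta> * x")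
    case True
    then have "x + y \<le> ennreal (1 + \<delta>) * x"
      unfolding d distrib_right by (simp add: add_left_mono)
    then have "(x + y) epowr s \<le> (ennreal (1 + \<delta>) * x) epowr s" using s by (intro epowr_mono)
    also have "\<dots> = 2 * x epowr s" by (simp only: epowr_mult 2)
    finally show ?thesis by (rule order_trans) simp
  next
    case False
    then have "ennreal (1 / \<delta>) * (ennreal \<delta> * x) \<le> ennreal (1 / \<delta>) * y" by (intro mult_left_mono) auto
    then have "x \<le> ennreal (1 / \<delta>) * y" using \<delta> by (simp flip: mult.assoc ennreal_mult)
    then have "x + y \<le> ennreal (1 + 1 / \<delta>) * y"
      unfolding d distrib_right add.commute[of x] by (simp add: add_left_mono)
    then have "(x + y) epowr s \<le> (ennreal (1 + 1 / \<delta>) * y) epowr s" using s by (intro epowr_mono)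
    also have "\<dots> = ennreal (quasi_const s) * y epowr s" by (simp only: epowr_mult q)
    finally show ?thesis by (rule order_trans) simp
  qed
qed

text \<open>The extra term on the left makes the induction go through: its weight is halved twice at each
  step and doubled once.\<close>

lemma geometric_sum_le:
  fixes h e :: "nat \<Rightarrow> ennreal"
  assumes s: "0 < s" and h0: "h 0 = e 0" and h: "\<And>i. h (Suc i) = h i + e (Suc i)"
  shows "(\<Sum>i\<le>n. ennreal ((1 / 4) ^ i) * h i epowr s) + ennreal ((1 / 4) ^ n) * h n epowr s
    \<le> ennreal (2 * quasi_const s) * (\<Sum>i\<le>n. ennreal ((1 / 4) ^ i) * e i epowr s)"
proof (induction n)
  case 0
  have "(2::ennreal) \<le> ennreal (2 * quasi_const s)"
    using epowr_plus_le2(1)[OF s] ennreal_leI[of 2 "2 * quasi_const s"] by simp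
  then have "2 * e 0 epowr s \<le> ennreal (2 * quasi_const s) * e 0 epowr s" by (intro mult_right_mono) auto
  then show ?case unfolding mult_2[of "e 0 epowr s"] by (simp add: h0)
next
  case (Suc n)
  define C where "C = quasi_const s"
  have C: "1 \<le> C" unfolding C_def by (rule epowr_plus_le2(1)[OF s])
  define a where "a = ennreal ((1 / 4) ^ Suc n)"
  have a: "2 * (a * 2) = ennreal ((1 / 4) ^ n)"
  proof -
    have "2 * (a * 2) = (2 * 2) * a" by (simp only: mult.commute[of a 2] mult.assoc)
    also have "\<dots> = 4 * a" by simp
    also have "\<dots> = ennreal (4 * (1 / 4) ^ Suc n)"
      unfolding a_def using ennreal_mult[of 4 "(1 / 4) ^ Suc n"] by simp
    finally show ?thesis by simp
  qed
  have "(\<Sum>i\<le>Suc n. ennreal ((1 / 4) ^ i) * h i epowr s) + a * h (Suc n) epowr s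
      = (\<Sum>i\<le>n. ennreal ((1 / 4) ^ i) * h i epowr s) + 2 * (a * (h n + e (Suc n)) epowr s)"
    by (simp add: a_def h mult_2 add.assoc)
  also have "\<dots> \<le> (\<Sum>i\<le>n. ennreal ((1 / 4) ^ i) * h i epowr s) + 2 * (a * (2 * h n epowr s + ennreal C * e (Suc n) epowr s))"
    unfolding C_def by (intro add_left_mono mult_left_mono epowr_plus_le2(2)[OF s]) auto
  also have "\<dots> = ((\<Sum>i\<le>n. ennreal ((1 / 4) ^ i) * h i epowr s) + 2 * (a * 2) * h n epowr s) + 2 * ennreal C * (a * e (Suc n) epowr s)"
    by (simp add: distrib_left ac_simps)
  also have "\<dots> \<le> ennreal (2 * C) * (\<Sum>i\<le>n. ennreal ((1 / 4) ^ i) * e i epowr s) + 2 * ennreal C * (a * e (Suc n) epowr s)"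
    using Suc unfolding a C_def by (intro add_right_mono)
  also have "2 * ennreal C = ennreal (2 * C)" using C by (simp add: ennreal_mult)
  finally show ?case by (simp add: a_def C_def distrib_left)
qed

lemma geometric_suminf_le:
  fixes h e :: "nat \<Rightarrow> ennreal"
  assumes s: "0 < s" and h: "h 0 = e 0" "\<And>i. h (Suc i) = h i + e (Suc i)"
  shows "(\<Sum>i. ennreal ((1 / 4) ^ i) * h i epowr s) \<le> ennreal (2 * quasi_const s) * (\<Sum>i. ennreal ((1 / 4) ^ i) * e i epowr s)"
proof (rule suminf_le_const)
  fix n
  have "(\<Sum>i<n. ennreal ((1 / 4) ^ i) * h i epowr s) \<le> (\<Sum>i\<le>n. ennreal ((1 / 4) ^ i) * h i epowr s)"
    by (intro sum_mono2) auto
  also have "\<dots> \<le> (\<Sum>i\<le>n. ennreal ((1 / 4) ^ i) * h i epowr s) + ennreal ((1 / 4) ^ n) * h n epowr s"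
    by simp
  also have "\<dots> \<le> ennreal (2 * quasi_const s) * (\<Sum>i\<le>n. ennreal ((1 / 4) ^ i) * e i epowr s)"
    by (rule geometric_sum_le[OF s h])
  also have "\<dots> \<le> ennreal (2 * quasi_const s) * (\<Sum>i. ennreal ((1 / 4) ^ i) * e i epowr s)"
    by (intro mult_left_mono sum_le_suminf) auto
  finally show "(\<Sum>i<n. ennreal ((1 / 4) ^ i) * h i epowr s) \<le> \<dots>" .
qed auto

context hardy_core
begin

lemma W_split: "x \<le> y \<Longrightarrow> W x = ig {x..<y} w + W y"
  unfolding W_def by (subst ig_Un[symmetric]) (auto intro!: ig_cong)

text \<open>The intermediate value property applied to \<open>w\<close> to the right of
  \<open>x0\<close>. As \<open>W\<close> is positive throughout \<open>D\<close> and tends to 0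
  along the points, these pass every point of \<open>D\<close>.\<close>

lemma W_levels:
  assumes x0: "x0 \<in> D" and \<omega>: "W x0 = ennreal \<omega>" "0 < \<omega>"
  shows "\<exists>X :: nat \<Rightarrow> real. X 0 = x0 \<and> (\<forall>k. X k \<in> D \<and> X k < X (Suc k) \<and> W (X k) = ennreal (\<omega> / 2 ^ k) \<and>
    ig {X k..<X (Suc k)} w = ennreal (\<omega> / 2 ^ Suc k)) \<and> (\<forall>x\<in>D. \<exists>k. x < X k)"
proof -
  define h where "h x = w x * indicator {x0..} x" for x
  have hm [measurable]: "h \<in> borel_measurable lebesgue" unfolding h_def by measurable
  have hw: "ig A h = ig (A \<inter> {x0..}) w" for A
    unfolding ig_def h_def by (intro nn_integral_cong) (auto simp: indicator_def)
  have hU: "ig UNIV h = ennreal \<omega>" using \<omega> by (simp add: hw W_def)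
  have "\<exists>x. x \<in> D \<and> x0 < x \<and> W x = ennreal (\<omega> / 2 ^ Suc k)" for k
  proof -
    have lt: "1 < (2::real) ^ Suc k" by (rule one_less_power) auto
    have "\<exists>x. ig {..<x} h = ennreal (\<omega> - \<omega> / 2 ^ Suc k)"
    proof (rule ig_intermediate_value[OF hm, of "ennreal (\<omega> - \<omega> / 2 ^ Suc k)"])
      show "ig UNIV h < top" by (simp add: hU)
      show "0 < ennreal (\<omega> - \<omega> / 2 ^ Suc k)" using \<omega> lt by (simp add: field_simps)
      show "ennreal (\<omega> - \<omega> / 2 ^ Suc k) < ig UNIV h"
        unfolding hU using \<omega> by (intro ennreal_lessI) auto
    qed auto
    then obtain x where x: "ig {..<x} h = ennreal (\<omega> - \<omega> / 2 ^ Suc k)" by blast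
    have xx0: "x0 < x"
    proof (rule ccontr)
      assume "\<not> x0 < x"
      then have "ig {..<x} h = 0" by (intro ig_eq_0) (auto simp: h_def)
      then show False using x \<omega> lt by (simp add: field_simps)
    qed
    have "ig {..<x} h = ig {x0..<x} w" unfolding hw using xx0 by (intro ig_cong) auto
    then have "ennreal \<omega> = ennreal (\<omega> - \<omega> / 2 ^ Suc k) + W x"
      using W_split[of x0 x] xx0 x \<omega> by simp
    moreover have "ennreal \<omega> = ennreal (\<omega> - \<omega> / 2 ^ Suc k) + ennreal (\<omega> / 2 ^ Suc k)"
      using \<omega> lt by (subst ennreal_plus[symmetric]) (auto simp: field_simps)
    ultimately have Wx: "W x = ennreal (\<omega> / 2 ^ Suc k)" by (metis ennreal_add_left_cancel ennreal_neq_top infinity_ennreal_def)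
    have "x \<in> D"
    proof (rule ccontr)
      assume n: "x \<notin> D"
      have "z \<notin> D" if "x \<le> z" for z using D_interval[OF x0, of z x] n xx0 that by auto
      then have "W x = 0" unfolding W_def using w_0 by (intro ig_eq_0) auto
      then show False using Wx \<omega> by simp
    qed
    then show ?thesis using xx0 Wx by blast
  qed
  then obtain X' where X': "\<And>k. X' k \<in> D" "\<And>k. x0 < X' k" "\<And>k. W (X' k) = ennreal (\<omega> / 2 ^ Suc k)" by metis
  define X where "X k = (case k of 0 \<Rightarrow> x0 | Suc j \<Rightarrow> X' j)" for k
  have XD: "X k \<in> D" for k using x0 X' by (auto simp: X_def split: nat.split)
  have XW: "W (X k) = ennreal (\<omega> / 2 ^ k)" for k using X'(3) \<omega> by (auto simp: X_def split: nat.split)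
  have Xs: "X k < X (Suc k)" for k
  proof (rule ccontr)
    assume "\<not> ?thesis"
    then have "ennreal (\<omega> / 2 ^ k) \<le> ennreal (\<omega> / 2 ^ Suc k)"
      using W_mono[of "X (Suc k)" "X k"] by (simp add: XW del: power_Suc)
    then show False using \<omega> by (simp add: ennreal_le_iff field_simps)
  qed
  have Xw: "ig {X k..<X (Suc k)} w = ennreal (\<omega> / 2 ^ Suc k)" for k
  proof -
    have "ennreal (\<omega> / 2 ^ Suc k) + ennreal (\<omega> / 2 ^ Suc k) = ennreal (\<omega> / 2 ^ k)"
      using \<omega> by (subst ennreal_plus[symmetric]) (auto simp: field_simps)
    also have "\<dots> = ennreal (\<omega> / 2 ^ Suc k) + ig {X k..<X (Suc k)} w"
      using W_split[of "X k" "X (Suc k)"] Xs[of k] by (simp add: XW add.commute del: power_Suc)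
    finally show ?thesis by (metis ennreal_add_left_cancel ennreal_neq_top infinity_ennreal_def)
  qed
  have "\<exists>k. x < X k" if "x \<in> D" for x
  proof (rule ccontr)
    assume "\<not> ?thesis"
    then have le: "W x \<le> ennreal (\<omega> / 2 ^ k)" for k using W_mono[of "X k" x] by (simp add: XW not_less)
    have "W x \<noteq> 0" using W_pos[OF that] by auto
    moreover have "W x \<noteq> top" using le[of 0] by (auto simp: top_unique)
    ultimately obtain e where e: "W x = ennreal e" "0 < e"
      by (metis ennreal_cases ennreal_0 less_eq_real_def)
    obtain k where "\<omega> / e < 2 ^ k" using real_arch_pow[of 2 "\<omega> / e"] by auto
    then have "\<omega> / 2 ^ k < e" using e(2) \<omega> by (simp add: field_simps)
    then show False using le[of k] e \<omega> by (simp add: ennreal_le_iff)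
  qed
  then show ?thesis using XD XW Xs Xw by (intro exI[of _ X]) (simp add: X_def del: power_Suc)
qed

text \<open>Up to \<open>y\<close> the factor \<open>U x\<close> is at most \<open>U x y\<close>;
  beyond \<open>y\<close> it is \<open>U x y\<close> plus \<open>U y\<close>, which contributes
  \<open>P y\<close>.\<close>

lemma P_le:
  assumes "x \<le> y"
  shows "P x \<le> 2 epowr (r / q) * (U x y epowr (r / q) * W x + P y)"
proof -
  have \<kappa>: "0 < r / q" using q r by simp
  define g where "g s = (w s * U y s epowr (r / q)) * indicator {y..} s" for s
  have gm [measurable]: "g \<in> borel_measurable lebesgue" unfolding g_def by measurable
  have "P x \<le> ig {x..} (\<lambda>s. 2 epowr (r / q) * (U x y epowr (r / q) * w s + g s))"
    unfolding P_def
  proof (intro ig_mono)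
    fix s assume s: "s \<in> {x..}"
    have "U x s epowr (r / q) \<le> 2 epowr (r / q) * (U x y epowr (r / q) + U y s epowr (r / q) * indicator {y..} s)"
    proof (cases "y \<le> s")
      case True
      then have "U x s epowr (r / q) = (U x y + U y s) epowr (r / q)" by (simp only: U_add[OF assms True])
      also have "\<dots> \<le> 2 epowr (r / q) * (U x y epowr (r / q) + U y s epowr (r / q))"
        using \<kappa> by (rule epowr_plus_le)
      finally show ?thesis using True by simp
    next
      case False
      then have "U x s epowr (r / q) \<le> 1 * U x y epowr (r / q)" using \<kappa> by (auto intro!: epowr_mono U_mono)
      also have "(1::ennreal) * U x y epowr (r / q) \<le> 2 epowr (r / q) * U x y epowr (r / q)"
        using epowr_mono[of 1 2 "r / q"] \<kappa> by (intro mult_right_mono) auto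
      finally show ?thesis using False by simp
    qed
    then have "w s * U x s epowr (r / q) \<le> w s * (2 epowr (r / q) * (U x y epowr (r / q) + U y s epowr (r / q) * indicator {y..} s))"
      by (intro mult_left_mono) auto
    then show "w s * U x s epowr (r / q) \<le> 2 epowr (r / q) * (U x y epowr (r / q) * w s + g s)"
      by (simp add: g_def distrib_left ac_simps)
  qed auto
  also have "\<dots> = 2 epowr (r / q) * (U x y epowr (r / q) * W x + ig {x..} g)"
    unfolding W_def by (simp add: ig_cmult ig_add)
  also have "ig {x..} g = P y"
    unfolding P_def ig_def g_def using assms by (intro nn_integral_cong) (auto simp: indicator_def)
  finally show ?thesis .
qed

text \<open>On block i, \<open>U (Y k)\<close> is at most \<open>h i\<close>, a sum of the
  increments \<open>e\<close> over single blocks, while the w-mass from its left end onwards decays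
  like 4^(-i). By \<open>geometric_suminf_le\<close> the decay outweighs the accumulation, and only
  single increments remain.\<close>

lemma P_geometric:
  assumes Y: "\<And>k. Y k < Y (Suc k)" "\<And>k. W (Y k) \<le> ennreal (\<omega> / 4 ^ k)" "\<And>x. x \<in> D \<Longrightarrow> \<exists>k. x < Y k" and \<omega>: "0 < \<omega>"
  shows "P (Y k) \<le> ennreal (2 * quasi_const (r / q)) * (\<Sum>i. ennreal (\<omega> / 4 ^ (k + i)) * U (Y (k + i)) (Y (Suc (k + i))) epowr (r / q))"
proof -
  have Ymono: "Y m \<le> Y n" if "m \<le> n" for m n
    by (rule lift_Suc_mono_le[OF _ that]) (simp add: Y less_imp_le)
  define B where "B i = {Y (k + i)..<Y (Suc (k + i))}" for i
  have Bm [measurable]: "B i \<in> sets lebesgue" for i unfolding B_def by measurable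
  have Bdis: "disjoint_family B"
  proof -
    have "B m \<inter> B n = {}" if "m < n" for m n using Ymono[of "Suc (k + m)" "k + n"] that by (auto simp: B_def)
    then show ?thesis unfolding disjoint_family_on_def by (metis Int_commute linorder_neqE_nat)
  qed
  have cover: "x \<in> (\<Union>i. B i)" if "x \<in> D" "Y k \<le> x" for x
  proof -
    define m where "m = (LEAST m. x < Y m)"
    have m: "x < Y m" unfolding m_def using Y(3)[OF that(1)] by (rule LeastI_ex)
    have "k < m"
    proof (rule ccontr)
      assume "\<not> k < m"
      then have "Y m \<le> Y k" by (intro Ymono) auto
      then show False using m that by simp
    qed
    then obtain i where i: "m = Suc (k + i)" using less_imp_Suc_add by blast
    have "Y (k + i) \<le> x" using not_less_Least[of "k + i" "\<lambda>m. x < Y m"] i unfolding m_def by (simp add: not_less)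
    then show ?thesis using m i by (auto simp: B_def)
  qed
  define h where "h i = U (Y k) (Y (Suc (k + i)))" for i
  define e where "e i = U (Y (k + i)) (Y (Suc (k + i)))" for i
  have he: "h 0 = e 0" "h (Suc i) = h i + e (Suc i)" for i
    using Ymono[of k "Suc (k + i)"] Ymono[of "Suc (k + i)" "Suc (Suc (k + i))"]
    by (auto simp: h_def e_def intro: U_add)
  have "P (Y k) = (\<Sum>i. ig ({Y k..} \<inter> B i) (\<lambda>s. w s * U (Y k) s epowr (r / q)))"
    unfolding P_def using cover w_0 by (intro ig_cover_le Bdis) auto
  also have "\<dots> \<le> (\<Sum>i. ennreal (\<omega> / 4 ^ k) * (ennreal ((1 / 4) ^ i) * h i epowr (r / q)))"
  proof (intro suminf_ennreal_mono)
    fix i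
    have "ig ({Y k..} \<inter> B i) (\<lambda>s. w s * U (Y k) s epowr (r / q)) \<le> ig {Y (k + i)..} (\<lambda>s. h i epowr (r / q) * w s)"
    proof (intro ig_mono)
      fix s assume "s \<in> {Y k..} \<inter> B i"
      then have "U (Y k) s epowr (r / q) \<le> h i epowr (r / q)"
        unfolding h_def using q r by (intro epowr_mono U_mono) (auto simp: B_def)
      then show "w s * U (Y k) s epowr (r / q) \<le> h i epowr (r / q) * w s"
        unfolding mult.commute[of "w s"] by (intro mult_right_mono) auto
    qed (auto simp: B_def)
    also have "\<dots> = h i epowr (r / q) * W (Y (k + i))" unfolding W_def by (intro ig_cmult) auto
    also have "\<dots> \<le> h i epowr (r / q) * ennreal (\<omega> / 4 ^ (k + i))" by (intro mult_left_mono Y) auto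
    also have "ennreal (\<omega> / 4 ^ (k + i)) = ennreal (\<omega> / 4 ^ k) * ennreal ((1 / 4) ^ i)"
      using \<omega> by (subst ennreal_mult[symmetric]) (auto simp: power_add power_divide)
    finally show "ig ({Y k..} \<inter> B i) (\<lambda>s. w s * U (Y k) s epowr (r / q)) \<le> ennreal (\<omega> / 4 ^ k) * (ennreal ((1 / 4) ^ i) * h i epowr (r / q))"
      by (simp add: ac_simps)
  qed
  also have "\<dots> = ennreal (\<omega> / 4 ^ k) * (\<Sum>i. ennreal ((1 / 4) ^ i) * h i epowr (r / q))" by simp
  also have "\<dots> \<le> ennreal (\<omega> / 4 ^ k) * (ennreal (2 * quasi_const (r / q)) * (\<Sum>i. ennreal ((1 / 4) ^ i) * e i epowr (r / q)))"
    using q r by (intro mult_left_mono geometric_suminf_le he) auto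
  also have "\<dots> = ennreal (2 * quasi_const (r / q)) * (\<Sum>i. ennreal (\<omega> / 4 ^ k) * (ennreal ((1 / 4) ^ i) * e i epowr (r / q)))"
    by (simp only: ennreal_suminf_cmult) (rule mult.left_commute)
  also have "(\<Sum>i. ennreal (\<omega> / 4 ^ k) * (ennreal ((1 / 4) ^ i) * e i epowr (r / q))) = (\<Sum>i. ennreal (\<omega> / 4 ^ (k + i)) * e i epowr (r / q))"
  proof (intro suminf_cong)
    fix i
    have "ennreal (\<omega> / 4 ^ (k + i)) = ennreal (\<omega> / 4 ^ k) * ennreal ((1 / 4) ^ i)"
      using \<omega> by (subst ennreal_mult[symmetric]) (auto simp: power_add power_divide)
    then show "ennreal (\<omega> / 4 ^ k) * (ennreal ((1 / 4) ^ i) * e i epowr (r / q)) = ennreal (\<omega> / 4 ^ (k + i)) * e i epowr (r / q)"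
      by (simp add: mult.assoc)
  qed
  finally show ?thesis by (simp add: e_def)
qed

end

text \<open>The constant of \<open>necessity_P_less\<close>: the first two factors come from
  splitting \<open>P\<close> at the end of a block, 16^(r/(p-r)+1) from charging \<open>Kl\<close>
  to the next block, the last summand from the discrete test.\<close>

definition c_P :: "real \<Rightarrow> real \<Rightarrow> real \<Rightarrow> ennreal" where
  "c_P p q r = (2 epowr (r / q)) epowr (r / (p - r)) * 2 epowr (r / (p - r)) *
    (16 epowr (r / (p - r) + 1) + 32 * (16 * ennreal (quasi_const (r / q))) epowr (r / (p - r)))"

context hardy_core
begin

text \<open>For the inequality, U x y and U t x are both at most U t y, and the exponents add up to
  \<sigma>. For finiteness, \<Phi>^\<rho> is split so that the part \<Phi>^(r/p) joins
  \<open>U\<close> and is absorbed by \<open>Kl x\<close>; the remaining exponent is positive and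
  \<open>\<Phi> x\<close> bounds that part.\<close>

lemma TT_bounds:
  assumes rp: "r < p" and x: "x \<in> D" and fin: "Kl x < top" "\<Phi> x < top"
  shows "TT x < top" and "x \<le> y \<Longrightarrow> U x y epowr (r / q * (r / (p - r))) * TT x \<le> Kl y epowr (r * p / (q * (p - r)))"
proof -
  define \<kappa> where "\<kappa> = r / q"
  define \<rho> where "\<rho> = r / (p - r)"
  define \<sigma> where "\<sigma> = r * p / (q * (p - r))"
  have e: "0 < \<kappa>" "0 < \<rho>" "0 < \<sigma>" "\<kappa> + \<kappa> * \<rho> = \<sigma>" "q / p * \<sigma> = \<rho>" "q / p * \<kappa> + (\<rho> - r / p) = \<rho>" "0 < \<rho> - r / p"
    using p q r rp by (auto simp: \<rho>_def \<kappa>_def \<sigma>_def field_simps)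
  have "TT x \<le> Kl x epowr \<kappa> * \<Phi> x epowr (\<rho> - r / p)"
    unfolding TT_def \<kappa>_def[symmetric] \<rho>_def[symmetric]
  proof (rule SUP_least)
    fix t assume t: "t \<in> D \<inter> {..<x}"
    have "U t x epowr \<kappa> * \<Phi> t epowr \<rho> = (U t x * \<Phi> t epowr (q / p)) epowr \<kappa> * \<Phi> t epowr (\<rho> - r / p)"
      unfolding epowr_mult epowr_epowr mult.assoc epowr_add[symmetric] e(6) ..
    also have "\<dots> \<le> Kl x epowr \<kappa> * \<Phi> x epowr (\<rho> - r / p)"
      using t e \<Phi>_mono by (intro mult_mono epowr_mono U\<Phi>_le_Kl) (auto simp: mono_def)
    finally show "U t x epowr \<kappa> * \<Phi> t epowr \<rho> \<le> Kl x epowr \<kappa> * \<Phi> x epowr (\<rho> - r / p)" .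
  qed
  also have "\<dots> < top" using fin by (simp add: ennreal_mult_less_top)
  finally show "TT x < top" .
  assume xy: "x \<le> y"
  have "U x y epowr (\<kappa> * \<rho>) * TT x = (SUP t\<in>D \<inter> {..<x}. U x y epowr (\<kappa> * \<rho>) * (U t x epowr \<kappa> * \<Phi> t epowr \<rho>))"
    unfolding TT_def \<kappa>_def[symmetric] \<rho>_def[symmetric] by (rule SUP_mult_left_ennreal)
  also have "\<dots> \<le> Kl y epowr \<sigma>"
  proof (rule SUP_least)
    fix t assume t: "t \<in> D \<inter> {..<x}"
    have "U x y epowr (\<kappa> * \<rho>) * (U t x epowr \<kappa> * \<Phi> t epowr \<rho>) \<le> U t y epowr (\<kappa> * \<rho>) * (U t y epowr \<kappa> * \<Phi> t epowr \<rho>)"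
      using t e xy by (intro mult_mono epowr_mono U_mono) auto
    also have "\<dots> = (U t y epowr \<kappa> * U t y epowr (\<kappa> * \<rho>)) * \<Phi> t epowr \<rho>" by (simp only: ac_simps)
    also have "\<dots> = (U t y * \<Phi> t epowr (q / p)) epowr \<sigma>"
      unfolding epowr_mult epowr_epowr epowr_add[symmetric] e(4,5) ..
    also have "\<dots> \<le> Kl y epowr \<sigma>" using t e xy by (intro epowr_mono U\<Phi>_le_Kl) auto
    finally show "U x y epowr (\<kappa> * \<rho>) * (U t x epowr \<kappa> * \<Phi> t epowr \<rho>) \<le> Kl y epowr \<sigma>" .
  qed
  finally show "U x y epowr (r / q * (r / (p - r))) * TT x \<le> Kl y epowr (r * p / (q * (p - r)))"
    by (simp only: \<kappa>_def \<rho>_def \<sigma>_def)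
qed

text \<open>Test functions concentrated at finitely many of the points \<open>\<sigma> l\<close>, measured on the disjoint
  intervals \<open>[X l, X (l + 1))\<close>.\<close>

lemma discrete_test:
  fixes X \<sigma> :: "nat \<Rightarrow> real"
  assumes rp: "r < p" and Z0: "0 \<le> Z" and \<Phi>: "\<And>x. x \<in> D \<Longrightarrow> \<Phi> x < top"
    and Z: "\<And>f. f \<in> Adm \<Longrightarrow> ig D (\<lambda>x. HL f x epowr (r / q) * w x) \<le> ennreal Z * nrm f epowr (r / p)"
    and X: "\<And>l. X l < X (Suc l)" and \<sigma>: "\<And>l. \<sigma> l \<in> D" "\<And>l. \<sigma> l \<le> X l"
  defines "mass l \<equiv> ig {X l..<X (Suc l)} w * U (\<sigma> l) (X l) epowr (r / q)"
  shows "(\<Sum>l. mass l * ((\<Sum>j. mass j * indicator {j. \<Phi> (\<sigma> l) \<le> \<Phi> (\<sigma> j)} j) epowr (r / (p - r)) * \<Phi> (\<sigma> l) epowr (r / (p - r))))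
    \<le> ennreal (hardyL_const (r / p) * Z powr (p / (p - r)))"
proof -
  have sR: "r / p / (1 - r / p) = r / (p - r)" "1 / (1 - r / p) = p / (p - r)"
    using p rp by (auto simp: field_simps)
  \<comment> \<open>The masses form a measure on the indices, to which \<open>level_set_test\<close>
    applies directly.\<close>
  define M where "M = density (count_space UNIV) mass"
  define S where "S l = enn2real (\<Phi> (\<sigma> l))" for l
  have S: "ennreal (S l) = \<Phi> (\<sigma> l)" for l using \<Phi>[OF \<sigma>(1)] by (simp add: S_def)
  have [simp]: "space M = UNIV" "sets M = UNIV" by (simp_all add: M_def)
  have intM: "(\<integral>\<^sup>+x. h x \<partial>M) = (\<Sum>l. mass l * h l)" for h
    unfolding M_def by (subst nn_integral_density) (auto simp: nn_integral_count_space_nat)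
  have emM: "emeasure M A = (\<Sum>l. mass l * indicator A l)" for A
    unfolding M_def by (subst emeasure_density) (auto simp: nn_integral_count_space_nat)
  define A where "A \<theta> = {t\<in>D. ennreal \<theta> < \<Phi> t}" for \<theta>
  have "\<exists>y :: nat \<Rightarrow> real. A \<theta> \<noteq> {} \<longrightarrow> (\<forall>n. y n \<in> A \<theta>) \<and> decseq y \<and> (\<forall>x\<in>A \<theta>. \<exists>n. y n \<le> x)" for \<theta>
    by (cases "A \<theta> = {}") (auto elim!: cofinal_sequence[of "A \<theta>"])
  then obtain yy :: "real \<Rightarrow> nat \<Rightarrow> real" where yy: "\<And>\<theta>. A \<theta> \<noteq> {} \<Longrightarrow>
      (\<forall>n. yy \<theta> n \<in> A \<theta>) \<and> decseq (yy \<theta>) \<and> (\<forall>x\<in>A \<theta>. \<exists>n. yy \<theta> n \<le> x)"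
    by metis
  define N where "N \<theta> n = (if A \<theta> = {} then {} else {l. yy \<theta> n \<le> \<sigma> l})" for \<theta> n
  have SA: "\<theta> < S l \<longleftrightarrow> \<sigma> l \<in> A \<theta>" if "0 < \<theta>" for \<theta> l
    using that \<sigma>(1)[of l] by (simp add: A_def S[symmetric] ennreal_less_iff)
  have "(\<integral>\<^sup>+x. emeasure M {y \<in> space M. S x \<le> S y} epowr (r / p / (1 - r / p)) * ennreal (S x) epowr (r / p / (1 - r / p)) \<partial>M)
    \<le> ennreal (hardyL_const (r / p) * Z powr (1 / (1 - r / p)))"
  proof (rule level_set_test[OF _ _ Z0, where N = N])
    show "0 < r / p" "r / p < 1" using p r rp by auto
    show "S \<in> borel_measurable M" by (simp add: measurable_def)
    show "0 \<le> S x" for x by (simp add: S_def)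
    show "N \<theta> n \<in> sets M" for \<theta> n by simp
    show "incseq (N \<theta>)" if "0 < \<theta>" for \<theta>
    proof (cases "A \<theta> = {}")
      case False
      then have "yy \<theta> n \<le> yy \<theta> m" if "m \<le> n" for m n
        using yy[of \<theta>] that by (auto simp: decseq_def)
      then show ?thesis by (fastforce simp: N_def incseq_def)
    qed (simp add: N_def incseq_def)
    show "(\<Union>n. N \<theta> n) = {x \<in> space M. \<theta> < S x}" if \<theta>: "0 < \<theta>" for \<theta>
    proof (cases "A \<theta> = {}")
      case True
      then show ?thesis using SA[OF \<theta>] by (simp add: N_def)
    next
      case False
      have "\<sigma> l \<in> A \<theta>" if "yy \<theta> n \<le> \<sigma> l" for l n
        using yy[OF False] \<Phi>_mono that \<sigma>(1)[of l] by (auto simp: A_def mono_def intro: less_le_trans)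
      moreover have "\<exists>n. yy \<theta> n \<le> \<sigma> l" if "\<sigma> l \<in> A \<theta>" for l
        using yy[OF False] that by auto
      ultimately show ?thesis using False SA[OF \<theta>] by (auto simp: N_def)
    qed
    fix k :: nat and \<theta> :: "nat \<Rightarrow> real" and n and a :: "nat \<Rightarrow> real"
    assume *: "\<And>i. i \<le> k \<Longrightarrow> 0 < \<theta> i \<and> 0 \<le> a i"
    define J where "J = {i. i \<le> k \<and> A (\<theta> i) \<noteq> {}}"
    have J: "finite J" unfolding J_def by simp
    have "yy (\<theta> i) n \<in> D \<and> 0 < \<theta> i \<and> ennreal (\<theta> i) < \<Phi> (yy (\<theta> i) n) \<and> 0 \<le> a i" if "i \<in> J" for i
      using yy[of "\<theta> i"] * that by (auto simp: J_def A_def)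
    then obtain g where g: "g \<in> Adm" "nrm g \<le> ennreal (\<Sum>i\<in>J. a i)"
      "\<And>i x. i \<in> J \<Longrightarrow> yy (\<theta> i) n \<le> x \<Longrightarrow> ennreal (a i * \<theta> i) \<le> F g x epowr p"
      using extremal_family[OF J, of "\<lambda>i. yy (\<theta> i) n" \<theta> a] by blast
    show "\<exists>h\<in>borel_measurable M. (\<forall>i\<le>k. \<forall>x\<in>N (\<theta> i) n. ennreal ((a i * \<theta> i) powr (r / p)) \<le> h x) \<and>
        (\<integral>\<^sup>+x. h x \<partial>M) \<le> ennreal (Z * (\<Sum>i\<le>k. a i) powr (r / p))"
    proof (intro bexI[of _ "\<lambda>l. F g (\<sigma> l) epowr r"] conjI allI impI ballI)
      fix i l assume il: "i \<le> k" "l \<in> N (\<theta> i) n"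
      then have i: "i \<in> J" "yy (\<theta> i) n \<le> \<sigma> l" by (auto simp: N_def J_def split: if_splits)
      have "ennreal ((a i * \<theta> i) powr (r / p)) = ennreal (a i * \<theta> i) epowr (r / p)"
        using *[OF il(1)] by (simp add: epowr_ennreal)
      also have "\<dots> \<le> (F g (\<sigma> l) epowr p) epowr (r / p)"
        using g(3)[OF i] p r by (intro epowr_mono) auto
      also have "\<dots> = F g (\<sigma> l) epowr r" using p by (simp add: epowr_epowr)
      finally show "ennreal ((a i * \<theta> i) powr (r / p)) \<le> F g (\<sigma> l) epowr r" .
    next
      have S0: "0 \<le> (\<Sum>i\<in>J. a i)" using * by (intro sum_nonneg) (auto simp: J_def)
      have Xm: "X m \<le> X n" if "m \<le> n" for m n
        by (rule lift_Suc_mono_le[OF _ that]) (simp add: X less_imp_le)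
      have dis: "disjoint_family (\<lambda>l. {X l..<X (Suc l)})"
      proof -
        have "{X m..<X (Suc m)} \<inter> {X n..<X (Suc n)} = {}" if "m < n" for m n
          using Xm[of "Suc m" n] that by auto
        then show ?thesis unfolding disjoint_family_on_def by (metis Int_commute linorder_neqE_nat)
      qed
      have "(\<integral>\<^sup>+x. F g (\<sigma> x) epowr r \<partial>M) = (\<Sum>l. mass l * F g (\<sigma> l) epowr r)" by (rule intM)
      also have "\<dots> \<le> (\<Sum>l. ig {X l..<X (Suc l)} (\<lambda>x. HL g x epowr (r / q) * w x))"
      proof (intro suminf_ennreal_mono)
        fix l
        have "mass l * F g (\<sigma> l) epowr r = (F g (\<sigma> l) epowr r * U (\<sigma> l) (X l) epowr (r / q)) * ig {X l..<X (Suc l)} w"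
          by (simp add: mass_def ac_simps)
        also have "\<dots> = ig {X l..<X (Suc l)} (\<lambda>x. (F g (\<sigma> l) epowr r * U (\<sigma> l) (X l) epowr (r / q)) * w x)"
          by (rule ig_cmult[symmetric]) measurable
        also have "\<dots> \<le> ig {X l..<X (Suc l)} (\<lambda>x. HL g x epowr (r / q) * w x)"
        proof (intro ig_mono mult_right_mono)
          fix x assume x: "x \<in> {X l..<X (Suc l)}"
          have "F g (\<sigma> l) epowr r * U (\<sigma> l) (X l) epowr (r / q) = (F g (\<sigma> l) epowr q * U (\<sigma> l) (X l)) epowr (r / q)"
            using q by (simp add: epowr_mult epowr_epowr)
          also have "\<dots> \<le> HL g (X l) epowr (r / q)"
            using q r \<sigma>(2) by (intro epowr_mono HL_lower) auto
          also have "\<dots> \<le> HL g x epowr (r / q)" using q r x by (intro epowr_mono HL_mono) auto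
          finally show "F g (\<sigma> l) epowr r * U (\<sigma> l) (X l) epowr (r / q) \<le> HL g x epowr (r / q)" .
        qed auto
        finally show "mass l * F g (\<sigma> l) epowr r \<le> ig {X l..<X (Suc l)} (\<lambda>x. HL g x epowr (r / q) * w x)" .
      qed
      also have "\<dots> = ig (\<Union>l. {X l..<X (Suc l)}) (\<lambda>x. HL g x epowr (r / q) * w x)"
        by (rule ig_UN[symmetric]) (use dis in auto)
      also have "\<dots> = ig ((\<Union>l. {X l..<X (Suc l)}) \<inter> D) (\<lambda>x. HL g x epowr (r / q) * w x)"
        using w_0 by (intro ig_restrict) auto
      also have "\<dots> \<le> ig D (\<lambda>x. HL g x epowr (r / q) * w x)" by (intro ig_mono) auto
      also have "\<dots> \<le> ennreal Z * nrm g epowr (r / p)" by (rule Z[OF g(1)])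
      also have "\<dots> \<le> ennreal Z * ennreal (\<Sum>i\<in>J. a i) epowr (r / p)"
        using g p r by (intro mult_left_mono epowr_mono) auto
      also have "\<dots> = ennreal (Z * (\<Sum>i\<in>J. a i) powr (r / p))"
        using S0 Z0 by (simp add: epowr_ennreal ennreal_mult)
      also have "\<dots> \<le> ennreal (Z * (\<Sum>i\<le>k. a i) powr (r / p))"
        using p r Z0 * by (intro ennreal_leI mult_left_mono powr_mono2 sum_mono2 sum_nonneg) (auto simp: J_def)
      finally show "(\<integral>\<^sup>+x. F g (\<sigma> x) epowr r \<partial>M) \<le> ennreal (Z * (\<Sum>i\<le>k. a i) powr (r / p))" .
    qed (simp add: measurable_def)
  qed
  moreover have "S l \<le> S j \<longleftrightarrow> \<Phi> (\<sigma> l) \<le> \<Phi> (\<sigma> j)" for l j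
    unfolding S[symmetric] by (subst ennreal_le_iff) (auto simp: S_def)
  ultimately show ?thesis unfolding intM emM sR S by simp
qed

text \<open>Inside a block \<open>P x\<close> is split at the right end y. The part with
  \<open>U x y\<close> combines with \<open>TT x\<close> and is absorbed by the integral of
  \<open>Kl\<close>, bounded in \<open>necessity_Kl_less\<close>. What remains is P(y)^\<rho> TT(y),
  one number per block: the moving supremum is frozen, and \<open>discrete_test\<close> can bound
  the series of these numbers.\<close>

lemma necessity_P_less:
  assumes rp: "r < p" and Z0: "0 \<le> Z"
    and Z: "\<And>f. f \<in> Adm \<Longrightarrow> ig D (\<lambda>x. HL f x epowr (r / q) * w x) \<le> ennreal Z * nrm f epowr (r / p)"
  shows "ig D (\<lambda>x. P x epowr (r / (p - r)) * w x * TT x)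
    \<le> c_P p q r * ennreal (hardyL_const (r / p) * Z powr (p / (p - r)))"
proof (rule ig_le_cutoff(1)[OF _ D_ne])
  fix x0 assume x0: "x0 \<in> D"
  define \<kappa> where "\<kappa> = r / q"
  define \<rho> where "\<rho> = r / (p - r)"
  define \<sigma> where "\<sigma> = r * p / (q * (p - r))"
  define B where "B = ennreal (hardyL_const (r / p) * Z powr (p / (p - r)))"
  define C where "C = 2 * quasi_const \<kappa>"
  have e: "0 < \<kappa>" "0 < \<rho>" "0 < \<sigma>" using p q r rp by (auto simp: \<rho>_def \<kappa>_def \<sigma>_def)
  have P\<Phi>: "P t * \<Phi> t epowr (r / p) < top" if "t \<in> D" for t
    using necessity_P[OF Z that] ennreal_less_top by (rule le_less_trans)
  have \<Phi>: "\<Phi> t < top" if "t \<in> D" for t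
    using ennreal_mult_less_topD[OF P\<Phi>[OF that] P_pos[OF that]] by simp
  have P: "P t < top" if "t \<in> D" for t
    by (rule ennreal_mult_less_topD[OF P\<Phi>[OF that, unfolded mult.commute[of "P t"]]]) (simp add: \<Phi>_pos that)
  have W: "W x < top" if x: "x \<in> D" for x
  proof -
    obtain t where t: "t \<in> D" "t < x" using D_left[OF x] by blast
    have "U t x epowr (r / q) * W x < top" using UW_le_P[of t x] t P[OF t(1)] by (auto intro: le_less_trans)
    then show ?thesis by (rule ennreal_mult_less_topD) (use U_pos[OF t] in auto)
  qed
  have Kl: "Kl x < top" if x: "x \<in> D" for x
  proof -
    have "W x * Kl x epowr (r / q) \<le> ennreal Z" by (rule necessity_Kl[OF Z])
    then have "W x * Kl x epowr (r / q) < top" by (rule le_less_trans) simp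
    then have "Kl x epowr (r / q) < top" by (rule ennreal_mult_less_topD[OF _ W_pos[OF x]])
    then show ?thesis by simp
  qed
  obtain \<omega> where \<omega>: "W x0 = ennreal \<omega>" "0 < \<omega>"
    using W[OF x0] W_pos[OF x0] by (metis ennreal_cases ennreal_0 less_eq_real_def less_irrefl)
  obtain X where X: "X 0 = x0" "\<forall>k. X k \<in> D \<and> X k < X (Suc k) \<and> W (X k) = ennreal (\<omega> / 2 ^ k) \<and>
    ig {X k..<X (Suc k)} w = ennreal (\<omega> / 2 ^ Suc k)" "\<forall>x\<in>D. \<exists>k. x < X k"
    using W_levels[OF x0 \<omega>] by (elim exE conjE) (rule that)
  have XD: "X k \<in> D" and Xs: "X k < X (Suc k)" and XW: "W (X k) = ennreal (\<omega> / 2 ^ k)"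
    and Xw: "ig {X k..<X (Suc k)} w = ennreal (\<omega> / 2 ^ Suc k)" for k
    using X(2) by auto
  have Xm: "X m \<le> X n" if "m \<le> n" for m n
    by (rule lift_Suc_mono_le[OF _ that]) (simp add: Xs less_imp_le)
  \<comment> \<open>Every second point, so that each block contains two consecutive intervals of
    \<open>X\<close>, one for each of the two families of test points below.\<close>
  define Y where "Y k = X (2 * k)" for k
  have YD: "Y k \<in> D" and Ys: "Y k < Y (Suc k)" for k
    using XD Xs[of "2 * k"] Xs[of "Suc (2 * k)"] by (auto simp: Y_def)
  have YW: "W (Y k) = ennreal (\<omega> / 4 ^ k)" for k by (simp add: Y_def XW power_mult)
  have Ycov: "\<exists>k. x < Y k" if xD: "x \<in> D" for x
  proof -
    obtain k where "x < X k" using X(3) xD by blast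
    then have "x < Y k" using Xm[of k "2 * k"] by (simp add: Y_def)
    then show ?thesis by blast
  qed
  have Ym: "Y m \<le> Y n" if "m \<le> n" for m n unfolding Y_def using that by (intro Xm) simp
  define G where "G x = P x epowr \<rho> * w x * TT x" for x
  define H where "H x = W x epowr \<rho> * w x * Kl x epowr \<sigma>" for x
  have [measurable]: "G \<in> borel_measurable lebesgue" "H \<in> borel_measurable lebesgue" unfolding G_def H_def by measurable
  define I where "I k = {Y k..<Y (Suc k)}" for k
  have [measurable]: "I k \<in> sets lebesgue" for k unfolding I_def by measurable
  have Idis: "disjoint_family I"
  proof -
    have "I m \<inter> I n = {}" if "m < n" for m n using Ym[of "Suc m" n] that by (auto simp: I_def)
    then show ?thesis unfolding disjoint_family_on_def by (metis Int_commute linorder_neqE_nat)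
  qed
  have cover: "x \<in> (\<Union>i. I i)" if "x \<in> D" "x0 \<le> x" for x
  proof -
    define m where "m = (LEAST m. x < Y m)"
    have m: "x < Y m" unfolding m_def using Ycov[OF that(1)] by (rule LeastI_ex)
    have "m \<noteq> 0"
    proof
      assume "m = 0" then show False using m that X(1) by (simp add: Y_def)
    qed
    then obtain i where i: "m = Suc i" by (cases m) auto
    have "Y i \<le> x" using not_less_Least[of i "\<lambda>m. x < Y m"] i unfolding m_def by (simp add: not_less)
    then show ?thesis using m i by (auto simp: I_def)
  qed
  define c1 where "c1 = (2 epowr \<kappa>) epowr \<rho> * 2 epowr \<rho>"
  define S2 where "S2 k = ennreal (\<omega> / 4 ^ k) * (P (Y (Suc k)) epowr \<rho> * TT (Y (Suc k)))" for k
  have block: "ig (I k) G \<le> c1 * (16 epowr (\<rho> + 1) * ig (I (Suc k)) H + S2 k)" for k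
  proof -
    define y where "y = Y (Suc k)"
    have "ig (I k) G = ig (I k \<inter> D) G" using w_0 by (intro ig_restrict) (auto simp: G_def)
    also have "\<dots> \<le> ig {Y k..} (\<lambda>x. (c1 * (ennreal (\<omega> / 4 ^ k) epowr \<rho> * Kl y epowr \<sigma> + P y epowr \<rho> * TT y)) * w x)"
    proof (intro ig_mono)
      fix x assume "x \<in> I k \<inter> D"
      then have x: "Y k \<le> x" "x \<le> y" "x \<in> D" by (auto simp: I_def y_def)
      have "P x epowr \<rho> \<le> (2 epowr \<kappa> * (U x y epowr \<kappa> * W x + P y)) epowr \<rho>"
        unfolding \<kappa>_def using e x by (intro epowr_mono P_le) auto
      also have "\<dots> = (2 epowr \<kappa>) epowr \<rho> * (U x y epowr \<kappa> * W x + P y) epowr \<rho>" by (rule epowr_mult)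
      also have "\<dots> \<le> (2 epowr \<kappa>) epowr \<rho> * (2 epowr \<rho> * ((U x y epowr \<kappa> * W x) epowr \<rho> + P y epowr \<rho>))"
        using e by (intro mult_left_mono epowr_plus_le) auto
      finally have Px: "P x epowr \<rho> \<le> c1 * (U x y epowr (\<kappa> * \<rho>) * W x epowr \<rho> + P y epowr \<rho>)"
        by (simp add: c1_def epowr_mult epowr_epowr mult.assoc)
      have "P x epowr \<rho> * TT x \<le> c1 * (U x y epowr (\<kappa> * \<rho>) * W x epowr \<rho> + P y epowr \<rho>) * TT x"
        using Px by (intro mult_right_mono) auto
      also have "\<dots> = c1 * (W x epowr \<rho> * (U x y epowr (\<kappa> * \<rho>) * TT x) + P y epowr \<rho> * TT x)"
        by (simp add: distrib_left distrib_right ac_simps)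
      also have "\<dots> \<le> c1 * (W (Y k) epowr \<rho> * Kl y epowr \<sigma> + P y epowr \<rho> * TT y)"
      proof (intro mult_left_mono add_mono mult_mono)
        show "W x epowr \<rho> \<le> W (Y k) epowr \<rho>" using e x by (intro epowr_mono W_mono) auto
        show "U x y epowr (\<kappa> * \<rho>) * TT x \<le> Kl y epowr \<sigma>"
          unfolding \<kappa>_def \<rho>_def \<sigma>_def using x Kl \<Phi> by (intro TT_bounds(2) rp) auto
        show "TT x \<le> TT y" using x by (intro TT_mono)
      qed auto
      finally have "(P x epowr \<rho> * TT x) * w x \<le> (c1 * (W (Y k) epowr \<rho> * Kl y epowr \<sigma> + P y epowr \<rho> * TT y)) * w x"
        by (intro mult_right_mono) auto
      then show "G x \<le> (c1 * (ennreal (\<omega> / 4 ^ k) epowr \<rho> * Kl y epowr \<sigma> + P y epowr \<rho> * TT y)) * w x"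
        by (simp add: G_def YW ac_simps)
    qed (auto simp: I_def)
    also have "\<dots> = (c1 * (ennreal (\<omega> / 4 ^ k) epowr \<rho> * Kl y epowr \<sigma> + P y epowr \<rho> * TT y)) * ennreal (\<omega> / 4 ^ k)"
      unfolding YW[symmetric] W_def by (rule ig_cmult) measurable
    also have "\<dots> = c1 * (ennreal (\<omega> / 4 ^ k) epowr (\<rho> + 1) * Kl y epowr \<sigma> + S2 k)"
      by (simp add: S2_def y_def epowr_add distrib_left distrib_right ac_simps)
    \<comment> \<open>Kl y is charged to the following block, where \<open>Kl\<close> is at least Kl
      y. There \<open>W\<close> and the w-mass of the block are both at least \<omega> / 4^(k+2),
      whence 16 = 4^2.\<close>
    also have "ennreal (\<omega> / 4 ^ k) epowr (\<rho> + 1) * Kl y epowr \<sigma> \<le> 16 epowr (\<rho> + 1) * ig (I (Suc k)) H"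
    proof -
      have q16: "ennreal (\<omega> / 4 ^ k) = 16 * ennreal (\<omega> / 4 ^ Suc (Suc k))"
        using \<omega> ennreal_mult[of 16 "\<omega> / 4 ^ Suc (Suc k)"] by simp
      have Iw: "ennreal (\<omega> / 4 ^ Suc (Suc k)) \<le> ig (I (Suc k)) w"
      proof -
        have "ennreal (\<omega> / 4 ^ Suc (Suc k)) \<le> ennreal (\<omega> / 2 ^ Suc (2 * Suc k))"
        proof (rule ennreal_leI)
          have "(2::real) ^ Suc (2 * Suc k) \<le> 4 ^ Suc (Suc k)" by (simp add: power_mult)
          then show "\<omega> / 4 ^ Suc (Suc k) \<le> \<omega> / 2 ^ Suc (2 * Suc k)"
            using \<omega>(2) by (intro divide_left_mono) auto
        qed
        also have "\<dots> = ig {X (2 * Suc k)..<X (Suc (2 * Suc k))} w" by (rule Xw[symmetric])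
        also have "\<dots> \<le> ig (I (Suc k)) w"
          unfolding I_def Y_def using Xm[of "Suc (2 * Suc k)" "2 * Suc (Suc k)"] by (intro ig_mono) auto
        finally show ?thesis .
      qed
      have "ennreal (\<omega> / 4 ^ k) epowr (\<rho> + 1) * Kl y epowr \<sigma>
          = 16 epowr (\<rho> + 1) * ((ennreal (\<omega> / 4 ^ Suc (Suc k)) epowr \<rho> * Kl y epowr \<sigma>) * ennreal (\<omega> / 4 ^ Suc (Suc k)))"
        unfolding q16 epowr_mult by (simp add: epowr_add ac_simps del: power_Suc)
      also have "\<dots> \<le> 16 epowr (\<rho> + 1) * ((ennreal (\<omega> / 4 ^ Suc (Suc k)) epowr \<rho> * Kl y epowr \<sigma>) * ig (I (Suc k)) w)"
        using Iw by (intro mult_left_mono) auto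
      also have "(ennreal (\<omega> / 4 ^ Suc (Suc k)) epowr \<rho> * Kl y epowr \<sigma>) * ig (I (Suc k)) w
          = ig (I (Suc k)) (\<lambda>x. (W (Y (Suc (Suc k))) epowr \<rho> * Kl y epowr \<sigma>) * w x)"
        unfolding YW by (rule ig_cmult[symmetric]) measurable
      also have "\<dots> \<le> ig (I (Suc k)) H"
      proof (intro ig_mono)
        fix x assume x: "x \<in> I (Suc k)"
        have "(W (Y (Suc (Suc k))) epowr \<rho> * Kl y epowr \<sigma>) * w x \<le> (W x epowr \<rho> * Kl x epowr \<sigma>) * w x"
          using x e by (intro mult_right_mono mult_mono epowr_mono W_mono Kl_mono) (auto simp: I_def y_def)
        then show "(W (Y (Suc (Suc k))) epowr \<rho> * Kl y epowr \<sigma>) * w x \<le> H x" by (simp add: H_def ac_simps)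
      qed auto
      finally show ?thesis by (simp add: mult_left_mono)
    qed
    finally show ?thesis by (simp add: mult_left_mono add_right_mono)
  qed
  \<comment> \<open>\<open>TT\<close> is positive and finite at the right end, so some point attains
    at least half of this supremum.\<close>
  have "\<exists>s. s \<in> D \<and> s < Y (Suc k) \<and> TT (Y (Suc k)) \<le> 2 * (U s (Y (Suc k)) epowr \<kappa> * \<Phi> s epowr \<rho>)" for k
  proof (rule ccontr)
    assume n: "\<not> ?thesis"
    have "TT (Y (Suc k)) \<le> ennreal (1 / 2) * TT (Y (Suc k))"
    proof -
      have "U s (Y (Suc k)) epowr \<kappa> * \<Phi> s epowr \<rho> \<le> ennreal (1 / 2) * TT (Y (Suc k))" if s: "s \<in> D \<inter> {..<Y (Suc k)}" for s
      proof -
        have "2 * (U s (Y (Suc k)) epowr \<kappa> * \<Phi> s epowr \<rho>) \<le> TT (Y (Suc k))" using n s by (auto simp: not_le intro: less_imp_le)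
        then have "ennreal (1 / 2) * (2 * (U s (Y (Suc k)) epowr \<kappa> * \<Phi> s epowr \<rho>)) \<le> ennreal (1 / 2) * TT (Y (Suc k))"
          by (intro mult_left_mono) auto
        moreover have "ennreal (1 / 2) * 2 = 1" using ennreal_mult[of "1 / 2" 2] by simp
        ultimately show ?thesis by (simp flip: mult.assoc)
      qed
      then show ?thesis unfolding TT_def[of "Y (Suc k)"] \<kappa>_def[symmetric] \<rho>_def[symmetric]
        by (intro SUP_least) (auto simp: TT_def \<kappa>_def \<rho>_def)
    qed
    moreover obtain T where T: "TT (Y (Suc k)) = ennreal T" "0 < T"
      using TT_bounds(1)[OF rp YD Kl[OF YD] \<Phi>[OF YD]] TT_pos[OF YD]
      by (metis ennreal_cases ennreal_0 less_eq_real_def less_irrefl)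
    moreover have "ennreal (1 / 2 * T) = ennreal (1 / 2) * ennreal T" using T(2) by (intro ennreal_mult) auto
    ultimately have "ennreal T \<le> ennreal (1 / 2 * T)" by (simp only:)
    then have "T \<le> 1 / 2 * T" using T(2) by (subst (asm) ennreal_le_iff) auto
    then show False using T(2) by simp
  qed
  then obtain s where s: "\<And>k. s k \<in> D" "\<And>k. s k < Y (Suc k)"
    "\<And>k. TT (Y (Suc k)) \<le> 2 * (U (s k) (Y (Suc k)) epowr \<kappa> * \<Phi> (s k) epowr \<rho>)" by metis
  \<comment> \<open>Even indices sit at the points \<open>Y\<close> and rebuild \<open>P\<close>
    from increments of \<open>U\<close>; odd indices sit at the points \<open>s\<close> that nearly
    attain \<open>TT\<close>. Index l uses the interval starting at X (l+2), so the intervals are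
    disjoint and each lies to the right of its test point.\<close>
  define \<tau> where "\<tau> l = (if even l then X l else s (l div 2))" for l
  define mass where "mass l = ig {X (l + 2)..<X (Suc (l + 2))} w * U (\<tau> l) (X (l + 2)) epowr \<kappa>" for l
  have \<tau>: "\<tau> l \<in> D" "\<tau> l \<le> X (l + 2)" for l
  proof -
    show "\<tau> l \<in> D" using XD s(1) by (simp add: \<tau>_def)
    show "\<tau> l \<le> X (l + 2)"
    proof (cases "even l")
      case True
      then show ?thesis using Xm[of l "l + 2"] by (simp add: \<tau>_def)
    next
      case False
      then have "2 * Suc (l div 2) \<le> l + 2" by presburger
      then have "Y (Suc (l div 2)) \<le> X (l + 2)" unfolding Y_def by (rule Xm)
      then show ?thesis using s(2)[of "l div 2"] False by (simp add: \<tau>_def)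
    qed
  qed
  define Q where "Q l = mass l * ((\<Sum>j. mass j * indicator {j. \<Phi> (\<tau> l) \<le> \<Phi> (\<tau> j)} j) epowr \<rho> * \<Phi> (\<tau> l) epowr \<rho>)" for l
  have Q: "(\<Sum>l. Q l) \<le> B"
    unfolding Q_def mass_def B_def \<rho>_def \<kappa>_def
    using discrete_test[OF rp Z0 \<Phi> Z, where X = "\<lambda>l. X (l + 2)" and \<sigma> = \<tau>] \<tau> Xs by simp
  \<comment> \<open>By \<open>P_geometric\<close>, P (Y (k+1)) is a series of increments, each being
    8 times an even mass since 2^(2j+3) = 8 * 4^j. Their points lie to the right of
    \<open>s k\<close>, so these masses all count in the cumulative mass E of the odd index 2k+1.
    For that index itself 2^(2k+4) = 16 * 4^k, and the 2 from the choice of \<open>s\<close> makes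
    32.\<close>
  have S2: "S2 k \<le> 32 * ennreal (8 * C) epowr \<rho> * Q (2 * k + 1)" for k
  proof -
    define E where "E = (\<Sum>j. mass j * indicator {j. \<Phi> (s k) \<le> \<Phi> (\<tau> j)} j)"
    have \<tau>s: "\<tau> (2 * k + 1) = s k" by (simp add: \<tau>_def)
    have C: "0 \<le> C" unfolding C_def using epowr_plus_le2(1)[OF e(1)] by simp
    have PE: "P (Y (Suc k)) \<le> ennreal (8 * C) * E"
    proof -
      have "P (Y (Suc k)) \<le> ennreal C * (\<Sum>i. ennreal (\<omega> / 4 ^ (Suc k + i)) * U (Y (Suc k + i)) (Y (Suc (Suc k + i))) epowr \<kappa>)"
        unfolding C_def \<kappa>_def using Ys YW Ycov \<omega>(2) by (intro P_geometric) auto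
      also have "(\<Sum>i. ennreal (\<omega> / 4 ^ (Suc k + i)) * U (Y (Suc k + i)) (Y (Suc (Suc k + i))) epowr \<kappa>)
          = (\<Sum>i. 8 * (mass (2 * (Suc k + i)) * indicator {j. \<Phi> (s k) \<le> \<Phi> (\<tau> j)} (2 * (Suc k + i))))"
      proof (intro suminf_cong)
        fix i
        define j where "j = Suc k + i"
        have "s k \<le> X (2 * j)" using s(2)[of k] Ym[of "Suc k" j] by (simp add: Y_def j_def)
        then have ind: "\<Phi> (s k) \<le> \<Phi> (\<tau> (2 * j))" using \<Phi>_mono by (simp add: \<tau>_def mono_def)
        have "ennreal (\<omega> / 4 ^ j) = 8 * ennreal (\<omega> / 2 ^ Suc (2 * j + 2))"
          using \<omega> ennreal_mult[of 8 "\<omega> / 2 ^ Suc (2 * j + 2)"] by (simp add: power_mult power_add)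
        then show "ennreal (\<omega> / 4 ^ (Suc k + i)) * U (Y (Suc k + i)) (Y (Suc (Suc k + i))) epowr \<kappa>
          = 8 * (mass (2 * (Suc k + i)) * indicator {j. \<Phi> (s k) \<le> \<Phi> (\<tau> j)} (2 * (Suc k + i)))"
          unfolding j_def[symmetric] using ind by (simp only: mass_def Xw) (simp add: \<tau>_def Y_def mult.assoc)
      qed
      also have "\<dots> = 8 * (\<Sum>i. mass (2 * (Suc k + i)) * indicator {j. \<Phi> (s k) \<le> \<Phi> (\<tau> j)} (2 * (Suc k + i)))" by simp
      also have "\<dots> \<le> 8 * E"
        unfolding E_def by (intro mult_left_mono suminf_inj_le[where g="\<lambda>i. 2 * (Suc k + i)"]) (auto simp: inj_def)
      also have "ennreal C * (8 * E) = ennreal (8 * C) * E"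
        using C by (simp add: ennreal_mult ac_simps)
      finally show ?thesis by (simp add: mult_left_mono)
    qed
    have mk: "ennreal (\<omega> / 4 ^ k) * U (s k) (Y (Suc k)) epowr \<kappa> \<le> 16 * mass (2 * k + 1)"
    proof -
      have "ennreal (\<omega> / 4 ^ k) = 16 * ennreal (\<omega> / 2 ^ Suc (2 * k + 1 + 2))"
        using \<omega> ennreal_mult[of 16 "\<omega> / 2 ^ Suc (2 * k + 1 + 2)"] by (simp add: power_mult power_add)
      moreover have "U (s k) (Y (Suc k)) epowr \<kappa> \<le> U (s k) (X (2 * k + 1 + 2)) epowr \<kappa>"
        unfolding Y_def using e by (intro epowr_mono U_mono Xm) auto
      ultimately show ?thesis unfolding mass_def \<tau>s Xw by (simp only: mult.assoc) (intro mult_left_mono, auto)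
    qed
    have "S2 k \<le> ennreal (\<omega> / 4 ^ k) * ((ennreal (8 * C) * E) epowr \<rho> * (2 * (U (s k) (Y (Suc k)) epowr \<kappa> * \<Phi> (s k) epowr \<rho>)))"
      unfolding S2_def using e PE s(3) by (intro mult_left_mono mult_mono epowr_mono) auto
    also have "\<dots> = 2 * ennreal (8 * C) epowr \<rho> * ((ennreal (\<omega> / 4 ^ k) * U (s k) (Y (Suc k)) epowr \<kappa>) * (E epowr \<rho> * \<Phi> (s k) epowr \<rho>))"
      by (simp only: epowr_mult ac_simps)
    also have "\<dots> \<le> 2 * ennreal (8 * C) epowr \<rho> * ((16 * mass (2 * k + 1)) * (E epowr \<rho> * \<Phi> (s k) epowr \<rho>))"
      using mk by (intro mult_left_mono mult_right_mono) auto
    also have "\<dots> = (2 * 16) * ennreal (8 * C) epowr \<rho> * Q (2 * k + 1)"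
      unfolding Q_def \<tau>s E_def by (simp only: ac_simps)
    finally show ?thesis by simp
  qed
  have "ig {x0..} G = (\<Sum>k. ig ({x0..} \<inter> I k) G)"
    using cover w_0 by (intro ig_cover_le Idis) (auto simp: G_def)
  also have "\<dots> \<le> (\<Sum>k. c1 * (16 epowr (\<rho> + 1) * ig (I (Suc k)) H + 32 * ennreal (8 * C) epowr \<rho> * Q (2 * k + 1)))"
  proof (intro suminf_ennreal_mono)
    fix k
    have "ig ({x0..} \<inter> I k) G \<le> ig (I k) G" by (intro ig_mono) auto
    also have "\<dots> \<le> c1 * (16 epowr (\<rho> + 1) * ig (I (Suc k)) H + S2 k)" by (rule block)
    also have "\<dots> \<le> c1 * (16 epowr (\<rho> + 1) * ig (I (Suc k)) H + 32 * ennreal (8 * C) epowr \<rho> * Q (2 * k + 1))"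
      by (intro mult_left_mono add_left_mono S2) auto
    finally show "ig ({x0..} \<inter> I k) G \<le> c1 * (16 epowr (\<rho> + 1) * ig (I (Suc k)) H + 32 * ennreal (8 * C) epowr \<rho> * Q (2 * k + 1))" .
  qed
  also have "\<dots> = c1 * (16 epowr (\<rho> + 1) * (\<Sum>k. ig (I (Suc k)) H) + 32 * ennreal (8 * C) epowr \<rho> * (\<Sum>k. Q (2 * k + 1)))"
    by (simp add: suminf_add[symmetric])
  also have "\<dots> \<le> c1 * (16 epowr (\<rho> + 1) * B + 32 * ennreal (8 * C) epowr \<rho> * B)"
  proof (intro mult_left_mono add_mono)
    have "(\<Sum>k. Q (2 * k + 1)) \<le> (\<Sum>l. Q l)" by (rule suminf_inj_le) (auto simp: inj_def)
    then show "(\<Sum>k. Q (2 * k + 1)) \<le> B" using Q by simp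
    have "(\<Sum>k. ig (I (Suc k)) H) \<le> (\<Sum>k. ig (I k) H)" by (rule suminf_inj_le) auto
    also have "\<dots> = ig (\<Union>k. I k) H" by (rule ig_UN[symmetric]) (use Idis in auto)
    also have "\<dots> = ig ((\<Union>k. I k) \<inter> D) H" using w_0 by (intro ig_restrict) (auto simp: H_def)
    also have "\<dots> \<le> ig D H" by (intro ig_mono) auto
    also have "\<dots> \<le> B" unfolding H_def B_def \<rho>_def \<sigma>_def by (rule necessity_Kl_less[OF rp Z0 Z])
    finally show "(\<Sum>k. ig (I (Suc k)) H) \<le> B" .
  qed auto
  also have "\<dots> = c_P p q r * B"
  proof -
    have "ennreal (8 * C) = 16 * ennreal (quasi_const \<kappa>)"
      unfolding C_def using ennreal_mult[of 16 "quasi_const \<kappa>"] epowr_plus_le2(1)[OF e(1)] by (simp add: mult.assoc[symmetric])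
    then show ?thesis unfolding c_P_def c1_def \<kappa>_def \<rho>_def by (simp add: distrib_right distrib_left mult.assoc)
  qed
  finally show "ig {x0..} (\<lambda>x. P x epowr (r / (p - r)) * w x * TT x) \<le> c_P p q r * ennreal (hardyL_const (r / p) * Z powr (p / (p - r)))"
    by (simp add: G_def[abs_def] B_def \<rho>_def)
qed measurable

end

section \<open>The four cases for the abstract constants\<close>

definition c_ge :: "real \<Rightarrow> real \<Rightarrow> ennreal" where "c_ge q r = (8 * 2 epowr q) epowr (r / q) * (4 epowr r + 1)"
definition c_lt :: "real \<Rightarrow> real \<Rightarrow> real \<Rightarrow> ennreal" where "c_lt p q r = (8 * 2 epowr q) epowr (r / q) * (4 epowr r * c_less p q r + 2)"
definition k_ge :: "real \<Rightarrow> ennreal" where "k_ge q = 4 epowr q"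
definition k_lt :: "real \<Rightarrow> ennreal" where "k_lt q = 8 * 4 epowr q"

context hardy_core
begin

text \<open>\<open>K1\<close> to \<open>K5\<close> are \<open>C1\<close> to \<open>C5\<close>
  written with \<open>\<Phi>\<close>, and with suprema in place of essential suprema; they are
  identified in \<open>C1_eq\<close> to \<open>C5_eq\<close>.\<close>

definition K1 :: ennreal where "K1 = (SUP x\<in>D. P x epowr (1 / r) * \<Phi> x epowr (1 / p))"
definition K2 :: ennreal where
  "K2 = ig D (\<lambda>x. W x epowr (r / (p - r)) * w x * SS x epowr (r * p / (q * (p - r)))) epowr ((p - r) / (p * r))"
definition K3 :: ennreal where
  "K3 = ig D (\<lambda>x. P x epowr (r / (p - r)) * w x * TT x) epowr ((p - r) / (p * r))"
definition K4 :: ennreal where "K4 = (SUP x\<in>D. W x epowr (1 / r) * BB x epowr ((p - q) / (p * q)))"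
definition K5 :: ennreal where
  "K5 = ig D (\<lambda>x. W x epowr (r / (p - r)) * w x * BB x epowr (r * (p - q) / (q * (p - r)))) epowr ((p - r) / (p * r))"

lemma four_ge_1: "(1::ennreal) \<le> 4 epowr s" if "0 < s" for s
  using epowr_mono[of 1 4 s] that by simp

lemma K1_le: "x \<in> D \<Longrightarrow> P x * \<Phi> x epowr (r / p) \<le> K1 epowr r"
proof -
  assume "x \<in> D"
  then have "(P x epowr (1 / r) * \<Phi> x epowr (1 / p)) epowr r \<le> K1 epowr r"
    unfolding K1_def using r by (intro epowr_mono SUP_upper) auto
  then show ?thesis using r by (simp add: epowr_mult epowr_epowr)
qed

lemma K4_le: "x \<in> D \<Longrightarrow> W x * (BB x epowr ((p - q) / p)) epowr (r / q) \<le> K4 epowr r"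
proof -
  assume "x \<in> D"
  then have "(W x epowr (1 / r) * BB x epowr ((p - q) / (p * q))) epowr r \<le> K4 epowr r"
    unfolding K4_def using r by (intro epowr_mono SUP_upper) auto
  moreover have "(p - q) / (p * q) * r = (p - q) / p * (r / q)" by simp
  ultimately show ?thesis using r by (simp only: epowr_mult epowr_epowr) simp
qed

lemma fin_P\<Phi>:
  assumes "\<And>t. t \<in> D \<Longrightarrow> P t * \<Phi> t epowr (r / p) < top" and t: "t \<in> D"
  shows "P t < top" "\<Phi> t < top"
proof -
  show "\<Phi> t < top" using ennreal_mult_less_topD[OF assms(1)[OF t] P_pos[OF t]] by simp
  show "P t < top"
    by (rule ennreal_mult_less_topD[OF assms(1)[OF t, unfolded mult.commute[of "P t"]]]) (simp add: \<Phi>_pos t)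
qed

lemma fin_U:
  assumes "P t < top" and "x \<in> D"
  shows "U t x < top"
proof (cases "t \<le> x")
  case True
  have "W x * U t x epowr (r / q) < top"
    using UW_le_P[OF True] assms(1) by (simp add: mult.commute le_less_trans)
  then have "U t x epowr (r / q) < top" by (rule ennreal_mult_less_topD[OF _ W_pos[OF assms(2)]])
  then show ?thesis by simp
qed (simp add: U_def)

text \<open>The w-mass right of \<open>y\<close> contributes to \<open>P t\<close> with a factor of
  at least U(t,y)^(r/q), as in \<open>UW_le_P\<close>. For p <= q the local term is thus already
  controlled by \<open>K1\<close>, and case (i) has a single constant.\<close>

lemma W_SS_le: "W y * SS y epowr (r / q) \<le> K1 epowr r"
proof -
  have "W y * SS y epowr (r / q) = (SUP t\<in>D \<inter> {..<y}. W y * (U t y * \<Phi> t epowr (q / p)) epowr (r / q))"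
    unfolding SS_def using q r by (simp add: epowr_SUP SUP_mult_left_ennreal)
  also have "\<dots> \<le> K1 epowr r"
  proof (rule SUP_least)
    fix t assume t: "t \<in> D \<inter> {..<y}"
    have "W y * (U t y * \<Phi> t epowr (q / p)) epowr (r / q) = (U t y epowr (r / q) * W y) * \<Phi> t epowr (r / p)"
      using q by (simp add: epowr_mult epowr_epowr ac_simps)
    also have "\<dots> \<le> P t * \<Phi> t epowr (r / p)" using t by (intro mult_right_mono UW_le_P) auto
    also have "\<dots> \<le> K1 epowr r" using t by (intro K1_le) auto
    finally show "W y * (U t y * \<Phi> t epowr (q / p)) epowr (r / q) \<le> K1 epowr r" .
  qed
  finally show ?thesis .
qed

lemma scale_le:
  assumes "Kl y \<le> k * G" "W y * G epowr (r / q) \<le> B"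
  shows "W y * Kl y epowr (r / q) \<le> k epowr (r / q) * B"
proof -
  have "W y * Kl y epowr (r / q) \<le> W y * (k * G) epowr (r / q)"
    using assms(1) q r by (intro mult_left_mono epowr_mono) auto
  also have "\<dots> = k epowr (r / q) * (W y * G epowr (r / q))" by (simp add: epowr_mult ac_simps)
  also have "\<dots> \<le> k epowr (r / q) * B" using assms(2) by (intro mult_left_mono) auto
  finally show ?thesis .
qed

lemma case1_sufficient:
  assumes "p \<le> r" "p \<le> q" and K: "K1 < top" and f: "f \<in> Adm" "nrm f < top"
  shows "ig D (\<lambda>x. HL f x epowr (r / q) * w x) \<le> c_ge q r * k_ge q epowr (r / q) * (K1 epowr r * nrm f epowr (r / p))"
proof -
  have X1: "P t * \<Phi> t epowr (r / p) \<le> k_ge q epowr (r / q) * K1 epowr r" if "t \<in> D" for t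
  proof -
    have "1 * K1 epowr r \<le> k_ge q epowr (r / q) * K1 epowr r"
      unfolding k_ge_def epowr_epowr using q r by (intro mult_right_mono four_ge_1) auto
    then show ?thesis using K1_le[OF that] by simp
  qed
  have fin: "P t * \<Phi> t epowr (r / p) < top" if "t \<in> D" for t
    by (rule le_less_trans[OF K1_le[OF that]]) (simp add: K)
  have \<Phi>: "\<Phi> t < top" if "t \<in> D" for t using fin that by (rule fin_P\<Phi>(2))
  have X2: "W y * Kl y epowr (r / q) \<le> k_ge q epowr (r / q) * K1 epowr r" if "y \<in> D" for y
    unfolding k_ge_def by (rule scale_le[OF Kl_le_SS[OF assms(2) that \<Phi>[OF that]] W_SS_le])
  have "k_ge q epowr (r / q) * K1 epowr r < top"
    using K by (simp add: ennreal_mult_less_top k_ge_def)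
  from sufficiency_ge[OF assms(1) this X1 X2 f] show ?thesis by (simp add: c_ge_def mult.assoc)
qed

lemma case3_sufficient:
  assumes "p \<le> r" "q < p" and K: "K1 + K4 < top" and f: "f \<in> Adm" "nrm f < top"
  shows "ig D (\<lambda>x. HL f x epowr (r / q) * w x) \<le> c_ge q r * k_lt q epowr (r / q) * ((K1 + K4) epowr r * nrm f epowr (r / p))"
proof -
  define K where "K = (K1 + K4) epowr r"
  have KK: "K1 epowr r \<le> K" "K4 epowr r \<le> K" unfolding K_def using r by (auto intro!: epowr_mono)
  have Kt: "K < top" unfolding K_def using K by simp
  have k1: "1 \<le> k_lt q epowr (r / q)"
  proof -
    have "1 * 1 \<le> 8 * (4::ennreal) epowr q" using q by (intro mult_mono four_ge_1) auto
    then show ?thesis unfolding k_lt_def using epowr_mono[of 1 "8 * 4 epowr q" "r / q"] q r by simp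
  qed
  have X1: "P t * \<Phi> t epowr (r / p) \<le> k_lt q epowr (r / q) * K" if "t \<in> D" for t
  proof -
    have "1 * K \<le> k_lt q epowr (r / q) * K" using k1 by (intro mult_right_mono) auto
    then show ?thesis using order_trans[OF K1_le[OF that] KK(1)] by simp
  qed
  have fin: "P t * \<Phi> t epowr (r / p) < top" if "t \<in> D" for t
    using order_trans[OF K1_le[OF that] KK(1)] Kt by (rule le_less_trans)
  note fin' = fin_P\<Phi>[OF fin]
  have X2: "W y * Kl y epowr (r / q) \<le> k_lt q epowr (r / q) * K" if y: "y \<in> D" for y
  proof (rule scale_le)
    have "Kl y \<le> 4 epowr q * (2 * BB y epowr ((p - q) / p))"
      using assms(2) y fin' by (intro Kl_le_BB fin_U) auto
    \<comment> \<open>The 2 of \<open>Kl_le_BB\<close> is enlarged to the 8 in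
      \<open>k_lt\<close>.\<close>
    also have "\<dots> \<le> 4 epowr q * (8 * BB y epowr ((p - q) / p))"
      by (intro mult_left_mono mult_right_mono) auto
    finally show "Kl y \<le> k_lt q * BB y epowr ((p - q) / p)" by (simp add: k_lt_def ac_simps)
    show "W y * (BB y epowr ((p - q) / p)) epowr (r / q) \<le> K" using order_trans[OF K4_le[OF y] KK(2)] .
  qed
  have "k_lt q epowr (r / q) * K < top"
    using Kt by (simp add: ennreal_mult_less_top k_lt_def)
  from sufficiency_ge[OF assms(1) this X1 X2 f] show ?thesis by (simp add: c_ge_def K_def mult.assoc)
qed

lemma integral_scale_le:
  assumes rp: "r < p" and G: "\<And>x. x \<in> D \<Longrightarrow> Kl x \<le> k * G x" and [measurable]: "G \<in> borel_measurable lebesgue"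
  shows "ig D (\<lambda>x. W x epowr (r / (p - r)) * w x * Kl x epowr (r * p / (q * (p - r))))
    \<le> k epowr (r * p / (q * (p - r))) * ig D (\<lambda>x. W x epowr (r / (p - r)) * w x * G x epowr (r * p / (q * (p - r))))"
proof -
  define \<sigma> where "\<sigma> = r * p / (q * (p - r))"
  have \<sigma>: "0 < \<sigma>" using p q r rp by (simp add: \<sigma>_def)
  have "ig D (\<lambda>x. W x epowr (r / (p - r)) * w x * Kl x epowr \<sigma>) \<le> ig D (\<lambda>x. k epowr \<sigma> * (W x epowr (r / (p - r)) * w x * G x epowr \<sigma>))"
  proof (intro ig_mono)
    fix x assume "x \<in> D"
    then have "Kl x epowr \<sigma> \<le> (k * G x) epowr \<sigma>" using G \<sigma> by (intro epowr_mono) auto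
    then have "W x epowr (r / (p - r)) * w x * Kl x epowr \<sigma> \<le> W x epowr (r / (p - r)) * w x * (k epowr \<sigma> * G x epowr \<sigma>)"
      by (simp add: epowr_mult mult_left_mono)
    then show "W x epowr (r / (p - r)) * w x * Kl x epowr \<sigma> \<le> k epowr \<sigma> * (W x epowr (r / (p - r)) * w x * G x epowr \<sigma>)"
      by (simp only: ac_simps)
  qed auto
  also have "\<dots> = k epowr \<sigma> * ig D (\<lambda>x. W x epowr (r / (p - r)) * w x * G x epowr \<sigma>)"
    by (intro ig_cmult) auto
  finally show ?thesis by (simp add: \<sigma>_def)
qed

lemma SS_mono: "x \<le> y \<Longrightarrow> SS x \<le> SS y"
  unfolding SS_def by (intro SUP_subset_mono mult_right_mono U_mono) auto

lemma SS_m [measurable]: "SS \<in> borel_measurable lebesgue"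
  by (intro mono_lebesgue) (auto simp: mono_def intro: SS_mono)

lemma BB_mono: "q < p \<Longrightarrow> x \<le> y \<Longrightarrow> BB x \<le> BB y"
  unfolding BB_def using q by (intro ig_mono mult_right_mono epowr_mono U_mono) auto

lemma BB_measurable: "q < p \<Longrightarrow> BB \<in> borel_measurable lebesgue"
  by (intro mono_lebesgue) (auto simp: mono_def intro: BB_mono)

lemma root_cancel: "r < p \<Longrightarrow> G epowr ((p - r) / (p * r)) \<le> K \<Longrightarrow> G \<le> K epowr (p * r / (p - r))"
proof -
  assume rp: "r < p" and "G epowr ((p - r) / (p * r)) \<le> K"
  moreover have "0 < (p - r) / (p * r)" using rp p r by simp
  ultimately show ?thesis using epowr_le_iff[of "(p - r) / (p * r)" G K] by simp
qed

lemma power_cancel: "r < p \<Longrightarrow> (K epowr (p * r / (p - r))) epowr ((p - r) / p) = K epowr r"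
  using p by (simp add: epowr_epowr)

text \<open>The integral in \<open>K3\<close> is used first: it gives the finiteness of
  \<open>\<Phi>\<close> on which the passage from \<open>Kl\<close> to \<open>SS\<close> rests. The
  identity \<sigma> (p-r)/p = r/q brings the constant to the same form as for p <= r.\<close>

lemma case2_sufficient:
  assumes rp: "r < p" and pq: "p \<le> q" and K: "K2 + K3 < top" and f: "f \<in> Adm" "nrm f < top"
  shows "ig D (\<lambda>x. HL f x epowr (r / q) * w x) \<le> c_lt p q r * k_ge q epowr (r / q) * ((K2 + K3) epowr r * nrm f epowr (r / p))"
proof -
  define \<sigma> where "\<sigma> = r * p / (q * (p - r))"
  have \<sigma>: "0 < \<sigma>" "\<sigma> * ((p - r) / p) = r / q" using p q r rp by (auto simp: \<sigma>_def field_simps)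
  define L where "L = (K2 + K3) epowr (p * r / (p - r))"
  have L: "L < top" unfolding L_def using K by simp
  define X where "X = k_ge q epowr \<sigma> * L"
  have Xt: "X < top" unfolding X_def using L by (simp add: ennreal_mult_less_top k_ge_def)
  have LX: "L \<le> X"
  proof -
    have "1 * L \<le> X" unfolding X_def k_ge_def epowr_epowr using q \<sigma> by (intro mult_right_mono four_ge_1) auto
    then show ?thesis by simp
  qed
  have "ig D (\<lambda>x. P x epowr (r / (p - r)) * w x * TT x) \<le> L"
    unfolding L_def by (rule root_cancel[OF rp]) (simp add: K3_def)
  then have X2: "ig D (\<lambda>x. P x epowr (r / (p - r)) * w x * TT x) \<le> X" using LX by (rule order_trans)
  have "ig D (\<lambda>x. W x epowr (r / (p - r)) * w x * Kl x epowr (r * p / (q * (p - r))))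
    \<le> k_ge q epowr (r * p / (q * (p - r))) * ig D (\<lambda>x. W x epowr (r / (p - r)) * w x * SS x epowr (r * p / (q * (p - r))))"
    unfolding k_ge_def using finite_of_integrals'[OF rp Xt X2] by (intro integral_scale_le[OF rp] Kl_le_SS pq) auto
  also have "\<dots> \<le> X"
    unfolding X_def \<sigma>_def L_def by (intro mult_left_mono root_cancel[OF rp]) (simp_all add: K2_def)
  finally have X1: "ig D (\<lambda>x. W x epowr (r / (p - r)) * w x * Kl x epowr (r * p / (q * (p - r)))) \<le> X" .
  have "X epowr ((p - r) / p) = k_ge q epowr (r / q) * (K2 + K3) epowr r"
    unfolding X_def epowr_mult epowr_epowr[of "k_ge q"] \<sigma>(2) L_def power_cancel[OF rp] ..
  then show ?thesis using sufficiency_less[OF rp Xt X1 X2 f] by (simp add: c_lt_def mult.assoc)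
qed

lemma case4_sufficient:
  assumes rp: "r < p" and qp: "q < p" and K: "K3 + K5 < top" and f: "f \<in> Adm" "nrm f < top"
  shows "ig D (\<lambda>x. HL f x epowr (r / q) * w x) \<le> c_lt p q r * k_lt q epowr (r / q) * ((K3 + K5) epowr r * nrm f epowr (r / p))"
proof -
  define \<sigma> where "\<sigma> = r * p / (q * (p - r))"
  have \<sigma>: "0 < \<sigma>" "\<sigma> * ((p - r) / p) = r / q" "(p - q) / p * (r * p / (q * (p - r))) = r * (p - q) / (q * (p - r))"
    using p q r rp by (auto simp: \<sigma>_def field_simps)
  define L where "L = (K3 + K5) epowr (p * r / (p - r))"
  have L: "L < top" unfolding L_def using K by simp
  define X where "X = k_lt q epowr \<sigma> * L"
  have Xt: "X < top" unfolding X_def using L by (simp add: ennreal_mult_less_top k_lt_def)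
  have LX: "L \<le> X"
  proof -
    have "1 * 1 \<le> 8 * (4::ennreal) epowr q" using q by (intro mult_mono four_ge_1) auto
    then have "1 \<le> k_lt q epowr \<sigma>" unfolding k_lt_def using epowr_mono[of 1 "8 * 4 epowr q" \<sigma>] \<sigma> by simp
    then have "1 * L \<le> X" unfolding X_def by (intro mult_right_mono) auto
    then show ?thesis by simp
  qed
  have "ig D (\<lambda>x. P x epowr (r / (p - r)) * w x * TT x) \<le> L"
    unfolding L_def by (rule root_cancel[OF rp]) (simp add: K3_def)
  then have X2: "ig D (\<lambda>x. P x epowr (r / (p - r)) * w x * TT x) \<le> X" using LX by (rule order_trans)
  note fin = finite_of_integrals'[OF rp Xt X2]
  have "ig D (\<lambda>x. W x epowr (r / (p - r)) * w x * Kl x epowr (r * p / (q * (p - r))))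
    \<le> k_lt q epowr (r * p / (q * (p - r))) * ig D (\<lambda>x. W x epowr (r / (p - r)) * w x * (BB x epowr ((p - q) / p)) epowr (r * p / (q * (p - r))))"
  proof (rule integral_scale_le[OF rp])
    note [measurable] = BB_measurable[OF qp]
    show "(\<lambda>x. BB x epowr ((p - q) / p)) \<in> borel_measurable lebesgue" by measurable
    fix y assume y: "y \<in> D"
    have "Kl y \<le> 4 epowr q * (2 * BB y epowr ((p - q) / p))"
      using qp y fin by (intro Kl_le_BB fin_U) auto
    also have "\<dots> \<le> 4 epowr q * (8 * BB y epowr ((p - q) / p))"
      by (intro mult_left_mono mult_right_mono) auto
    finally show "Kl y \<le> k_lt q * BB y epowr ((p - q) / p)" by (simp add: k_lt_def ac_simps)
  qed
  also have "\<dots> \<le> X"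
    unfolding X_def \<sigma>_def L_def epowr_epowr[of "BB _"] \<sigma>(3)
    by (intro mult_left_mono root_cancel[OF rp]) (simp_all add: K5_def)
  finally have X1: "ig D (\<lambda>x. W x epowr (r / (p - r)) * w x * Kl x epowr (r * p / (q * (p - r)))) \<le> X" .
  have "X epowr ((p - r) / p) = k_lt q epowr (r / q) * (K3 + K5) epowr r"
    unfolding X_def epowr_mult epowr_epowr[of "k_lt q"] \<sigma>(2) L_def power_cancel[OF rp] ..
  then show ?thesis using sufficiency_less[OF rp Xt X1 X2 f] by (simp add: c_lt_def mult.assoc)
qed

text \<open>The inequality raised to the power r, the common form of the bounds in both
  directions.\<close>

definition holds :: "real \<Rightarrow> bool" where
  "holds C \<longleftrightarrow> (\<forall>f\<in>Adm. ig D (\<lambda>x. HL f x epowr (r / q) * w x) \<le> ennreal (C powr r) * nrm f epowr (r / p))"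

lemma K1_necessary:
  assumes C: "0 \<le> C" and "holds C"
  shows "K1 \<le> ennreal C"
  unfolding K1_def
proof (rule SUP_least)
  fix x assume x: "x \<in> D"
  have "P x * \<Phi> x epowr (r / p) \<le> ennreal (C powr r)"
    using assms(2) x unfolding holds_def by (intro necessity_P) auto
  then have "(P x * \<Phi> x epowr (r / p)) epowr (1 / r) \<le> ennreal (C powr r) epowr (1 / r)"
    using r by (intro epowr_mono) auto
  then show "P x epowr (1 / r) * \<Phi> x epowr (1 / p) \<le> ennreal C"
    using r C by (simp add: epowr_mult epowr_epowr epowr_ennreal powr_powr)
qed

lemma fin_of_holds:
  assumes "holds C" "t \<in> D"
  shows "P t < top" "\<Phi> t < top"
proof -
  have "P t * \<Phi> t epowr (r / p) < top" if "t \<in> D" for t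
  proof -
    have "P t * \<Phi> t epowr (r / p) \<le> ennreal (C powr r)"
      using assms(1) that unfolding holds_def by (intro necessity_P) auto
    then show ?thesis using ennreal_less_top by (rule le_less_trans)
  qed
  from fin_P\<Phi>[OF this assms(2)] show "P t < top" "\<Phi> t < top" by auto
qed

lemma K4_necessary:
  assumes qp: "q < p" and C: "0 \<le> C" and h: "holds C"
  shows "K4 \<le> ennreal ((hardyL_const (q / p) powr ((p - q) / p)) powr (1 / q)) * ennreal C"
  unfolding K4_def
proof (rule SUP_least)
  fix x assume x: "x \<in> D"
  define k where "k = hardyL_const (q / p) powr ((p - q) / p)"
  have k: "0 \<le> k" by (simp add: k_def)
  have W: "W x * Kl x epowr (r / q) \<le> ennreal (C powr r)"
    using h unfolding holds_def by (intro necessity_Kl) auto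
  have "BB x epowr ((p - q) / p) \<le> ennreal k * Kl x"
    unfolding k_def using fin_of_holds(2)[OF h] x by (intro BB_le_Kl qp) auto
  then have "W x * (BB x epowr ((p - q) / p)) epowr (r / q) \<le> W x * (ennreal k * Kl x) epowr (r / q)"
    using q r by (intro mult_left_mono epowr_mono) auto
  also have "\<dots> = ennreal k epowr (r / q) * (W x * Kl x epowr (r / q))" by (simp add: epowr_mult ac_simps)
  also have "\<dots> \<le> ennreal k epowr (r / q) * ennreal (C powr r)" using W by (intro mult_left_mono) auto
  finally have "(W x * (BB x epowr ((p - q) / p)) epowr (r / q)) epowr (1 / r)
      \<le> (ennreal k epowr (r / q) * ennreal (C powr r)) epowr (1 / r)"
    using r by (intro epowr_mono) auto
  moreover have "(p - q) / p * (r / q) * (1 / r) = (p - q) / (p * q)" "r / q * (1 / r) = 1 / q" using r by auto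
  moreover have "ennreal (C powr r) epowr (1 / r) = ennreal C" using r C by (simp add: epowr_ennreal powr_powr)
  ultimately have "W x epowr (1 / r) * BB x epowr ((p - q) / (p * q)) \<le> ennreal k epowr (1 / q) * ennreal C"
    by (simp only: epowr_mult epowr_epowr mult.assoc)
  then show "W x epowr (1 / r) * BB x epowr ((p - q) / (p * q)) \<le> ennreal (k powr (1 / q)) * ennreal C"
    using k by (simp add: epowr_ennreal)
qed

text \<open>The exponents r p/(p-r) and (p-r)/(p r) are reciprocal, so \<open>C\<close> comes out to
  the first power, as a comparison of best constants requires.\<close>

lemma root_bound:
  assumes rp: "r < p" and C: "0 \<le> C" and "G \<le> k * ennreal (hardyL_const (r / p) * (C powr r) powr (p / (p - r)))"
  shows "G epowr ((p - r) / (p * r)) \<le> (k * ennreal (hardyL_const (r / p))) epowr ((p - r) / (p * r)) * ennreal C"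
proof -
  have e: "0 < (p - r) / (p * r)" "r * (p / (p - r)) * ((p - r) / (p * r)) = 1" using p r rp by auto
  have "G epowr ((p - r) / (p * r)) \<le> (k * ennreal (hardyL_const (r / p) * (C powr r) powr (p / (p - r)))) epowr ((p - r) / (p * r))"
    using assms(3) e by (intro epowr_mono) auto
  also have "ennreal (hardyL_const (r / p) * (C powr r) powr (p / (p - r))) = ennreal (hardyL_const (r / p)) * ennreal C epowr (r * (p / (p - r)))"
    using C hardyL_const_nonneg[of "r / p"] by (simp add: ennreal_mult epowr_ennreal powr_powr)
  also have "(k * (ennreal (hardyL_const (r / p)) * ennreal C epowr (r * (p / (p - r))))) epowr ((p - r) / (p * r))
      = (k * ennreal (hardyL_const (r / p))) epowr ((p - r) / (p * r)) * ennreal C"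
    unfolding epowr_mult epowr_epowr e(2) by (simp add: mult.assoc)
  finally show ?thesis .
qed

lemma integral_Kl_necessary:
  assumes rp: "r < p" and h: "holds C"
  shows "ig D (\<lambda>x. W x epowr (r / (p - r)) * w x * Kl x epowr (r * p / (q * (p - r))))
    \<le> ennreal (hardyL_const (r / p) * (C powr r) powr (p / (p - r)))"
  using h unfolding holds_def by (intro necessity_Kl_less rp) auto

lemma K3_necessary:
  assumes rp: "r < p" and C: "0 \<le> C" and h: "holds C"
  shows "K3 \<le> (c_P p q r * ennreal (hardyL_const (r / p))) epowr ((p - r) / (p * r)) * ennreal C"
  unfolding K3_def
proof (rule root_bound[OF rp C])
  show "ig D (\<lambda>x. P x epowr (r / (p - r)) * w x * TT x) \<le> c_P p q r * ennreal (hardyL_const (r / p) * (C powr r) powr (p / (p - r)))"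
    using h unfolding holds_def by (intro necessity_P_less rp) auto
qed

lemma K2_necessary:
  assumes rp: "r < p" and C: "0 \<le> C" and h: "holds C"
  shows "K2 \<le> (1 * ennreal (hardyL_const (r / p))) epowr ((p - r) / (p * r)) * ennreal C"
  unfolding K2_def
proof (rule root_bound[OF rp C])
  have "ig D (\<lambda>x. W x epowr (r / (p - r)) * w x * SS x epowr (r * p / (q * (p - r))))
      \<le> ig D (\<lambda>x. W x epowr (r / (p - r)) * w x * Kl x epowr (r * p / (q * (p - r))))"
    using p q r rp by (intro ig_mono mult_left_mono epowr_mono SS_le_Kl) auto
  also have "\<dots> \<le> ennreal (hardyL_const (r / p) * (C powr r) powr (p / (p - r)))"
    by (rule integral_Kl_necessary[OF rp h])
  finally show "ig D (\<lambda>x. W x epowr (r / (p - r)) * w x * SS x epowr (r * p / (q * (p - r)))) \<le> 1 * \<dots>" by simp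
qed

lemma K5_necessary:
  assumes rp: "r < p" and qp: "q < p" and C: "0 \<le> C" and h: "holds C"
  shows "K5 \<le> (ennreal (hardyL_const (q / p) powr ((p - q) / p)) epowr (r * p / (q * (p - r))) * ennreal (hardyL_const (r / p))) epowr ((p - r) / (p * r)) * ennreal C"
  unfolding K5_def
proof (rule root_bound[OF rp C])
  define \<sigma> where "\<sigma> = r * p / (q * (p - r))"
  define k where "k = ennreal (hardyL_const (q / p) powr ((p - q) / p))"
  have \<sigma>: "0 < \<sigma>" "(p - q) / p * \<sigma> = r * (p - q) / (q * (p - r))"
    using p q r rp by (auto simp: \<sigma>_def field_simps)
  have "ig D (\<lambda>x. W x epowr (r / (p - r)) * w x * BB x epowr (r * (p - q) / (q * (p - r))))
      \<le> ig D (\<lambda>x. k epowr \<sigma> * (W x epowr (r / (p - r)) * w x * Kl x epowr \<sigma>))"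
  proof (intro ig_mono)
    fix x assume x: "x \<in> D"
    have "(BB x epowr ((p - q) / p)) epowr \<sigma> \<le> (k * Kl x) epowr \<sigma>"
      unfolding k_def using \<sigma> fin_of_holds(2)[OF h] x by (intro epowr_mono BB_le_Kl qp) auto
    then have "BB x epowr (r * (p - q) / (q * (p - r))) \<le> k epowr \<sigma> * Kl x epowr \<sigma>"
      by (simp only: epowr_epowr \<sigma>(2) epowr_mult)
    then have "W x epowr (r / (p - r)) * w x * BB x epowr (r * (p - q) / (q * (p - r))) \<le> W x epowr (r / (p - r)) * w x * (k epowr \<sigma> * Kl x epowr \<sigma>)"
      by (intro mult_left_mono) auto
    then show "W x epowr (r / (p - r)) * w x * BB x epowr (r * (p - q) / (q * (p - r))) \<le> k epowr \<sigma> * (W x epowr (r / (p - r)) * w x * Kl x epowr \<sigma>)"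
      by (simp only: ac_simps)
  qed auto
  also have "\<dots> = k epowr \<sigma> * ig D (\<lambda>x. W x epowr (r / (p - r)) * w x * Kl x epowr \<sigma>)"
    by (intro ig_cmult) auto
  also have "\<dots> \<le> k epowr \<sigma> * ennreal (hardyL_const (r / p) * (C powr r) powr (p / (p - r)))"
    unfolding \<sigma>_def by (intro mult_left_mono integral_Kl_necessary[OF rp h]) auto
  finally show "ig D (\<lambda>x. W x epowr (r / (p - r)) * w x * BB x epowr (r * (p - q) / (q * (p - r))))
      \<le> ennreal (hardyL_const (q / p) powr ((p - q) / p)) epowr (r * p / (q * (p - r))) * ennreal (hardyL_const (r / p) * (C powr r) powr (p / (p - r)))"
    by (simp only: k_def \<sigma>_def)
qed

end

section \<open>Weights on an interval\<close>

lemma ess_sup_on_AE: "AE s in lebesgue. s \<in> einterval x y \<longrightarrow> g s \<le> ess_sup_on x y g"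
  using esssup_AE[where M="lebesgue_on (einterval x y)" and f=g] unfolding ess_sup_on_def
  by (subst (asm) AE_restrict_space_iff) (simp_all add: borel_lebesgue)

lemma ess_sup_on_le:
  assumes "g \<in> borel_measurable (lebesgue_on (einterval x y))" "AE s in lebesgue. s \<in> einterval x y \<longrightarrow> g s \<le> c"
  shows "ess_sup_on x y g \<le> c"
  unfolding ess_sup_on_def using assms
  by (intro esssup_I) (simp_all add: AE_restrict_space_iff borel_lebesgue)

lemma AE_interval_point:
  assumes "AE t in lebesgue. Q t" "x < (y::real)"
  shows "\<exists>t. x < t \<and> t < y \<and> Q t"
proof (rule ccontr)
  assume "\<not> ?thesis"
  then have "AE t in lebesgue. t \<notin> {x<..<y}" using assms(1) by (auto elim!: eventually_mono)
  then have "emeasure lebesgue {x<..<y} = 0"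
    by (subst (asm) AE_iff_measurable[where N="{x<..<y}"]) auto
  then show False using \<open>x < y\<close> by simp
qed

text \<open>Left continuity of the nondecreasing factor makes the essential supremum a supremum.\<close>

lemma ess_sup_on_product:
  assumes S: "S = einterval x y" and m: "(\<lambda>t. \<alpha> t * \<beta> t) \<in> borel_measurable (lebesgue_on S)"
    and anti: "\<And>s t. s \<in> S \<Longrightarrow> t \<in> S \<Longrightarrow> s \<le> t \<Longrightarrow> \<alpha> t \<le> \<alpha> s"
    and mono: "\<And>s t. s \<in> S \<Longrightarrow> t \<in> S \<Longrightarrow> s \<le> t \<Longrightarrow> \<beta> s \<le> \<beta> t"
    and left: "\<And>t. t \<in> S \<Longrightarrow> \<beta> t \<le> (SUP s\<in>S \<inter> {..<t}. \<beta> s)"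
  shows "ess_sup_on x y (\<lambda>t. \<alpha> t * \<beta> t) = (SUP t\<in>S. \<alpha> t * \<beta> t)"
proof (rule antisym)
  show "ess_sup_on x y (\<lambda>t. \<alpha> t * \<beta> t) \<le> (SUP t\<in>S. \<alpha> t * \<beta> t)"
    using m unfolding S by (intro ess_sup_on_le AE_I2) (auto intro: SUP_upper)
  let ?M = "ess_sup_on x y (\<lambda>t. \<alpha> t * \<beta> t)"
  show "(SUP t\<in>S. \<alpha> t * \<beta> t) \<le> ?M"
  proof (rule SUP_least)
    fix t assume t: "t \<in> S"
    have "\<alpha> t * \<beta> t \<le> \<alpha> t * (SUP s\<in>S \<inter> {..<t}. \<beta> s)"
      by (intro mult_left_mono left t) auto
    also have "\<dots> = (SUP s\<in>S \<inter> {..<t}. \<alpha> t * \<beta> s)" by (rule SUP_mult_left_ennreal)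
    also have "\<dots> \<le> ?M"
    proof (rule SUP_least)
      fix s assume s: "s \<in> S \<inter> {..<t}"
      then have "s < t" by simp
      from AE_interval_point[OF ess_sup_on_AE[of x y "\<lambda>t. \<alpha> t * \<beta> t"] this]
      obtain z where z: "s < z" "z < t" "z \<in> einterval x y \<longrightarrow> \<alpha> z * \<beta> z \<le> ?M" by blast
      have "x < ereal s" "ereal s < ereal z" "ereal z < ereal t" "ereal t < y"
        using s t z(1,2) by (auto simp: S einterval_iff)
      then have zS: "z \<in> S" unfolding S einterval_iff by (blast intro: less_trans)
      have "\<alpha> t * \<beta> s \<le> \<alpha> z * \<beta> z" using s t z zS by (intro mult_mono anti mono) auto
      then show "\<alpha> t * \<beta> s \<le> ?M" using z(3) zS by (auto simp: S)
    qed
    finally show "\<alpha> t * \<beta> t \<le> ?M" .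
  qed
qed

definition zext :: "ereal \<Rightarrow> ereal \<Rightarrow> (real \<Rightarrow> ennreal) \<Rightarrow> real \<Rightarrow> ennreal" where
  "zext a b g x = (if x \<in> einterval a b then g x else 0)"

lemma zext_measurable:
  assumes "g \<in> borel_measurable (lebesgue_on (einterval a b))"
  shows "zext a b g \<in> borel_measurable lebesgue"
proof -
  have "(\<lambda>x. g x * indicator (einterval a b) x) \<in> borel_measurable lebesgue"
    using assms by (subst (asm) borel_measurable_restrict_space_iff_ennreal) (auto simp: borel_lebesgue)
  also have "(\<lambda>x. g x * indicator (einterval a b) x) = zext a b g"
    by (auto simp: zext_def indicator_def)
  finally show ?thesis .
qed

locale weights =
  fixes a b :: ereal and u v w :: "real \<Rightarrow> real" and p q r :: real
  assumes ab: "a < b" and wt: "weight a b u" "weight a b v" "weight a b w"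
    and p1: "1 \<le> p" and q0: "0 < q" and r0: "0 < r"
begin

abbreviation "D \<equiv> einterval a b"
definition "u' = zext a b (\<lambda>x. ennreal (u x))"
definition "v' = zext a b (\<lambda>x. ennreal (v x))"
definition "w' = zext a b (\<lambda>x. ennreal (w x))"
definition "V x = Vp p v a (ereal x)"
text \<open>The supremum makes \<open>\<Phi>\<close> nondecreasing on the whole line, not only on \<open>(a, b)\<close>.\<close>

definition "\<Phi> x = (SUP y\<in>D \<inter> {..x}. V y epowr p)"

lemma v_m [measurable]: "v \<in> borel_measurable (lebesgue_on D)" and v_pos: "x \<in> D \<Longrightarrow> 0 < v x"
  using wt(2) by (auto simp: weight_def)

lemma ext_m [measurable]: "u' \<in> borel_measurable lebesgue" "v' \<in> borel_measurable lebesgue" "w' \<in> borel_measurable lebesgue"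
  using wt unfolding u'_def v'_def w'_def weight_def by (auto intro!: zext_measurable)

lemma D_between: "x \<in> D \<Longrightarrow> z \<in> D \<Longrightarrow> x \<le> y \<Longrightarrow> y \<le> z \<Longrightarrow> y \<in> D"
  unfolding einterval_iff by (metis ereal_less_eq(3) le_less_trans less_le_trans)

lemma einterval_left: "x \<in> D \<Longrightarrow> einterval a (ereal x) = D \<inter> {..<x}"
  unfolding einterval_iff einterval_def by (auto intro: less_trans[of _ "ereal x"])

lemma einterval_right: "x \<in> D \<Longrightarrow> einterval (ereal x) b = D \<inter> {x<..}"
  unfolding einterval_iff einterval_def by (auto intro: less_trans[of _ "ereal x"])

lemma integ_left:
  assumes "x \<in> D" "\<And>t. t \<in> D \<Longrightarrow> t < x \<Longrightarrow> g t = g' t" "\<And>t. t \<notin> D \<Longrightarrow> g' t = 0"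
  shows "integ a (ereal x) g = ig {..<x} g'"
proof -
  have "ig {..<x} g' = ig ({..<x} \<inter> D) g'" using assms(3) by (intro ig_restrict) auto
  also have "\<dots> = ig (einterval a (ereal x)) g" using assms by (intro ig_cong) (auto simp: einterval_left)
  finally show ?thesis by (simp add: integ_def ig_def)
qed

lemma integ_right:
  assumes "x \<in> D" "\<And>t. t \<in> D \<Longrightarrow> x < t \<Longrightarrow> g t = g' t" "\<And>t. t \<notin> D \<Longrightarrow> g' t = 0"
  shows "integ (ereal x) b g = ig {x..} g'"
proof -
  have "ig {x..} g' = ig ({x<..} \<union> {x}) g'" by (intro ig_cong) auto
  also have "\<dots> = ig {x<..} g'" by (intro ig_point) simp
  also have "\<dots> = ig ({x<..} \<inter> D) g'" using assms(3) by (intro ig_restrict) auto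
  also have "\<dots> = ig (einterval (ereal x) b) g" using assms by (intro ig_cong) (auto simp: einterval_right)
  finally show ?thesis by (simp add: integ_def ig_def)
qed

lemma integ_mid:
  assumes "s \<in> D" "x \<in> D" "\<And>t. t \<in> D \<Longrightarrow> g t = g' t"
  shows "integ (ereal s) (ereal x) g = ig {s..<x} g'"
proof -
  have sub: "t \<in> D" if "s \<le> t" "t < x" for t using D_between[OF assms(1,2)] that by simp
  show ?thesis
  proof (cases "s < x")
    case True
    have "ig {s..<x} g' = ig ({s<..<x} \<union> {s}) g'" using True by (intro ig_cong) auto
    also have "\<dots> = ig {s<..<x} g'" by (intro ig_point) simp
    also have "\<dots> = ig (einterval (ereal s) (ereal x)) g" using assms sub by (intro ig_cong) auto
    finally show ?thesis by (simp add: integ_def ig_def)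
  qed (simp add: integ_def ig_def)
qed

lemma integ_all: "(\<And>t. t \<in> D \<Longrightarrow> g t = g' t) \<Longrightarrow> integ a b g = ig D g'"
  unfolding integ_def ig_def by (intro nn_integral_cong) (auto simp: indicator_def)

text \<open>The dual weight v^(1-p') with p' = p/(p-1); it is used for p > 1 only.\<close>

definition "\<sigma> = zext a b (\<lambda>s. ennreal (v s powr (- (1 / (p - 1)))))"

lemma \<sigma>_m [measurable]: "\<sigma> \<in> borel_measurable lebesgue"
  unfolding \<sigma>_def by (intro zext_measurable) measurable

lemma V_gt1: "1 < p \<Longrightarrow> x \<in> D \<Longrightarrow> V x = ig {..<x} \<sigma> epowr ((p - 1) / p)"
  unfolding V_def Vp_def by (simp add: integ_left[where g'=\<sigma>] \<sigma>_def zext_def)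

lemma V_1: "p = 1 \<Longrightarrow> V x = ess_sup_on a (ereal x) (\<lambda>s. ennreal (inverse (v s)))"
  unfolding V_def Vp_def by simp

lemma inv_v_m: "x \<in> D \<Longrightarrow> (\<lambda>s. ennreal (inverse (v s))) \<in> borel_measurable (lebesgue_on (einterval a (ereal x)))"
proof -
  assume "x \<in> D"
  have "(\<lambda>s. ennreal (inverse (v s))) \<in> borel_measurable (lebesgue_on D)" by measurable
  then show ?thesis by (rule measurable_restrict_mono) (auto simp: einterval_left[OF \<open>x \<in> D\<close>])
qed

lemma V_mono: "x \<in> D \<Longrightarrow> y \<in> D \<Longrightarrow> x \<le> y \<Longrightarrow> V x \<le> V y"
proof (cases "p = 1")
  case True
  assume x: "x \<in> D" "y \<in> D" "x \<le> y"
  have "AE s in lebesgue. s \<in> einterval a (ereal x) \<longrightarrow> ennreal (inverse (v s)) \<le> V y"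
    unfolding V_1[OF True] using ess_sup_on_AE[of a "ereal y" "\<lambda>s. ennreal (inverse (v s))"] x
    by (auto simp: einterval_left elim!: eventually_mono)
  then show ?thesis unfolding V_1[OF True, of x] by (intro ess_sup_on_le inv_v_m x)
next
  case False
  assume x: "x \<in> D" "y \<in> D" "x \<le> y"
  have "1 < p" using False p1 by simp
  then show ?thesis using x by (auto simp: V_gt1 intro!: epowr_mono ig_mono)
qed

text \<open>Left continuity. For p = 1 the bound for 1/v holds almost everywhere left of each
  rational below \<open>x\<close>, and countably many exceptional null sets suffice; for p > 1 it is
  monotone convergence of the integral of \<open>\<sigma>\<close>.\<close>

lemma V_left: "x \<in> D \<Longrightarrow> V x \<le> (SUP y\<in>D \<inter> {..<x}. V y)"
proof (cases "p = 1")
  case True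
  assume x: "x \<in> D"
  let ?c = "SUP y\<in>D \<inter> {..<x}. V y"
  have "AE s in lebesgue. \<forall>\<rho>::rat. of_rat \<rho> \<in> D \<inter> {..<x} \<longrightarrow> s \<in> D \<longrightarrow> s < of_rat \<rho> \<longrightarrow> ennreal (inverse (v s)) \<le> ?c"
    unfolding AE_all_countable
  proof
    fix \<rho> :: rat
    show "AE s in lebesgue. of_rat \<rho> \<in> D \<inter> {..<x} \<longrightarrow> s \<in> D \<longrightarrow> s < of_rat \<rho> \<longrightarrow> ennreal (inverse (v s)) \<le> ?c"
    proof (cases "(of_rat \<rho> :: real) \<in> D \<inter> {..<x}")
      case \<rho>: True
      then have "V (of_rat \<rho>) \<le> ?c" by (intro SUP_upper)
      then show ?thesis
        using ess_sup_on_AE[of a "ereal (of_rat \<rho>)" "\<lambda>s. ennreal (inverse (v s))"] \<rho>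
        unfolding V_1[OF True] by (auto simp: einterval_left elim!: eventually_mono)
    qed auto
  qed
  then have "AE s in lebesgue. s \<in> einterval a (ereal x) \<longrightarrow> ennreal (inverse (v s)) \<le> ?c"
  proof (rule eventually_mono, intro impI)
    fix s assume *: "\<forall>\<rho>::rat. of_rat \<rho> \<in> D \<inter> {..<x} \<longrightarrow> s \<in> D \<longrightarrow> s < of_rat \<rho> \<longrightarrow> ennreal (inverse (v s)) \<le> ?c"
      and "s \<in> einterval a (ereal x)"
    then have s: "s \<in> D" "s < x" using x by (auto simp: einterval_left)
    obtain \<rho> where \<rho>: "s < of_rat \<rho>" "of_rat \<rho> < x" using of_rat_dense[OF s(2)] by blast
    then have "of_rat \<rho> \<in> D \<inter> {..<x}" using D_between[OF s(1) x, of "of_rat \<rho>"] by auto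
    then show "ennreal (inverse (v s)) \<le> ?c" using * s \<rho> by blast
  qed
  then show ?thesis unfolding V_1[OF True, of x] by (intro ess_sup_on_le inv_v_m x)
next
  case False
  assume x: "x \<in> D"
  have p: "1 < p" using False p1 by simp
  then have e: "0 < (p - 1) / p" by simp
  let ?B = "(SUP y\<in>D \<inter> {..<x}. V y) epowr (1 / ((p - 1) / p))"
  have "D \<inter> {..<x} \<noteq> {}" using einterval_nonempty[of a "ereal x"] x einterval_left[OF x] by (auto simp: einterval_iff)
  then have "ig (D \<inter> {..<x}) \<sigma> \<le> ?B"
  proof (rule ig_le_cutoff(2)[rotated])
    show "\<sigma> \<in> borel_measurable lebesgue" by measurable
    show "open (D \<inter> {..<x})" by (intro open_Int open_einterval open_lessThan)
    fix y assume y: "y \<in> D \<inter> {..<x}"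
    have "ig {..<y} \<sigma> epowr ((p - 1) / p) \<le> (SUP y\<in>D \<inter> {..<x}. V y)"
      using y p by (subst V_gt1[symmetric]) (auto intro: SUP_upper)
    then show "ig {..<y} \<sigma> \<le> ?B" using epowr_le_iff[OF e] by blast
  qed
  moreover have "ig {..<x} \<sigma> = ig ({..<x} \<inter> D) \<sigma>" by (intro ig_restrict) (auto simp: \<sigma>_def zext_def)
  ultimately have "ig {..<x} \<sigma> \<le> ?B" by (simp add: Int_commute)
  then show ?thesis unfolding V_gt1[OF p x] using epowr_le_iff[OF e] by blast
qed

lemma \<Phi>_eq: "x \<in> D \<Longrightarrow> \<Phi> x = V x epowr p"
  unfolding \<Phi>_def using p1 by (intro antisym SUP_least SUP_upper) (auto intro!: epowr_mono V_mono)

lemma \<Phi>_1: "p = 1 \<Longrightarrow> x \<in> D \<Longrightarrow> \<Phi> x = V x"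
  using \<Phi>_eq[of x] epowr_one[of "V x"] by metis

lemma V_eq: "x \<in> D \<Longrightarrow> V x epowr s = \<Phi> x epowr (s / p)"
  using p1 by (simp add: \<Phi>_eq epowr_epowr)

lemma \<Phi>_gt1: "1 < p \<Longrightarrow> x \<in> D \<Longrightarrow> \<Phi> x = ig {..<x} \<sigma> epowr (p - 1)"
  by (simp add: \<Phi>_eq V_gt1 epowr_epowr)

lemma \<Phi>_pos: "x \<in> D \<Longrightarrow> 0 < \<Phi> x"
proof (cases "p = 1")
  case True
  assume x: "x \<in> D"
  obtain y where y: "y \<in> D" "y < x"
    using einterval_nonempty[of a "ereal x"] x einterval_left[OF x] by (auto simp: einterval_iff)
  from AE_interval_point[OF ess_sup_on_AE[of a "ereal x" "\<lambda>s. ennreal (inverse (v s))"] y(2)]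
  obtain s where s: "y < s" "s < x" "s \<in> einterval a (ereal x) \<longrightarrow> ennreal (inverse (v s)) \<le> V x"
    unfolding V_1[OF True, symmetric] by blast
  have "s \<in> D" using D_between[OF y(1) x, of s] s by simp
  then have "0 < ennreal (inverse (v s))" "ennreal (inverse (v s)) \<le> V x"
    using s x v_pos by (auto simp: einterval_left)
  then show ?thesis unfolding \<Phi>_1[OF True x] by (rule less_le_trans)
next
  case False
  assume x: "x \<in> D"
  have p: "1 < p" using False p1 by simp
  obtain y where y: "y \<in> D" "y < x"
    using einterval_nonempty[of a "ereal x"] x einterval_left[OF x] by (auto simp: einterval_iff)
  have "0 < ig {..<x} \<sigma>"
  proof (rule ig_pos[OF \<sigma>_m y(2)])
    fix t assume "t \<in> {y<..<x}"
    then have "t \<in> D" using D_between[OF y(1) x, of t] by simp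
    then show "0 < \<sigma> t" using v_pos[of t] by (simp add: \<sigma>_def zext_def)
  qed auto
  then show ?thesis using p x by (simp add: \<Phi>_gt1)
qed

text \<open>For p = 1, 1/v is at most V t almost everywhere left of \<open>t\<close>. For p > 1,
  Hoelder's inequality applies to f = (f^p v)^(1/p) \<sigma>^(1-1/p).\<close>

lemma Hoelder_V:
  assumes f [measurable]: "f \<in> borel_measurable lebesgue" and f0: "\<And>x. x \<notin> D \<Longrightarrow> f x = 0"
    and A: "A \<in> sets borel" and t: "t \<in> D" and At: "A \<subseteq> {..<t}"
  shows "ig A f epowr p \<le> \<Phi> t * ig A (\<lambda>x. f x epowr p * v' x)"
proof (cases "p = 1")
  case True
  note [measurable] = borel_lebesgue[OF A]
  have "ig A f \<le> ig A (\<lambda>x. V t * (f x * v' x))"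
    unfolding ig_def
  proof (rule nn_integral_mono_AE)
    show "AE x in lebesgue. f x * indicator A x \<le> V t * (f x * v' x) * indicator A x"
      using ess_sup_on_AE[of a "ereal t" "\<lambda>s. ennreal (inverse (v s))"]
    proof (rule eventually_mono)
      fix x assume *: "x \<in> einterval a (ereal t) \<longrightarrow> ennreal (inverse (v x)) \<le> ess_sup_on a (ereal t) (\<lambda>s. ennreal (inverse (v s)))"
      show "f x * indicator A x \<le> V t * (f x * v' x) * indicator A x"
      proof (cases "x \<in> A \<and> x \<in> D")
        case x: True
        then have "ennreal (inverse (v x)) \<le> V t" using * At t by (auto simp: einterval_left V_1[OF True])
        then have "ennreal (inverse (v x)) * (f x * ennreal (v x)) \<le> V t * (f x * ennreal (v x))" by (intro mult_right_mono) auto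
        moreover have "ennreal (inverse (v x)) * ennreal (v x) = 1"
          using v_pos[of x] x by (simp flip: ennreal_mult)
        then have "ennreal (inverse (v x)) * (f x * ennreal (v x)) = f x" by (metis mult.left_commute mult.right_neutral)
        ultimately show ?thesis using x by (simp add: v'_def zext_def)
      qed (use f0 in auto)
    qed
  qed
  also have "\<dots> = V t * ig A (\<lambda>x. f x * v' x)" by (intro ig_cmult) auto
  finally have "ig A f epowr 1 \<le> \<Phi> t * ig A (\<lambda>x. f x epowr 1 * v' x)" by (simp add: \<Phi>_1[OF True t])
  then show ?thesis by (simp only: True)
next
  case False
  then have p: "1 < p" using p1 by simp
  note [measurable] = borel_lebesgue[OF A]
  define s where "s = 1 / p"
  have s: "0 < s" "s < 1" "p * s = 1" "s * p = 1" "(1 - s) * p = p - 1" using p by (auto simp: s_def field_simps)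
  have "ig A f = (\<integral>\<^sup>+x. ((f x epowr p * v' x) * indicator A x) epowr s * (\<sigma> x * indicator A x) epowr (1 - s) \<partial>lebesgue)"
    unfolding ig_def
  proof (rule nn_integral_cong)
    fix x
    show "f x * indicator A x = ((f x epowr p * v' x) * indicator A x) epowr s * (\<sigma> x * indicator A x) epowr (1 - s)"
    proof (cases "x \<in> A \<and> x \<in> D")
      case x: True
      have vx: "0 < v x" using x v_pos by blast
      have "ennreal (v x) epowr s * ennreal (v x powr (- (1 / (p - 1)))) epowr (1 - s) = ennreal (v x powr (s + - (1 / (p - 1)) * (1 - s)))"
        using vx ennreal_mult[of "v x powr s" "v x powr (- (1 / (p - 1)) * (1 - s))"]
        by (simp only: epowr_ennreal powr_powr powr_add less_imp_le powr_ge_zero)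
      also have "s + - (1 / (p - 1)) * (1 - s) = 0" using p by (simp add: s_def field_simps)
      finally have "ennreal (v x) epowr s * ennreal (v x powr (- (1 / (p - 1)))) epowr (1 - s) = 1" using vx by simp
      then have "(f x epowr p * ennreal (v x)) epowr s * ennreal (v x powr (- (1 / (p - 1)))) epowr (1 - s) = f x"
        by (simp only: epowr_mult epowr_epowr s epowr_one mult.assoc mult.right_neutral)
      then show ?thesis using x by (simp add: v'_def \<sigma>_def zext_def)
    qed (use f0 in \<open>auto simp: v'_def zext_def\<close>)
  qed
  also have "\<dots> \<le> (\<integral>\<^sup>+x. (f x epowr p * v' x) * indicator A x \<partial>lebesgue) epowr s * (\<integral>\<^sup>+x. \<sigma> x * indicator A x \<partial>lebesgue) epowr (1 - s)"
    by (intro nn_integral_Hoelder s) measurable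
  finally have "ig A f \<le> ig A (\<lambda>x. f x epowr p * v' x) epowr s * ig A \<sigma> epowr (1 - s)" by (simp add: ig_def)
  also have "\<dots> \<le> ig A (\<lambda>x. f x epowr p * v' x) epowr s * ig {..<t} \<sigma> epowr (1 - s)"
    using s At by (intro mult_left_mono epowr_mono ig_mono) auto
  finally have "ig A f epowr p \<le> (ig A (\<lambda>x. f x epowr p * v' x) epowr s * ig {..<t} \<sigma> epowr (1 - s)) epowr p"
    using p by (intro epowr_mono) auto
  also have "\<dots> = \<Phi> t * ig A (\<lambda>x. f x epowr p * v' x)"
    unfolding epowr_mult epowr_epowr s \<Phi>_gt1[OF p t] by (simp add: mult.commute)
  finally show ?thesis .
qed

text \<open>For p = 1 a constant on a bounded set of positive measure where 1/v exceeds
  \<open>N\<close>; for p > 1 a multiple of \<open>\<sigma>\<close>, the equality case of Hoelder's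
  inequality. As \<open>\<sigma>\<close> need not be integrable, it is cut to a bounded set on which
  it is bounded.\<close>

lemma extremal_V:
  assumes y: "y \<in> D" and N: "0 < N" "ennreal N < \<Phi> y"
  shows "\<exists>f\<in>borel_measurable lebesgue. (\<forall>x. f x \<noteq> 0 \<longrightarrow> x \<in> D \<and> x < y) \<and>
    ig UNIV (\<lambda>x. f x epowr p * v' x) \<le> 1 \<and> ennreal N \<le> ig UNIV f epowr p"
proof (cases "p = 1")
  case True
  define E where "E n = {x\<in>D. x < y \<and> N < inverse (v x) \<and> \<bar>x\<bar> \<le> real n}" for n
  have Em [measurable]: "E n \<in> sets lebesgue" for n
  proof -
    have "{x\<in>space (lebesgue_on D). x < y \<and> N < inverse (v x) \<and> \<bar>x\<bar> \<le> real n} \<in> sets (lebesgue_on D)"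
    proof -
      have [measurable]: "(\<lambda>x. x) \<in> borel_measurable (lebesgue_on D)"
        by (intro measurable_restrict_space1 measurable_completion) simp
      show ?thesis by measurable
    qed
    then show ?thesis
      by (auto simp: E_def sets_restrict_space_iff borel_lebesgue space_restrict_space)
  qed
  have "\<exists>n. emeasure lebesgue (E n) \<noteq> 0"
  proof (rule ccontr)
    assume "\<not> ?thesis"
    then have "\<forall>n. E n \<in> null_sets lebesgue" by auto
    then have "(\<Union>n. E n) \<in> null_sets lebesgue" by (intro null_sets_UN) auto
    then have "AE s in lebesgue. s \<notin> (\<Union>n. E n)" by (rule AE_not_in)
    then have "AE s in lebesgue. s \<in> einterval a (ereal y) \<longrightarrow> ennreal (inverse (v s)) \<le> ennreal N"
    proof (rule eventually_mono, intro impI)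
      fix s assume *: "s \<notin> (\<Union>n. E n)" "s \<in> einterval a (ereal y)"
      obtain n where "\<bar>s\<bar> \<le> real n" using real_arch_simple by blast
      then have "\<not> N < inverse (v s)" using * y by (auto simp: E_def einterval_left)
      then show "ennreal (inverse (v s)) \<le> ennreal N" by (intro ennreal_leI) simp
    qed
    then have "V y \<le> ennreal N" unfolding V_1[OF True] by (intro ess_sup_on_le inv_v_m y)
    then show False using N \<Phi>_1[OF True y] by simp
  qed
  then obtain n where n: "emeasure lebesgue (E n) \<noteq> 0" by blast
  have "emeasure lebesgue (E n) \<le> emeasure lebesgue {- real n..real n}"
    by (intro emeasure_mono) (auto simp: E_def)
  also have "\<dots> < top" by simp
  finally obtain e where e: "emeasure lebesgue (E n) = ennreal e" "0 < e"
    using n by (metis ennreal_cases ennreal_0 less_eq_real_def less_irrefl)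
  have E1: "ig (E n) (\<lambda>_. 1) = ennreal e" using e by (simp add: ig_def)
  define c where "c = ig (E n) v'"
  \<comment> \<open>N v is at most 1 on \<open>E n\<close>. This makes \<open>c\<close> finite and,
    after division by \<open>c\<close>, bounds the integral of the test function from below by
    \<open>N\<close>.\<close>
  have Nc: "ennreal N * c \<le> ennreal e"
  proof -
    have "ennreal N * c = ig (E n) (\<lambda>x. ennreal N * v' x)" unfolding c_def by (intro ig_cmult[symmetric]) auto
    also have "\<dots> \<le> ig (E n) (\<lambda>_. 1)"
    proof (intro ig_mono)
      fix x assume "x \<in> E n"
      then have x: "x \<in> D" "N < inverse (v x)" by (auto simp: E_def)
      then have "N * v x \<le> 1" using v_pos[of x] by (simp add: field_simps)
      then have "ennreal (N * v x) \<le> 1" by (metis ennreal_1 ennreal_leI)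
      moreover have "ennreal (N * v x) = ennreal N * ennreal (v x)"
        using N v_pos[OF x(1)] by (intro ennreal_mult) auto
      ultimately show "ennreal N * v' x \<le> 1" using x by (simp add: v'_def zext_def)
    qed auto
    finally show ?thesis by (simp add: E1)
  qed
  have "c \<noteq> 0"
  proof
    assume "c = 0"
    then have "AE x in lebesgue. v' x * indicator (E n) x = 0"
      unfolding c_def ig_def by (subst (asm) nn_integral_0_iff_AE) auto
    then have "AE x in lebesgue. x \<notin> E n"
    proof (rule eventually_mono)
      fix x assume "v' x * indicator (E n) x = 0"
      then show "x \<notin> E n" using v_pos[of x] by (auto simp: v'_def zext_def E_def indicator_def split: if_splits)
    qed
    then show False using n by (subst (asm) AE_iff_measurable[where N="E n"]) auto
  qed
  moreover have "c \<noteq> top" using Nc N by (auto simp: ennreal_mult_top top_unique)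
  ultimately obtain c' where c': "c = ennreal c'" "0 < c'"
    by (metis ennreal_cases ennreal_0 less_eq_real_def)
  define f where "f x = ennreal (1 / c') * indicator (E n) x" for x
  have [measurable]: "f \<in> borel_measurable lebesgue" unfolding f_def by measurable
  have inv: "ennreal (1 / c') * ennreal c' = 1" using c' by (simp flip: ennreal_mult)
  show ?thesis
  proof (intro bexI[of _ f] conjI allI impI)
    show "x \<in> D" "x < y" if "f x \<noteq> 0" for x using that by (auto simp: f_def E_def indicator_def split: if_splits)
    have "ig UNIV (\<lambda>x. f x epowr p * v' x) = ig (E n) (\<lambda>x. ennreal (1 / c') * v' x)"
      unfolding ig_def f_def True by (intro nn_integral_cong) (auto simp: indicator_def)
    also have "\<dots> = ennreal (1 / c') * c" unfolding c_def by (intro ig_cmult) auto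
    finally show "ig UNIV (\<lambda>x. f x epowr p * v' x) \<le> 1" using inv c' by simp
    have "ig UNIV f = ennreal (1 / c') * ennreal e"
      unfolding ig_def f_def e(1)[symmetric] by (simp add: nn_integral_cmult_indicator)
    also have "\<dots> \<ge> ennreal (1 / c') * (ennreal N * ennreal c')" using Nc c' by (intro mult_left_mono) auto
    also have "ennreal (1 / c') * (ennreal N * ennreal c') = ennreal N" by (metis inv mult.left_commute mult.right_neutral)
    finally show "ennreal N \<le> ig UNIV f epowr p" using True by simp
  qed measurable
next
  case False
  then have p: "1 < p" using p1 by simp
  define N' where "N' = N powr (1 / (p - 1))"
  have N': "ennreal N' < ig {..<y} \<sigma>"
  proof (rule ccontr)
    assume "\<not> ?thesis"
    then have "ig {..<y} \<sigma> epowr (p - 1) \<le> ennreal N' epowr (p - 1)" using p by (intro epowr_mono) auto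
    also have "\<dots> = ennreal N" using N p by (simp add: N'_def epowr_ennreal powr_powr)
    finally show False using N y p by (simp add: \<Phi>_gt1)
  qed
  define E where "E n = {x. \<sigma> x \<le> ennreal (real n)} \<inter> {x\<in>D. x < y \<and> \<bar>x\<bar> \<le> real n}" for n
  have Em [measurable]: "E n \<in> sets lebesgue" for n
  proof -
    have "{x\<in>space lebesgue. \<sigma> x \<le> ennreal (real n)} \<in> sets lebesgue" by measurable
    moreover have "D \<inter> {..<y} \<inter> {- real n..real n} \<in> sets lebesgue" by (intro sets.Int borel_lebesgue) auto
    ultimately have "{x\<in>space lebesgue. \<sigma> x \<le> ennreal (real n)} \<inter> (D \<inter> {..<y} \<inter> {- real n..real n}) \<in> sets lebesgue"
      by (rule sets.Int)
    also have "{x\<in>space lebesgue. \<sigma> x \<le> ennreal (real n)} \<inter> (D \<inter> {..<y} \<inter> {- real n..real n}) = E n"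
      unfolding E_def by (auto simp: abs_le_iff)
    finally show ?thesis .
  qed
  have inc: "incseq E"
    unfolding incseq_def E_def by (auto intro: order_trans ennreal_leI)
  have "ig {..<y} \<sigma> \<le> ig (\<Union>n. E n) \<sigma>"
  proof -
    have "ig {..<y} \<sigma> = ig ({..<y} \<inter> D) \<sigma>" by (intro ig_restrict) (auto simp: \<sigma>_def zext_def)
    also have "\<dots> \<le> ig (\<Union>n. E n) \<sigma>"
    proof (intro ig_mono subsetI)
      fix x assume x: "x \<in> {..<y} \<inter> D"
      obtain m where m: "\<bar>x\<bar> \<le> real m" using real_arch_simple by blast
      obtain k where k: "v x powr (- (1 / (p - 1))) \<le> real k" using real_arch_simple by blast
      have "\<sigma> x \<le> ennreal (real (max m k))" using x k by (auto simp: \<sigma>_def zext_def intro!: ennreal_leI)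
      then have "x \<in> E (max m k)" using x m by (auto simp: E_def)
      then show "x \<in> (\<Union>n. E n)" by blast
    qed auto
    finally show ?thesis .
  qed
  also have "\<dots> = (SUP n. ig (E n) \<sigma>)" using inc by (intro ig_SUP) auto
  finally have "ennreal N' < (SUP n. ig (E n) \<sigma>)" by (rule less_le_trans[OF N'])
  then obtain n where n: "ennreal N' < ig (E n) \<sigma>" unfolding less_SUP_iff by blast
  have "ig (E n) \<sigma> \<le> ig {- real n..real n} (\<lambda>_. ennreal (real n))"
    by (intro ig_mono) (auto simp: E_def)
  also have "\<dots> = ennreal (real n) * emeasure lebesgue {- real n..real n}"
    unfolding ig_def by (intro nn_integral_cmult_indicator) simp
  also have "\<dots> < top" by (simp add: ennreal_mult_less_top)
  finally obtain l where l: "ig (E n) \<sigma> = ennreal l" "0 < l"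
    using n by (metis ennreal_cases ennreal_0 less_eq_real_def less_irrefl not_less_zero)
  have N'l: "N' < l" using n l by (simp add: ennreal_less_iff N'_def)
  \<comment> \<open>Since \<sigma>^p v = \<sigma>, this factor normalises the weighted integral of
    f^p to 1. The integral of \<open>f\<close> is l^(1-1/p), whose p-th power l^(p-1) is at least
    \<open>N\<close>.\<close>
  define f where "f x = ennreal (l powr (- (1 / p))) * (\<sigma> x * indicator (E n) x)" for x
  have [measurable]: "f \<in> borel_measurable lebesgue" unfolding f_def by measurable
  show ?thesis
  proof (intro bexI[of _ f] conjI allI impI)
    show "x \<in> D" "x < y" if "f x \<noteq> 0" for x using that by (auto simp: f_def E_def indicator_def split: if_splits)
    have "ig UNIV (\<lambda>x. f x epowr p * v' x) = ig (E n) (\<lambda>x. ennreal (1 / l) * \<sigma> x)"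
      unfolding ig_def
    proof (intro nn_integral_cong)
      fix x
      show "f x epowr p * v' x * indicator UNIV x = ennreal (1 / l) * \<sigma> x * indicator (E n) x"
      proof (cases "x \<in> E n")
        case True
        then have x: "x \<in> D" by (simp add: E_def)
        have vx: "0 < v x" using x v_pos by blast
        have "\<sigma> x epowr p * v' x = ennreal (v x powr (- (1 / (p - 1)) * p + 1))"
        proof -
          have "\<sigma> x epowr p * v' x = ennreal (v x powr (- (1 / (p - 1)) * p) * v x powr 1)"
            using x vx by (simp add: \<sigma>_def v'_def zext_def epowr_ennreal powr_powr ennreal_mult)
          then show ?thesis by (simp only: powr_add)
        qed
        also have "- (1 / (p - 1)) * p + 1 = - (1 / (p - 1))" using p by (simp add: field_simps)
        finally have "\<sigma> x epowr p * v' x = \<sigma> x" using x by (simp add: \<sigma>_def zext_def)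
        moreover have "ennreal (l powr (- (1 / p))) epowr p = ennreal (1 / l)"
        proof -
          have "- (1 / p) * p = - 1" using p by simp
          moreover have "l powr - 1 = 1 / l" using l by (simp add: powr_minus_divide)
          ultimately show ?thesis by (simp only: epowr_ennreal powr_powr powr_ge_zero)
        qed
        ultimately show ?thesis using True by (simp add: f_def epowr_mult mult.assoc)
      qed (simp add: f_def)
    qed
    also have "\<dots> = ennreal (1 / l) * ennreal l" unfolding l(1)[symmetric] by (intro ig_cmult) auto
    also have "\<dots> = 1" using l by (simp flip: ennreal_mult)
    finally show "ig UNIV (\<lambda>x. f x epowr p * v' x) \<le> 1" by simp
    have "ig UNIV f = ig (E n) (\<lambda>x. ennreal (l powr (- (1 / p))) * \<sigma> x)"
      unfolding ig_def f_def by (intro nn_integral_cong) (auto simp: indicator_def)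
    also have "\<dots> = ennreal (l powr (- (1 / p))) * ennreal l" unfolding l(1)[symmetric] by (intro ig_cmult) auto
    also have "\<dots> = ennreal (l powr (- (1 / p) + 1))"
      using l by (simp only: powr_add powr_one less_imp_le powr_ge_zero ennreal_mult)
    finally have "ig UNIV f epowr p = ennreal (l powr ((- (1 / p) + 1) * p))"
      by (simp only: epowr_ennreal powr_powr powr_ge_zero)
    also have "(- (1 / p) + 1) * p = p - 1" using p by (simp add: field_simps)
    finally have If: "ig UNIV f epowr p = ennreal (l powr (p - 1))" .
    have "N = N' powr (p - 1)" using N p by (simp add: N'_def powr_powr)
    also have "\<dots> \<le> l powr (p - 1)" using N'l p by (intro powr_mono2) (auto simp: N'_def)
    finally show "ennreal N \<le> ig UNIV f epowr p" unfolding If by (rule ennreal_leI)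
  qed measurable
qed

lemma core: "hardy_core D u' w' v' \<Phi> p q r"
proof
  show "open D" by (rule open_einterval)
  show "D \<noteq> {}" using einterval_nonempty[OF ab] by blast
  show "y \<in> D" if "x \<in> D" "z \<in> D" "x \<le> y" "y \<le> z" for x y z using D_between that by blast
  show "u' \<in> borel_measurable lebesgue" "w' \<in> borel_measurable lebesgue" "v' \<in> borel_measurable lebesgue" by measurable
  show "u' x = 0" "w' x = 0" if "x \<notin> D" for x using that by (auto simp: u'_def w'_def zext_def)
  show "0 < u' x" "0 < w' x" if "x \<in> D" for x using that wt by (auto simp: u'_def w'_def zext_def weight_def)
  show "0 < p" "0 < q" "0 < r" using p1 q0 r0 by auto
  show "mono \<Phi>" unfolding \<Phi>_def mono_def by (intro allI impI SUP_subset_mono) auto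
  show "0 < \<Phi> x" if "x \<in> D" for x using that by (rule \<Phi>_pos)
  show "ig A f epowr p \<le> \<Phi> t * ig A (\<lambda>x. f x epowr p * v' x)"
    if "f \<in> borel_measurable lebesgue" "\<And>x. x \<notin> D \<Longrightarrow> f x = 0" "A \<in> sets borel" "t \<in> D" "A \<subseteq> {..<t}" for f A t
    using that by (intro Hoelder_V) auto
  show "\<exists>f\<in>borel_measurable lebesgue. (\<forall>x. f x \<noteq> 0 \<longrightarrow> x \<in> D \<and> x < y) \<and>
      ig UNIV (\<lambda>x. f x epowr p * v' x) \<le> 1 \<and> ennreal N \<le> ig UNIV f epowr p"
    if "y \<in> D" "0 < N" "ennreal N < \<Phi> y" for y N using that by (intro extremal_V)
qed

end

text \<open>The library value for nonmeasurable functions is \<open>top\<close>, so both functions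
  must be seen to be measurable or nonmeasurable together.\<close>

lemma ess_sup_on_cong:
  assumes "\<And>t. t \<in> einterval x y \<Longrightarrow> g t = h t"
  shows "ess_sup_on x y g = ess_sup_on x y h"
proof -
  have sp: "space (lebesgue_on (einterval x y)) = einterval x y" by simp
  have m: "g \<in> borel_measurable (lebesgue_on (einterval x y)) \<longleftrightarrow> h \<in> borel_measurable (lebesgue_on (einterval x y))"
    using assms by (intro measurable_cong) (simp add: sp)
  show ?thesis
  proof (cases "g \<in> borel_measurable (lebesgue_on (einterval x y))")
    case True
    then show ?thesis unfolding ess_sup_on_def using m assms by (intro esssup_AE_cong AE_I2) (auto simp: sp)
  next
    case False
    then show ?thesis unfolding ess_sup_on_def using m by (simp add: esssup_non_measurable)
  qed
qed

sublocale weights \<subseteq> H: hardy_core D u' w' v' \<Phi> p q r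
  by (rule core)

context weights
begin

section \<open>Identification of \<open>C1\<close> to \<open>C5\<close> and of the
  inequality\<close>

lemma U_eq: "s \<in> D \<Longrightarrow> x \<in> D \<Longrightarrow> integ (ereal s) (ereal x) (\<lambda>s. ennreal (u s)) = H.U s x"
  unfolding H.U_def by (intro integ_mid) (auto simp: u'_def zext_def)

lemma W_eq: "x \<in> D \<Longrightarrow> integ (ereal x) b (\<lambda>s. ennreal (w s)) = H.W x"
  unfolding H.W_def by (intro integ_right) (auto simp: w'_def zext_def)

lemma P_eq: "x \<in> D \<Longrightarrow> integ (ereal x) b (\<lambda>s. ennreal (w s) * integ (ereal x) (ereal s) (\<lambda>s. ennreal (u s)) epowr (r / q)) = H.P x"
  unfolding H.P_def by (intro integ_right) (auto simp: w'_def zext_def U_eq)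

lemma \<Phi>_left:
  assumes x: "x \<in> D" and s: "0 < s"
  shows "\<Phi> x epowr s \<le> (SUP y\<in>D \<inter> {..<x}. \<Phi> y epowr s)"
proof -
  have ps: "0 < p * s" using p1 s by simp
  have "\<Phi> x epowr s = V x epowr (p * s)" using \<Phi>_eq[OF x] by (simp add: epowr_epowr)
  also have "\<dots> \<le> (SUP y\<in>D \<inter> {..<x}. V y) epowr (p * s)" by (intro epowr_mono V_left x ps)
  also have "\<dots> = (SUP y\<in>D \<inter> {..<x}. V y epowr (p * s))" by (rule epowr_SUP[OF ps])
  also have "\<dots> = (SUP y\<in>D \<inter> {..<x}. \<Phi> y epowr s)" by (intro SUP_cong) (auto simp: \<Phi>_eq epowr_epowr)
  finally show ?thesis .
qed

text \<open>\<open>ess_sup_on_product\<close> applies: the power of \<open>U\<close> is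
  nonincreasing in t, and the power of \<open>\<Phi>\<close> is nondecreasing and left continuous by
  \<open>\<Phi>_left\<close>.\<close>

lemma inner_SUP:
  assumes x: "x \<in> D" and e: "0 < e" and s: "0 < s"
  shows "ess_sup_on a (ereal x) (\<lambda>t. integ (ereal t) (ereal x) (\<lambda>s. ennreal (u s)) epowr e * Vp p v a (ereal t) epowr s)
    = (SUP t\<in>D \<inter> {..<x}. H.U t x epowr e * \<Phi> t epowr (s / p))"
proof -
  have sp: "0 < s / p" using s p1 by simp
  have "ess_sup_on a (ereal x) (\<lambda>t. integ (ereal t) (ereal x) (\<lambda>s. ennreal (u s)) epowr e * Vp p v a (ereal t) epowr s)
      = ess_sup_on a (ereal x) (\<lambda>t. H.U t x epowr e * \<Phi> t epowr (s / p))"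
    using x by (intro ess_sup_on_cong) (simp add: einterval_left U_eq V_eq flip: V_def)
  also have "\<dots> = (SUP t\<in>D \<inter> {..<x}. H.U t x epowr e * \<Phi> t epowr (s / p))"
  proof (rule ess_sup_on_product)
    show "D \<inter> {..<x} = einterval a (ereal x)" using x by (simp add: einterval_left)
    show "(\<lambda>t. H.U t x epowr e * \<Phi> t epowr (s / p)) \<in> borel_measurable (lebesgue_on (D \<inter> {..<x}))"
      by (intro measurable_restrict_space1) measurable
    show "H.U t' x epowr e \<le> H.U t x epowr e" if "t \<le> t'" for t t' using that e by (intro epowr_mono H.U_mono) auto
    show "\<Phi> t epowr (s / p) \<le> \<Phi> t' epowr (s / p)" if "t \<le> t'" for t t'
      using that sp by (intro epowr_mono monoD[OF H.\<Phi>_mono]) auto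
    show "\<Phi> t epowr (s / p) \<le> (SUP y\<in>D \<inter> {..<x} \<inter> {..<t}. \<Phi> y epowr (s / p))" if "t \<in> D \<inter> {..<x}" for t
    proof -
      have "D \<inter> {..<x} \<inter> {..<t} = D \<inter> {..<t}" using that by auto
      then show ?thesis using \<Phi>_left[of t "s / p"] that sp by simp
    qed
  qed
  finally show ?thesis .
qed

lemma C1_eq: "C1 p q r a b u v w = H.K1"
proof -
  have "C1 p q r a b u v w = ess_sup_on a b (\<lambda>x. H.P x epowr (1 / r) * \<Phi> x epowr (1 / p))"
    unfolding C1_def using V_eq[of _ 1] by (intro ess_sup_on_cong) (simp add: P_eq flip: V_def)
  also have "\<dots> = H.K1"
    unfolding H.K1_def
  proof (rule ess_sup_on_product)
    show "(\<lambda>t. H.P t epowr (1 / r) * \<Phi> t epowr (1 / p)) \<in> borel_measurable (lebesgue_on D)"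
      by (intro measurable_restrict_space1) measurable
    show "H.P t epowr (1 / r) \<le> H.P s epowr (1 / r)" if "s \<le> t" for s t
      using that r0 by (intro epowr_mono H.P_mono) auto
    show "\<Phi> t epowr (1 / p) \<le> \<Phi> t' epowr (1 / p)" if "t \<le> t'" for t t'
      using that p1 by (intro epowr_mono monoD[OF H.\<Phi>_mono]) auto
    show "\<Phi> t epowr (1 / p) \<le> (SUP y\<in>D \<inter> {..<t}. \<Phi> y epowr (1 / p))" if "t \<in> D" for t
      using p1 that by (intro \<Phi>_left) auto
  qed simp
  finally show ?thesis .
qed

lemma C2_eq:
  assumes rp: "r < p"
  shows "C2 p q r a b u v w = H.K2"
proof -
  define e where "e = r * p / (q * (p - r))"
  have e: "0 < e" "q / p * e = r / (p - r)" using rp p1 q0 r0 by (auto simp: e_def)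
  have s: "0 < p * r / (p - r)" "p * r / (p - r) / p = r / (p - r)" using rp p1 r0 by auto
  have "(SUP t\<in>D \<inter> {..<x}. H.U t x epowr e * \<Phi> t epowr (r / (p - r))) = H.SS x epowr e" for x
    unfolding H.SS_def epowr_SUP[OF e(1)] epowr_mult epowr_epowr e(2) ..
  then have S: "ess_sup_on a (ereal x) (\<lambda>t. integ (ereal t) (ereal x) (\<lambda>s. ennreal (u s)) epowr e * Vp p v a (ereal t) epowr (p * r / (p - r)))
      = H.SS x epowr e" if "x \<in> D" for x
    using inner_SUP[OF that e(1) s(1)] unfolding s(2) by simp
  show ?thesis unfolding C2_def H.K2_def e_def[symmetric]
    by (intro arg_cong2[where f="(epowr)"] refl integ_all) (simp add: W_eq S w'_def zext_def)
qed

lemma C3_eq: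
  assumes rp: "r < p"
  shows "C3 p q r a b u v w = H.K3"
proof -
  have s: "0 < p * r / (p - r)" "p * r / (p - r) / p = r / (p - r)" and e: "0 < r / q" using rp p1 r0 q0 by auto
  have S: "ess_sup_on a (ereal x) (\<lambda>t. integ (ereal t) (ereal x) (\<lambda>s. ennreal (u s)) epowr (r / q) * Vp p v a (ereal t) epowr (p * r / (p - r)))
      = H.TT x" if "x \<in> D" for x
    using inner_SUP[OF that e s(1)] unfolding s(2) H.TT_def .
  show ?thesis unfolding C3_def H.K3_def
    by (intro arg_cong2[where f="(epowr)"] refl integ_all) (simp add: P_eq S w'_def zext_def)
qed

lemma BB_eq:
  assumes qp: "q < p" and x: "x \<in> D"
  shows "integ a (ereal x) (\<lambda>t. integ (ereal t) (ereal x) (\<lambda>s. ennreal (u s)) epowr (q / (p - q)) * ennreal (u t) *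
    Vp p v a (ereal t) epowr (p * q / (p - q))) = H.BB x"
  unfolding H.BB_def
proof (rule integ_left[OF x])
  have s: "p * q / (p - q) / p = q / (p - q)" using p1 by simp
  show "integ (ereal t) (ereal x) (\<lambda>s. ennreal (u s)) epowr (q / (p - q)) * ennreal (u t) * Vp p v a (ereal t) epowr (p * q / (p - q))
      = H.U t x epowr (q / (p - q)) * u' t * \<Phi> t epowr (q / (p - q))" if "t \<in> D" for t
    using V_eq[OF that, of "p * q / (p - q)"] that x unfolding s V_def by (simp add: U_eq u'_def zext_def)
  show "H.U t x epowr (q / (p - q)) * u' t * \<Phi> t epowr (q / (p - q)) = 0" if "t \<notin> D" for t
    using that by (simp add: u'_def zext_def)
qed

lemma C4_eq: "q < p \<Longrightarrow> C4 p q r a b u v w = H.K4"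
  unfolding C4_def H.K4_def by (intro SUP_cong) (simp_all add: W_eq BB_eq)

lemma C5_eq: "q < p \<Longrightarrow> C5 p q r a b u v w = H.K5"
  unfolding C5_def H.K5_def
  by (intro arg_cong2[where f="(epowr)"] refl integ_all) (simp add: W_eq BB_eq w'_def zext_def)

lemma hardy_ineq_iff:
  "hardy_ineq p q r a b u v w C f \<longleftrightarrow>
    ig D (\<lambda>x. H.HL (zext a b f) x epowr (r / q) * w' x) epowr (1 / r) \<le> ennreal C * H.nrm (zext a b f) epowr (1 / p)"
proof -
  have F: "integ a (ereal t) f = H.F (zext a b f) t" if "t \<in> D" for t
    unfolding H.F_def using that by (intro integ_left) (auto simp: zext_def)
  have HL: "integ a (ereal x) (\<lambda>t. integ a (ereal t) f epowr q * ennreal (u t)) = H.HL (zext a b f) x" if "x \<in> D" for x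
    unfolding H.HL_def using that by (intro integ_left) (auto simp: F u'_def zext_def)
  have "integ a b (\<lambda>x. f x epowr p * ennreal (v x)) = ig D (\<lambda>x. zext a b f x epowr p * v' x)"
    by (intro integ_all) (simp add: v'_def zext_def)
  also have "\<dots> = H.nrm (zext a b f)"
    unfolding H.nrm_def using ig_restrict[of UNIV D "\<lambda>x. zext a b f x epowr p * v' x"] by (simp add: v'_def zext_def)
  finally have N: "integ a b (\<lambda>x. f x epowr p * ennreal (v x)) = H.nrm (zext a b f)" .
  have L: "integ a b (\<lambda>x. integ a (ereal x) (\<lambda>t. integ a (ereal t) f epowr q * ennreal (u t)) epowr (r / q) * ennreal (w x))
      = ig D (\<lambda>x. H.HL (zext a b f) x epowr (r / q) * w' x)"
    by (intro integ_all) (simp add: HL w'_def zext_def)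
  show ?thesis unfolding hardy_ineq_def N L ..
qed

lemma zext_Adm: "f \<in> nonneg_measurable a b \<Longrightarrow> zext a b f \<in> H.Adm"
  unfolding H.Adm_def nonneg_measurable_def by (auto intro: zext_measurable simp: zext_def)

lemma admissible_holds:
  assumes "C \<in> admissible p q r a b u v w"
  shows "H.holds C"
  unfolding H.holds_def
proof
  fix f assume f: "f \<in> H.Adm"
  then have "f \<in> nonneg_measurable a b" unfolding H.Adm_def nonneg_measurable_def
    by (auto intro: measurable_restrict_space1)
  then have "hardy_ineq p q r a b u v w C f" using assms by (simp add: admissible_def)
  moreover have "zext a b f = f" using f by (auto simp: H.Adm_def zext_def)
  ultimately have "ig D (\<lambda>x. H.HL f x epowr (r / q) * w' x) epowr (1 / r) \<le> ennreal C * H.nrm f epowr (1 / p)"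
    by (simp add: hardy_ineq_iff)
  then have "ig D (\<lambda>x. H.HL f x epowr (r / q) * w' x) \<le> (ennreal C * H.nrm f epowr (1 / p)) epowr r"
    using epowr_le_iff[of "1 / r"] r0 by simp
  also have "\<dots> = ennreal (C powr r) * H.nrm f epowr (r / p)"
    using assms by (simp add: epowr_mult epowr_epowr epowr_ennreal admissible_def)
  finally show "ig D (\<lambda>x. H.HL f x epowr (r / q) * w' x) \<le> ennreal (C powr r) * H.nrm f epowr (r / p)" .
qed

text \<open>Functions of infinite norm satisfy the inequality trivially because \<open>C\<close> is
  positive; the others are covered by the bound after an r-th root.\<close>

lemma admissible_of_bound:
  assumes bound: "\<And>f. f \<in> H.Adm \<Longrightarrow> H.nrm f < top \<Longrightarrow>
      ig D (\<lambda>x. H.HL f x epowr (r / q) * w' x) \<le> B * (K epowr r * H.nrm f epowr (r / p))"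
    and C: "0 < C" "B epowr (1 / r) * K \<le> ennreal C"
  shows "C \<in> admissible p q r a b u v w"
  unfolding admissible_def hardy_ineq_iff
proof (intro CollectI conjI ballI C(1))
  fix f assume "f \<in> nonneg_measurable a b"
  then have f: "zext a b f \<in> H.Adm" by (rule zext_Adm)
  let ?g = "zext a b f"
  show "ig D (\<lambda>x. H.HL ?g x epowr (r / q) * w' x) epowr (1 / r) \<le> ennreal C * H.nrm ?g epowr (1 / p)"
  proof (cases "H.nrm ?g < top")
    case True
    have "ig D (\<lambda>x. H.HL ?g x epowr (r / q) * w' x) epowr (1 / r)
        \<le> (B * (K epowr r * H.nrm ?g epowr (r / p))) epowr (1 / r)"
      using r0 by (intro epowr_mono bound f True) auto
    also have "\<dots> = B epowr (1 / r) * K * H.nrm ?g epowr (1 / p)"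
      using r0 by (simp add: epowr_mult epowr_epowr mult.assoc)
    also have "\<dots> \<le> ennreal C * H.nrm ?g epowr (1 / p)" by (intro mult_right_mono C) auto
    finally show ?thesis .
  next
    case False
    then show ?thesis using C by (simp add: less_top[symmetric] ennreal_mult_top)
  qed
qed

text \<open>The step common to all cases, from one bound in each direction to the equivalence and to
  the best constant. \<open>K\<close> is a single constant or the sum of two, which is finite
  exactly when both are.\<close>

lemma characterization:
  assumes suff: "\<And>f. K < top \<Longrightarrow> f \<in> H.Adm \<Longrightarrow> H.nrm f < top \<Longrightarrow>
      ig D (\<lambda>x. H.HL f x epowr (r / q) * w' x) \<le> B * (K epowr r * H.nrm f epowr (r / p))"
    and nec: "\<And>C. 0 \<le> C \<Longrightarrow> H.holds C \<Longrightarrow> K \<le> k * ennreal C"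
    and c: "0 < c" "B epowr (1 / r) \<le> ennreal c" "k \<le> ennreal c"
  shows "((\<exists>C>0. \<forall>f\<in>nonneg_measurable a b. hardy_ineq p q r a b u v w C f) \<longleftrightarrow> K < top) \<and>
    best_const p q r a b u v w \<le> ennreal c * K \<and> K \<le> ennreal c * best_const p q r a b u v w"
proof -
  let ?A = "admissible p q r a b u v w"
  have upper: "C \<in> ?A" if "K < top" "0 < C" "ennreal c * K \<le> ennreal C" for C
  proof (rule admissible_of_bound[where B=B and K=K])
    have "B epowr (1 / r) * K \<le> ennreal c * K" by (intro mult_right_mono c) auto
    then show "B epowr (1 / r) * K \<le> ennreal C" using that(3) by (rule order_trans)
  qed (use suff that in auto)
  have lower: "K \<le> ennreal c * ennreal C" if "C \<in> ?A" for C
  proof -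
    have "K \<le> k * ennreal C" using nec[of C] admissible_holds[OF that] that by (simp add: admissible_def)
    also have "\<dots> \<le> ennreal c * ennreal C" by (intro mult_right_mono c) auto
    finally show ?thesis .
  qed
  have ex: "(\<exists>C>0. \<forall>f\<in>nonneg_measurable a b. hardy_ineq p q r a b u v w C f) \<longleftrightarrow> ?A \<noteq> {}"
    by (auto simp: admissible_def)
  \<comment> \<open>An admissible constant must be positive also when K = 0, so c K is only
    approached from above.\<close>
  have approx: "\<exists>C. ennreal C = ennreal c * K + ennreal e \<and> C \<in> ?A" if K: "K < top" and e: "0 < e" for e
  proof -
    obtain k0 where k0: "0 \<le> k0" "K = ennreal k0" using K by (cases K) auto
    have *: "ennreal (c * k0 + e) = ennreal c * K + ennreal e" using c k0 e by (simp add: ennreal_mult)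
    moreover have "c * k0 + e \<in> ?A"
      by (rule upper[OF K]) (use c k0 e * in \<open>auto intro!: add_nonneg_pos\<close>)
    ultimately show ?thesis by blast
  qed
  have "?A \<noteq> {} \<longleftrightarrow> K < top"
  proof
    assume "?A \<noteq> {}"
    then obtain C where C: "C \<in> ?A" by blast
    have "ennreal c * ennreal C < top" by (simp add: ennreal_mult_less_top)
    then show "K < top" using lower[OF C] by (rule le_less_trans[rotated])
  next
    assume "K < top"
    from approx[OF this, of 1] show "?A \<noteq> {}" by auto
  qed
  moreover have "best_const p q r a b u v w \<le> ennreal c * K"
  proof (cases "K < top")
    case True
    show ?thesis
    proof (rule ennreal_le_epsilon)
      fix e :: real assume "0 < e"
      then obtain C where "ennreal C = ennreal c * K + ennreal e" "C \<in> ?A" using approx[OF True] by blast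
      then show "best_const p q r a b u v w \<le> ennreal c * K + ennreal e"
        unfolding best_const_def by (metis INF_lower)
    qed
  next
    case False
    then have "K = top" by (simp add: less_top[symmetric])
    then show ?thesis using c by (simp add: ennreal_mult_top)
  qed
  moreover have "K \<le> ennreal c * best_const p q r a b u v w"
  proof -
    have inv: "ennreal (1 / c) * ennreal c = 1" using c by (simp flip: ennreal_mult)
    have "ennreal (1 / c) * K \<le> best_const p q r a b u v w"
      unfolding best_const_def
    proof (rule INF_greatest)
      fix C assume "C \<in> ?A"
      then have "ennreal (1 / c) * K \<le> ennreal (1 / c) * (ennreal c * ennreal C)" by (intro mult_left_mono lower) auto
      then show "ennreal (1 / c) * K \<le> ennreal C" by (simp add: inv flip: mult.assoc)
    qed
    then have "ennreal c * (ennreal (1 / c) * K) \<le> ennreal c * best_const p q r a b u v w" by (intro mult_left_mono) auto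
    moreover have "ennreal c * (ennreal (1 / c) * K) = K"
      using inv by (simp add: mult.commute[of "ennreal c"] flip: mult.assoc)
    ultimately show ?thesis by simp
  qed
  ultimately show ?thesis unfolding ex by blast
qed

end

theorem theorem1p1:
  fixes p q r :: real
  assumes "1 \<le> p" and "0 < q" and "0 < r"
  shows "\<exists>c>0::real. \<forall>(a::ereal) (b::ereal) (u::real \<Rightarrow> real) (v::real \<Rightarrow> real) (w::real \<Rightarrow> real).
    a < b \<longrightarrow> weight a b u \<longrightarrow> weight a b v \<longrightarrow> weight a b w \<longrightarrow>
    (let Holds = (\<exists>C>0::real. \<forall>f\<in>nonneg_measurable a b. hardy_ineq p q r a b u v w C f);
         Best = best_const p q r a b u v w;
         K1 = C1 p q r a b u v w; K2 = C2 p q r a b u v w; K3 = C3 p q r a b u v w;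
         K4 = C4 p q r a b u v w; K5 = C5 p q r a b u v w
     in
       (p \<le> r \<and> p \<le> q \<longrightarrow>
          (Holds \<longleftrightarrow> K1 < \<infinity>) \<and>
          Best \<le> ennreal c * K1 \<and> K1 \<le> ennreal c * Best) \<and>
       (r < p \<and> p \<le> q \<longrightarrow>
          (Holds \<longleftrightarrow> K2 < \<infinity> \<and> K3 < \<infinity>) \<and>
          Best \<le> ennreal c * (K2 + K3) \<and> K2 + K3 \<le> ennreal c * Best) \<and>
       (q < p \<and> p \<le> r \<longrightarrow>
          (Holds \<longleftrightarrow> K1 < \<infinity> \<and> K4 < \<infinity>) \<and>
          Best \<le> ennreal c * (K1 + K4) \<and> K1 + K4 \<le> ennreal c * Best) \<and>
       (r < p \<and> q < p \<longrightarrow>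
          (Holds \<longleftrightarrow> K3 < \<infinity> \<and> K5 < \<infinity>) \<and>
          Best \<le> ennreal c * (K3 + K5) \<and> K3 + K5 \<le> ennreal c * Best))"
proof -
  define h where "h = ennreal (hardyL_const (r / p))"
  define hq where "hq = hardyL_const (q / p) powr ((p - q) / p)"
  define e where "e = (p - r) / (p * r)"
  define B where "B x = x epowr (1 / r)" for x :: ennreal
  define k2 where "k2 = (1 * h) epowr e"
  define k3 where "k3 = (c_P p q r * h) epowr e"
  define k4 where "k4 = ennreal (hq powr (1 / q))"
  define k5 where "k5 = (ennreal hq epowr (r * p / (q * (p - r))) * h) epowr e"
  define B1 where "B1 = c_ge q r * k_ge q epowr (r / q)"
  define B2 where "B2 = c_lt p q r * k_ge q epowr (r / q)"
  define B3 where "B3 = c_ge q r * k_lt q epowr (r / q)"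
  define B4 where "B4 = c_lt p q r * k_lt q epowr (r / q)"
  \<comment> \<open>One bound serves all four cases; it is fixed before the interval and the
    weights, so it depends on p, q, r only.\<close>
  define S where "S = B B1 + B B2 + B B3 + B B4 + (1 + k2 + k3 + k4 + k5)"
  \<comment> \<open>Powers of finite values are finite for every exponent, so this holds even for
    those summands whose exponents are meant for a different case.\<close>
  have "S < top"
    by (simp add: S_def B_def B1_def B2_def B3_def B4_def k2_def k3_def k4_def k5_def h_def
        c_ge_def c_lt_def k_ge_def k_lt_def c_P_def c_less_def ennreal_mult_less_top)
  then have S: "S = ennreal (enn2real S)" by simp
  define c where "c = enn2real S + 1"
  have c0: "0 < c" by (simp add: c_def add_nonneg_pos)
  have Sc: "S \<le> ennreal c" unfolding c_def by (subst S) (intro ennreal_leI, simp)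
  have le: "x \<le> ennreal c" if "x \<le> S" for x using that Sc by (rule order_trans)
  have B: "B B1 \<le> ennreal c" "B B2 \<le> ennreal c" "B B3 \<le> ennreal c" "B B4 \<le> ennreal c"
    unfolding S_def by (intro le, simp add: S_def add.assoc add_increasing add_increasing2)+
  have k: "1 \<le> ennreal c" "k2 + k3 \<le> ennreal c" "1 + k4 \<le> ennreal c" "k3 + k5 \<le> ennreal c"
  proof -
    have k: "k2 + k3 + (1 + k4 + k5) \<le> S" "k3 + k5 + (1 + k2 + k4) \<le> S" "1 + k4 + (k2 + k3 + k5) \<le> S"
      unfolding S_def by (auto intro!: add_increasing simp: ac_simps)
    have add_le: "x \<le> ennreal c" if "x + y \<le> S" for x y
      using that by (intro le) (metis add_increasing2 dual_order.refl order_trans zero_le)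
    show "k2 + k3 \<le> ennreal c" "k3 + k5 \<le> ennreal c" "1 + k4 \<le> ennreal c" using k by (blast intro: add_le)+
    show "1 \<le> ennreal c" using k(3) by (intro add_le[of 1 "k4 + (k2 + k3 + k5)"]) (simp add: add.assoc)
  qed
  show ?thesis
  proof (intro exI[of _ c] conjI allI impI c0)
    fix a b :: ereal and u v w :: "real \<Rightarrow> real"
    assume wt: "a < b" "weight a b u" "weight a b v" "weight a b w"
    interpret weights a b u v w p q r by standard (use assms wt in auto)
    let ?Holds = "\<exists>C>0. \<forall>f\<in>nonneg_measurable a b. hardy_ineq p q r a b u v w C f"
    let ?Best = "best_const p q r a b u v w"
    have 1: "(?Holds \<longleftrightarrow> C1 p q r a b u v w < \<infinity>) \<and>
        ?Best \<le> ennreal c * C1 p q r a b u v w \<and> C1 p q r a b u v w \<le> ennreal c * ?Best"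
      if "p \<le> r \<and> p \<le> q"
    proof -
      from that have pr: "p \<le> r" "p \<le> q" by auto
      have nec: "H.K1 \<le> 1 * ennreal C" if "0 \<le> C" "H.holds C" for C
        using H.K1_necessary[OF that] by simp
      show ?thesis unfolding C1_eq infinity_ennreal_def
        by (rule characterization[OF _ _ c0 B(1)[unfolded B_def B1_def] k(1)])
          (erule (2) H.case1_sufficient[OF pr], erule (1) nec)
    qed
    have 2: "(?Holds \<longleftrightarrow> C2 p q r a b u v w < \<infinity> \<and> C3 p q r a b u v w < \<infinity>) \<and>
        ?Best \<le> ennreal c * (C2 p q r a b u v w + C3 p q r a b u v w) \<and>
        C2 p q r a b u v w + C3 p q r a b u v w \<le> ennreal c * ?Best"
      if "r < p \<and> p \<le> q"
    proof -
      from that have pr: "r < p" "p \<le> q" by auto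
      have nec: "H.K2 + H.K3 \<le> (k2 + k3) * ennreal C" if "0 \<le> C" "H.holds C" for C
        unfolding distrib_right k2_def k3_def e_def h_def
        by (intro add_mono H.K2_necessary H.K3_necessary pr that)
      show ?thesis
        unfolding C2_eq[OF pr(1)] C3_eq[OF pr(1)] infinity_ennreal_def ennreal_add_less_top[symmetric]
        by (rule characterization[OF _ _ c0 B(2)[unfolded B_def B2_def] k(2)])
          (erule (2) H.case2_sufficient[OF pr], erule (1) nec)
    qed
    have 3: "(?Holds \<longleftrightarrow> C1 p q r a b u v w < \<infinity> \<and> C4 p q r a b u v w < \<infinity>) \<and>
        ?Best \<le> ennreal c * (C1 p q r a b u v w + C4 p q r a b u v w) \<and>
        C1 p q r a b u v w + C4 p q r a b u v w \<le> ennreal c * ?Best"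
      if "q < p \<and> p \<le> r"
    proof -
      from that have pr: "p \<le> r" "q < p" by auto
      have nec: "H.K1 + H.K4 \<le> (1 + k4) * ennreal C" if "0 \<le> C" "H.holds C" for C
        unfolding distrib_right k4_def hq_def mult_1_left
        by (intro add_mono H.K1_necessary H.K4_necessary pr that)
      show ?thesis
        unfolding C1_eq C4_eq[OF pr(2)] infinity_ennreal_def ennreal_add_less_top[symmetric]
        by (rule characterization[OF _ _ c0 B(3)[unfolded B_def B3_def] k(3)])
          (erule (2) H.case3_sufficient[OF pr], erule (1) nec)
    qed
    have 4: "(?Holds \<longleftrightarrow> C3 p q r a b u v w < \<infinity> \<and> C5 p q r a b u v w < \<infinity>) \<and>
        ?Best \<le> ennreal c * (C3 p q r a b u v w + C5 p q r a b u v w) \<and>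
        C3 p q r a b u v w + C5 p q r a b u v w \<le> ennreal c * ?Best"
      if "r < p \<and> q < p"
    proof -
      from that have pr: "r < p" "q < p" by auto
      have nec: "H.K3 + H.K5 \<le> (k3 + k5) * ennreal C" if "0 \<le> C" "H.holds C" for C
        unfolding distrib_right k3_def k5_def e_def h_def hq_def
        by (intro add_mono H.K3_necessary H.K5_necessary pr that)
      show ?thesis
        unfolding C3_eq[OF pr(1)] C5_eq[OF pr(2)] infinity_ennreal_def ennreal_add_less_top[symmetric]
        by (rule characterization[OF _ _ c0 B(4)[unfolded B_def B4_def] k(4)])
          (erule (2) H.case4_sufficient[OF pr], erule (1) nec)
    qed
    show "let Holds = ?Holds; Best = ?Best;
         K1 = C1 p q r a b u v w; K2 = C2 p q r a b u v w; K3 = C3 p q r a b u v w;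
         K4 = C4 p q r a b u v w; K5 = C5 p q r a b u v w
     in
       (p \<le> r \<and> p \<le> q \<longrightarrow>
          (Holds \<longleftrightarrow> K1 < \<infinity>) \<and>
          Best \<le> ennreal c * K1 \<and> K1 \<le> ennreal c * Best) \<and>
       (r < p \<and> p \<le> q \<longrightarrow>
          (Holds \<longleftrightarrow> K2 < \<infinity> \<and> K3 < \<infinity>) \<and>
          Best \<le> ennreal c * (K2 + K3) \<and> K2 + K3 \<le> ennreal c * Best) \<and>
       (q < p \<and> p \<le> r \<longrightarrow>
          (Holds \<longleftrightarrow> K1 < \<infinity> \<and> K4 < \<infinity>) \<and>
          Best \<le> ennreal c * (K1 + K4) \<and> K1 + K4 \<le> ennreal c * Best) \<and>
       (r < p \<and> q < p \<longrightarrow>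
          (Holds \<longleftrightarrow> K3 < \<infinity> \<and> K5 < \<infinity>) \<and>
          Best \<le> ennreal c * (K3 + K5) \<and> K3 + K5 \<le> ennreal c * Best)"
      unfolding Let_def by (intro conjI[OF impI[OF 1] conjI[OF impI[OF 2] conjI[OF impI[OF 3] impI[OF 4]]]])
  qed
qed

end
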